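(* Assume that $r$ and all $\rho_i$, $i=1,\dots,n$, are deterministic, that no $\rho_i$ is identically $0$, and that $\Psi<1$. Then the $n$-agent relative-wealth mean-variance game has a unique Nash equilibrium.
   Context: Setting. $T>0$; $(\Omega,\mathcal F,\mathbb P)$ is a complete probability space carrying a one-dimensional Brownian motion $W$ on $[0,T]$; $\mathbb F$ is the (completed) filtration generated by $W$. $L^2_{\mathbb F}(0,T;\mathbb{R}^m)$: $\mathbb F$-adapted $\mathbb{R}^m$-valued $v$ with $\mathbb E\int_0^T|v|^2\mathrm{d}t<\infty$ (processes equal a.e. a.s. are identified). Parameters. $n\ge2$; for $i=1,\dots,n$: $x_i\in\mathbb{R}$, $\theta_i\in[0,1]$, $\gamma_i>0$. The processes $r,\mu_i$ are $\mathbb F$-adapted, essentially bounded and nonnegative; $\sigma_i$ is $\mathbb F$-adapted with $c^{-1}\le\sigma_i\le c$ a.e. a.s. for some constant $c>0$; $\rho_i=(\mu_i-r)/\sigma_i$. Put $\Psi=\sum_{i=1}^n\frac{\theta_i}{n-1+\theta_i}\in[0,1]$. Game. Let $\mathcal U=L^2_{\mathbb F}(0,T;\mathbb{R})$. If agent $i$ uses $\pi_i\in\mathcal U$, the wealth $X_i$ solves $\mathrm{d}X_i=[rX_i+\pi_i\sigma_i\rho_i]\mathrm{d}t+\pi_i\sigma_i\,\mathrm{d}W$, $X_i(0)=x_i$. With $\hat X_i=\frac1{n-1}\sum_{k\ne i}X_k$, agent $i$ maximizes $$\hat J_i(\pi_1,\dots,\pi_n)=\mathbb E[X_i(T)-\theta_i\hat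 X_i(T)]-\tfrac{\gamma_i}{2}\operatorname{Var}[X_i(T)-\theta_i\hat X_i(T)].$$ $\boldsymbol\pi^*\in\mathcal U^n$ is a Nash equilibrium if for every $i$ and every $\pi_i\in\mathcal U$, $\hat J_i(\boldsymbol\pi^* )\ge\hat J_i(\pi_1^*,\dots,\pi_{i-1}^*,\pi_i,\pi_{i+1}^*,\dots,\pi_n^* )$. *)

theory Defs
  imports "HOL-Probability.Probability"
begin

text \<open>
  Processes are functions \<open>v\<close> of time and scenario, \<open>v t \<omega>\<close>; only times in \<open>{0..T}\<close> matter.
\<close>

definition natural_filtration :: "'a measure \<Rightarrow> (real \<Rightarrow> 'a \<Rightarrow> real) \<Rightarrow> real \<Rightarrow> 'a measure" where
  "natural_filtration M W t =
     sigma (space M) {W s -` A \<inter> space M | s A. s \<in> {0..t} \<and> A \<in> sets borel}"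

locale brownian_space = prob_space M + complete_measure M
  for M :: "'a measure" +
  fixes T :: real and W :: "real \<Rightarrow> 'a \<Rightarrow> real"
  assumes T_pos: "T > 0"
    and W_measurable: "\<And>t. t \<in> {0..T} \<Longrightarrow> W t \<in> borel_measurable M"
    and W_zero: "AE \<omega> in M. W 0 \<omega> = 0"
    and W_continuous: "AE \<omega> in M. continuous_on {0..T} (\<lambda>t. W t \<omega>)"
    and W_increment_normal: "\<And>s t. 0 \<le> s \<Longrightarrow> s < t \<Longrightarrow> t \<le> T \<Longrightarrow>
       distributed M lborel (\<lambda>\<omega>. W t \<omega> - W s \<omega>) (normal_density 0 (sqrt (t - s)))"
    and W_increment_indep: "\<And>s t. 0 \<le> s \<Longrightarrow> s < t \<Longrightarrow> t \<le> T \<Longrightarrow>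
       indep_set (sets (natural_filtration M W s))
         {(\<lambda>\<omega>. W t \<omega> - W s \<omega>) -` A \<inter> space M | A. A \<in> sets borel}"
begin

definition \<F> :: "real \<Rightarrow> 'a measure" where
  "\<F> t = sigma (space M) (sets (natural_filtration M W t) \<union> null_sets M)"

text \<open>
  The measure \<open>dt \<otimes> P\<close> on \<open>[0,T] \<times> \<Omega>\<close>; statements holding a.e. a.s. are those holding
  almost everywhere for this measure, and \<open>E \<integral>\<^sub>0\<^sup>T \<dots> dt\<close> is the integral with respect to it.
\<close>

definition dt_P :: "(real \<times> 'a) measure" where
  "dt_P = restrict_space lborel {0..T} \<Otimes>\<^sub>M M"

definition adapted :: "(real \<Rightarrow> 'a \<Rightarrow> real) \<Rightarrow> bool" where
  "adapted v \<longleftrightarrow>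
     (\<lambda>(t, \<omega>). v t \<omega>) \<in> borel_measurable dt_P \<and> (\<forall>t\<in>{0..T}. v t \<in> borel_measurable (\<F> t))"

definition L2F :: "(real \<Rightarrow> 'a \<Rightarrow> real) set" where
  "L2F = {v. adapted v \<and> integrable dt_P (\<lambda>(t, \<omega>). (v t \<omega>)\<^sup>2)}"

definition ae_eq :: "(real \<Rightarrow> 'a \<Rightarrow> real) \<Rightarrow> (real \<Rightarrow> 'a \<Rightarrow> real) \<Rightarrow> bool" where
  "ae_eq u v \<longleftrightarrow> (AE (t, \<omega>) in dt_P. u t \<omega> = v t \<omega>)"

definition ess_bounded :: "(real \<Rightarrow> 'a \<Rightarrow> real) \<Rightarrow> bool" where
  "ess_bounded v \<longleftrightarrow> (\<exists>K. AE (t, \<omega>) in dt_P. \<bar>v t \<omega>\<bar> \<le> K)"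

definition deterministic :: "(real \<Rightarrow> 'a \<Rightarrow> real) \<Rightarrow> bool" where
  "deterministic v \<longleftrightarrow> (\<exists>g\<in>borel_measurable lborel. ae_eq v (\<lambda>t \<omega>. g t))"

text \<open>
  Simple integrands \<open>\<Sum>\<^sub>j \<xi>\<^sub>j 1\<^bsub>(\<tau>\<^sub>j, \<tau>\<^sub>j\<^sub>+\<^sub>1]\<^esub>\<close>, \<open>j < k\<close>, with \<open>\<xi>\<^sub>j\<close> bounded and known at time \<open>\<tau>\<^sub>j\<close>.
\<close>

definition simple_integrand :: "nat \<Rightarrow> (nat \<Rightarrow> real) \<Rightarrow> (nat \<Rightarrow> 'a \<Rightarrow> real) \<Rightarrow> bool" where
  "simple_integrand k \<tau> \<xi> \<longleftrightarrow>
     (\<forall>j<k. 0 \<le> \<tau> j \<and> \<tau> j \<le> \<tau> (Suc j) \<and> \<tau> (Suc j) \<le> T \<and>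
        \<xi> j \<in> borel_measurable (\<F> (\<tau> j)) \<and> (\<exists>B. \<forall>\<omega>\<in>space M. \<bar>\<xi> j \<omega>\<bar> \<le> B))"

definition simple_process ::
    "nat \<Rightarrow> (nat \<Rightarrow> real) \<Rightarrow> (nat \<Rightarrow> 'a \<Rightarrow> real) \<Rightarrow> real \<Rightarrow> 'a \<Rightarrow> real" where
  "simple_process k \<tau> \<xi> t \<omega> = (\<Sum>j<k. \<xi> j \<omega> * indicator {\<tau> j<..\<tau> (Suc j)} t)"

definition simple_integral ::
    "nat \<Rightarrow> (nat \<Rightarrow> real) \<Rightarrow> (nat \<Rightarrow> 'a \<Rightarrow> real) \<Rightarrow> real \<Rightarrow> 'a \<Rightarrow> real" where
  "simple_integral k \<tau> \<xi> t \<omega> =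
     (\<Sum>j<k. \<xi> j \<omega> * (W (min t (\<tau> (Suc j))) \<omega> - W (min t (\<tau> j)) \<omega>))"

text \<open>
  \<open>ito_integral v I\<close>: the process \<open>I\<close> is (a continuous version of) \<open>\<integral>\<^sub>0\<^sup>t v dW\<close>, \<open>t \<in> [0,T]\<close>,
  that is, the \<open>L\<^sup>2\<close>-limit of the integrals of simple processes approximating \<open>v\<close> in
  \<open>L\<^sup>2(dt \<otimes> P)\<close>.  The integrals are taken in \<open>ennreal\<close>, so that convergence to \<open>0\<close> is meaningful
  without separate integrability conditions.
\<close>

definition ito_integral :: "(real \<Rightarrow> 'a \<Rightarrow> real) \<Rightarrow> (real \<Rightarrow> 'a \<Rightarrow> real) \<Rightarrow> bool" where
  "ito_integral v I \<longleftrightarrow>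
     v \<in> L2F \<and> adapted I \<and> (AE \<omega> in M. continuous_on {0..T} (\<lambda>t. I t \<omega>)) \<and>
     (\<exists>k \<tau> \<xi>. (\<forall>m::nat. simple_integrand (k m) (\<tau> m) (\<xi> m)) \<and>
        (\<lambda>m. \<integral>\<^sup>+ (t, \<omega>). ennreal ((simple_process (k m) (\<tau> m) (\<xi> m) t \<omega> - v t \<omega>)\<^sup>2) \<partial>dt_P)
          \<longlonglongrightarrow> 0 \<and>
        (\<forall>t\<in>{0..T}.
          (\<lambda>m. \<integral>\<^sup>+ \<omega>. ennreal ((simple_integral (k m) (\<tau> m) (\<xi> m) t \<omega> - I t \<omega>)\<^sup>2) \<partial>M)
            \<longlonglongrightarrow> 0))"

text \<open>Strong solutions \<open>X\<close> on \<open>[0,T]\<close> of \<open>dX = b(t, X) dt + v dW\<close>, \<open>X(0) = x\<close>.\<close>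

definition sde_solution ::
    "(real \<Rightarrow> 'a \<Rightarrow> real \<Rightarrow> real) \<Rightarrow> (real \<Rightarrow> 'a \<Rightarrow> real) \<Rightarrow> real \<Rightarrow> (real \<Rightarrow> 'a \<Rightarrow> real) \<Rightarrow> bool" where
  "sde_solution b v x X \<longleftrightarrow>
     adapted X \<and> (AE \<omega> in M. continuous_on {0..T} (\<lambda>t. X t \<omega>)) \<and>
     (\<exists>I. ito_integral v I \<and>
        (AE \<omega> in M. set_integrable lborel {0..T} (\<lambda>s. b s \<omega> (X s \<omega>)) \<and>
           (\<forall>t\<in>{0..T}. X t \<omega> = x + (LBINT s:{0..t}. b s \<omega> (X s \<omega>)) + I t \<omega>)))"

end

locale relative_wealth_game = brownian_space M T W
  for M :: "'a measure" and T :: real and W :: "real \<Rightarrow> 'a \<Rightarrow> real" +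
  fixes n :: nat and x \<theta> \<gamma> :: "nat \<Rightarrow> real"
    and r :: "real \<Rightarrow> 'a \<Rightarrow> real" and \<mu> \<sigma> :: "nat \<Rightarrow> real \<Rightarrow> 'a \<Rightarrow> real"
  assumes n_ge_2: "n \<ge> 2"
    and \<theta>_range: "\<And>i. i \<in> {1..n} \<Longrightarrow> \<theta> i \<in> {0..1}"
    and \<gamma>_pos: "\<And>i. i \<in> {1..n} \<Longrightarrow> \<gamma> i > 0"
    and r_adapted: "adapted r"
    and r_bounded: "ess_bounded r"
    and r_nonneg: "AE (t, \<omega>) in dt_P. r t \<omega> \<ge> 0"
    and \<mu>_adapted: "\<And>i. i \<in> {1..n} \<Longrightarrow> adapted (\<mu> i)"
    and \<mu>_bounded: "\<And>i. i \<in> {1..n} \<Longrightarrow> ess_bounded (\<mu> i)"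
    and \<mu>_nonneg: "\<And>i. i \<in> {1..n} \<Longrightarrow> AE (t, \<omega>) in dt_P. \<mu> i t \<omega> \<ge> 0"
    and \<sigma>_adapted: "\<And>i. i \<in> {1..n} \<Longrightarrow> adapted (\<sigma> i)"
    and \<sigma>_bounds: "\<And>i. i \<in> {1..n} \<Longrightarrow>
       \<exists>c>0. AE (t, \<omega>) in dt_P. inverse c \<le> \<sigma> i t \<omega> \<and> \<sigma> i t \<omega> \<le> c"
begin

definition \<rho> :: "nat \<Rightarrow> real \<Rightarrow> 'a \<Rightarrow> real" where
  "\<rho> i t \<omega> = (\<mu> i t \<omega> - r t \<omega>) / \<sigma> i t \<omega>"

definition \<Psi> :: real where
  "\<Psi> = (\<Sum>i=1..n. \<theta> i / (real n - 1 + \<theta> i))"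

definition is_wealth :: "nat \<Rightarrow> (real \<Rightarrow> 'a \<Rightarrow> real) \<Rightarrow> (real \<Rightarrow> 'a \<Rightarrow> real) \<Rightarrow> bool" where
  "is_wealth i p X \<longleftrightarrow>
     sde_solution (\<lambda>t \<omega> y. r t \<omega> * y + p t \<omega> * \<sigma> i t \<omega> * \<rho> i t \<omega>)
       (\<lambda>t \<omega>. p t \<omega> * \<sigma> i t \<omega>) (x i) X"

text \<open>
  For \<open>p \<in> L2F\<close> this linear equation has a solution, unique up to indistinguishability; expectation
  and variance below do not depend on the version selected.
\<close>

definition wealth :: "nat \<Rightarrow> (real \<Rightarrow> 'a \<Rightarrow> real) \<Rightarrow> real \<Rightarrow> 'a \<Rightarrow> real" where
  "wealth i p = (SOME X. is_wealth i p X)"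

definition peer_wealth :: "nat \<Rightarrow> (nat \<Rightarrow> real \<Rightarrow> 'a \<Rightarrow> real) \<Rightarrow> real \<Rightarrow> 'a \<Rightarrow> real" where
  "peer_wealth i \<pi> t \<omega> = (\<Sum>k\<in>{1..n} - {i}. wealth k (\<pi> k) t \<omega>) / (real n - 1)"

definition relative_wealth :: "nat \<Rightarrow> (nat \<Rightarrow> real \<Rightarrow> 'a \<Rightarrow> real) \<Rightarrow> 'a \<Rightarrow> real" where
  "relative_wealth i \<pi> \<omega> = wealth i (\<pi> i) T \<omega> - \<theta> i * peer_wealth i \<pi> T \<omega>"

definition J :: "nat \<Rightarrow> (nat \<Rightarrow> real \<Rightarrow> 'a \<Rightarrow> real) \<Rightarrow> real" where
  "J i \<pi> = expectation (relative_wealth i \<pi>) - \<gamma> i / 2 * variance (relative_wealth i \<pi>)"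

definition nash_equilibrium :: "(nat \<Rightarrow> real \<Rightarrow> 'a \<Rightarrow> real) \<Rightarrow> bool" where
  "nash_equilibrium \<pi> \<longleftrightarrow>
     (\<forall>i\<in>{1..n}. \<pi> i \<in> L2F) \<and> (\<forall>i\<in>{1..n}. \<forall>p\<in>L2F. J i \<pi> \<ge> J i (\<pi>(i := p)))"

text \<open>Strategy profiles are identified when, for every agent, they agree a.e. a.s.\<close>

definition unique_nash_equilibrium :: bool where
  "unique_nash_equilibrium \<longleftrightarrow>
     (\<exists>\<pi>. nash_equilibrium \<pi> \<and>
        (\<forall>\<pi>'. nash_equilibrium \<pi>' \<longrightarrow> (\<forall>i\<in>{1..n}. ae_eq (\<pi>' i) (\<pi> i))))"

end

end

theory Submission
  imports Defs
begin

text \<open>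
  As \<open>r\<close> is deterministic, the terminal wealth of agent \<open>i\<close> is a constant plus an expression \<open>Y\<^sub>i(\<pi>\<^sub>i)\<close>
  that is linear in the strategy.  An energy estimate run backwards from \<open>T\<close>, which uses only that \<open>\<rho>\<^sub>i\<close>
  is bounded, gives \<open>E \<integral> \<pi>\<^sub>i\<^sup>2 dt \<le> C Var Y\<^sub>i(\<pi>\<^sub>i)\<close>; so covariance is an equivalent inner product on
  strategies, and no martingale representation is needed.  Each \<open>J\<^sub>i\<close> is a concave quadratic function
  of \<open>\<pi>\<^sub>i\<close>, and with \<open>S = \<Sum>\<^sub>k Y\<^sub>k(\<pi>\<^sub>k)\<close> and \<open>q\<^sub>i = \<theta>\<^sub>i / (n - 1 + \<theta>\<^sub>i)\<close> the first-order conditions read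
  \<open>Cov(Y\<^sub>i(\<pi>\<^sub>i), Y\<^sub>i(p)) = q\<^sub>i Cov(S, Y\<^sub>i(p)) + \<kappa>\<^sub>i E Y\<^sub>i(p)\<close> for all \<open>p\<close>.
  Orthogonal projection onto the ranges of the \<open>Y\<^sub>i\<close> and summation reduce this to one equation for \<open>S\<close>,
  coercive because \<open>\<Sum>\<^sub>i q\<^sub>i = \<Psi> < 1\<close>.
\<close>

subsection \<open>Square-integrable functions\<close>

text \<open>The obstacle is the link between variance and strategy norm. The energy estimate
  controls a solution by its second moment at time T, whereas the objective contains a variance, so
  a constant must be removed at T and the result must again be the terminal value of a solution.
  With a rate that is a function of time alone, \<open>c\<close> at time T is reached without
  trading from the initial value \<open>c * exp (- R T)\<close>; a shift of the initial value thus
  turns a variance into a second moment. The same fact makes terminal wealth affine in the strategy.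

  No Ito formula is used. Wealth is solved path by path as a linear integral equation with
  continuous forcing term, and its expected square is computed from integration by parts in time,
  the isometry, and the martingale property tested against square-integrable variables. Since
  processes are identified almost everywhere while adaptedness is a condition at each single time,
  limits are built pointwise along subsequences and null sets are absorbed by the completed
  filtration.\<close>

lemma quadratic_nonneg_imp:
  fixes a b c :: real
  assumes "\<And>t. a + 2 * t * b + t\<^sup>2 * c \<ge> 0"
  shows "b\<^sup>2 \<le> a * c"
proof (cases "c = 0")
  case True
  have "b = 0"
  proof (rule ccontr)
    assume "b \<noteq> 0"
    \<comment> \<open>With \<open>c = 0\<close> the polynomial is affine in \<open>t\<close>, and
      this argument gives it the value -1.\<close>
    have "a + 2 * (- (a + 1) / (2 * b)) * b \<ge> 0"
      using assms[of "- (a + 1) / (2 * b)"] True by simp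
    moreover have "2 * (- (a + 1) / (2 * b)) * b = - (a + 1)"
      using \<open>b \<noteq> 0\<close> by (simp add: field_simps)
    ultimately show False by linarith
  qed
  with True show ?thesis by simp
next
  case False
  have "c > 0"
  proof (rule ccontr)
    assume "\<not> c > 0"
    with False have "c < 0" by simp
    \<comment> \<open>Far enough out the negative quadratic term dominates: \<open>t\<close> is at
      least 1 and \<open>t * \<bar>c\<bar>\<close> exceeds the remaining coefficients.\<close>
    define t where "t = (\<bar>a\<bar> + 2 * \<bar>b\<bar> + 1) / \<bar>c\<bar> + 1"
    have t: "t \<ge> 1" "t * \<bar>c\<bar> \<ge> \<bar>a\<bar> + 2 * \<bar>b\<bar> + 1"
      using \<open>c < 0\<close> by (auto simp: t_def field_simps)
    have "t\<^sup>2 * c = - (t * (t * \<bar>c\<bar>))"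
      using \<open>c < 0\<close> by (simp add: power2_eq_square)
    also have "\<dots> \<le> - (t * (\<bar>a\<bar> + 2 * \<bar>b\<bar> + 1))"
      using t by (simp add: mult_left_mono)
    finally have *: "t\<^sup>2 * c \<le> - (t * \<bar>a\<bar>) - 2 * (t * \<bar>b\<bar>) - t"
      by (simp add: algebra_simps)
    have "t * b \<le> t * \<bar>b\<bar>"
      using t by (intro mult_left_mono) auto
    moreover have "a \<le> t * \<bar>a\<bar>"
      using mult_right_mono[OF t(1), of "\<bar>a\<bar>"] by linarith
    ultimately have "a + 2 * t * b + t\<^sup>2 * c < 0"
      using * t(1) by linarith
    with assms[of t] show False by linarith
  qed
  have "0 \<le> a + 2 * (- b / c) * b + (- b / c)\<^sup>2 * c"
    by (rule assms)
  also have "\<dots> = a - b\<^sup>2 / c"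
    using \<open>c > 0\<close> by (simp add: field_simps power2_eq_square)
  finally show ?thesis
    using \<open>c > 0\<close> by (simp add: field_simps)
qed

text \<open>
  The vector space structure enters only through a binary linear combination \<open>lc a u b v\<close>, read
  \<open>a u + b v\<close>, so that the carrier can be a set of processes identified almost everywhere.
\<close>

locale semi_inner =
  fixes V :: "'v set" and lc :: "real \<Rightarrow> 'v \<Rightarrow> real \<Rightarrow> 'v \<Rightarrow> 'v" and B :: "'v \<Rightarrow> 'v \<Rightarrow> real"
  assumes lc_closed: "u \<in> V \<Longrightarrow> v \<in> V \<Longrightarrow> lc a u b v \<in> V"
    and B_linear: "u \<in> V \<Longrightarrow> v \<in> V \<Longrightarrow> w \<in> V \<Longrightarrow> B (lc a u b v) w = a * B u w + b * B v w"
    and B_sym: "u \<in> V \<Longrightarrow> v \<in> V \<Longrightarrow> B u v = B v u"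
    and B_nonneg: "u \<in> V \<Longrightarrow> B u u \<ge> 0"
begin

lemma B_quadratic:
  assumes "u \<in> V" "v \<in> V"
  shows "B (lc a u b v) (lc a u b v) = a\<^sup>2 * B u u + 2 * a * b * B u v + b\<^sup>2 * B v v"
proof -
  have "B (lc a u b v) (lc a u b v) = a * B u (lc a u b v) + b * B v (lc a u b v)"
    using assms by (intro B_linear lc_closed)
  also have "B u (lc a u b v) = a * B u u + b * B v u"
    using B_sym[OF assms(1) lc_closed[OF assms]] B_linear[OF assms assms(1)] by simp
  also have "B v (lc a u b v) = a * B u v + b * B v v"
    using B_sym[OF assms(2) lc_closed[OF assms]] B_linear[OF assms assms(2)] by simp
  finally show ?thesis
    using B_sym[OF assms] by (simp add: power2_eq_square algebra_simps)
qed

text \<open>\<open>B\<close> is only semidefinite, so \<open>v\<close> cannot be normalised.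
  Nonnegativity of \<open>B\<close> along the line through \<open>u\<close> in direction
  \<open>v\<close> gives the discriminant inequality, which includes the case
  \<open>B v v = 0\<close>.\<close>

lemma B_Cauchy_Schwarz:
  assumes "u \<in> V" "v \<in> V"
  shows "(B u v)\<^sup>2 \<le> B u u * B v v"
proof (rule quadratic_nonneg_imp)
  fix t
  have "B (lc 1 u t v) (lc 1 u t v) \<ge> 0"
    using assms by (intro B_nonneg lc_closed)
  then show "0 \<le> B u u + 2 * t * B u v + t\<^sup>2 * B v v"
    using assms by (simp add: B_quadratic)
qed

text \<open>Direct method: a minimiser of \<open>B u u / 2 - l u\<close> solves the equation. Cauchy
  sequences and limits are measured by \<open>B\<close> alone, so that elements at
  \<open>B\<close>-distance zero need not be equal; the theorem then serves processes up to almost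
  everywhere equality as well as random variables up to constants.\<close>

theorem riesz_representation:
  fixes l :: "'v \<Rightarrow> real"
  assumes nonempty: "V \<noteq> {}"
    and complete: "\<And>u. (\<And>m. u m \<in> V) \<Longrightarrow>
      (\<And>e. e > 0 \<Longrightarrow> \<exists>K. \<forall>m\<ge>K. \<forall>k\<ge>K. B (lc 1 (u m) (-1) (u k)) (lc 1 (u m) (-1) (u k)) < e) \<Longrightarrow>
      \<exists>v\<in>V. (\<lambda>m::nat. B (lc 1 (u m) (-1) v) (lc 1 (u m) (-1) v)) \<longlonglongrightarrow> 0"
    and l_linear: "\<And>a b u v. u \<in> V \<Longrightarrow> v \<in> V \<Longrightarrow> l (lc a u b v) = a * l u + b * l v"
    and C: "C \<ge> 0"
    and l_bounded: "\<And>u. u \<in> V \<Longrightarrow> (l u)\<^sup>2 \<le> C * B u u"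
  shows "\<exists>u\<in>V. \<forall>v\<in>V. B u v = l v"
proof -
  define F where "F u = B u u / 2 - l u" for u
  \<comment> \<open>From \<open>4 * C * x \<le> (x + C)\<^sup>2\<close> with
    \<open>x = B u u\<close>: the linear term costs at most half of \<open>x + C\<close>.\<close>
  have lower: "F u \<ge> - C / 2" if "u \<in> V" for u
  proof -
    have "(2 * l u)\<^sup>2 \<le> 4 * (C * B u u)"
      using l_bounded[OF that] by (simp add: power_mult_distrib)
    also have "\<dots> \<le> (B u u + C)\<^sup>2"
      using zero_le_power2[of "B u u - C"] by (simp add: power2_eq_square algebra_simps)
    finally have "2 * l u \<le> B u u + C"
      by (rule power2_le_imp_le) (use C B_nonneg[OF that] in auto)
    then show ?thesis by (simp add: F_def)
  qed
  define I where "I = Inf (F ` V)"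
  have bdd: "bdd_below (F ` V)"
    using lower by (intro bdd_belowI2)
  have I_le: "I \<le> F u" if "u \<in> V" for u
    using that bdd by (simp add: I_def cINF_lower)
  have "\<exists>u\<in>V. F u < I + 1 / (real m + 1)" for m
  proof -
    have "Inf (F ` V) < I + 1 / (real m + 1)"
      by (simp add: I_def)
    then show ?thesis
      using nonempty bdd by (subst (asm) cInf_less_iff) auto
  qed
  then have "\<forall>m. \<exists>u. u \<in> V \<and> F u < I + 1 / (real m + 1)" by blast
  then obtain u where uV: "\<And>m. u m \<in> V" and uF: "\<And>m. F (u m) < I + 1 / (real m + 1)"
    by (auto dest!: choice)
  \<comment> \<open>Parallelogram identity: the midpoint of two near-minimisers has value at least
    \<open>I\<close>, which leaves only a small \<open>B\<close>-distance between them.\<close>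
  have cauchy: "B (lc 1 (u m) (-1) (u k)) (lc 1 (u m) (-1) (u k))
      \<le> 4 * (1 / (real m + 1) + 1 / (real k + 1))" for m k
  proof -
    have arith: "a - 2 * b + c \<le> 4 * (p + q)"
      if "I \<le> (a / 4 + b / 2 + c / 4) / 2 - (x + y) / 2" "a / 2 - x < I + p" "c / 2 - y < I + q"
      for a b c x y p q :: real
      using that by argo
    have "I \<le> F (lc (1/2) (u m) (1/2) (u k))"
      using uV by (intro I_le lc_closed)
    also have "\<dots> =
        (B (u m) (u m) / 4 + B (u m) (u k) / 2 + B (u k) (u k) / 4) / 2 - (l (u m) + l (u k)) / 2"
      unfolding F_def B_quadratic[OF uV uV] l_linear[OF uV uV]
      by (simp add: power2_eq_square add_divide_distrib diff_divide_distrib)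
    finally have "B (u m) (u m) - 2 * B (u m) (u k) + B (u k) (u k)
        \<le> 4 * (1 / (real m + 1) + 1 / (real k + 1))"
      by (rule arith) (use uF[of m] uF[of k] in \<open>simp_all only: F_def\<close>)
    then show ?thesis
      unfolding B_quadratic[OF uV uV] by simp
  qed
  have "\<exists>v\<in>V. (\<lambda>m::nat. B (lc 1 (u m) (-1) v) (lc 1 (u m) (-1) v)) \<longlonglongrightarrow> 0"
  proof (rule complete[OF uV])
    fix e :: real assume "e > 0"
    obtain K :: nat where "K > 8 / e"
      using reals_Archimedean2[of "8 / e"] by auto
    then have "8 / (real K + 1) < e"
      using \<open>e > 0\<close> by (simp add: field_simps)
    moreover have "4 * (1 / (real m + 1) + 1 / (real k + 1)) \<le> 8 / (real K + 1)"
      if "m \<ge> K" "k \<ge> K" for m k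
    proof -
      have "1 / (real m + 1) \<le> 1 / (real K + 1)" "1 / (real k + 1) \<le> 1 / (real K + 1)"
        using that by (auto intro!: divide_left_mono)
      then show ?thesis by simp
    qed
    ultimately have "B (lc 1 (u m) (-1) (u k)) (lc 1 (u m) (-1) (u k)) < e" if "m \<ge> K" "k \<ge> K" for m k
      using cauchy[of m k] that by fastforce
    then show "\<exists>K. \<forall>m\<ge>K. \<forall>k\<ge>K. B (lc 1 (u m) (-1) (u k)) (lc 1 (u m) (-1) (u k)) < e"
      by blast
  qed
  then obtain v where v: "v \<in> V"
    and lim: "(\<lambda>m. B (lc 1 (u m) (-1) v) (lc 1 (u m) (-1) v)) \<longlonglongrightarrow> 0" by blast
  define d where "d m = lc 1 (u m) (-1) v" for m
  have dV: "d m \<in> V" for m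
    by (simp add: d_def lc_closed uV v)
  have lim_d: "(\<lambda>m. B (d m) (d m)) \<longlonglongrightarrow> 0"
    using lim by (simp add: d_def)
  have ld: "(\<lambda>m. l (d m)) \<longlonglongrightarrow> 0"
  proof -
    have "(\<lambda>m. (l (d m))\<^sup>2) \<longlonglongrightarrow> 0"
    proof (rule tendsto_sandwich[of "\<lambda>_. 0" _ _ "\<lambda>m. C * B (d m) (d m)"])
      show "(\<lambda>m. C * B (d m) (d m)) \<longlonglongrightarrow> 0"
        using tendsto_mult_right_zero[OF lim_d] .
    qed (simp_all add: l_bounded dV)
    then show ?thesis by simp
  qed
  have Bd: "(\<lambda>m. B (d m) v) \<longlonglongrightarrow> 0"
  proof -
    have "(\<lambda>m. (B (d m) v)\<^sup>2) \<longlonglongrightarrow> 0"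
    proof (rule tendsto_sandwich[of "\<lambda>_. 0" _ _ "\<lambda>m. B (d m) (d m) * B v v"])
      show "(\<lambda>m. B (d m) (d m) * B v v) \<longlonglongrightarrow> 0"
        using tendsto_mult_left_zero[OF lim_d] .
    qed (simp_all add: B_Cauchy_Schwarz dV v)
    then show ?thesis by simp
  qed
  have Fd: "F (u m) = F v + B (d m) v + B (d m) (d m) / 2 - l (d m)" for m
    unfolding F_def d_def B_quadratic[OF uV v] l_linear[OF uV v] B_linear[OF uV v v]
    by (simp add: add_divide_distrib diff_divide_distrib)
  have "(\<lambda>m. F (u m)) \<longlonglongrightarrow> F v + 0 + 0 / 2 - 0"
    unfolding Fd by (intro tendsto_add tendsto_diff tendsto_divide tendsto_const Bd lim_d ld) simp
  moreover have "(\<lambda>m. F (u m)) \<longlonglongrightarrow> I"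
  proof (rule tendsto_sandwich[where f = "\<lambda>_. I"])
    show "(\<lambda>m. I + 1 / (real m + 1)) \<longlonglongrightarrow> I"
      using tendsto_add[OF tendsto_const[of I] LIMSEQ_inverse_real_of_nat]
      by (simp add: inverse_eq_divide add.commute)
  qed (use I_le uV uF in \<open>auto intro!: always_eventually less_imp_le\<close>)
  ultimately have Fv: "F v = I"
    using LIMSEQ_unique[of "\<lambda>m. F (u m)" "F v" I] by simp
  \<comment> \<open>Minimality along \<open>v + 2 t w\<close>: the step \<open>2 * t\<close> brings
    the increment into the form of \<open>quadratic_nonneg_imp\<close> with constant term 0, which
    forces the linear coefficient to vanish.\<close>
  have "B v w = l w" if w: "w \<in> V" for w
  proof -
    have "(B v w - l w)\<^sup>2 \<le> 0 * (2 * B w w)"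
    proof (rule quadratic_nonneg_imp)
      fix t
      have "F (lc 1 v (2 * t) w) \<ge> F v"
        unfolding Fv by (intro I_le lc_closed v w)
      then show "0 \<le> 0 + 2 * t * (B v w - l w) + t\<^sup>2 * (2 * B w w)"
        unfolding F_def B_quadratic[OF v w] l_linear[OF v w]
        by (simp add: power_mult_distrib algebra_simps add_divide_distrib)
    qed
    then show ?thesis by simp
  qed
  with v show ?thesis by blast
qed

end

lemma convergent_real_bounded_above:
  fixes f :: "nat \<Rightarrow> real"
  assumes "f \<longlonglongrightarrow> a"
  obtains C where "\<And>m. f m \<le> C"
proof -
  have "Bseq f" using assms by (intro convergent_imp_Bseq convergentI)
  then obtain C where "\<And>m. norm (f m) \<le> C" by (auto simp: Bseq_def)
  then have "f m \<le> C" for m using abs_le_D1 by auto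
  with that show thesis by blast
qed

section \<open>The semi-inner-product space of square-integrable functions\<close>

definition sq_int :: "'b measure \<Rightarrow> ('b \<Rightarrow> real) \<Rightarrow> bool" where
  "sq_int N f \<longleftrightarrow> f \<in> borel_measurable N \<and> integrable N (\<lambda>x. (f x)\<^sup>2)"

lemma sq_intD:
  assumes "sq_int N f"
  shows "f \<in> borel_measurable N" "integrable N (\<lambda>x. (f x)\<^sup>2)"
  using assms by (auto simp: sq_int_def)

lemma sq_intI_nn:
  assumes "f \<in> borel_measurable N" "(\<integral>\<^sup>+ x. ennreal ((f x)\<^sup>2) \<partial>N) < \<infinity>"
  shows "sq_int N f"
proof -
  have "integrable N (\<lambda>x. (f x)\<^sup>2)"
    by (rule integrableI_bounded) (use assms in simp_all)
  with assms show ?thesis by (simp add: sq_int_def)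
qed

lemma sq_int_mult:
  assumes "sq_int N f" "sq_int N g"
  shows "integrable N (\<lambda>x. f x * g x)"
proof (rule Bochner_Integration.integrable_bound)
  show "integrable N (\<lambda>x. (f x)\<^sup>2 + (g x)\<^sup>2)"
    using assms by (auto simp: sq_int_def)
  have "\<bar>a * b\<bar> \<le> a\<^sup>2 + b\<^sup>2" for a b :: real
  proof -
    have "0 \<le> (\<bar>a\<bar> - \<bar>b\<bar>)\<^sup>2" "0 \<le> a\<^sup>2" "0 \<le> b\<^sup>2" by simp_all
    then have "2 * \<bar>a * b\<bar> \<le> a\<^sup>2 + b\<^sup>2"
      by (simp add: power2_eq_square algebra_simps abs_mult)
    then show ?thesis by linarith
  qed
  then show "AE x in N. norm (f x * g x) \<le> norm ((f x)\<^sup>2 + (g x)\<^sup>2)"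
    by auto
qed (use assms in \<open>auto simp: sq_int_def\<close>)

lemma sq_int_lin:
  assumes "sq_int N f" "sq_int N g"
  shows "sq_int N (\<lambda>x. a * f x + b * g x)"
proof -
  have "integrable N (\<lambda>x. a\<^sup>2 * (f x)\<^sup>2 + 2 * a * b * (f x * g x) + b\<^sup>2 * (g x)\<^sup>2)"
    using assms sq_int_mult[OF assms] by (auto simp: sq_int_def)
  moreover have "a\<^sup>2 * (f x)\<^sup>2 + 2 * a * b * (f x * g x) + b\<^sup>2 * (g x)\<^sup>2 = (a * f x + b * g x)\<^sup>2" for x
    by (simp add: power2_eq_square algebra_simps)
  ultimately show ?thesis
    using assms by (auto simp: sq_int_def)
qed

lemma sq_int_add: "sq_int N f \<Longrightarrow> sq_int N g \<Longrightarrow> sq_int N (\<lambda>x. f x + g x)"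
  using sq_int_lin[of N f g 1 1] by simp

lemma sq_int_diff: "sq_int N f \<Longrightarrow> sq_int N g \<Longrightarrow> sq_int N (\<lambda>x. f x - g x)"
  using sq_int_lin[of N f g 1 "-1"] by simp

lemma sq_int_cmult: "sq_int N f \<Longrightarrow> sq_int N (\<lambda>x. c * f x)"
  using sq_int_lin[of N f f c 0] by simp

lemma sq_int_zero [simp]: "sq_int N (\<lambda>x. 0)"
  by (simp add: sq_int_def)

lemma sq_int_sum: "(\<And>i. i \<in> I \<Longrightarrow> sq_int N (f i)) \<Longrightarrow> sq_int N (\<lambda>x. \<Sum>i\<in>I. f i x)"
  by (induction I rule: infinite_finite_induct) (auto intro: sq_int_add)

lemma sq_int_bound:
  assumes "sq_int N g" "f \<in> borel_measurable N" "AE x in N. \<bar>f x\<bar> \<le> c * \<bar>g x\<bar>"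
  shows "sq_int N f"
proof -
  have "integrable N (\<lambda>x. (f x)\<^sup>2)"
  proof (rule Bochner_Integration.integrable_bound)
    show "integrable N (\<lambda>x. c\<^sup>2 * (g x)\<^sup>2)"
      using assms by (simp add: sq_int_def)
    show "AE x in N. norm ((f x)\<^sup>2) \<le> norm (c\<^sup>2 * (g x)\<^sup>2)"
      using assms(3)
    proof eventually_elim
      case (elim x)
      then have "\<bar>f x\<bar>\<^sup>2 \<le> (c * \<bar>g x\<bar>)\<^sup>2" by (intro power_mono) auto
      then show ?case by (simp add: power_mult_distrib)
    qed
  qed (use assms in auto)
  with assms show ?thesis by (simp add: sq_int_def)
qed

lemma (in finite_measure) sq_int_const [simp]: "sq_int M (\<lambda>x. c)"
  by (simp add: sq_int_def)

lemma (in finite_measure) sq_int_integrable: "sq_int M f \<Longrightarrow> integrable M f"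
  using sq_int_mult[of M f "\<lambda>_. 1"] by simp

interpretation L2: semi_inner "{f. sq_int N f}" "\<lambda>a u b v x. a * u x + b * v x" "\<lambda>f g. \<integral>x. f x * g x \<partial>N"
  for N :: "'b measure"
proof (unfold_locales, goal_cases)
  case (2 u v w a b)
  have "(\<integral>x. (a * u x + b * v x) * w x \<partial>N) = (\<integral>x. a * (u x * w x) + b * (v x * w x) \<partial>N)"
    by (simp add: algebra_simps)
  also have "\<dots> = a * (\<integral>x. u x * w x \<partial>N) + b * (\<integral>x. v x * w x \<partial>N)"
    using 2 by (subst Bochner_Integration.integral_add) (auto intro: sq_int_mult)
  finally show ?case .
qed (auto intro: sq_int_lin simp: mult.commute)

lemma L2_Cauchy_Schwarz:
  assumes "sq_int N f" "sq_int N g"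
  shows "(\<integral>x. f x * g x \<partial>N)\<^sup>2 \<le> (\<integral>x. (f x)\<^sup>2 \<partial>N) * (\<integral>x. (g x)\<^sup>2 \<partial>N)"
  using L2.B_Cauchy_Schwarz[of f N g] assms by (simp add: power2_eq_square)

text \<open>Cauchy-Schwarz with one factor vanishing in norm and the other bounded in norm.
  \<open>Z\<close> varies with the index so that the product of two vanishing errors is covered as
  well.\<close>

lemma L2_inner_tendsto_zero:
  assumes "\<And>m. sq_int N (X m)" "sq_int N Y" "(\<lambda>m. \<integral>x. (X m x)\<^sup>2 \<partial>N) \<longlonglongrightarrow> 0"
    and "\<And>m. sq_int N (Z m)" "\<And>m. (\<integral>x. (Z m x)\<^sup>2 \<partial>N) \<le> C"
  shows "(\<lambda>m. \<integral>x. X m x * Z m x \<partial>N) \<longlonglongrightarrow> 0"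
proof -
  have "(\<lambda>m. (\<integral>x. X m x * Z m x \<partial>N)\<^sup>2) \<longlonglongrightarrow> 0"
  proof (rule tendsto_sandwich[OF _ _ tendsto_const[of 0]])
    show "(\<lambda>m. (\<integral>x. (X m x)\<^sup>2 \<partial>N) * C) \<longlonglongrightarrow> 0"
      using tendsto_mult_right[OF assms(3), of C] by simp
    show "\<forall>\<^sub>F m in sequentially. (\<integral>x. X m x * Z m x \<partial>N)\<^sup>2 \<le> (\<integral>x. (X m x)\<^sup>2 \<partial>N) * C"
    proof (intro always_eventually allI)
      fix m
      have "(\<integral>x. X m x * Z m x \<partial>N)\<^sup>2 \<le> (\<integral>x. (X m x)\<^sup>2 \<partial>N) * (\<integral>x. (Z m x)\<^sup>2 \<partial>N)"
        by (intro L2_Cauchy_Schwarz assms)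
      also have "\<dots> \<le> (\<integral>x. (X m x)\<^sup>2 \<partial>N) * C"
        by (intro mult_left_mono assms) simp
      finally show "(\<integral>x. X m x * Z m x \<partial>N)\<^sup>2 \<le> (\<integral>x. (X m x)\<^sup>2 \<partial>N) * C" .
    qed
  qed auto
  then show ?thesis by simp
qed

text \<open>Square integrability of all members is part of the notion: the Bochner integral of a
  nonintegrable square is 0 and would make the limit meaningless.\<close>

definition L2_tendsto :: "'b measure \<Rightarrow> (nat \<Rightarrow> 'b \<Rightarrow> real) \<Rightarrow> ('b \<Rightarrow> real) \<Rightarrow> bool" where
  "L2_tendsto N X Y \<longleftrightarrow> (\<forall>m. sq_int N (X m)) \<and> sq_int N Y \<and> (\<lambda>m. \<integral>x. (X m x - Y x)\<^sup>2 \<partial>N) \<longlonglongrightarrow> 0"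

text \<open>Each product splits into the limit product, two mixed error terms and the product of the
  errors. The isometry and the martingale property are carried to the limit in this polarised
  form.\<close>

lemma L2_inner_tendsto:
  assumes "L2_tendsto N X X'" "L2_tendsto N Y Y'"
  shows "(\<lambda>m. \<integral>x. X m x * Y m x \<partial>N) \<longlonglongrightarrow> (\<integral>x. X' x * Y' x \<partial>N)"
proof -
  have sq: "sq_int N (X m)" "sq_int N X'" "sq_int N (Y m)" "sq_int N Y'" for m
    using assms by (auto simp: L2_tendsto_def)
  define dX where "dX m x = X m x - X' x" for m x
  define dY where "dY m x = Y m x - Y' x" for m x
  have sqd: "sq_int N (dX m)" "sq_int N (dY m)" for m
    unfolding dX_def dY_def by (intro sq_int_diff sq)+
  have lX: "(\<lambda>m. \<integral>x. (dX m x)\<^sup>2 \<partial>N) \<longlonglongrightarrow> 0" and lY: "(\<lambda>m. \<integral>x. (dY m x)\<^sup>2 \<partial>N) \<longlonglongrightarrow> 0"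
    using assms by (auto simp: L2_tendsto_def dX_def dY_def)
  obtain C where C: "\<And>m. (\<integral>x. (dY m x)\<^sup>2 \<partial>N) \<le> C"
    using convergent_real_bounded_above[OF lY] by blast
  have *: "(\<integral>x. X m x * Y m x \<partial>N) =
      (\<integral>x. X' x * Y' x \<partial>N) + (\<integral>x. dX m x * Y' x \<partial>N) + (\<integral>x. dY m x * X' x \<partial>N) + (\<integral>x. dX m x * dY m x \<partial>N)" for m
  proof -
    have "(\<integral>x. X m x * Y m x \<partial>N) =
        (\<integral>x. X' x * Y' x + dX m x * Y' x + dY m x * X' x + dX m x * dY m x \<partial>N)"
      by (intro Bochner_Integration.integral_cong) (auto simp: dX_def dY_def algebra_simps)
    then show ?thesis
      using sq sqd by (simp add: sq_int_mult)
  qed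
  have "(\<lambda>m. \<integral>x. dX m x * Y' x \<partial>N) \<longlonglongrightarrow> 0"
    by (rule L2_inner_tendsto_zero[OF sqd(1) sq(2) lX sq(4) order_refl])
  moreover have "(\<lambda>m. \<integral>x. dY m x * X' x \<partial>N) \<longlonglongrightarrow> 0"
    by (rule L2_inner_tendsto_zero[OF sqd(2) sq(2) lY sq(2) order_refl])
  moreover have "(\<lambda>m. \<integral>x. dX m x * dY m x \<partial>N) \<longlonglongrightarrow> 0"
    by (rule L2_inner_tendsto_zero[OF sqd(1) sq(2) lX sqd(2) C])
  ultimately have "(\<lambda>m. \<integral>x. X m x * Y m x \<partial>N) \<longlonglongrightarrow> (\<integral>x. X' x * Y' x \<partial>N) + 0 + 0 + 0"
    unfolding * by (intro tendsto_add tendsto_const)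
  then show ?thesis by simp
qed

text \<open>Passage from the extended-real convergence in \<open>ito_integral\<close> to Bochner
  integrals. The limit is square integrable because its distance to a single \<open>X m\<close> is
  finite.\<close>

lemma L2_tendsto_nnI:
  assumes X: "\<And>m. sq_int N (X m)" and Y: "Y \<in> borel_measurable N"
    and lim: "(\<lambda>m. \<integral>\<^sup>+ x. ennreal ((X m x - Y x)\<^sup>2) \<partial>N) \<longlonglongrightarrow> 0"
  shows "L2_tendsto N X Y"
proof -
  have [measurable]: "X m \<in> borel_measurable N" for m
    using X by (auto simp: sq_int_def)
  note Y [measurable]
  have "\<forall>\<^sub>F m in sequentially. (\<integral>\<^sup>+ x. ennreal ((X m x - Y x)\<^sup>2) \<partial>N) < 1"
    using lim by (rule order_tendstoD) simp
  then obtain m where m: "(\<integral>\<^sup>+ x. ennreal ((X m x - Y x)\<^sup>2) \<partial>N) < 1"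
    using eventually_sequentially by auto
  have "sq_int N (\<lambda>x. X m x - Y x)"
    by (rule sq_intI_nn) (use order.strict_trans[OF m, of \<infinity>] in auto)
  from sq_int_diff[OF X[of m] this] have sqY: "sq_int N Y" by simp
  have "ennreal (\<integral>x. (X m x - Y x)\<^sup>2 \<partial>N) = (\<integral>\<^sup>+ x. ennreal ((X m x - Y x)\<^sup>2) \<partial>N)" for m
    using sq_int_diff[OF X[of m] sqY] by (intro nn_integral_eq_integral[symmetric]) (auto simp: sq_int_def)
  with lim have "(\<lambda>m. ennreal (\<integral>x. (X m x - Y x)\<^sup>2 \<partial>N)) \<longlonglongrightarrow> ennreal 0"
    by simp
  then have "(\<lambda>m. \<integral>x. (X m x - Y x)\<^sup>2 \<partial>N) \<longlonglongrightarrow> 0"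
    by (subst (asm) tendsto_ennreal_iff) auto
  with X sqY show ?thesis by (simp add: L2_tendsto_def)
qed

lemma L2_tendsto_nnD:
  assumes "L2_tendsto N X Y"
  shows "(\<lambda>m. \<integral>\<^sup>+ x. ennreal ((X m x - Y x)\<^sup>2) \<partial>N) \<longlonglongrightarrow> 0"
proof -
  have sq: "sq_int N (X m)" "sq_int N Y" for m
    using assms by (auto simp: L2_tendsto_def)
  have "(\<integral>\<^sup>+ x. ennreal ((X m x - Y x)\<^sup>2) \<partial>N) = ennreal (\<integral>x. (X m x - Y x)\<^sup>2 \<partial>N)" for m
    using sq_int_diff[OF sq] by (intro nn_integral_eq_integral) (auto simp: sq_int_def)
  moreover have "(\<lambda>m. ennreal (\<integral>x. (X m x - Y x)\<^sup>2 \<partial>N)) \<longlonglongrightarrow> ennreal 0"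
    using assms by (intro tendsto_ennrealI) (simp add: L2_tendsto_def)
  ultimately show ?thesis by simp
qed

text \<open>Fatou's lemma applied to squares. It converts estimates between members of a sequence
  into estimates against the almost sure limit.\<close>

lemma L2_Fatou:
  assumes f: "\<And>k. sq_int N (f k)" and g: "g \<in> borel_measurable N"
    and le: "\<And>k. k \<ge> K \<Longrightarrow> (\<integral>x. (f k x)\<^sup>2 \<partial>N) \<le> e"
    and lim: "AE x in N. (\<lambda>k. f k x) \<longlonglongrightarrow> g x"
  shows "sq_int N g" "(\<integral>x. (g x)\<^sup>2 \<partial>N) \<le> e"
proof -
  have e: "0 \<le> e"
    using order_trans[OF _ le[of K]] by simp
  have [measurable]: "f k \<in> borel_measurable N" for k
    using f by (auto simp: sq_int_def)
  note g [measurable]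
  have "(\<integral>\<^sup>+ x. ennreal ((g x)\<^sup>2) \<partial>N) = (\<integral>\<^sup>+ x. liminf (\<lambda>k. ennreal ((f k x)\<^sup>2)) \<partial>N)"
  proof (rule nn_integral_cong_AE)
    show "AE x in N. ennreal ((g x)\<^sup>2) = liminf (\<lambda>k. ennreal ((f k x)\<^sup>2))"
      using lim
    proof eventually_elim
      case (elim x)
      then have "(\<lambda>k. ennreal ((f k x)\<^sup>2)) \<longlonglongrightarrow> ennreal ((g x)\<^sup>2)"
        by (intro tendsto_ennrealI tendsto_intros)
      then show ?case by (intro lim_imp_Liminf[symmetric]) auto
    qed
  qed
  also have "\<dots> \<le> liminf (\<lambda>k. \<integral>\<^sup>+ x. ennreal ((f k x)\<^sup>2) \<partial>N)"
    by (rule nn_integral_liminf) simp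
  also have "\<dots> \<le> ennreal e"
  proof (rule Liminf_le)
    show "\<forall>\<^sub>F k in sequentially. (\<integral>\<^sup>+ x. ennreal ((f k x)\<^sup>2) \<partial>N) \<le> ennreal e"
      unfolding eventually_sequentially
    proof (intro exI[of _ K] allI impI)
      fix k assume "k \<ge> K"
      have "(\<integral>\<^sup>+ x. ennreal ((f k x)\<^sup>2) \<partial>N) = ennreal (\<integral>x. (f k x)\<^sup>2 \<partial>N)"
        using f by (intro nn_integral_eq_integral) (auto simp: sq_int_def)
      then show "(\<integral>\<^sup>+ x. ennreal ((f k x)\<^sup>2) \<partial>N) \<le> ennreal e"
        using le[OF \<open>k \<ge> K\<close>] by (simp add: ennreal_leI)
    qed
  qed simp
  finally have *: "(\<integral>\<^sup>+ x. ennreal ((g x)\<^sup>2) \<partial>N) \<le> ennreal e" .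
  then show sq: "sq_int N g"
    by (intro sq_intI_nn) (use order.strict_trans1[OF *, of \<infinity>] in auto)
  then have "ennreal (\<integral>x. (g x)\<^sup>2 \<partial>N) = (\<integral>\<^sup>+ x. ennreal ((g x)\<^sup>2) \<partial>N)"
    by (intro nn_integral_eq_integral[symmetric]) (auto simp: sq_int_def)
  with * have "ennreal (\<integral>x. (g x)\<^sup>2 \<partial>N) \<le> ennreal e" by simp
  then show "(\<integral>x. (g x)\<^sup>2 \<partial>N) \<le> e" using e by (subst (asm) ennreal_le_iff) auto
qed

lemma fast_subsequence:
  assumes "\<And>e::real. e > 0 \<Longrightarrow> \<exists>K::nat. \<forall>m\<ge>K. \<forall>k\<ge>K. P e m k"
    and "\<And>k::nat. (\<epsilon> k :: real) > 0"
  shows "\<exists>s. strict_mono s \<and> (\<forall>j. \<forall>m\<ge>s j. \<forall>k\<ge>s j. P (\<epsilon> j) m k)"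
proof -
  have "\<forall>j. \<exists>K. \<forall>m\<ge>K. \<forall>k\<ge>K. P (\<epsilon> j) m k"
    using assms by blast
  then obtain K where K: "\<And>j m k. m \<ge> K j \<Longrightarrow> k \<ge> K j \<Longrightarrow> P (\<epsilon> j) m k"
    by (auto dest!: choice)
  \<comment> \<open>The summand \<open>j\<close> makes \<open>s\<close> strictly increasing, and the
    sum dominates \<open>K j\<close>.\<close>
  define s where "s j = j + (\<Sum>i\<le>j. K i)" for j
  have "strict_mono s"
    unfolding strict_mono_Suc_iff s_def by simp
  moreover have "K j \<le> s j" for j
    using member_le_sum[of j "{..j}" K] by (simp add: s_def)
  ultimately show ?thesis
    using K by (intro exI[of _ s]) (meson order_trans)
qed

text \<open>
  The limit is taken along one explicit subsequence at every point where it exists, so that it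
  inherits measurability with respect to every \<open>\<sigma>\<close>-algebra that makes the sequence measurable.
\<close>

lemma L2_complete:
  assumes f: "\<And>m. sq_int N (f m)"
    and cauchy: "\<And>e. e > 0 \<Longrightarrow> \<exists>K. \<forall>m\<ge>K. \<forall>k\<ge>K. (\<integral>x. (f m x - f k x)\<^sup>2 \<partial>N) < e"
  obtains s where "strict_mono s"
    and "AE x in N. convergent (\<lambda>k. f (s k) x)"
    and "L2_tendsto N f (\<lambda>x. if convergent (\<lambda>k. f (s k) x) then lim (\<lambda>k. f (s k) x) else 0)"
proof -
  have [measurable]: "f m \<in> borel_measurable N" for m
    using f by (auto simp: sq_int_def)
  obtain s where s: "strict_mono s"
    and sC: "\<And>j m k. m \<ge> s j \<Longrightarrow> k \<ge> s j \<Longrightarrow> (\<integral>x. (f m x - f k x)\<^sup>2 \<partial>N) < (1/8)^j"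
    using fast_subsequence[where P = "\<lambda>e m k. (\<integral>x. (f m x - f k x)\<^sup>2 \<partial>N) < e" and \<epsilon> = "\<lambda>j. (1/8)^j"]
      cauchy by auto
  \<comment> \<open>The weight \<open>4^j\<close> leaves the integrals bounded by
    \<open>(1/2)^j\<close>, hence summable, and still forces increments of order
    \<open>(1/2)^j\<close> at almost every point.\<close>
  define d where "d j x = 4^j * (f (s (Suc j)) x - f (s j) x)\<^sup>2" for j x
  have dint: "integrable N (d j)" for j
    unfolding d_def using sq_int_diff[OF f f] by (auto simp: sq_int_def)
  have dle: "(\<integral>x. norm (d j x) \<partial>N) \<le> (1/2)^j" for j
  proof -
    have "(\<integral>x. norm (d j x) \<partial>N) = 4^j * (\<integral>x. (f (s (Suc j)) x - f (s j) x)\<^sup>2 \<partial>N)"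
      unfolding d_def by simp
    also have "\<dots> \<le> 4^j * (1/8)^j"
      using sC[of j "s (Suc j)" "s j"] strict_monoD[OF s, of j "Suc j"]
      by (intro mult_left_mono) auto
    also have "\<dots> = (1/2)^j"
      by (simp flip: power_mult_distrib)
    finally show ?thesis .
  qed
  have "summable (\<lambda>j. \<integral>x. norm (d j x) \<partial>N)"
    by (rule summable_comparison_test'[of "\<lambda>j. (1/2)^j" 0]) (use dle in \<open>auto simp: summable_geometric\<close>)
  then have "(\<Sum>j. \<integral>\<^sup>+ x. ennreal (d j x) \<partial>N) < \<infinity>"
  proof -
    have eq: "(\<integral>\<^sup>+ x. ennreal (d j x) \<partial>N) = ennreal (\<integral>x. norm (d j x) \<partial>N)" for j
      using nn_integral_eq_integral[OF integrable_norm[OF dint[of j]]] by (simp add: d_def)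
    show ?thesis
      unfolding eq using \<open>summable (\<lambda>j. \<integral>x. norm (d j x) \<partial>N)\<close>
      by (subst suminf_ennreal2) auto
  qed
  then have "(\<integral>\<^sup>+ x. (\<Sum>j. ennreal (d j x)) \<partial>N) \<noteq> \<infinity>"
    by (subst nn_integral_suminf) (auto simp: d_def)
  then have "AE x in N. (\<Sum>j. ennreal (d j x)) \<noteq> \<infinity>"
    by (intro nn_integral_PInf_AE) (auto simp: d_def)
  then have conv: "AE x in N. convergent (\<lambda>k. f (s k) x)"
  proof eventually_elim
    case (elim x)
    have "summable (\<lambda>j. d j x)"
      using elim by (intro summable_suminf_not_top) (auto simp: d_def)
    then have "(\<lambda>j. d j x) \<longlonglongrightarrow> 0" by (rule summable_LIMSEQ_zero)
    then obtain C where C: "\<And>j. d j x \<le> C"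
      using convergent_real_bounded_above by blast
    have C0: "C \<ge> 0"
      using order_trans[OF _ C[of 0]] by (simp add: d_def)
    have "\<bar>f (s (Suc j)) x - f (s j) x\<bar> \<le> sqrt C * (1/2)^j" for j
    proof (rule power2_le_imp_le)
      have "4^j * (f (s (Suc j)) x - f (s j) x)\<^sup>2 \<le> C"
        using C[of j] by (simp add: d_def)
      then have "(f (s (Suc j)) x - f (s j) x)\<^sup>2 \<le> C / 4^j"
        by (simp add: field_simps)
      also have "C / 4^j = (sqrt C * (1/2)^j)\<^sup>2"
      proof -
        have "((1/2::real)^j)\<^sup>2 = 1 / 4^j"
          by (simp add: power2_eq_square flip: power_mult_distrib) (simp add: power_one_over)
        then show ?thesis using C0 by (simp add: power_mult_distrib)
      qed
      finally show "\<bar>f (s (Suc j)) x - f (s j) x\<bar>\<^sup>2 \<le> (sqrt C * (1/2)^j)\<^sup>2" by simp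
    qed (use C0 in auto)
    moreover have "summable (\<lambda>j. sqrt C * (1/2)^j)"
      by (intro summable_mult summable_geometric) simp
    ultimately have "summable (\<lambda>j. f (s (Suc j)) x - f (s j) x)"
      using summable_comparison_test'[of "\<lambda>j. sqrt C * (1/2)^j" 0 "\<lambda>j. f (s (Suc j)) x - f (s j) x"]
      by simp
    then show "convergent (\<lambda>k. f (s k) x)"
      unfolding summable_iff_convergent
      using convergent_add_const_iff[of "- f (s 0) x" "\<lambda>k. f (s k) x"]
      by (simp add: sum_lessThan_telescope[of "\<lambda>k. f (s k) x"])
  qed
  define F where "F x = (if convergent (\<lambda>k. f (s k) x) then lim (\<lambda>k. f (s k) x) else 0)" for x
  have [measurable]: "Measurable.pred N (\<lambda>x. convergent (\<lambda>k. f (s k) x))"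
    unfolding Cauchy_convergent_iff[symmetric] pred_def
    by (rule sets_Collect_Cauchy) simp
  have F[measurable]: "F \<in> borel_measurable N"
    unfolding F_def[abs_def] by measurable
  have lim: "AE x in N. (\<lambda>k. f (s k) x) \<longlonglongrightarrow> F x"
    using conv by eventually_elim (simp add: F_def convergent_LIMSEQ_iff)
  \<comment> \<open>The Cauchy estimate between \<open>f m\<close> and \<open>f (s k)\<close> passes
    to the limit in \<open>k\<close> by Fatou, so the full sequence converges and not only the
    subsequence.\<close>
  have est: "sq_int N (\<lambda>x. f m x - F x)" "(\<integral>x. (f m x - F x)\<^sup>2 \<partial>N) \<le> (1/8)^j" if "m \<ge> s j" for m j
  proof -
    have "AE x in N. (\<lambda>k. f m x - f (s k) x) \<longlonglongrightarrow> f m x - F x"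
      using lim by eventually_elim (intro tendsto_intros)
    moreover have "(\<integral>x. (f m x - f (s k) x)\<^sup>2 \<partial>N) \<le> (1/8)^j" if "k \<ge> j" for k
      using sC[of j m "s k"] \<open>m \<ge> s j\<close> that s by (simp add: strict_mono_less_eq less_imp_le)
    ultimately show "sq_int N (\<lambda>x. f m x - F x)" "(\<integral>x. (f m x - F x)\<^sup>2 \<partial>N) \<le> (1/8)^j"
      using L2_Fatou[of N "\<lambda>k x. f m x - f (s k) x" "\<lambda>x. f m x - F x" j "(1/8)^j"]
        sq_int_diff[OF f f] by auto
  qed
  have "sq_int N F"
    using sq_int_diff[OF f[of "s 0"] est(1)[of 0 "s 0"]] by simp
  moreover have "(\<lambda>m. \<integral>x. (f m x - F x)\<^sup>2 \<partial>N) \<longlonglongrightarrow> 0"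
  proof (rule LIMSEQ_I)
    fix e :: real assume "e > 0"
    then obtain j where "(1/8)^j < e"
      using real_arch_pow_inv[of e "1/8"] by auto
    then show "\<exists>no. \<forall>m\<ge>no. norm ((\<integral>x. (f m x - F x)\<^sup>2 \<partial>N) - 0) < e"
      using est(2)[of j] by (intro exI[of _ "s j"]) (auto intro: le_less_trans)
  qed
  ultimately have "L2_tendsto N f F"
    using f by (simp add: L2_tendsto_def)
  with s conv show ?thesis
    by (intro that[of s]) (auto simp: F_def[abs_def])
qed

subsection \<open>Lebesgue integrals on an interval\<close>

lemma continuous_on_Icc_bounded:
  fixes f :: "real \<Rightarrow> real"
  assumes "continuous_on {a..b} f"
  obtains C where "C \<ge> 0" "\<And>s. s \<in> {a..b} \<Longrightarrow> \<bar>f s\<bar> \<le> C"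
proof -
  have "compact (f ` {a..b})"
    using assms by (intro compact_continuous_image) auto
  then obtain C where "\<forall>s\<in>{a..b}. \<bar>f s\<bar> \<le> C"
    by (auto dest!: compact_imp_bounded simp: bounded_iff)
  then show thesis using that[of "max C 0"] by fastforce
qed

text \<open>Absolute integrability on the interval gives gauge integrability, and the indefinite
  gauge integral is continuous.\<close>

lemma continuous_on_set_lebesgue_integral:
  fixes u :: "real \<Rightarrow> real"
  assumes "set_integrable lborel {0..T} u"
  shows "continuous_on {0..T} (\<lambda>t. LBINT s:{0..t}. u s)"
proof -
  have "u integrable_on {0..T}"
    using assms by (rule set_borel_integral_eq_integral)
  then have "continuous_on {0..T} (\<lambda>t. integral {0..t} u)"
    by (rule indefinite_integral_continuous_1)
  moreover have "integral {0..t} u = (LBINT s:{0..t}. u s)" if "t \<in> {0..T}" for t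
  proof -
    have "set_integrable lborel {0..t} u"
      using assms by (rule set_integrable_subset) (use that in auto)
    then show ?thesis by (simp add: set_borel_integral_eq_integral)
  qed
  ultimately show ?thesis
    by (subst (asm) continuous_on_cong[OF refl]) auto
qed

lemma set_integrable_continuous_mult:
  fixes u U :: "real \<Rightarrow> real"
  assumes u: "set_integrable lborel {0..T} u" and U: "continuous_on {0..T} U"
  shows "set_integrable lborel {0..T} (\<lambda>s. U s * u s)"
proof -
  obtain C where C: "\<And>s. s \<in> {0..T} \<Longrightarrow> \<bar>U s\<bar> \<le> C"
    using continuous_on_Icc_bounded[OF U] by blast
  have [measurable]: "(\<lambda>s. indicator {0..T} s * U s) \<in> borel_measurable lborel"
    using borel_measurable_continuous_on_indicator[OF _ U] by simp
  have u': "integrable lborel (\<lambda>s. indicator {0..T} s * u s)"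
    using u by (simp add: set_integrable_def)
  then have [measurable]: "(\<lambda>s. indicator {0..T} s * u s) \<in> borel_measurable lborel"
    by auto
  have "integrable lborel (\<lambda>s. (indicator {0..T} s * U s) * (indicator {0..T} s * u s))"
  proof (rule Bochner_Integration.integrable_bound)
    show "integrable lborel (\<lambda>s. C * (indicator {0..T} s * u s))"
      using u' by (rule integrable_mult_right)
    show "AE s in lborel. norm ((indicator {0..T} s * U s) * (indicator {0..T} s * u s))
        \<le> norm (C * (indicator {0..T} s * u s))"
    proof (intro AE_I2)
      fix s
      show "norm ((indicator {0..T} s * U s) * (indicator {0..T} s * u s))
          \<le> norm (C * (indicator {0..T} s * u s))"
        using C[of s] order_trans[OF abs_ge_zero C[of s]]
        by (auto simp: indicator_def abs_mult intro!: mult_right_mono)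
    qed
  qed measurable
  moreover have "(indicator {0..T} s * U s) * (indicator {0..T} s * u s) =
      indicator {0..T} s *\<^sub>R (U s * u s)" for s
    by (simp add: indicator_def)
  ultimately show ?thesis by (simp add: set_integrable_def)
qed

text \<open>Fubini on the square, split along the diagonal.\<close>

lemma set_lebesgue_integral_by_parts:
  fixes u v :: "real \<Rightarrow> real"
  defines "U t \<equiv> LBINT s:{0..t}. u s" and "V t \<equiv> LBINT s:{0..t}. v s"
  assumes u: "set_integrable lborel {0..T} u" and v: "set_integrable lborel {0..T} v"
    and t: "t \<in> {0..T}"
  shows "U t * V t = (LBINT s:{0..t}. u s * V s + U s * v s)"
proof -
  define u' where "u' s = indicator {0..t} s * u s" for s
  define v' where "v' s = indicator {0..t} s * v s" for s
  have u't: "set_integrable lborel {0..t} u" and v't: "set_integrable lborel {0..t} v"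
    using u v t by (auto intro: set_integrable_subset)
  then have u': "integrable lborel u'" and v': "integrable lborel v'"
    by (simp_all add: u'_def[abs_def] v'_def[abs_def] set_integrable_def)
  then have [measurable]: "u' \<in> borel_measurable borel" "v' \<in> borel_measurable borel"
    by auto
  have UV: "U t = (\<integral>s. u' s \<partial>lborel)" "V t = (\<integral>s. v' s \<partial>lborel)"
    by (simp_all add: U_def V_def u'_def v'_def set_lebesgue_integral_def)
  have h: "integrable (lborel \<Otimes>\<^sub>M lborel) (\<lambda>(s, q). u' s * v' q)"
    by (rule lborel_pair.Fubini_integrable) (use u' v' in \<open>auto simp: abs_mult\<close>)
  \<comment> \<open>Splitting by \<open>q \<le> s\<close> and \<open>s < q\<close> makes the inner
    integrals the indefinite integrals \<open>V s\<close> and \<open>U q\<close>.\<close>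
  have a: "integrable (lborel \<Otimes>\<^sub>M lborel) (\<lambda>(s, q). u' s * (if q \<le> s then v' q else 0))"
    by (rule Bochner_Integration.integrable_bound[OF h]) auto
  have b: "integrable (lborel \<Otimes>\<^sub>M lborel) (\<lambda>(s, q). (if s < q then u' s else 0) * v' q)"
    by (rule Bochner_Integration.integrable_bound[OF h]) auto
  have "U t * V t = (\<integral>s. (\<integral>q. u' s * v' q \<partial>lborel) \<partial>lborel)"
    using u' v' by (simp add: UV)
  also have "\<dots> = (\<integral>(s, q). u' s * v' q \<partial>(lborel \<Otimes>\<^sub>M lborel))"
    using h by (rule lborel_pair.integral_fst)
  also have "\<dots> = (\<integral>p. (case p of (s, q) \<Rightarrow> u' s * (if q \<le> s then v' q else 0)) +
      (case p of (s, q) \<Rightarrow> (if s < q then u' s else 0) * v' q) \<partial>(lborel \<Otimes>\<^sub>M lborel))"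
    by (intro Bochner_Integration.integral_cong) auto
  also have "\<dots> = (\<integral>(s, q). u' s * (if q \<le> s then v' q else 0) \<partial>(lborel \<Otimes>\<^sub>M lborel)) +
      (\<integral>(s, q). (if s < q then u' s else 0) * v' q \<partial>(lborel \<Otimes>\<^sub>M lborel))"
    by (rule Bochner_Integration.integral_add[OF a b])
  also have "(\<integral>(s, q). u' s * (if q \<le> s then v' q else 0) \<partial>(lborel \<Otimes>\<^sub>M lborel)) =
      (\<integral>s. (\<integral>q. u' s * (if q \<le> s then v' q else 0) \<partial>lborel) \<partial>lborel)"
    using lborel_pair.integral_fst[OF a] by simp
  also have "\<dots> = (\<integral>s. u' s * V s \<partial>lborel)"
  proof (intro Bochner_Integration.integral_cong refl)
    fix s
    show "(\<integral>q. u' s * (if q \<le> s then v' q else 0) \<partial>lborel) = u' s * V s"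
    proof (cases "s \<in> {0..t}")
      case True
      have "(\<integral>q. u' s * (if q \<le> s then v' q else 0) \<partial>lborel) =
          (\<integral>q. u' s * (indicator {0..s} q * v q) \<partial>lborel)"
        using True by (intro Bochner_Integration.integral_cong) (auto simp: v'_def indicator_def)
      then show ?thesis by (simp add: V_def set_lebesgue_integral_def)
    qed (simp add: u'_def)
  qed
  also have "(\<integral>(s, q). (if s < q then u' s else 0) * v' q \<partial>(lborel \<Otimes>\<^sub>M lborel)) =
      (\<integral>q. (\<integral>s. (if s < q then u' s else 0) * v' q \<partial>lborel) \<partial>lborel)"
    using lborel_pair.integral_snd[OF b] by simp
  also have "\<dots> = (\<integral>q. U q * v' q \<partial>lborel)"
  proof (intro Bochner_Integration.integral_cong refl)
    fix q
    show "(\<integral>s. (if s < q then u' s else 0) * v' q \<partial>lborel) = U q * v' q"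
    proof (cases "q \<in> {0..t}")
      case True
      have [measurable]: "(\<lambda>s. indicator {0..q} s * u s) \<in> borel_measurable borel"
      proof -
        have "(\<lambda>s. indicator {0..q} s * u s) = (\<lambda>s. indicator {0..q} s * u' s)"
          using True by (auto simp: u'_def indicator_def)
        then show ?thesis by simp
      qed
      have "(\<integral>s. (if s < q then u' s else 0) * v' q \<partial>lborel) =
          (\<integral>s. (indicator {0..q} s * u s) * v' q \<partial>lborel)"
      proof (rule integral_cong_AE)
        \<comment> \<open>\<open>U q\<close> integrates over a closed interval while the half-plane
          is strict; the two differ at the single point \<open>q\<close>.\<close>
        show "AE s in lborel. (if s < q then u' s else 0) * v' q = (indicator {0..q} s * u s) * v' q"
          using AE_lborel_singleton[of q]
          by eventually_elim (use True in \<open>auto simp: u'_def indicator_def\<close>)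
      qed auto
      then show ?thesis by (simp add: U_def set_lebesgue_integral_def)
    qed (simp add: v'_def)
  qed
  also have "(\<integral>s. u' s * V s \<partial>lborel) + (\<integral>q. U q * v' q \<partial>lborel) =
      (LBINT s:{0..t}. V s * u s) + (LBINT s:{0..t}. U s * v s)"
    by (simp add: u'_def v'_def set_lebesgue_integral_def mult_ac)
  also have "\<dots> = (LBINT s:{0..t}. V s * u s + U s * v s)"
    unfolding U_def V_def using u't v't
    by (intro set_integral_add(2)[symmetric] set_integrable_continuous_mult
        continuous_on_set_lebesgue_integral)
  finally show ?thesis by (simp add: mult.commute)
qed

text \<open>The chain rule for the exponential of an indefinite integral, without differentiation:
  integration by parts yields all powers of \<open>R\<close> by induction, and the exponential
  series is integrated term by term.\<close>

lemma set_lebesgue_integral_exp: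
  fixes g :: "real \<Rightarrow> real"
  defines "R t \<equiv> LBINT s:{0..t}. g s"
  assumes g: "set_integrable lborel {0..T} g" and t: "t \<in> {0..T}"
  shows "exp (R t) = 1 + (LBINT s:{0..t}. g s * exp (R s))"
proof -
  have contR: "continuous_on {0..T} R"
    unfolding R_def by (rule continuous_on_set_lebesgue_integral[OF g])
  have gR: "set_integrable lborel {0..T} (\<lambda>s. R s ^ k * g s)" for k
    by (intro set_integrable_continuous_mult g continuous_intros contR)
  have pow: "R q ^ Suc k = (LBINT s:{0..q}. real (Suc k) * (R s ^ k * g s))" if "q \<in> {0..T}" for k q
    using that
  proof (induction k arbitrary: q)
    case 0
    then show ?case by (simp add: R_def)
  next
    case (Suc k)
    have "R q ^ Suc (Suc k) = R q * R q ^ Suc k"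
      by simp
    also have "\<dots> = (LBINT s:{0..q}. g s) * (LBINT s:{0..q}. real (Suc k) * (R s ^ k * g s))"
      by (subst Suc.IH[OF Suc.prems]) (simp add: R_def)
    also have "\<dots> = (LBINT s:{0..q}. g s * (LBINT y:{0..s}. real (Suc k) * (R y ^ k * g y)) +
        (LBINT y:{0..s}. g y) * (real (Suc k) * (R s ^ k * g s)))"
      by (rule set_lebesgue_integral_by_parts[OF g _ Suc.prems]) (intro set_integrable_mult_right gR)
    also have "\<dots> = (LBINT s:{0..q}. real (Suc (Suc k)) * (R s ^ Suc k * g s))"
    proof (rule set_lebesgue_integral_cong)
      show "\<forall>s. s \<in> {0..q} \<longrightarrow> g s * (LBINT y:{0..s}. real (Suc k) * (R y ^ k * g y)) +
          (LBINT y:{0..s}. g y) * (real (Suc k) * (R s ^ k * g s)) =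
          real (Suc (Suc k)) * (R s ^ Suc k * g s)"
      proof (intro allI impI)
        fix s assume "s \<in> {0..q}"
        then have "s \<in> {0..T}" using Suc.prems by auto
        show "g s * (LBINT y:{0..s}. real (Suc k) * (R y ^ k * g y)) +
          (LBINT y:{0..s}. g y) * (real (Suc k) * (R s ^ k * g s)) =
          real (Suc (Suc k)) * (R s ^ Suc k * g s)"
          unfolding Suc.IH[OF \<open>s \<in> {0..T}\<close>, symmetric] R_def[symmetric]
          by (simp add: algebra_simps)
      qed
    qed simp
    finally show ?case .
  qed
  \<comment> \<open>Terms of the series of \<open>g s * exp (R s)\<close>; a bound \<open>C\<close>
    on \<open>\<bar>R\<bar>\<close> dominates them by an exponential series times
    \<open>\<bar>g\<bar>\<close>.\<close>
  define f where "f k s = indicator {0..t} s * (R s ^ k / fact k * g s)" for k s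
  have gRt: "set_integrable lborel {0..t} (\<lambda>s. R s ^ k * g s)" for k
    by (rule set_integrable_subset[OF gR]) (use t in auto)
  have fint: "integrable lborel (f k)" for k
    using gRt[of k] set_integrable_divide[OF gRt[of k], of "fact k"]
    by (simp add: f_def[abs_def] set_integrable_def mult_ac)
  obtain C where C: "\<And>s. s \<in> {0..T} \<Longrightarrow> \<bar>R s\<bar> \<le> C" and C0: "C \<ge> 0"
    using continuous_on_Icc_bounded[OF contR] by blast
  have exp_sums: "(\<lambda>k. x ^ k / fact k) sums exp x" for x :: real
    using exp_converges[of x] by (simp add: divide_inverse mult.commute)
  have g': "integrable lborel (\<lambda>s. indicator {0..t} s * \<bar>g s\<bar>)"
    using set_integrable_abs[OF set_integrable_subset[OF g, of "{0..t}"]] t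
    by (simp add: set_integrable_def)
  have fle: "norm (f k s) \<le> C ^ k / fact k * (indicator {0..t} s * \<bar>g s\<bar>)" for k s
  proof (cases "s \<in> {0..t}")
    case True
    then have "\<bar>R s\<bar> ^ k \<le> C ^ k"
      using C[of s] t by (intro power_mono) auto
    then have "\<bar>R s\<bar> ^ k / fact k * \<bar>g s\<bar> \<le> C ^ k / fact k * \<bar>g s\<bar>"
      by (intro mult_right_mono divide_right_mono) auto
    with True show ?thesis by (simp add: f_def abs_mult power_abs)
  qed (simp add: f_def)
  have "(\<lambda>k. \<integral>s. f k s \<partial>lborel) sums (\<integral>s. (\<Sum>k. f k s) \<partial>lborel)"
  proof (rule sums_integral[OF fint])
    show "AE s in lborel. summable (\<lambda>k. norm (f k s))"
    proof (intro AE_I2)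
      fix s
      have "summable (\<lambda>k. C ^ k / fact k * (indicator {0..t} s * \<bar>g s\<bar>))"
        using exp_sums by (intro summable_mult2) (auto intro: sums_summable)
      then show "summable (\<lambda>k. norm (f k s))"
        using summable_comparison_test'[of _ 0 "\<lambda>k. norm (f k s)"] fle by simp
    qed
    have "(\<integral>s. norm (f k s) \<partial>lborel) \<le> C ^ k / fact k * (\<integral>s. indicator {0..t} s * \<bar>g s\<bar> \<partial>lborel)" for k
    proof -
      have "(\<integral>s. norm (f k s) \<partial>lborel) \<le> (\<integral>s. C ^ k / fact k * (indicator {0..t} s * \<bar>g s\<bar>) \<partial>lborel)"
        by (rule integral_mono[OF integrable_norm[OF fint] integrable_mult_right[OF g'] fle])
      then show ?thesis by simp
    qed
    moreover have "summable (\<lambda>k. C ^ k / fact k * (\<integral>s. indicator {0..t} s * \<bar>g s\<bar> \<partial>lborel))"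
      using exp_sums by (intro summable_mult2) (auto intro: sums_summable)
    ultimately show "summable (\<lambda>k. \<integral>s. norm (f k s) \<partial>lborel)"
      using summable_comparison_test'[of _ 0 "\<lambda>k. \<integral>s. norm (f k s) \<partial>lborel"] by simp
  qed
  moreover have "(\<Sum>k. f k s) = indicator {0..t} s *\<^sub>R (g s * exp (R s))" for s
  proof -
    have "(\<lambda>k. indicator {0..t} s * g s * (R s ^ k / fact k)) sums (indicator {0..t} s * g s * exp (R s))"
      by (intro sums_mult exp_sums)
    then show ?thesis
      by (intro sums_unique[symmetric]) (simp add: f_def mult_ac)
  qed
  moreover have "(\<integral>s. f k s \<partial>lborel) = R t ^ Suc k / fact (Suc k)" for k
  proof -
    have "R t ^ Suc k = real (Suc k) * (LBINT s:{0..t}. R s ^ k * g s)"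
      by (subst pow[OF t]) (rule set_integral_mult_right)
    moreover have "(\<integral>s. f k s \<partial>lborel) = (LBINT s:{0..t}. R s ^ k * g s) / fact k"
      unfolding set_lebesgue_integral_def f_def
      by (subst integral_divide_zero[symmetric]) (simp add: mult_ac)
    ultimately show ?thesis by simp
  qed
  ultimately have "(\<lambda>k. R t ^ Suc k / fact (Suc k)) sums (LBINT s:{0..t}. g s * exp (R s))"
    by (simp add: set_lebesgue_integral_def)
  \<comment> \<open>Term \<open>k\<close> of the integrated series is term \<open>k + 1\<close> of
    \<open>exp (R t)\<close>; the missing term of index 0 is the added 1.\<close>
  then have "(\<lambda>k. R t ^ k / fact k) sums ((LBINT s:{0..t}. g s * exp (R s)) + 1)"
    by (subst (asm) sums_Suc_iff) simp
  from sums_unique2[OF exp_sums this] show ?thesis by simp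
qed

section \<open>Non-anticipative approximation by step functions\<close>

lemma emeasure_lborel_Ioc_finite:
  fixes a b :: real
  shows "emeasure lborel {a<..b} < \<infinity>"
  using emeasure_bounded_finite[of "{a<..b}"] by simp

lemma integrable_indicator_Ioc [simp]: "integrable lborel (indicator {a<..b::real} :: real \<Rightarrow> real)"
  by (rule integrable_real_indicator) (simp, rule emeasure_lborel_Ioc_finite)

text \<open>A measurable function is an almost everywhere limit of continuous ones; clipping these
  at the bound \<open>K\<close> of \<open>f\<close> keeps the limit and supplies the dominating
  function.\<close>

lemma continuous_L1_approximation:
  fixes f :: "real \<Rightarrow> real"
  assumes f[measurable]: "f \<in> borel_measurable borel" and K: "\<And>s. \<bar>f s\<bar> \<le> K" and "e > 0"
  obtains g where "continuous_on UNIV g" "\<And>s. \<bar>g s\<bar> \<le> K"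
    "(\<integral>s. indicator {a<..b} s * \<bar>f s - g s\<bar> \<partial>lborel) < e"
proof -
  have "f \<in> borel_measurable lebesgue"
    using f by (intro measurable_completion) simp
  then have "f measurable_on UNIV"
    by (intro lebesgue_measurable_imp_measurable_on) auto
  then obtain N g where N: "negligible N" and g: "\<And>n. continuous_on UNIV (g n)"
    and lim: "\<And>x. x \<notin> N \<Longrightarrow> (\<lambda>n. g n x) \<longlonglongrightarrow> f x"
    unfolding measurable_on_def by (auto simp: eventually_sequentially)
  define g' where "g' n x = max (- K) (min K (g n x))" for n :: nat and x
  have g'c: "continuous_on UNIV (g' n)" for n
    unfolding g'_def by (intro continuous_intros g)
  then have [measurable]: "g' n \<in> borel_measurable borel" for n
    by (rule borel_measurable_continuous_onI)
  have g'K: "\<bar>g' n x\<bar> \<le> K" for n x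
    using order_trans[OF abs_ge_zero K[of x]] unfolding g'_def by linarith
  have ae: "AE x in lborel. x \<notin> N"
    using N AE_not_in[of N lebesgue] by (simp add: negligible_iff_null_sets AE_completion_iff)
  have "(\<lambda>n. \<integral>s. indicator {a<..b} s * \<bar>f s - g' n s\<bar> \<partial>lborel) \<longlonglongrightarrow> (\<integral>s. 0 \<partial>(lborel :: real measure))"
  proof (rule integral_dominated_convergence)
    show "integrable lborel (\<lambda>s. indicator {a<..b} s * (2 * K))"
      by simp
    show "AE s in lborel. (\<lambda>n. indicator {a<..b} s * \<bar>f s - g' n s\<bar>) \<longlonglongrightarrow> 0"
      using ae
    proof eventually_elim
      case (elim s)
      have "(\<lambda>n. indicator {a<..b} s * \<bar>f s - g' n s\<bar>) \<longlonglongrightarrow>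
          indicator {a<..b} s * \<bar>f s - max (- K) (min K (f s))\<bar>"
        unfolding g'_def by (intro tendsto_intros lim elim)
      moreover have "max (- K) (min K (f s)) = f s"
        using K[of s] by linarith
      ultimately show ?case by simp
    qed
    show "AE s in lborel. norm (indicator {a<..b} s * \<bar>f s - g' n s\<bar>) \<le> indicator {a<..b} s * (2 * K)" for n
    proof (intro AE_I2)
      fix s
      have "\<bar>f s - g' n s\<bar> \<le> 2 * K" using K[of s] g'K[of n s] by linarith
      then show "norm (indicator {a<..b} s * \<bar>f s - g' n s\<bar>) \<le> indicator {a<..b} s * (2 * K)"
        by (auto simp: indicator_def)
    qed
  qed auto
  then have "\<forall>\<^sub>F n in sequentially. (\<integral>s. indicator {a<..b} s * \<bar>f s - g' n s\<bar> \<partial>lborel) < e"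
    using \<open>e > 0\<close> by (intro order_tendstoD) auto
  then obtain n where "(\<integral>s. indicator {a<..b} s * \<bar>f s - g' n s\<bar> \<partial>lborel) < e"
    by (auto simp: eventually_sequentially)
  with g'c g'K show thesis by (rule that)
qed

text \<open>
  On the \<open>j\<close>-th grid interval the step function takes the mean of \<open>f\<close> over the interval before it,
  which is known at the left end point: this is what makes the approximation non-anticipative.
\<close>

definition lagged_mean :: "real \<Rightarrow> nat \<Rightarrow> (real \<Rightarrow> real) \<Rightarrow> real \<Rightarrow> real" where
  "lagged_mean h N f t = (\<Sum>j<N. (\<integral>s. indicator {(real j - 1) * h<..real j * h} s * f s \<partial>lborel) / h *
     indicator {real j * h<..real (Suc j) * h} t)"

lemma grid_indicator:
  assumes "h > (0::real)" "t \<in> {real i * h<..real (Suc i) * h}"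
  shows "indicator {real j * h<..real (Suc j) * h} t = (if j = i then 1 else 0 :: real)"
proof (cases "j = i")
  case False
  have disj: "t \<notin> {real j * h<..real (Suc j) * h}"
  proof
    assume "t \<in> {real j * h<..real (Suc j) * h}"
    with assms have "real j * h < real (Suc i) * h" "real i * h < real (Suc j) * h"
      using less_le_trans[of "real j * h" t "real (Suc i) * h"] less_le_trans[of "real i * h" t "real (Suc j) * h"]
      by (simp_all del: of_nat_Suc)
    with \<open>h > 0\<close> have "real j < real (Suc i)" "real i < real (Suc j)"
      by (simp_all only: mult_less_cancel_right_pos)
    with False show False by linarith
  qed
  with False show ?thesis by (simp del: of_nat_Suc)
qed (use assms in \<open>simp del: of_nat_Suc\<close>)

lemma grid_interval_exists:
  assumes "h > (0::real)" "t \<in> {0<..real N * h}"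
  obtains i where "i < N" "t \<in> {real i * h<..real (Suc i) * h}"
proof -
  \<comment> \<open>The grid intervals are open on the left, hence the ceiling minus one rather than
    the floor.\<close>
  define i where "i = nat (\<lceil>t / h\<rceil> - 1)"
  have "t / h > 0" using assms by simp
  then have "\<lceil>t / h\<rceil> \<ge> 1" by linarith
  then have i: "real i = of_int \<lceil>t / h\<rceil> - 1" by (simp add: i_def)
  have "real i < t / h" "t / h \<le> real (Suc i)"
    using i by (simp_all; linarith)+
  then have "t \<in> {real i * h<..real (Suc i) * h}"
    using assms(1) by (simp_all add: field_simps)
  moreover have "i < N"
  proof -
    have "real i * h < real N * h"
      using calculation assms less_le_trans[of "real i * h" t "real N * h"] by simp
    with assms(1) show ?thesis by simp
  qed
  ultimately show thesis by (rule that[rotated])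
qed

lemma lagged_mean_eq:
  assumes "h > 0" "i < N" "t \<in> {real i * h<..real (Suc i) * h}"
  shows "lagged_mean h N f t = (\<integral>s. indicator {(real i - 1) * h<..real i * h} s * f s \<partial>lborel) / h"
proof -
  have "(\<Sum>j<N. c j * (if j = i then 1 else 0)) = c i" for c :: "nat \<Rightarrow> real"
  proof -
    have "(\<Sum>j<N. c j * (if j = i then 1 else 0)) = (\<Sum>j<N. if j = i then c j else 0)"
      by (intro sum.cong) auto
    then show ?thesis using assms(2) by simp
  qed
  then show ?thesis
    unfolding lagged_mean_def grid_indicator[OF assms(1,3)] .
qed

lemma sum_grid_indicator_le:
  assumes "h > (0::real)"
  shows "(\<Sum>j<N. indicator {(real j - 1) * h<..real j * h} s) = (indicator {- h<..(real N - 1) * h} s :: real)"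
proof (induction N)
  case (Suc N)
  have "- h \<le> (real N - 1) * h" "(real N - 1) * h \<le> real N * h"
    using assms by (simp_all add: algebra_simps)
  then show ?case
    using Suc by (auto simp: indicator_def)
qed (use assms in auto)

text \<open>Each mean, multiplied by the length \<open>h\<close> of the interval on which it is
  used, is at most the integral of \<open>\<bar>\<phi>\<bar>\<close> over the preceding interval.
  These preceding intervals are disjoint and lie in \<open>{-T<..T}\<close>; negative times enter
  because the mean of index 0 looks back before time 0.\<close>

lemma lagged_mean_L1_contraction:
  fixes \<phi> :: "real \<Rightarrow> real"
  assumes h: "h > 0" and [measurable]: "\<phi> \<in> borel_measurable borel" and K: "\<And>s. \<bar>\<phi> s\<bar> \<le> K"
    and N: "real N * h = T"
  shows "(\<integral>t. indicator {0<..T} t * \<bar>lagged_mean h N \<phi> t\<bar> \<partial>lborel) \<le>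
    (\<integral>s. indicator {-T<..T} s * \<bar>\<phi> s\<bar> \<partial>lborel)"
proof -
  have int: "integrable lborel (\<lambda>s. indicator {a<..b} s * \<phi> s)" for a b
    using integrableI_bounded_set_indicator[of "{a<..b}" lborel \<phi> K] K emeasure_lborel_Ioc_finite[of a b] by simp
  have int': "integrable lborel (\<lambda>s. indicator {a<..b} s * \<bar>\<phi> s\<bar>)" for a b
    using integrable_abs[OF int[of a b]] by (simp add: abs_mult)
  define c where "c j = (\<integral>s. indicator {(real j - 1) * h<..real j * h} s * \<phi> s \<partial>lborel)" for j :: nat
  have ind: "integrable lborel (\<lambda>t. indicator {real j * h<..real (Suc j) * h} t * x)" for j and x :: real
    by simp
  have K0: "K \<ge> 0" using order_trans[OF abs_ge_zero K[of 0]] .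
  have "(\<integral>t. indicator {0<..T} t * \<bar>lagged_mean h N \<phi> t\<bar> \<partial>lborel) \<le>
      (\<integral>t. (\<Sum>j<N. indicator {real j * h<..real (Suc j) * h} t * (\<bar>c j\<bar> / h)) \<partial>lborel)"
  proof (rule integral_mono_AE')
    show "integrable lborel (\<lambda>t. \<Sum>j<N. indicator {real j * h<..real (Suc j) * h} t * (\<bar>c j\<bar> / h))"
      by (intro Bochner_Integration.integrable_sum ind)
    show "AE t in lborel. indicator {0<..T} t * \<bar>lagged_mean h N \<phi> t\<bar> \<le>
        (\<Sum>j<N. indicator {real j * h<..real (Suc j) * h} t * (\<bar>c j\<bar> / h))"
    proof (intro AE_I2)
      fix t
      have "\<bar>lagged_mean h N \<phi> t\<bar> \<le>
          (\<Sum>j<N. \<bar>c j / h * indicator {real j * h<..real (Suc j) * h} t\<bar>)"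
        unfolding lagged_mean_def c_def by (rule sum_abs)
      also have "\<dots> = (\<Sum>j<N. indicator {real j * h<..real (Suc j) * h} t * (\<bar>c j\<bar> / h))"
        using h by (simp add: abs_mult mult.commute)
      finally show "indicator {0<..T} t * \<bar>lagged_mean h N \<phi> t\<bar> \<le>
        (\<Sum>j<N. indicator {real j * h<..real (Suc j) * h} t * (\<bar>c j\<bar> / h))"
        using h by (auto simp: indicator_def intro!: sum_nonneg)
    qed
    show "AE t in lborel. 0 \<le> (\<Sum>j<N. indicator {real j * h<..real (Suc j) * h} t * (\<bar>c j\<bar> / h))"
      using h by (intro AE_I2 sum_nonneg) simp
  qed
  also have "\<dots> = (\<Sum>j<N. \<integral>t. indicator {real j * h<..real (Suc j) * h} t * (\<bar>c j\<bar> / h) \<partial>lborel)"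
    by (rule Bochner_Integration.integral_sum[OF ind])
  also have "\<dots> = (\<Sum>j<N. \<bar>c j\<bar>)"
  proof (rule sum.cong[OF refl])
    fix j
    have "measure lborel {real j * h<..real (Suc j) * h} = h"
      using h by (simp add: algebra_simps)
    then show "(\<integral>t. indicator {real j * h<..real (Suc j) * h} t * (\<bar>c j\<bar> / h) \<partial>lborel) = \<bar>c j\<bar>"
      using h by simp
  qed
  also have "\<dots> \<le> (\<Sum>j<N. \<integral>s. indicator {(real j - 1) * h<..real j * h} s * \<bar>\<phi> s\<bar> \<partial>lborel)"
  proof (rule sum_mono)
    fix j
    show "\<bar>c j\<bar> \<le> (\<integral>s. indicator {(real j - 1) * h<..real j * h} s * \<bar>\<phi> s\<bar> \<partial>lborel)"
      using integral_abs_bound[of lborel "\<lambda>s. indicator {(real j - 1) * h<..real j * h} s * \<phi> s"]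
      by (simp add: c_def abs_mult)
  qed
  also have "\<dots> = (\<integral>s. (\<Sum>j<N. indicator {(real j - 1) * h<..real j * h} s * \<bar>\<phi> s\<bar>) \<partial>lborel)"
    by (rule Bochner_Integration.integral_sum[OF int', symmetric])
  also have "\<dots> = (\<integral>s. indicator {- h<..(real N - 1) * h} s * \<bar>\<phi> s\<bar> \<partial>lborel)"
    by (simp add: sum_grid_indicator_le[OF h] flip: sum_distrib_right)
  also have "\<dots> \<le> (\<integral>s. indicator {-T<..T} s * \<bar>\<phi> s\<bar> \<partial>lborel)"
  proof (rule integral_mono[OF int' int'])
    fix s
    have "{- h<..(real N - 1) * h} \<subseteq> {-T<..T}"
    proof (cases "N = 0")
      case False
      then have "1 * h \<le> real N * h" using h by (intro mult_right_mono) auto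
      then have "h \<le> T" "(real N - 1) * h \<le> T" using h N by (simp_all add: left_diff_distrib)
      then show ?thesis by auto
    qed (use h in auto)
    then show "indicator {- h<..(real N - 1) * h} s * \<bar>\<phi> s\<bar> \<le> indicator {-T<..T} s * \<bar>\<phi> s\<bar>"
      by (intro mult_right_mono) (auto simp: indicator_def)
  qed
  finally show ?thesis .
qed

text \<open>Uniform continuity on \<open>{-T..T}\<close>: every point averaged over lies within
  \<open>2 * h\<close> of \<open>t\<close>, one interval length for the lag and one for the interval
  containing \<open>t\<close>.\<close>

lemma lagged_mean_continuous:
  fixes g :: "real \<Rightarrow> real"
  assumes g: "continuous_on UNIV g" and "T > 0" "e > 0"
  shows "\<forall>\<^sub>F m in sequentially. \<forall>t\<in>{0<..T}. \<bar>lagged_mean (T / real (Suc m)) (Suc m) g t - g t\<bar> \<le> e"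
proof -
  have "uniformly_continuous_on {-T..T} g"
    by (intro compact_uniformly_continuous continuous_on_subset[OF g]) auto
  then obtain d where d: "d > 0"
    and gd: "\<And>s t. s \<in> {-T..T} \<Longrightarrow> t \<in> {-T..T} \<Longrightarrow> \<bar>s - t\<bar> < d \<Longrightarrow> \<bar>g s - g t\<bar> < e"
    unfolding uniformly_continuous_on_def dist_real_def using \<open>e > 0\<close> by metis
  \<comment> \<open>Makes the reach \<open>2 * h\<close> of the lagged mean smaller than
    \<open>d\<close> from index \<open>M\<close> on.\<close>
  obtain M :: nat where M: "real M > 2 * T / d"
    using reals_Archimedean2 by blast
  have [measurable]: "g \<in> borel_measurable borel"
    using g by (rule borel_measurable_continuous_onI)
  show ?thesis
    unfolding eventually_sequentially
  proof (intro exI[of _ M] allI impI ballI)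
    fix m t assume m: "m \<ge> M" and t: "t \<in> {0<..T}"
    define h where "h = T / real (Suc m)"
    have h: "h > 0" "real (Suc m) * h = T" using \<open>T > 0\<close> by (simp_all add: h_def)
    have "h \<le> T" using \<open>T > 0\<close> by (simp add: h_def field_simps)
    have "2 * T / d < real (Suc m)" using M m by simp
    then have h2: "2 * h < d" using d by (simp add: h_def field_simps)
    obtain i where i: "i < Suc m" "t \<in> {real i * h<..real (Suc i) * h}"
      using grid_interval_exists[of h t "Suc m"] h t by auto
    define A where "A = {(real i - 1) * h<..real i * h}"
    have mA: "measure lborel A = h"
      using h by (simp add: A_def algebra_simps)
    have close: "\<bar>g s - g t\<bar> \<le> e" if "s \<in> A" for s
    proof -
      have "0 \<le> h * real i" using h(1) by simp
      moreover have "h * real i - h < s" "s \<le> h * real i" "h * real i < t" "t \<le> h + h * real i"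
        using that i(2) by (auto simp: A_def algebra_simps)
      ultimately have "s \<ge> - h" "\<bar>s - t\<bar> \<le> 2 * h" "s \<le> t"
        by linarith+
      then show ?thesis
        using gd[of s t] h2 t \<open>h \<le> T\<close> by auto
    qed
    obtain C where C: "\<And>s. s \<in> {-T..T} \<Longrightarrow> \<bar>g s\<bar> \<le> C"
      using continuous_on_Icc_bounded[OF continuous_on_subset[OF g]] by (metis UNIV_I subsetI)
    have intc: "integrable lborel (\<lambda>s. indicator A s * c)" for c :: real
      by (simp add: A_def)
    have intg: "integrable lborel (\<lambda>s. indicator A s * g s)"
    proof (rule Bochner_Integration.integrable_bound[OF intc[of "\<bar>g t\<bar> + e"]])
      show "AE s in lborel. norm (indicator A s * g s) \<le> norm (indicator A s * (\<bar>g t\<bar> + e))"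
      proof (intro AE_I2)
        fix s show "norm (indicator A s * g s) \<le> norm (indicator A s * (\<bar>g t\<bar> + e))"
          using close[of s] by (cases "s \<in> A") auto
      qed
    qed (simp add: A_def)
    have "lagged_mean h (Suc m) g t - g t = (\<integral>s. indicator A s * g s \<partial>lborel) / h - g t"
      using lagged_mean_eq[OF h(1) i] by (simp add: A_def)
    also have "\<dots> = ((\<integral>s. indicator A s * g s \<partial>lborel) - (\<integral>s. indicator A s * g t \<partial>lborel)) / h"
      using h mA by (simp add: diff_divide_distrib)
    also have "\<dots> = (\<integral>s. indicator A s * (g s - g t) \<partial>lborel) / h"
      by (subst Bochner_Integration.integral_diff[OF intg intc, symmetric]) (simp add: right_diff_distrib)
    finally have eq: "lagged_mean h (Suc m) g t - g t = (\<integral>s. indicator A s * (g s - g t) \<partial>lborel) / h" .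
    have "\<bar>\<integral>s. indicator A s * (g s - g t) \<partial>lborel\<bar> \<le> (\<integral>s. \<bar>indicator A s * (g s - g t)\<bar> \<partial>lborel)"
      by (rule integral_abs_bound)
    also have "\<dots> \<le> (\<integral>s. indicator A s * e \<partial>lborel)"
      by (rule integral_mono_AE'[OF intc]) (use close \<open>e > 0\<close> in \<open>auto simp: indicator_def\<close>)
    also have "\<dots> = h * e" using mA by simp
    finally have "\<bar>\<integral>s. indicator A s * (g s - g t) \<partial>lborel\<bar> / h \<le> e"
      using h(1) by (simp add: field_simps)
    then show "\<bar>lagged_mean (T / real (Suc m)) (Suc m) g t - g t\<bar> \<le> e"
      using h(1) eq unfolding h_def[symmetric] by simp
  qed
qed

lemma lagged_mean_measurable [measurable]: "lagged_mean h N f \<in> borel_measurable borel"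
  unfolding lagged_mean_def[abs_def] by measurable

text \<open>Three-term estimate. A continuous \<open>g\<close> close to \<open>f\<close> in mean is
  approximated uniformly, and the mean error of \<open>\<phi> = f - g\<close> is not enlarged by the
  averaging, by \<open>lagged_mean_L1_contraction\<close>.\<close>

theorem lagged_mean_L1_tendsto:
  fixes f :: "real \<Rightarrow> real"
  assumes f[measurable]: "f \<in> borel_measurable borel" and K: "\<And>s. \<bar>f s\<bar> \<le> K" and T: "T > 0"
  shows "(\<lambda>m. \<integral>t. indicator {0<..T} t * \<bar>lagged_mean (T / real (Suc m)) (Suc m) f t - f t\<bar> \<partial>lborel) \<longlonglongrightarrow> 0"
proof (rule LIMSEQ_I)
  fix e :: real assume e: "e > 0"
  obtain g where g: "continuous_on UNIV g" and gK: "\<And>s. \<bar>g s\<bar> \<le> K"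
    and ge: "(\<integral>s. indicator {-T<..T} s * \<bar>f s - g s\<bar> \<partial>lborel) < e / 3"
    by (rule continuous_L1_approximation[OF f K, of "e / 3" "-T" T]) (use e in auto)
  have g_meas[measurable]: "g \<in> borel_measurable borel"
    using g by (rule borel_measurable_continuous_onI)
  \<comment> \<open>The uniform error integrates to \<open>T * \<delta> = e / 4\<close>, strictly
    below its share \<open>e / 3\<close>.\<close>
  define \<delta> where "\<delta> = e / (4 * T)"
  have \<delta>: "\<delta> > 0" "T * \<delta> < e / 3" using T e by (simp_all add: \<delta>_def field_simps)
  obtain M where M: "\<And>m t. m \<ge> M \<Longrightarrow> t \<in> {0<..T} \<Longrightarrow>
      \<bar>lagged_mean (T / real (Suc m)) (Suc m) g t - g t\<bar> \<le> \<delta>"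
    using lagged_mean_continuous[OF g T \<delta>(1)] unfolding eventually_sequentially by blast
  have intb: "integrable lborel (\<lambda>s. indicator {a<..b} s * \<phi> s)"
    if [measurable]: "\<phi> \<in> borel_measurable borel" and "\<And>s. s \<in> {a<..b} \<Longrightarrow> \<bar>\<phi> s\<bar> \<le> C"
    for \<phi> :: "real \<Rightarrow> real" and a b C
    using integrableI_bounded_set_indicator[of "{a<..b}" lborel \<phi> C] that emeasure_lborel_Ioc_finite[of a b] by simp
  show "\<exists>no. \<forall>m\<ge>no. norm ((\<integral>t. indicator {0<..T} t * \<bar>lagged_mean (T / real (Suc m)) (Suc m) f t - f t\<bar> \<partial>lborel) - 0) < e"
  proof (intro exI[of _ M] allI impI)
    fix m assume m: "m \<ge> M"
    define h where "h = T / real (Suc m)"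
    define A where "A = lagged_mean h (Suc m)"
    have h: "h > 0" "real (Suc m) * h = T" using T by (simp_all add: h_def)
    define \<phi> where "\<phi> s = f s - g s" for s
    have [measurable]: "\<phi> \<in> borel_measurable borel" unfolding \<phi>_def[abs_def] by simp
    have \<phi>K: "\<bar>\<phi> s\<bar> \<le> 2 * K" for s using K[of s] gK[of s] unfolding \<phi>_def by linarith
    have Ameas[measurable]: "A \<psi> \<in> borel_measurable borel" for \<psi>
      unfolding A_def by simp
    have intF: "integrable lborel (\<lambda>s. indicator {a<..b} s * \<psi> s)"
      if "\<psi> \<in> borel_measurable borel" "\<And>s. \<bar>\<psi> s\<bar> \<le> C" for \<psi> :: "real \<Rightarrow> real" and C a b
      using that by (intro intb) auto
    have Alin: "A f t = A \<phi> t + A g t" if t: "t \<in> {0<..T}" for t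
    proof -
      obtain i where i: "i < Suc m" "t \<in> {real i * h<..real (Suc i) * h}"
        using grid_interval_exists[of h t "Suc m"] h t by auto
      have "(\<integral>s. indicator {(real i - 1) * h<..real i * h} s * f s \<partial>lborel) =
          (\<integral>s. indicator {(real i - 1) * h<..real i * h} s * \<phi> s
            + indicator {(real i - 1) * h<..real i * h} s * g s \<partial>lborel)"
        by (simp add: \<phi>_def right_diff_distrib)
      also have "\<dots> = (\<integral>s. indicator {(real i - 1) * h<..real i * h} s * \<phi> s \<partial>lborel) +
          (\<integral>s. indicator {(real i - 1) * h<..real i * h} s * g s \<partial>lborel)"
        by (intro Bochner_Integration.integral_add intF[OF _ \<phi>K] intF[OF _ gK]) simp_all
      finally show ?thesis
        unfolding A_def lagged_mean_eq[OF h(1) i] by (simp add: add_divide_distrib)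
    qed
    have A_bound: "\<bar>A \<phi> t\<bar> \<le> 2 * K" if t: "t \<in> {0<..T}" for t
    proof -
      obtain i where i: "i < Suc m" "t \<in> {real i * h<..real (Suc i) * h}"
        using grid_interval_exists[of h t "Suc m"] h t by auto
      let ?I = "{(real i - 1) * h<..real i * h}"
      have "\<bar>\<integral>s. indicator ?I s * \<phi> s \<partial>lborel\<bar> \<le> (\<integral>s. \<bar>indicator ?I s * \<phi> s\<bar> \<partial>lborel)"
        by (rule integral_abs_bound)
      also have "\<dots> \<le> (\<integral>s. indicator ?I s * (2 * K) \<partial>lborel)"
        using \<phi>K order_trans[OF abs_ge_zero K[of 0]]
        by (intro integral_mono_AE' intF[where C = "2 * K"]) (auto simp: indicator_def)
      also have "\<dots> = h * (2 * K)"
        using h by (simp add: algebra_simps)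
      finally show ?thesis
        unfolding A_def lagged_mean_eq[OF h(1) i] using h(1) by (simp add: field_simps)
    qed
    have i1: "integrable lborel (\<lambda>t. indicator {0<..T} t * \<bar>A \<phi> t\<bar>)"
      using A_bound by (intro intb) auto
    have i2: "integrable lborel (\<lambda>t. indicator {0<..T} t * \<delta>)"
      using \<delta>(1) by (intro intb[where C = \<delta>]) auto
    have i3: "integrable lborel (\<lambda>t. indicator {0<..T} t * \<bar>\<phi> t\<bar>)"
      using \<phi>K by (intro intb) auto
    have "(\<integral>t. indicator {0<..T} t * \<bar>A f t - f t\<bar> \<partial>lborel) \<le>
        (\<integral>t. indicator {0<..T} t * \<bar>A \<phi> t\<bar> + indicator {0<..T} t * \<delta> + indicator {0<..T} t * \<bar>\<phi> t\<bar> \<partial>lborel)"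
    proof (rule integral_mono_AE')
      show "integrable lborel (\<lambda>t. indicator {0<..T} t * \<bar>A \<phi> t\<bar> + indicator {0<..T} t * \<delta> + indicator {0<..T} t * \<bar>\<phi> t\<bar>)"
        by (intro Bochner_Integration.integrable_add i1 i2 i3)
      show "AE t in lborel. indicator {0<..T} t * \<bar>A f t - f t\<bar> \<le>
          indicator {0<..T} t * \<bar>A \<phi> t\<bar> + indicator {0<..T} t * \<delta> + indicator {0<..T} t * \<bar>\<phi> t\<bar>"
      proof (intro AE_I2)
        fix t
        show "indicator {0<..T} t * \<bar>A f t - f t\<bar> \<le>
          indicator {0<..T} t * \<bar>A \<phi> t\<bar> + indicator {0<..T} t * \<delta> + indicator {0<..T} t * \<bar>\<phi> t\<bar>"
        proof (cases "t \<in> {0<..T}")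
          case True
          then show ?thesis
            using M[OF m True] Alin[OF True] unfolding \<phi>_def A_def h_def by simp
        qed simp
      qed
      show "AE t in lborel. 0 \<le> indicator {0<..T} t * \<bar>A \<phi> t\<bar> + indicator {0<..T} t * \<delta> + indicator {0<..T} t * \<bar>\<phi> t\<bar>"
        using \<delta>(1) by (intro AE_I2) simp
    qed
    also have "\<dots> = (\<integral>t. indicator {0<..T} t * \<bar>A \<phi> t\<bar> \<partial>lborel) + T * \<delta> + (\<integral>t. indicator {0<..T} t * \<bar>\<phi> t\<bar> \<partial>lborel)"
      using i1 i2 i3 T by simp
    also have "\<dots> < e / 3 + e / 3 + e / 3"
    proof -
      have "(\<integral>t. indicator {0<..T} t * \<bar>A \<phi> t\<bar> \<partial>lborel) < e / 3"
      proof (rule le_less_trans)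
        show "(\<integral>t. indicator {0<..T} t * \<bar>A \<phi> t\<bar> \<partial>lborel) \<le> (\<integral>s. indicator {-T<..T} s * \<bar>\<phi> s\<bar> \<partial>lborel)"
          unfolding A_def by (rule lagged_mean_L1_contraction[OF h(1) _ \<phi>K h(2)]) simp
      qed (use ge in \<open>simp add: \<phi>_def\<close>)
      moreover have "(\<integral>t. indicator {0<..T} t * \<bar>\<phi> t\<bar> \<partial>lborel) \<le> (\<integral>s. indicator {-T<..T} s * \<bar>\<phi> s\<bar> \<partial>lborel)"
        using \<phi>K T by (intro integral_mono i3 intF[where C = "2 * K"]) (auto simp: indicator_def)
      ultimately show ?thesis using ge \<delta>(2) unfolding \<phi>_def by linarith
    qed
    finally show "norm ((\<integral>t. indicator {0<..T} t * \<bar>lagged_mean (T / real (Suc m)) (Suc m) f t - f t\<bar> \<partial>lborel) - 0) < e"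
      unfolding A_def h_def by simp
  qed
qed

subsection \<open>Brownian increments\<close>

lemma Int_stable_preimages: "Int_stable {X -` A \<inter> S | A. A \<in> sets N}"
  unfolding Int_stable_def
proof (intro ballI)
  fix a b assume "a \<in> {X -` A \<inter> S | A. A \<in> sets N}" "b \<in> {X -` A \<inter> S | A. A \<in> sets N}"
  then obtain A B where "A \<in> sets N" "B \<in> sets N" "a = X -` A \<inter> S" "b = X -` B \<inter> S" by blast
  moreover have "a \<inter> b = X -` (A \<inter> B) \<inter> S" using calculation by blast
  ultimately show "a \<inter> b \<in> {X -` A \<inter> S | A. A \<in> sets N}" using sets.Int[of A N B] by blast
qed

context brownian_space
begin

lemma natural_space [simp]: "space (natural_filtration M W t) = space M"
  unfolding natural_filtration_def by (intro space_measure_of) auto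

lemma sets_natural:
  "sets (natural_filtration M W t) =
     sigma_sets (space M) {W s -` A \<inter> space M | s A. s \<in> {0..t} \<and> A \<in> sets borel}"
  unfolding natural_filtration_def by (intro sets_measure_of) auto

lemma natural_subset_events: "t \<le> T \<Longrightarrow> sets (natural_filtration M W t) \<subseteq> sets M"
  unfolding sets_natural
  by (intro sets.sigma_sets_subset) (auto intro!: measurable_sets[OF W_measurable])

lemma F_space [simp]: "space (\<F> t) = space M"
  unfolding \<F>_def using sets.space_closed[of "natural_filtration M W t"] sets.space_closed[of M]
  by (intro space_measure_of) (auto simp: null_sets_def)

lemma sets_F: "sets (\<F> t) = sigma_sets (space M) (sets (natural_filtration M W t) \<union> null_sets M)"
  unfolding \<F>_def using sets.space_closed[of "natural_filtration M W t"] sets.space_closed[of M]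
  by (intro sets_measure_of) (auto simp: null_sets_def)

lemma F_subset_events: "t \<le> T \<Longrightarrow> sets (\<F> t) \<subseteq> sets M"
  unfolding sets_F using natural_subset_events[of t]
  by (intro sets.sigma_sets_subset) (auto simp: null_sets_def)

lemma F_mono: "s \<le> t \<Longrightarrow> sets (\<F> s) \<subseteq> sets (\<F> t)"
proof -
  assume "s \<le> t"
  then have "sets (natural_filtration M W s) \<subseteq> sets (natural_filtration M W t)"
    unfolding sets_natural by (intro sigma_sets_mono') fastforce
  then show ?thesis
    unfolding sets_F by (intro sigma_sets_mono') auto
qed

lemma F_measurable_mono:
  "s \<le> t \<Longrightarrow> f \<in> borel_measurable (\<F> s) \<Longrightarrow> f \<in> borel_measurable (\<F> t)"
  using F_mono[of s t] by (auto simp: measurable_def)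

lemma F_measurable_M:
  "t \<le> T \<Longrightarrow> f \<in> borel_measurable (\<F> t) \<Longrightarrow> f \<in> borel_measurable M"
  using F_subset_events[of t] by (auto simp: measurable_def)

lemma null_sets_F: "N \<in> null_sets M \<Longrightarrow> N \<in> sets (\<F> t)"
  unfolding sets_F by (intro sigma_sets.Basic) auto

text \<open>This is what completeness of the space and of the filtration provides: the two preimages
  differ inside a null set, and every subset of a null set belongs to every \<open>\<F> t\<close>.
  Limits that exist only almost surely therefore stay adapted.\<close>

lemma F_measurable_AE_eq:
  fixes f g :: "'a \<Rightarrow> real"
  assumes f: "f \<in> borel_measurable (\<F> t)" and eq: "AE \<omega> in M. f \<omega> = g \<omega>"
  shows "g \<in> borel_measurable (\<F> t)"
proof (rule measurableI)
  fix A :: "real set" assume A: "A \<in> sets borel"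
  obtain N where N: "N \<in> null_sets M" "{\<omega> \<in> space M. f \<omega> \<noteq> g \<omega>} \<subseteq> N"
    using eq by (auto elim!: AE_E)
  have "g -` A \<inter> space M \<inter> N \<in> null_sets M"
    using N(1) complete[of "g -` A \<inter> space M \<inter> N" N] null_sets_subset[OF N(1)] by auto
  then have "g -` A \<inter> space M \<inter> N \<in> sets (\<F> t)" "N \<in> sets (\<F> t)"
    using N(1) by (auto intro: null_sets_F)
  moreover have "f -` A \<inter> space M \<in> sets (\<F> t)"
    using measurable_sets[OF f A] by simp
  ultimately have "(f -` A \<inter> space M - N) \<union> (g -` A \<inter> space M \<inter> N) \<in> sets (\<F> t)"
    by auto
  moreover have "(f -` A \<inter> space M - N) \<union> (g -` A \<inter> space M \<inter> N) = g -` A \<inter> space (\<F> t)"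
    using N(2) by auto
  ultimately show "g -` A \<inter> space (\<F> t) \<in> sets (\<F> t)" by simp
qed auto

lemma W_measurable_F:
  assumes "0 \<le> s" "s \<le> t"
  shows "W s \<in> borel_measurable (\<F> t)"
proof (rule measurableI)
  fix A :: "real set" assume "A \<in> sets borel"
  with assms show "W s -` A \<inter> space (\<F> t) \<in> sets (\<F> t)"
    unfolding sets_F sets_natural by (auto intro!: sigma_sets.Basic)
qed auto

definition inc :: "real \<Rightarrow> real \<Rightarrow> 'a \<Rightarrow> real" where
  "inc s t \<omega> = W t \<omega> - W s \<omega>"

lemma inc_measurable_F: "0 \<le> s \<Longrightarrow> s \<le> t \<Longrightarrow> t \<le> u \<Longrightarrow> inc s t \<in> borel_measurable (\<F> u)"
  unfolding inc_def[abs_def] by (intro borel_measurable_diff W_measurable_F) auto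

lemma inc_measurable_M: "0 \<le> s \<Longrightarrow> s \<le> t \<Longrightarrow> t \<le> T \<Longrightarrow> inc s t \<in> borel_measurable M"
  using F_measurable_M[OF _ inc_measurable_F[of s t t]] by simp

text \<open>Independence is given for the natural filtration only. Adding the null sets keeps the
  generator stable under intersection, and the product formula is trivial for a null set, so the
  extension to the generated sigma-algebra applies.\<close>

lemma F_increment_indep:
  assumes st: "0 \<le> s" "s < t" "t \<le> T"
  shows "indep_set (sets (\<F> s)) {inc s t -` A \<inter> space M | A. A \<in> sets borel}"
proof -
  let ?E = "{inc s t -` A \<inter> space M | A. A \<in> sets borel}"
  have ind: "indep_set (sets (natural_filtration M W s)) ?E"
    using W_increment_indep[OF st] by (simp add: inc_def[abs_def])
  have E: "?E \<subseteq> sets M"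
    using measurable_sets[OF inc_measurable_M[of s t]] st by auto
  have "indep_set (sigma_sets (space M) (sets (natural_filtration M W s) \<union> null_sets M))
      (sigma_sets (space M) ?E)"
  proof (rule indep_set_sigma_sets)
    show "indep_set (sets (natural_filtration M W s) \<union> null_sets M) ?E"
    proof (rule indep_setI[OF _ E])
      show "sets (natural_filtration M W s) \<union> null_sets M \<subseteq> sets M"
        using natural_subset_events[of s] st by (auto simp: null_sets_def)
    next
      fix a b assume a: "a \<in> sets (natural_filtration M W s) \<union> null_sets M" and b: "b \<in> ?E"
      then show "prob (a \<inter> b) = prob a * prob b"
      proof (elim UnE)
        assume "a \<in> null_sets M"
        moreover have "a \<inter> b \<in> null_sets M"
          using null_set_Int2[OF \<open>a \<in> null_sets M\<close>, of b] b E by (auto simp: Int_commute)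
        ultimately show ?thesis
          by (simp add: null_sets_def measure_def)
      qed (rule indep_setD[OF ind])
    qed
    show "Int_stable (sets (natural_filtration M W s) \<union> null_sets M)"
      unfolding Int_stable_def
    proof (intro ballI)
      fix a b assume "a \<in> sets (natural_filtration M W s) \<union> null_sets M"
        "b \<in> sets (natural_filtration M W s) \<union> null_sets M"
      then show "a \<inter> b \<in> sets (natural_filtration M W s) \<union> null_sets M"
        using null_set_Int1[of a M b] null_set_Int1[of b M a] natural_subset_events[of s] st
        by (auto simp: Int_commute null_sets_def subset_iff)
    qed
    show "Int_stable ?E"
      by (rule Int_stable_preimages)
  qed
  then have *: "indep_set (sets (\<F> s)) (sigma_sets (space M) ?E)"
    by (simp add: sets_F)
  show ?thesis
    by (rule indep_setI[OF _ E]) (use indep_setD[OF *] F_subset_events[of s] st in \<open>auto\<close>)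
qed

lemma preimages_comp_subset:
  assumes "\<psi> \<in> measurable N N'"
    and "X \<in> S \<rightarrow> space N"
  shows "{(\<lambda>\<omega>. \<psi> (X \<omega>)) -` A \<inter> S | A. A \<in> sets N'} \<subseteq> {X -` A \<inter> S | A. A \<in> sets N}"
proof (rule subsetI)
  fix b assume "b \<in> {(\<lambda>\<omega>. \<psi> (X \<omega>)) -` A \<inter> S | A. A \<in> sets N'}"
  then obtain A where A: "A \<in> sets N'" and b: "b = (\<lambda>\<omega>. \<psi> (X \<omega>)) -` A \<inter> S"
    by blast
  have "b = X -` (\<psi> -` A \<inter> space N) \<inter> S"
    using assms(2) by (auto simp: b)
  with measurable_sets[OF assms(1) A] show "b \<in> {X -` A \<inter> S | A. A \<in> sets N}"
    by blast
qed

text \<open>Conditional mean and variance of an increment given the past, expressed through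
  multiplication by an integrable variable of the past. Independence of \<open>Z\<close> from the
  increment and from its square reduces both to moments of the normal law.\<close>

lemma
  assumes st: "0 \<le> s" "s \<le> t" "t \<le> T" and Z: "Z \<in> borel_measurable (\<F> s)" "integrable M Z"
  shows inc_first_moment: "integrable M (\<lambda>\<omega>. Z \<omega> * inc s t \<omega>)" "expectation (\<lambda>\<omega>. Z \<omega> * inc s t \<omega>) = 0"
    and inc_second_moment: "integrable M (\<lambda>\<omega>. Z \<omega> * (inc s t \<omega>)\<^sup>2)"
      "expectation (\<lambda>\<omega>. Z \<omega> * (inc s t \<omega>)\<^sup>2) = expectation Z * (t - s)"
proof -
  have "integrable M (\<lambda>\<omega>. Z \<omega> * inc s t \<omega>) \<and> expectation (\<lambda>\<omega>. Z \<omega> * inc s t \<omega>) = 0 \<and>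
    integrable M (\<lambda>\<omega>. Z \<omega> * (inc s t \<omega>)\<^sup>2) \<and>
      expectation (\<lambda>\<omega>. Z \<omega> * (inc s t \<omega>)\<^sup>2) = expectation Z * (t - s)"
  \<comment> \<open>The normal law is given only for \<open>s < t\<close>; for \<open>s = t\<close>
    the increment vanishes.\<close>
  proof (cases "s = t")
    case True
    then show ?thesis by (simp add: inc_def)
  next
    case False
    with st have "s < t" by simp
    let ?\<sigma> = "sqrt (t - s)"
    have \<sigma>: "0 < ?\<sigma>" using \<open>s < t\<close> by simp
    have D: "distributed M lborel (inc s t) (normal_density 0 ?\<sigma>)"
      unfolding inc_def[abs_def] using W_increment_normal[of s t] st \<open>s < t\<close> by simp
    have [measurable]: "inc s t \<in> borel_measurable M" "Z \<in> borel_measurable M"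
      using st Z by (auto intro: inc_measurable_M F_measurable_M)
    have i1: "integrable M (inc s t)"
      by (rule distributed_integrable_var[OF D])
        (use integrable_normal_moment_nz_1[OF \<sigma>, of 0] in auto)
    have i2: "integrable M (\<lambda>\<omega>. (inc s t \<omega>)\<^sup>2)"
      using distributed_integrable[OF D, of "\<lambda>x. x\<^sup>2"] integrable_normal_moment[OF \<sigma>, of 0 2] by simp
    have e1: "expectation (inc s t) = 0"
      by (rule normal_distributed_expectation[OF \<sigma> D])
    have e2: "expectation (\<lambda>\<omega>. (inc s t \<omega>)\<^sup>2) = t - s"
      using normal_distributed_variance[OF \<sigma> D] e1 \<open>s < t\<close> by simp
    have ind: "indep_var borel Z borel (\<lambda>\<omega>. \<psi> (inc s t \<omega>))"
      if \<psi>: "\<psi> \<in> borel_measurable borel" for \<psi> :: "real \<Rightarrow> real"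
    proof -
      let ?A = "{Z -` A \<inter> space M | A. A \<in> sets borel}"
      let ?B = "{(\<lambda>\<omega>. \<psi> (inc s t \<omega>)) -` A \<inter> space M | A. A \<in> sets borel}"
      have A: "?A \<subseteq> sets (\<F> s)"
        using measurable_sets[OF Z(1)] by auto
      have B: "?B \<subseteq> {inc s t -` A \<inter> space M | A. A \<in> sets borel}"
        by (rule preimages_comp_subset[OF \<psi>]) simp
      have "indep_set ?A ?B"
      proof (rule indep_setI)
        note ind = F_increment_indep[OF st(1) \<open>s < t\<close> st(3)]
        show "?A \<subseteq> events"
          using A F_subset_events[of s] st by (meson order_trans)
        show "?B \<subseteq> events"
          using measurable_sets[OF measurable_compose[OF \<open>inc s t \<in> borel_measurable M\<close> \<psi>]] by blast
        show "prob (a \<inter> b) = prob a * prob b" if "a \<in> ?A" "b \<in> ?B" for a b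
          by (rule indep_setD[OF ind subsetD[OF A that(1)] subsetD[OF B that(2)]])
      qed
      then have "indep_set (sigma_sets (space M) ?A) (sigma_sets (space M) ?B)"
        by (rule indep_set_sigma_sets) (rule Int_stable_preimages)+
      then show ?thesis
        unfolding indep_var_eq using \<psi> by simp
    qed
    have "indep_var borel Z borel (inc s t)" "indep_var borel Z borel (\<lambda>\<omega>. (inc s t \<omega>)\<^sup>2)"
      using ind[of "\<lambda>x. x"] ind[of "\<lambda>x. x\<^sup>2"] by simp_all
    then show ?thesis
      using indep_var_integrable[OF _ Z(2)] indep_var_lebesgue_integral[OF _ Z(2)] i1 i2 e1 e2 by simp
  qed
  then show "integrable M (\<lambda>\<omega>. Z \<omega> * inc s t \<omega>)" "expectation (\<lambda>\<omega>. Z \<omega> * inc s t \<omega>) = 0"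
    "integrable M (\<lambda>\<omega>. Z \<omega> * (inc s t \<omega>)\<^sup>2)"
    "expectation (\<lambda>\<omega>. Z \<omega> * (inc s t \<omega>)\<^sup>2) = expectation Z * (t - s)"
    by auto
qed

lemma inc_sq_int: "0 \<le> s \<Longrightarrow> s \<le> t \<Longrightarrow> t \<le> T \<Longrightarrow> sq_int M (inc s t)"
proof -
  assume st: "0 \<le> s" "s \<le> t" "t \<le> T"
  have "integrable M (\<lambda>\<omega>. 1 * (inc s t \<omega>)\<^sup>2)"
    by (rule inc_second_moment(1)[OF st borel_measurable_const integrable_const])
  with inc_measurable_M[OF st] show ?thesis
    unfolding sq_int_def mult_1 by (rule conjI)
qed

definition bounded_rv :: "('a \<Rightarrow> real) \<Rightarrow> bool" where
  "bounded_rv Z \<longleftrightarrow> (\<exists>B. \<forall>\<omega>\<in>space M. \<bar>Z \<omega>\<bar> \<le> B)"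

lemma bounded_rv_integrable:
  assumes "Z \<in> borel_measurable M" "bounded_rv Z"
  shows "integrable M Z"
proof -
  obtain B where B: "\<And>\<omega>. \<omega> \<in> space M \<Longrightarrow> \<bar>Z \<omega>\<bar> \<le> B"
    using assms(2) unfolding bounded_rv_def by blast
  show ?thesis
    by (rule integrable_const_bound[where B = B, OF AE_I2 assms(1)]) (simp add: B)
qed

lemma bounded_rv_mult:
  assumes "bounded_rv Z" "bounded_rv Y"
  shows "bounded_rv (\<lambda>\<omega>. Z \<omega> * Y \<omega>)"
proof -
  obtain A B where A: "\<And>\<omega>. \<omega> \<in> space M \<Longrightarrow> \<bar>Z \<omega>\<bar> \<le> A" and B: "\<And>\<omega>. \<omega> \<in> space M \<Longrightarrow> \<bar>Y \<omega>\<bar> \<le> B"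
    using assms unfolding bounded_rv_def by blast
  have "\<bar>Z \<omega> * Y \<omega>\<bar> \<le> A * B" if "\<omega> \<in> space M" for \<omega>
    unfolding abs_mult
    by (rule mult_mono[OF A B order_trans[OF abs_ge_zero A] abs_ge_zero]) (rule that)+
  then show ?thesis unfolding bounded_rv_def by blast
qed

lemma bounded_rv_mult_sq_int:
  assumes "Z \<in> borel_measurable M" "bounded_rv Z" "sq_int M Y"
  shows "sq_int M (\<lambda>\<omega>. Z \<omega> * Y \<omega>)"
proof -
  obtain B where B: "\<And>\<omega>. \<omega> \<in> space M \<Longrightarrow> \<bar>Z \<omega>\<bar> \<le> B"
    using assms(2) unfolding bounded_rv_def by blast
  show ?thesis
  proof (rule sq_int_bound[OF assms(3) borel_measurable_times[OF assms(1) sq_intD(1)[OF assms(3)]]])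
    show "AE \<omega> in M. \<bar>Z \<omega> * Y \<omega>\<bar> \<le> B * \<bar>Y \<omega>\<bar>"
      by (intro AE_I2) (simp add: abs_mult mult_right_mono B)
  qed
qed

text \<open>Only the common interval contributes to the cross moment, and \<open>max 0\<close>
  covers disjoint intervals. After cutting at the overlap, the other products have one factor that
  starts when everything else is already known, so their mean is 0.\<close>

lemma inc_product:
  assumes ab: "0 \<le> a" "a \<le> b" "b \<le> T" and cd: "a \<le> c" "c \<le> d" "d \<le> T"
    and \<zeta>: "\<zeta> \<in> borel_measurable (\<F> c)" "bounded_rv \<zeta>"
  shows "integrable M (\<lambda>\<omega>. \<zeta> \<omega> * (inc a b \<omega> * inc c d \<omega>))"
    and "expectation (\<lambda>\<omega>. \<zeta> \<omega> * (inc a b \<omega> * inc c d \<omega>)) = expectation \<zeta> * max 0 (min b d - c)"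
proof -
  have \<zeta>M: "\<zeta> \<in> borel_measurable M" "integrable M \<zeta>"
  proof -
    show "\<zeta> \<in> borel_measurable M" by (rule F_measurable_M[OF _ \<zeta>(1)]) (use cd in linarith)
    then show "integrable M \<zeta>" by (rule bounded_rv_integrable[OF _ \<zeta>(2)])
  qed
  have intZ: "integrable M (\<lambda>\<omega>. \<zeta> \<omega> * inc p q \<omega>)" if "0 \<le> p" "p \<le> q" "q \<le> T" for p q
    using sq_int_integrable[OF bounded_rv_mult_sq_int[OF \<zeta>M(1) \<zeta>(2) inc_sq_int[OF that]]] .
  have ZF: "(\<lambda>\<omega>. \<zeta> \<omega> * inc p q \<omega>) \<in> borel_measurable (\<F> u)" if "0 \<le> p" "p \<le> q" "q \<le> u" "c \<le> u" for p q u
    by (intro borel_measurable_times F_measurable_mono[OF that(4) \<zeta>(1)] inc_measurable_F that)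
  have sep: "integrable M (\<lambda>\<omega>. \<zeta> \<omega> * (inc p q \<omega> * inc u v \<omega>))"
    "expectation (\<lambda>\<omega>. \<zeta> \<omega> * (inc p q \<omega> * inc u v \<omega>)) = 0"
    if "0 \<le> p" "p \<le> q" "q \<le> u" "c \<le> u" "u \<le> v" "v \<le> T" for p q u v
  proof -
    have u: "0 \<le> u" "q \<le> T" using that by linarith+
    show "integrable M (\<lambda>\<omega>. \<zeta> \<omega> * (inc p q \<omega> * inc u v \<omega>))"
      "expectation (\<lambda>\<omega>. \<zeta> \<omega> * (inc p q \<omega> * inc u v \<omega>)) = 0"
      using inc_first_moment[OF u(1) that(5,6) ZF[OF that(1-4)] intZ[OF that(1,2) u(2)]]
      by (simp_all only: mult.assoc)
  qed
  have "integrable M (\<lambda>\<omega>. \<zeta> \<omega> * (inc a b \<omega> * inc c d \<omega>)) \<and>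
    expectation (\<lambda>\<omega>. \<zeta> \<omega> * (inc a b \<omega> * inc c d \<omega>)) = expectation \<zeta> * max 0 (min b d - c)"
  proof (cases "b \<le> c")
    case True
    then have "max 0 (min b d - c) = 0" by simp
    then show ?thesis
      using sep[OF ab(1,2) True order_refl cd(2,3)] by (simp only: mult_zero_right simp_thms)
  next
    case False
    define e where "e = min b d"
    define f where "f = max b d"
    have ef: "c \<le> e" "e \<le> f" "f \<le> T" "max 0 (min b d - c) = e - c"
      using False ab cd by (auto simp: e_def f_def)
    \<comment> \<open>With \<open>e\<close> and \<open>f\<close> the smaller and the larger right
      end point, \<open>inc c b\<close> and \<open>inc c d\<close> share \<open>inc c e\<close>, and
      the longer of them adds \<open>inc e f\<close>; the square of the shared part is the only term
      that can have nonzero mean.\<close>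
    have split: "\<zeta> \<omega> * (inc a b \<omega> * inc c d \<omega>) = \<zeta> \<omega> * (inc a c \<omega> * inc c d \<omega>) +
        \<zeta> \<omega> * (inc c e \<omega>)\<^sup>2 + \<zeta> \<omega> * (inc c e \<omega> * inc e f \<omega>)" for \<omega>
    proof -
      have "inc a b \<omega> = inc a c \<omega> + inc c b \<omega>" by (simp add: inc_def)
      moreover have "inc c b \<omega> * inc c d \<omega> = inc c e \<omega> * (inc c e \<omega> + inc e f \<omega>)"
        unfolding inc_def e_def f_def by (cases "b \<le> d") (simp_all add: min_def max_def)
      ultimately show ?thesis by (simp add: algebra_simps power2_eq_square)
    qed
    have 1: "integrable M (\<lambda>\<omega>. \<zeta> \<omega> * (inc a c \<omega> * inc c d \<omega>))"
      "expectation (\<lambda>\<omega>. \<zeta> \<omega> * (inc a c \<omega> * inc c d \<omega>)) = 0"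
      by (rule sep[OF ab(1) cd(1) order_refl order_refl cd(2,3)])+
    have 2: "integrable M (\<lambda>\<omega>. \<zeta> \<omega> * (inc c e \<omega>)\<^sup>2)"
      "expectation (\<lambda>\<omega>. \<zeta> \<omega> * (inc c e \<omega>)\<^sup>2) = expectation \<zeta> * (e - c)"
      by (rule inc_second_moment[OF _ ef(1) _ \<zeta>(1) \<zeta>M(2)]; use ab cd ef in linarith)+
    have 3: "integrable M (\<lambda>\<omega>. \<zeta> \<omega> * (inc c e \<omega> * inc e f \<omega>))"
      "expectation (\<lambda>\<omega>. \<zeta> \<omega> * (inc c e \<omega> * inc e f \<omega>)) = 0"
      by (rule sep[OF _ ef(1) order_refl ef(1,2,3)]; use ab cd in linarith)+
    show ?thesis
      unfolding split ef(4)
      using 1(2) 2(2) 3(2) Bochner_Integration.integrable_add[OF Bochner_Integration.integrable_add[OF 1(1) 2(1)] 3(1)]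
      by (simp only: Bochner_Integration.integral_add[OF Bochner_Integration.integrable_add[OF 1(1) 2(1)] 3(1)]
          Bochner_Integration.integral_add[OF 1(1) 2(1)] add_0 add_0_right simp_thms)
  qed
  then show "integrable M (\<lambda>\<omega>. \<zeta> \<omega> * (inc a b \<omega> * inc c d \<omega>))"
    "expectation (\<lambda>\<omega>. \<zeta> \<omega> * (inc a b \<omega> * inc c d \<omega>)) = expectation \<zeta> * max 0 (min b d - c)"
    by auto
qed

section \<open>Increments of the stopped Brownian path\<close>

definition stopped_inc :: "real \<Rightarrow> real \<Rightarrow> real \<Rightarrow> 'a \<Rightarrow> real" where
  "stopped_inc a b t \<omega> = W (min t b) \<omega> - W (min t a) \<omega>"

lemma stopped_inc_eq:
  "a \<le> b \<Longrightarrow> stopped_inc a b t = (if a \<le> t then inc a (min t b) else (\<lambda>_. 0))"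
  by (auto simp: stopped_inc_def[abs_def] inc_def[abs_def] min_def fun_eq_iff)

text \<open>\<open>a \<le> c\<close> makes both weights known at time \<open>c\<close>, where the
  later increment starts, so that \<open>inc_product\<close> applies with weight
  \<open>\<xi> * \<eta>\<close>. The integral on the right is the length of the common interval up
  to \<open>t\<close>.\<close>

lemma stopped_inc_product_ordered:
  assumes ab: "0 \<le> a" "a \<le> b" "b \<le> T" and cd: "a \<le> c" "c \<le> d" "d \<le> T" and t: "0 \<le> t" "t \<le> T"
    and \<xi>: "\<xi> \<in> borel_measurable (\<F> a)" "bounded_rv \<xi>"
    and \<eta>: "\<eta> \<in> borel_measurable (\<F> c)" "bounded_rv \<eta>"
  shows "integrable M (\<lambda>\<omega>. (\<xi> \<omega> * stopped_inc a b t \<omega>) * (\<eta> \<omega> * stopped_inc c d t \<omega>)) \<and>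
    expectation (\<lambda>\<omega>. (\<xi> \<omega> * stopped_inc a b t \<omega>) * (\<eta> \<omega> * stopped_inc c d t \<omega>)) =
      expectation (\<lambda>\<omega>. \<xi> \<omega> * \<eta> \<omega>) *
        (\<integral>s. indicator {0..t} s * (indicator {a<..b} s * indicator {c<..d} s) \<partial>lborel)"
proof (cases "c \<le> t")
  case True
  have \<zeta>: "(\<lambda>\<omega>. \<xi> \<omega> * \<eta> \<omega>) \<in> borel_measurable (\<F> c)" "bounded_rv (\<lambda>\<omega>. \<xi> \<omega> * \<eta> \<omega>)"
    using F_measurable_mono[OF cd(1) \<xi>(1)] \<eta> \<xi>(2) by (auto intro: bounded_rv_mult)
  have "indicator {0..t} s * (indicator {a<..b} s * indicator {c<..d} s) =
      (indicator {c<..min (min t b) (min t d)} s :: real)" for s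
    using ab cd t by (auto simp: indicator_def)
  then have "(\<integral>s. indicator {0..t} s * (indicator {a<..b} s * indicator {c<..d} s) \<partial>lborel) =
      (\<integral>s. indicator {c<..min (min t b) (min t d)} s \<partial>lborel :: real)"
    by (intro Bochner_Integration.integral_cong) simp_all
  also have "\<dots> = max 0 (min (min t b) (min t d) - c)"
  proof (cases "c \<le> min (min t b) (min t d)")
    case False
    then have "{c<..min (min t b) (min t d)} = {}" "max 0 (min (min t b) (min t d) - c) = 0" by auto
    then show ?thesis by (simp only:) simp
  qed simp
  finally have "(\<integral>s. indicator {0..t} s * (indicator {a<..b} s * indicator {c<..d} s) \<partial>lborel) =
      max 0 (min (min t b) (min t d) - c)" .
  moreover have "(\<xi> \<omega> * stopped_inc a b t \<omega>) * (\<eta> \<omega> * stopped_inc c d t \<omega>) =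
      (\<xi> \<omega> * \<eta> \<omega>) * (inc a (min t b) \<omega> * inc c (min t d) \<omega>)" for \<omega>
    using True ab cd by (simp add: stopped_inc_eq mult_ac)
  moreover have "0 \<le> a" "a \<le> min t b" "min t b \<le> T" "a \<le> c" "c \<le> min t d" "min t d \<le> T"
    using True ab cd t by auto
  note inc_product[OF this \<zeta>]
  ultimately show ?thesis by (simp only: simp_thms)
next
  case False
  have "indicator {0..t} s * (indicator {a<..b} s * indicator {c<..d} s) = (0 :: real)" for s
    using False by (auto simp: indicator_def)
  then have "(\<integral>s. indicator {0..t} s * (indicator {a<..b} s * indicator {c<..d} s) \<partial>lborel) = (0 :: real)"
    by (simp only: integral_zero)
  then show ?thesis
    using False cd by (simp add: stopped_inc_eq)
qed

lemma stopped_inc_product: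
  assumes ab: "0 \<le> a" "a \<le> b" "b \<le> T" and cd: "0 \<le> c" "c \<le> d" "d \<le> T" and t: "0 \<le> t" "t \<le> T"
    and \<xi>: "\<xi> \<in> borel_measurable (\<F> a)" "bounded_rv \<xi>"
    and \<eta>: "\<eta> \<in> borel_measurable (\<F> c)" "bounded_rv \<eta>"
  shows "integrable M (\<lambda>\<omega>. (\<xi> \<omega> * stopped_inc a b t \<omega>) * (\<eta> \<omega> * stopped_inc c d t \<omega>))"
    and "expectation (\<lambda>\<omega>. (\<xi> \<omega> * stopped_inc a b t \<omega>) * (\<eta> \<omega> * stopped_inc c d t \<omega>)) =
      expectation (\<lambda>\<omega>. \<xi> \<omega> * \<eta> \<omega>) *
        (\<integral>s. indicator {0..t} s * (indicator {a<..b} s * indicator {c<..d} s) \<partial>lborel)"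
proof -
  have "integrable M (\<lambda>\<omega>. (\<xi> \<omega> * stopped_inc a b t \<omega>) * (\<eta> \<omega> * stopped_inc c d t \<omega>)) \<and>
    expectation (\<lambda>\<omega>. (\<xi> \<omega> * stopped_inc a b t \<omega>) * (\<eta> \<omega> * stopped_inc c d t \<omega>)) =
      expectation (\<lambda>\<omega>. \<xi> \<omega> * \<eta> \<omega>) *
        (\<integral>s. indicator {0..t} s * (indicator {a<..b} s * indicator {c<..d} s) \<partial>lborel)"
  proof (cases "a \<le> c")
    case True
    show ?thesis by (rule stopped_inc_product_ordered[OF ab True cd(2,3) t \<xi> \<eta>])
  next
    case False
    then have "c \<le> a" by simp
    from stopped_inc_product_ordered[OF cd this ab(2,3) t \<eta> \<xi>] show ?thesis
      by (simp only: mult_ac)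
  qed
  then show "integrable M (\<lambda>\<omega>. (\<xi> \<omega> * stopped_inc a b t \<omega>) * (\<eta> \<omega> * stopped_inc c d t \<omega>))"
    "expectation (\<lambda>\<omega>. (\<xi> \<omega> * stopped_inc a b t \<omega>) * (\<eta> \<omega> * stopped_inc c d t \<omega>)) =
      expectation (\<lambda>\<omega>. \<xi> \<omega> * \<eta> \<omega>) *
        (\<integral>s. indicator {0..t} s * (indicator {a<..b} s * indicator {c<..d} s) \<partial>lborel)"
    by blast+
qed

lemma stopped_inc_sq_int:
  assumes "0 \<le> a" "a \<le> b" "b \<le> T" "0 \<le> t" "t \<le> T"
  shows "sq_int M (stopped_inc a b t)"
proof (cases "a \<le> t")
  case True
  have "sq_int M (inc a (min t b))"
    by (rule inc_sq_int) (use assms True in auto)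
  then show ?thesis by (simp only: stopped_inc_eq[OF assms(2)] True if_True)
next
  case False
  then show ?thesis by (simp only: stopped_inc_eq[OF assms(2)] if_False sq_int_zero)
qed

lemma stopped_inc_measurable_F:
  assumes "0 \<le> a" "a \<le> b" "b \<le> T" "0 \<le> t" "t \<le> T" "\<xi> \<in> borel_measurable (\<F> a)"
  shows "(\<lambda>\<omega>. \<xi> \<omega> * stopped_inc a b t \<omega>) \<in> borel_measurable (\<F> t)"
proof (cases "a \<le> t")
  case True
  have "inc a (min t b) \<in> borel_measurable (\<F> t)"
    by (rule inc_measurable_F) (use assms True in auto)
  from borel_measurable_times[OF F_measurable_mono[OF True assms(6)] this]
  show ?thesis by (simp only: stopped_inc_eq[OF assms(2)] True if_True)
next
  case False
  then show ?thesis by (simp only: stopped_inc_eq[OF assms(2)] if_False mult_zero_right borel_measurable_const)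
qed

text \<open>Between \<open>s\<close> and \<open>t\<close> the stopped increment changes by the
  Brownian increment over the part of \<open>{a<..b}\<close> inside \<open>{s<..t}\<close>, and
  \<open>\<xi> * Z\<close> is known at the start \<open>max a s\<close> of that part.\<close>

lemma stopped_inc_martingale:
  assumes ab: "0 \<le> a" "a \<le> b" "b \<le> T" and st: "0 \<le> s" "s \<le> t" "t \<le> T"
    and \<xi>: "\<xi> \<in> borel_measurable (\<F> a)" "bounded_rv \<xi>"
    and Z: "Z \<in> borel_measurable (\<F> s)" "sq_int M Z"
  shows "expectation (\<lambda>\<omega>. (\<xi> \<omega> * stopped_inc a b t \<omega>) * Z \<omega>) =
    expectation (\<lambda>\<omega>. (\<xi> \<omega> * stopped_inc a b s \<omega>) * Z \<omega>)"
proof -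
  have \<xi>M: "\<xi> \<in> borel_measurable M" using F_measurable_M[OF _ \<xi>(1)] ab by simp
  have int: "integrable M (\<lambda>\<omega>. (\<xi> \<omega> * stopped_inc a b u \<omega>) * Z \<omega>)" if "0 \<le> u" "u \<le> T" for u
    by (intro sq_int_mult bounded_rv_mult_sq_int \<xi>M \<xi>(2) stopped_inc_sq_int ab that Z(2))
  have "expectation (\<lambda>\<omega>. (\<xi> \<omega> * stopped_inc a b t \<omega>) * Z \<omega> - (\<xi> \<omega> * stopped_inc a b s \<omega>) * Z \<omega>) = 0"
  proof (cases "a \<le> t \<and> s \<le> b")
    case True
    define p where "p = max a s"
    define q where "q = min t b"
    have pq: "0 \<le> p" "p \<le> q" "q \<le> T" "a \<le> p" "s \<le> p" using True ab st by (auto simp: p_def q_def)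
    have diff: "inc p q \<omega> = stopped_inc a b t \<omega> - stopped_inc a b s \<omega>" for \<omega>
      using True ab st by (auto simp: stopped_inc_def inc_def p_def q_def min_def max_def)
    have "(\<xi> \<omega> * stopped_inc a b t \<omega>) * Z \<omega> - (\<xi> \<omega> * stopped_inc a b s \<omega>) * Z \<omega> =
        (\<xi> \<omega> * Z \<omega>) * inc p q \<omega>" for \<omega>
      unfolding diff by (simp add: algebra_simps)
    moreover have "expectation (\<lambda>\<omega>. (\<xi> \<omega> * Z \<omega>) * inc p q \<omega>) = 0"
      using sq_int_integrable[OF bounded_rv_mult_sq_int[OF \<xi>M \<xi>(2) Z(2)]]
        F_measurable_mono[OF pq(4) \<xi>(1)] F_measurable_mono[OF pq(5) Z(1)]
      by (intro inc_first_moment(2) pq) auto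
    ultimately show ?thesis by simp
  next
    case False
    then have "stopped_inc a b t = stopped_inc a b s"
      using ab st by (auto simp: stopped_inc_def[abs_def] fun_eq_iff min_def)
    then show ?thesis by simp
  qed
  then show ?thesis
    using int[of t] int[of s] st by simp
qed

end

subsection \<open>The isometry for simple integrands\<close>

text \<open>With \<open>c\<close> the indicator of \<open>{0..t}\<close>, this restricts an
  approximation of an integrand to an initial time interval.\<close>

lemma L2_tendsto_bounded_mult:
  assumes X: "L2_tendsto N X Y" and c: "c \<in> borel_measurable N" "\<And>x. \<bar>c x\<bar> \<le> 1"
  shows "L2_tendsto N (\<lambda>m x. c x * X m x) (\<lambda>x. c x * Y x)"
proof -
  have sq: "sq_int N (X m)" "sq_int N Y" "sq_int N (\<lambda>x. X m x - Y x)" for m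
    using X by (auto simp: L2_tendsto_def intro: sq_int_diff)
  have cs: "sq_int N (\<lambda>x. c x * f x)" if "sq_int N f" for f
  proof (rule sq_int_bound[OF that borel_measurable_times[OF c(1) sq_intD(1)[OF that]]])
    show "AE x in N. \<bar>c x * f x\<bar> \<le> 1 * \<bar>f x\<bar>"
      by (intro AE_I2) (simp only: abs_mult mult_right_mono c(2) abs_ge_zero)
  qed
  have le: "(\<integral>x. (c x * X m x - c x * Y x)\<^sup>2 \<partial>N) \<le> (\<integral>x. (X m x - Y x)\<^sup>2 \<partial>N)" for m
  proof (rule integral_mono)
    show "integrable N (\<lambda>x. (c x * X m x - c x * Y x)\<^sup>2)"
      using sq_intD(2)[OF sq_int_diff[OF cs[OF sq(1)] cs[OF sq(2)]]] .
    show "integrable N (\<lambda>x. (X m x - Y x)\<^sup>2)"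
      using sq_intD(2)[OF sq(3)] .
    fix x
    have "(c x)\<^sup>2 * (X m x - Y x)\<^sup>2 \<le> 1 * (X m x - Y x)\<^sup>2"
      using c(2)[of x] by (intro mult_right_mono) (simp_all add: abs_square_le_1)
    then show "(c x * X m x - c x * Y x)\<^sup>2 \<le> (X m x - Y x)\<^sup>2"
      by (simp add: power_mult_distrib flip: right_diff_distrib)
  qed
  have "(\<lambda>m. \<integral>x. (c x * X m x - c x * Y x)\<^sup>2 \<partial>N) \<longlonglongrightarrow> 0"
  proof (rule tendsto_sandwich[of "\<lambda>_. 0"])
    show "(\<lambda>m. \<integral>x. (X m x - Y x)\<^sup>2 \<partial>N) \<longlonglongrightarrow> 0" using X by (simp add: L2_tendsto_def)
  qed (use le in auto)
  then show ?thesis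
    unfolding L2_tendsto_def using cs sq by blast
qed

lemma L2_zero_AE:
  assumes "sq_int N f" "(\<integral>x. (f x)\<^sup>2 \<partial>N) = 0"
  shows "AE x in N. f x = 0"
  using assms integral_nonneg_eq_0_iff_AE[of N "\<lambda>x. (f x)\<^sup>2"] by (simp add: sq_int_def)

context brownian_space
begin

definition time_measure :: "real measure" where
  "time_measure = restrict_space lborel {0..T}"

lemma dt_P_eq: "dt_P = time_measure \<Otimes>\<^sub>M M"
  by (simp only: dt_P_def time_measure_def)

lemma space_time_measure [simp]: "space time_measure = {0..T}"
  by (simp add: time_measure_def space_restrict_space)

lemma finite_time_measure: "finite_measure time_measure"
  by (rule finite_measureI) (simp add: time_measure_def emeasure_restrict_space space_restrict_space emeasure_lborel_Icc_eq)

sublocale time: finite_measure time_measure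
  by (rule finite_time_measure)

sublocale time_prob: pair_sigma_finite time_measure M
  by unfold_locales

sublocale dtP: finite_measure dt_P
  unfolding dt_P_eq by (intro finite_measure_pair_measure finite_time_measure finite_measure_axioms)

lemma space_dt_P: "space dt_P = {0..T} \<times> space M"
  by (simp add: dt_P_eq space_pair_measure space_restrict_space)

lemma time_measurable: "f \<in> borel_measurable borel \<Longrightarrow> f \<in> borel_measurable time_measure"
  unfolding time_measure_def by (rule measurable_restrict_space1) (simp only: measurable_lborel1 measurable_lborel2)

lemma fst_dt_P_measurable: "f \<in> borel_measurable borel \<Longrightarrow> (\<lambda>p. f (fst p)) \<in> borel_measurable dt_P"
  unfolding dt_P_eq by (rule measurable_compose[OF measurable_fst time_measurable])

lemma snd_dt_P_measurable: "f \<in> borel_measurable M \<Longrightarrow> (\<lambda>p. f (snd p)) \<in> borel_measurable dt_P"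
  unfolding dt_P_eq by (rule measurable_compose[OF measurable_snd])

lemma dt_P_tensor:
  fixes f :: "real \<Rightarrow> real" and g :: "'a \<Rightarrow> real"
  assumes f: "integrable time_measure f" and g: "integrable M g"
  shows "integrable dt_P (\<lambda>(s, \<omega>). f s * g \<omega>)"
    and "(\<integral>(s, \<omega>). f s * g \<omega> \<partial>dt_P) = (\<integral>s. f s \<partial>time_measure) * expectation g"
proof -
  have [measurable]: "f \<in> borel_measurable time_measure" "g \<in> borel_measurable M" using f g by auto
  show i: "integrable dt_P (\<lambda>(s, \<omega>). f s * g \<omega>)"
    unfolding dt_P_eq
  proof (rule time_prob.Fubini_integrable)
    show "AE s in time_measure. integrable M (\<lambda>\<omega>. case (s, \<omega>) of (s, \<omega>) \<Rightarrow> f s * g \<omega>)"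
      using g by simp
    have "integrable time_measure (\<lambda>s. \<bar>f s\<bar> * (\<integral>\<omega>. \<bar>g \<omega>\<bar> \<partial>M))"
      using integrable_abs[OF f] by (rule integrable_mult_left)
    then show "integrable time_measure (\<lambda>s. \<integral>\<omega>. norm (case (s, \<omega>) of (s, \<omega>) \<Rightarrow> f s * g \<omega>) \<partial>M)"
      by (simp add: abs_mult)
  qed measurable
  have "(\<integral>(s, \<omega>). f s * g \<omega> \<partial>dt_P) = (\<integral>s. (\<integral>\<omega>. f s * g \<omega> \<partial>M) \<partial>time_measure)"
    using time_prob.integral_fst[OF i[unfolded dt_P_eq]] by (simp only: dt_P_eq)
  then show "(\<integral>(s, \<omega>). f s * g \<omega> \<partial>dt_P) = (\<integral>s. f s \<partial>time_measure) * expectation g"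
    by simp
qed

text \<open>The partition is hidden so that an integrand and its integral can be passed on together.
  It is a relation because the integral is defined through a representation and not through the
  process.\<close>

definition simple_pair :: "(real \<Rightarrow> 'a \<Rightarrow> real) \<Rightarrow> (real \<Rightarrow> 'a \<Rightarrow> real) \<Rightarrow> bool" where
  "simple_pair s S \<longleftrightarrow>
     (\<exists>k \<tau> \<xi>. simple_integrand k \<tau> \<xi> \<and> s = simple_process k \<tau> \<xi> \<and> S = simple_integral k \<tau> \<xi>)"

lemma simple_integral_eq:
  "simple_integral k \<tau> \<xi> t \<omega> = (\<Sum>j<k. \<xi> j \<omega> * stopped_inc (\<tau> j) (\<tau> (Suc j)) t \<omega>)"
  by (simp add: simple_integral_def stopped_inc_def)

lemma simple_integrandD:
  assumes "simple_integrand k \<tau> \<xi>" "j < k"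
  shows "0 \<le> \<tau> j" "\<tau> j \<le> \<tau> (Suc j)" "\<tau> (Suc j) \<le> T" "\<xi> j \<in> borel_measurable (\<F> (\<tau> j))"
    "bounded_rv (\<xi> j)" "\<xi> j \<in> borel_measurable M"
proof -
  show *: "0 \<le> \<tau> j" "\<tau> j \<le> \<tau> (Suc j)" "\<tau> (Suc j) \<le> T" "\<xi> j \<in> borel_measurable (\<F> (\<tau> j))"
    "bounded_rv (\<xi> j)"
    using assms unfolding simple_integrand_def bounded_rv_def by blast+
  show "\<xi> j \<in> borel_measurable M"
    by (rule F_measurable_M[OF _ *(4)]) (use * in linarith)
qed

lemma simple_integral_sq_int:
  assumes S: "simple_pair s S" and t: "0 \<le> t" "t \<le> T"
  shows "sq_int M (S t)"
proof -
  obtain k \<tau> \<xi> where *: "simple_integrand k \<tau> \<xi>" "S = simple_integral k \<tau> \<xi>"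
    using S unfolding simple_pair_def by blast
  have "S t = (\<lambda>\<omega>. \<Sum>j<k. \<xi> j \<omega> * stopped_inc (\<tau> j) (\<tau> (Suc j)) t \<omega>)"
    by (simp add: *(2) simple_integral_eq fun_eq_iff)
  moreover have "sq_int M (\<lambda>\<omega>. \<Sum>j<k. \<xi> j \<omega> * stopped_inc (\<tau> j) (\<tau> (Suc j)) t \<omega>)"
  proof (rule sq_int_sum)
    fix j assume "j \<in> {..<k}"
    then have "j < k" by simp
    note D = simple_integrandD[OF *(1) this]
    show "sq_int M (\<lambda>\<omega>. \<xi> j \<omega> * stopped_inc (\<tau> j) (\<tau> (Suc j)) t \<omega>)"
      by (rule bounded_rv_mult_sq_int[OF D(6,5) stopped_inc_sq_int[OF D(1-3) t]])
  qed
  ultimately show ?thesis by (simp only:)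
qed

lemma simple_integral_measurable_F:
  assumes S: "simple_pair s S" and t: "0 \<le> t" "t \<le> T"
  shows "S t \<in> borel_measurable (\<F> t)"
proof -
  obtain k \<tau> \<xi> where *: "simple_integrand k \<tau> \<xi>" "S = simple_integral k \<tau> \<xi>"
    using S unfolding simple_pair_def by blast
  have "S t = (\<lambda>\<omega>. \<Sum>j<k. \<xi> j \<omega> * stopped_inc (\<tau> j) (\<tau> (Suc j)) t \<omega>)"
    by (simp add: *(2) simple_integral_eq fun_eq_iff)
  moreover have "(\<lambda>\<omega>. \<Sum>j<k. \<xi> j \<omega> * stopped_inc (\<tau> j) (\<tau> (Suc j)) t \<omega>) \<in> borel_measurable (\<F> t)"
  proof (rule borel_measurable_sum)
    fix j assume "j \<in> {..<k}"
    then have "j < k" by simp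
    note D = simple_integrandD[OF *(1) this]
    show "(\<lambda>\<omega>. \<xi> j \<omega> * stopped_inc (\<tau> j) (\<tau> (Suc j)) t \<omega>) \<in> borel_measurable (\<F> t)"
      by (rule stopped_inc_measurable_F[OF D(1-3) t D(4)])
  qed
  ultimately show ?thesis by (simp only:)
qed

lemma simple_integral_zero: "simple_pair s S \<Longrightarrow> S 0 \<omega> = 0"
proof -
  assume "simple_pair s S"
  then obtain k \<tau> \<xi> where *: "simple_integrand k \<tau> \<xi>" "S = simple_integral k \<tau> \<xi>"
    unfolding simple_pair_def by blast
  have "stopped_inc (\<tau> j) (\<tau> (Suc j)) 0 \<omega> = 0" if "j < k" for j
    using simple_integrandD(1,2)[OF *(1) that] by (simp add: stopped_inc_def)
  then show ?thesis
    unfolding *(2) simple_integral_eq by (intro sum.neutral) simp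
qed

lemma simple_process_sq_int:
  assumes "simple_pair s S"
  shows "sq_int dt_P (\<lambda>(t, \<omega>). s t \<omega>)"
proof -
  obtain k \<tau> \<xi> where *: "simple_integrand k \<tau> \<xi>" "s = simple_process k \<tau> \<xi>"
    using assms unfolding simple_pair_def by blast
  have "(\<lambda>(t, \<omega>). s t \<omega>) = (\<lambda>p. \<Sum>j<k. \<xi> j (snd p) * indicator {\<tau> j<..\<tau> (Suc j)} (fst p))"
    by (simp add: *(2) simple_process_def fun_eq_iff)
  moreover have "sq_int dt_P (\<lambda>p. \<Sum>j<k. \<xi> j (snd p) * indicator {\<tau> j<..\<tau> (Suc j)} (fst p))"
  proof (rule sq_int_sum)
    fix j assume "j \<in> {..<k}"
    then have "j < k" by simp
    note D = simple_integrandD[OF *(1) this]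
    obtain B where B: "\<And>\<omega>. \<omega> \<in> space M \<Longrightarrow> \<bar>\<xi> j \<omega>\<bar> \<le> B"
      using D(5) unfolding bounded_rv_def by blast
    show "sq_int dt_P (\<lambda>p. \<xi> j (snd p) * indicator {\<tau> j<..\<tau> (Suc j)} (fst p))"
    proof (rule sq_int_bound[of dt_P "\<lambda>_. 1" _ B])
      show "(\<lambda>p. \<xi> j (snd p) * indicator {\<tau> j<..\<tau> (Suc j)} (fst p)) \<in> borel_measurable dt_P"
        by (intro borel_measurable_times snd_dt_P_measurable D fst_dt_P_measurable) simp
      show "AE p in dt_P. \<bar>\<xi> j (snd p) * indicator {\<tau> j<..\<tau> (Suc j)} (fst p)\<bar> \<le> B * \<bar>1\<bar>"
      proof (intro AE_I2)
        fix p assume "p \<in> space dt_P"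
        then have "snd p \<in> space M" by (auto simp: space_dt_P)
        from B[OF this] show "\<bar>\<xi> j (snd p) * indicator {\<tau> j<..\<tau> (Suc j)} (fst p)\<bar> \<le> B * \<bar>1\<bar>"
          by (auto simp: indicator_def)
      qed
    qed (rule dtP.sq_int_const)
  qed
  ultimately show ?thesis by (simp only:)
qed

text \<open>Polarised, for two unrelated partitions. No common refinement is formed:
  \<open>stopped_inc_product\<close> evaluates the cross moment of any two summands, and
  \<open>dt_P_tensor\<close> recognises it as an integral over time and scenario.\<close>

lemma simple_isometry:
  assumes S: "simple_pair s S" and S': "simple_pair s' S'" and t: "0 \<le> t" "t \<le> T"
  shows "expectation (\<lambda>\<omega>. S t \<omega> * S' t \<omega>) = (\<integral>(q, \<omega>). indicator {0..t} q * (s q \<omega> * s' q \<omega>) \<partial>dt_P)"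
proof -
  obtain k \<tau> \<xi> where 1: "simple_integrand k \<tau> \<xi>" "s = simple_process k \<tau> \<xi>" "S = simple_integral k \<tau> \<xi>"
    using S unfolding simple_pair_def by blast
  obtain k' \<tau>' \<xi>' where 2: "simple_integrand k' \<tau>' \<xi>'" "s' = simple_process k' \<tau>' \<xi>'" "S' = simple_integral k' \<tau>' \<xi>'"
    using S' unfolding simple_pair_def by blast
  define f :: "nat \<Rightarrow> nat \<Rightarrow> real \<Rightarrow> real" where "f j l q = indicator {0..t} q * (indicator {\<tau> j<..\<tau> (Suc j)} q * indicator {\<tau>' l<..\<tau>' (Suc l)} q)"
    for j l q
  define G where "G j l \<omega> = (\<xi> j \<omega> * stopped_inc (\<tau> j) (\<tau> (Suc j)) t \<omega>) * (\<xi>' l \<omega> * stopped_inc (\<tau>' l) (\<tau>' (Suc l)) t \<omega>)"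
    for j l \<omega>
  have G: "integrable M (G j l)" "expectation (G j l) = expectation (\<lambda>\<omega>. \<xi> j \<omega> * \<xi>' l \<omega>) * (\<integral>q. f j l q \<partial>lborel)"
    if "j < k" "l < k'" for j l
    unfolding G_def f_def
    by (rule stopped_inc_product[OF simple_integrandD(1-3)[OF 1(1) that(1)] simple_integrandD(1-3)[OF 2(1) that(2)] t
          simple_integrandD(4,5)[OF 1(1) that(1)] simple_integrandD(4,5)[OF 2(1) that(2)]])+
  have f: "integrable time_measure (f j l)" for j l
  proof (rule time.integrable_const_bound[where B = 1])
    show "f j l \<in> borel_measurable time_measure"
      unfolding f_def by (rule time_measurable) simp
  qed (auto simp: f_def indicator_def)
  have fT: "(\<integral>q. f j l q \<partial>time_measure) = (\<integral>q. f j l q \<partial>lborel)" for j l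
  proof -
    have "(\<integral>q. f j l q \<partial>time_measure) = (\<integral>q. indicator {0..T} q *\<^sub>R f j l q \<partial>lborel)"
      unfolding time_measure_def by (rule integral_restrict_space) simp
    also have "\<dots> = (\<integral>q. f j l q \<partial>lborel)"
      using t by (intro Bochner_Integration.integral_cong) (auto simp: f_def indicator_def)
    finally show ?thesis .
  qed
  have \<xi>\<xi>: "integrable M (\<lambda>\<omega>. \<xi> j \<omega> * \<xi>' l \<omega>)" if "j < k" "l < k'" for j l
    by (rule bounded_rv_integrable[OF borel_measurable_times bounded_rv_mult])
      (use simple_integrandD(5,6)[OF 1(1) that(1)] simple_integrandD(5,6)[OF 2(1) that(2)] in blast)+
  have "expectation (\<lambda>\<omega>. S t \<omega> * S' t \<omega>) = expectation (\<lambda>\<omega>. \<Sum>j<k. \<Sum>l<k'. G j l \<omega>)"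
    by (simp only: 1(3) 2(3) simple_integral_eq sum_product G_def)
  also have "\<dots> = (\<Sum>j<k. expectation (\<lambda>\<omega>. \<Sum>l<k'. G j l \<omega>))"
    by (rule Bochner_Integration.integral_sum) (use G(1) in \<open>intro Bochner_Integration.integrable_sum, simp\<close>)
  also have "\<dots> = (\<Sum>j<k. \<Sum>l<k'. expectation (G j l))"
    by (intro sum.cong[OF refl] Bochner_Integration.integral_sum) (use G(1) in simp)
  also have "\<dots> = (\<Sum>j<k. \<Sum>l<k'. \<integral>(q, \<omega>). f j l q * (\<xi> j \<omega> * \<xi>' l \<omega>) \<partial>dt_P)"
    by (intro sum.cong refl) (simp add: G(2) fT dt_P_tensor(2)[OF f \<xi>\<xi>])
  also have "\<dots> = (\<Sum>j<k. \<integral>p. (\<Sum>l<k'. (\<lambda>(q, \<omega>). f j l q * (\<xi> j \<omega> * \<xi>' l \<omega>)) p) \<partial>dt_P)"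
    by (intro sum.cong[OF refl] Bochner_Integration.integral_sum[symmetric] dt_P_tensor(1) f \<xi>\<xi>) simp_all
  also have "\<dots> = (\<integral>p. (\<Sum>j<k. \<Sum>l<k'. (\<lambda>(q, \<omega>). f j l q * (\<xi> j \<omega> * \<xi>' l \<omega>)) p) \<partial>dt_P)"
    by (intro Bochner_Integration.integral_sum[symmetric] Bochner_Integration.integrable_sum dt_P_tensor(1) f \<xi>\<xi>) simp_all
  also have "\<dots> = (\<integral>(q, \<omega>). indicator {0..t} q * (s q \<omega> * s' q \<omega>) \<partial>dt_P)"
  proof (rule arg_cong[where f = "integral\<^sup>L dt_P"], rule ext)
    fix p :: "real \<times> 'a"
    obtain q \<omega> where p: "p = (q, \<omega>)" by (cases p)
    show "(\<Sum>j<k. \<Sum>l<k'. (\<lambda>(q, \<omega>). f j l q * (\<xi> j \<omega> * \<xi>' l \<omega>)) p) =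
        (case p of (q, \<omega>) \<Rightarrow> indicator {0..t} q * (s q \<omega> * s' q \<omega>))"
      unfolding p prod.case 1(2) 2(2) simple_process_def sum_product
      by (simp add: sum_distrib_left f_def mult_ac)
  qed
  finally show ?thesis .
qed

text \<open>Conditional expectations are replaced by testing against square-integrable
  \<open>Z\<close> known at time \<open>q\<close>; in this form the property survives limits in mean
  square.\<close>

lemma simple_martingale:
  assumes S: "simple_pair s S" and qt: "0 \<le> q" "q \<le> t" "t \<le> T"
    and Z: "Z \<in> borel_measurable (\<F> q)" "sq_int M Z"
  shows "expectation (\<lambda>\<omega>. S t \<omega> * Z \<omega>) = expectation (\<lambda>\<omega>. S q \<omega> * Z \<omega>)"
proof -
  obtain k \<tau> \<xi> where *: "simple_integrand k \<tau> \<xi>" "S = simple_integral k \<tau> \<xi>"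
    using S unfolding simple_pair_def by blast
  have eq: "expectation (\<lambda>\<omega>. S u \<omega> * Z \<omega>) =
      (\<Sum>j<k. expectation (\<lambda>\<omega>. (\<xi> j \<omega> * stopped_inc (\<tau> j) (\<tau> (Suc j)) u \<omega>) * Z \<omega>))"
    if u: "0 \<le> u" "u \<le> T" for u
    unfolding *(2) simple_integral_eq sum_distrib_right
  proof (rule Bochner_Integration.integral_sum)
    fix j assume "j \<in> {..<k}"
    then have "j < k" by simp
    note D = simple_integrandD[OF *(1) this]
    show "integrable M (\<lambda>\<omega>. (\<xi> j \<omega> * stopped_inc (\<tau> j) (\<tau> (Suc j)) u \<omega>) * Z \<omega>)"
      by (rule sq_int_mult[OF bounded_rv_mult_sq_int[OF D(6,5) stopped_inc_sq_int[OF D(1-3) u]] Z(2)])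
  qed
  have "0 \<le> t" "q \<le> T" using qt by linarith+
  show ?thesis
    unfolding eq[OF \<open>0 \<le> t\<close> qt(3)] eq[OF qt(1) \<open>q \<le> T\<close>]
  proof (rule sum.cong[OF refl])
    fix j assume "j \<in> {..<k}"
    then have "j < k" by simp
    note D = simple_integrandD[OF *(1) this]
    show "expectation (\<lambda>\<omega>. (\<xi> j \<omega> * stopped_inc (\<tau> j) (\<tau> (Suc j)) t \<omega>) * Z \<omega>) =
        expectation (\<lambda>\<omega>. (\<xi> j \<omega> * stopped_inc (\<tau> j) (\<tau> (Suc j)) q \<omega>) * Z \<omega>)"
      by (rule stopped_inc_martingale[OF D(1-3) qt D(4,5) Z])
  qed
qed

section \<open>Isometry and martingale property of the stochastic integral\<close>

lemma adaptedD:
  assumes "adapted v"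
  shows "(\<lambda>(t, \<omega>). v t \<omega>) \<in> borel_measurable dt_P"
    "t \<in> {0..T} \<Longrightarrow> v t \<in> borel_measurable (\<F> t)" "t \<in> {0..T} \<Longrightarrow> v t \<in> borel_measurable M"
  using assms F_measurable_M[of t "v t"] unfolding adapted_def by auto

lemma L2F_iff: "v \<in> L2F \<longleftrightarrow> adapted v \<and> sq_int dt_P (\<lambda>(t, \<omega>). v t \<omega>)"
  unfolding L2F_def sq_int_def by (auto simp: adapted_def case_prod_beta')

lemma ito_integralE:
  assumes "ito_integral v I"
  obtains s S where "\<And>m. simple_pair (s m) (S m)"
    "L2_tendsto dt_P (\<lambda>m (t, \<omega>). s m t \<omega>) (\<lambda>(t, \<omega>). v t \<omega>)"
    "\<And>t. t \<in> {0..T} \<Longrightarrow> L2_tendsto M (\<lambda>m. S m t) (I t)"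
proof -
  obtain k \<tau> \<xi> where si: "\<And>m::nat. simple_integrand (k m) (\<tau> m) (\<xi> m)"
    and c1: "(\<lambda>m. \<integral>\<^sup>+ (t, \<omega>). ennreal ((simple_process (k m) (\<tau> m) (\<xi> m) t \<omega> - v t \<omega>)\<^sup>2) \<partial>dt_P) \<longlonglongrightarrow> 0"
    and c2: "\<And>t. t \<in> {0..T} \<Longrightarrow>
      (\<lambda>m. \<integral>\<^sup>+ \<omega>. ennreal ((simple_integral (k m) (\<tau> m) (\<xi> m) t \<omega> - I t \<omega>)\<^sup>2) \<partial>M) \<longlonglongrightarrow> 0"
    using assms unfolding ito_integral_def by blast
  have v: "v \<in> L2F" and I: "adapted I"
    using assms unfolding ito_integral_def by blast+
  define s where "s m = simple_process (k m) (\<tau> m) (\<xi> m)" for m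
  define S where "S m = simple_integral (k m) (\<tau> m) (\<xi> m)" for m
  have sp: "simple_pair (s m) (S m)" for m
    unfolding simple_pair_def s_def S_def using si by blast
  show thesis
  proof (rule that[OF sp])
    show "L2_tendsto dt_P (\<lambda>m (t, \<omega>). s m t \<omega>) (\<lambda>(t, \<omega>). v t \<omega>)"
    proof (rule L2_tendsto_nnI)
      show "sq_int dt_P (\<lambda>(t, \<omega>). s m t \<omega>)" for m by (rule simple_process_sq_int[OF sp])
      show "(\<lambda>(t, \<omega>). v t \<omega>) \<in> borel_measurable dt_P"
        using v by (auto simp: L2F_iff sq_int_def)
      show "(\<lambda>m. \<integral>\<^sup>+ x. ennreal (((case x of (t, \<omega>) \<Rightarrow> s m t \<omega>) - (case x of (t, \<omega>) \<Rightarrow> v t \<omega>))\<^sup>2) \<partial>dt_P) \<longlonglongrightarrow> 0"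
        using c1 by (simp add: s_def case_prod_beta')
    qed
    fix t assume t: "t \<in> {0..T}"
    show "L2_tendsto M (\<lambda>m. S m t) (I t)"
    proof (rule L2_tendsto_nnI)
      show "sq_int M (S m t)" for m using t by (intro simple_integral_sq_int[OF sp]) auto
      show "I t \<in> borel_measurable M" by (rule adaptedD(3)[OF I t])
      show "(\<lambda>m. \<integral>\<^sup>+ x. ennreal ((S m t x - I t x)\<^sup>2) \<partial>M) \<longlonglongrightarrow> 0"
        using c2[OF t] by (simp add: S_def)
    qed
  qed
qed

lemma ito_sq_int: "ito_integral v I \<Longrightarrow> t \<in> {0..T} \<Longrightarrow> sq_int M (I t)"
  by (rule ito_integralE) (auto simp: L2_tendsto_def)

text \<open>Both sides are limits of inner products of approximating pairs. Being stated for two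
  integrands, it can later express orthogonality, from which linearity of the integral
  follows.\<close>

lemma ito_isometry:
  assumes I: "ito_integral v I" and I': "ito_integral v' I'" and t: "t \<in> {0..T}"
  shows "expectation (\<lambda>\<omega>. I t \<omega> * I' t \<omega>) = (\<integral>(q, \<omega>). indicator {0..t} q * (v q \<omega> * v' q \<omega>) \<partial>dt_P)"
proof -
  obtain s S where sS: "\<And>m. simple_pair (s m) (S m)"
    "L2_tendsto dt_P (\<lambda>m (t, \<omega>). s m t \<omega>) (\<lambda>(t, \<omega>). v t \<omega>)" "L2_tendsto M (\<lambda>m. S m t) (I t)"
    using ito_integralE[OF I] t by metis
  obtain s' S' where sS': "\<And>m. simple_pair (s' m) (S' m)"
    "L2_tendsto dt_P (\<lambda>m (t, \<omega>). s' m t \<omega>) (\<lambda>(t, \<omega>). v' t \<omega>)" "L2_tendsto M (\<lambda>m. S' m t) (I' t)"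
    using ito_integralE[OF I'] t by metis
  have 1: "(\<lambda>m. expectation (\<lambda>\<omega>. S m t \<omega> * S' m t \<omega>)) \<longlonglongrightarrow> expectation (\<lambda>\<omega>. I t \<omega> * I' t \<omega>)"
    by (rule L2_inner_tendsto[OF sS(3) sS'(3)])
  have ind: "(\<lambda>p. indicator {0..t} (fst p) :: real) \<in> borel_measurable dt_P"
    by (rule fst_dt_P_measurable) simp
  have 2: "(\<lambda>m. \<integral>p. (indicator {0..t} (fst p) * (case p of (t, \<omega>) \<Rightarrow> s m t \<omega>)) * (case p of (t, \<omega>) \<Rightarrow> s' m t \<omega>) \<partial>dt_P)
    \<longlonglongrightarrow> (\<integral>p. (indicator {0..t} (fst p) * (case p of (t, \<omega>) \<Rightarrow> v t \<omega>)) * (case p of (t, \<omega>) \<Rightarrow> v' t \<omega>) \<partial>dt_P)"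
    by (rule L2_inner_tendsto[OF L2_tendsto_bounded_mult[OF sS(2) ind] sS'(2)]) simp
  have "expectation (\<lambda>\<omega>. S m t \<omega> * S' m t \<omega>) =
      (\<integral>p. (indicator {0..t} (fst p) * (case p of (t, \<omega>) \<Rightarrow> s m t \<omega>)) * (case p of (t, \<omega>) \<Rightarrow> s' m t \<omega>) \<partial>dt_P)" for m
    using simple_isometry[OF sS(1) sS'(1)] t by (simp add: case_prod_beta' mult.assoc)
  with 1 2 have "expectation (\<lambda>\<omega>. I t \<omega> * I' t \<omega>) =
      (\<integral>p. (indicator {0..t} (fst p) * (case p of (t, \<omega>) \<Rightarrow> v t \<omega>)) * (case p of (t, \<omega>) \<Rightarrow> v' t \<omega>) \<partial>dt_P)"
    by (simp only:) (rule LIMSEQ_unique)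
  then show ?thesis by (simp add: case_prod_beta' mult.assoc)
qed

lemma ito_martingale:
  assumes I: "ito_integral v I" and qt: "0 \<le> q" "q \<le> t" "t \<le> T"
    and Z: "Z \<in> borel_measurable (\<F> q)" "sq_int M Z"
  shows "expectation (\<lambda>\<omega>. I t \<omega> * Z \<omega>) = expectation (\<lambda>\<omega>. I q \<omega> * Z \<omega>)"
proof -
  have tq: "t \<in> {0..T}" "q \<in> {0..T}" using qt by auto
  obtain s S where sS: "\<And>m. simple_pair (s m) (S m)"
    "L2_tendsto M (\<lambda>m. S m t) (I t)" "L2_tendsto M (\<lambda>m. S m q) (I q)"
    using ito_integralE[OF I] tq by metis
  have const: "L2_tendsto M (\<lambda>_. Z) Z" using Z(2) by (simp add: L2_tendsto_def)
  show ?thesis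
    using L2_inner_tendsto[OF sS(2) const] L2_inner_tendsto[OF sS(3) const]
    unfolding simple_martingale[OF sS(1) qt Z] by (rule LIMSEQ_unique)
qed

lemma ito_expectation:
  assumes I: "ito_integral v I" and t: "t \<in> {0..T}"
  shows "expectation (I t) = 0"
proof -
  obtain s S where sS: "\<And>m. simple_pair (s m) (S m)" "L2_tendsto M (\<lambda>m. S m t) (I t)"
    using ito_integralE[OF I] t by metis
  have one: "L2_tendsto M (\<lambda>_ _. 1) (\<lambda>_. 1)" by (simp add: L2_tendsto_def)
  have "expectation (\<lambda>\<omega>. S m t \<omega> * 1) = 0" for m
  proof -
    \<comment> \<open>The martingale property with \<open>Z = 1\<close>, compared with time 0, where
      a simple integral vanishes.\<close>
    have "expectation (\<lambda>\<omega>. S m t \<omega> * 1) = expectation (\<lambda>\<omega>. S m 0 \<omega> * 1)"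
      by (rule simple_martingale[OF sS(1)]) (use t in auto)
    then show ?thesis by (simp add: simple_integral_zero[OF sS(1)])
  qed
  with L2_inner_tendsto[OF sS(2) one] show ?thesis by (simp add: LIMSEQ_const_iff)
qed

end

subsection \<open>Time integrals\<close>

context brownian_space
begin

text \<open>Rounding down to the grid of width \<open>T / 2 ^ n\<close>. It maps
  \<open>{0..T}\<close> into itself, so continuity on that interval suffices for convergence along
  the grid.\<close>

definition dyadic :: "nat \<Rightarrow> real \<Rightarrow> real" where
  "dyadic n t = T * real_of_int \<lfloor>2 ^ n * t / T\<rfloor> / 2 ^ n"

lemma dyadic_bounds: "dyadic n t \<le> t" "t - T / 2 ^ n \<le> dyadic n t"
proof -
  have 1: "real_of_int \<lfloor>2 ^ n * t / T\<rfloor> \<le> 2 ^ n * t / T" by (rule of_int_floor_le)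
  have 2: "2 ^ n * t / T - 1 \<le> real_of_int \<lfloor>2 ^ n * t / T\<rfloor>" by linarith
  have c: "T / 2 ^ n \<ge> 0" using T_pos by simp
  have d: "dyadic n t = T / 2 ^ n * real_of_int \<lfloor>2 ^ n * t / T\<rfloor>" by (simp add: dyadic_def)
  have e: "T / 2 ^ n * (2 ^ n * t / T) = t" using T_pos by simp
  show "dyadic n t \<le> t"
    using mult_left_mono[OF 1 c] unfolding d e .
  show "t - T / 2 ^ n \<le> dyadic n t"
    using mult_left_mono[OF 2 c] unfolding d right_diff_distrib e by simp
qed

lemma dyadic_in: "t \<in> {0..T} \<Longrightarrow> dyadic n t \<in> {0..T}"
  using dyadic_bounds(1)[of n t] T_pos by (auto simp: dyadic_def)

lemma dyadic_tendsto: "(\<lambda>n. dyadic n t) \<longlonglongrightarrow> t"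
proof (rule tendsto_sandwich)
  have "(\<lambda>n. T * (1 / 2) ^ n) \<longlonglongrightarrow> T * 0"
    by (intro tendsto_mult tendsto_const LIMSEQ_realpow_zero) auto
  then have "(\<lambda>n. t - T * (1 / 2) ^ n) \<longlonglongrightarrow> t - T * 0"
    by (intro tendsto_diff tendsto_const)
  then show "(\<lambda>n. t - T / 2 ^ n) \<longlonglongrightarrow> t"
    by (simp add: power_divide)
qed (use dyadic_bounds in auto)

lemma continuous_dyadic:
  assumes "continuous_on {0..T} f" "t \<in> {0..T}"
  shows "(\<lambda>n. f (dyadic n t)) \<longlonglongrightarrow> f t"
proof -
  have "\<forall>\<^sub>F n in sequentially. dyadic n t \<in> {0..T}"
    using dyadic_in[OF assms(2)] by simp
  with continuous_on_tendsto_compose[OF assms(1) dyadic_tendsto assms(2)] show ?thesis .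
qed

text \<open>The process sampled at dyadic times depends on time through an integer index only, so it
  is jointly measurable; continuity of the paths gives the limit.\<close>

lemma continuous_paths_measurable:
  fixes X :: "real \<Rightarrow> 'a \<Rightarrow> real"
  assumes X: "\<And>t. t \<in> {0..T} \<Longrightarrow> X t \<in> borel_measurable M"
    and cont: "\<And>\<omega>. \<omega> \<in> space M \<Longrightarrow> continuous_on {0..T} (\<lambda>t. X t \<omega>)"
  shows "(\<lambda>(t, \<omega>). X t \<omega>) \<in> borel_measurable dt_P"
proof (rule borel_measurable_LIMSEQ_metric[where f = "\<lambda>n p. X (dyadic n (fst p)) (snd p)"])
  fix p assume p: "p \<in> space dt_P"
  then show "(\<lambda>n. X (dyadic n (fst p)) (snd p)) \<longlonglongrightarrow> (case p of (t, \<omega>) \<Rightarrow> X t \<omega>)"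
    using continuous_dyadic[OF cont, of "snd p" "fst p"] by (auto simp: space_dt_P)
next
  fix n
  \<comment> \<open>The index runs over all integers while \<open>X\<close> is known to be
    measurable only at times in \<open>{0..T}\<close>, hence the clamping.\<close>
  define f :: "int \<Rightarrow> real \<times> 'a \<Rightarrow> real" where "f i p = X (max 0 (min T (T * real_of_int i / 2 ^ n))) (snd p)" for i p
  have "(\<lambda>p. f \<lfloor>2 ^ n * fst p / T\<rfloor> p) \<in> borel_measurable dt_P"
  proof (rule measurable_compose_countable)
    show "f i \<in> borel_measurable dt_P" for i
      unfolding f_def using T_pos by (intro snd_dt_P_measurable X) auto
    have "(\<lambda>t. \<lfloor>2 ^ n * t / T\<rfloor>) \<in> measurable borel (count_space UNIV)"
      by measurable
    then have "(\<lambda>t. \<lfloor>2 ^ n * t / T\<rfloor>) \<in> measurable time_measure (count_space UNIV)"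
      unfolding time_measure_def by (intro measurable_restrict_space1) (simp only: measurable_lborel2)
    then show "(\<lambda>p. \<lfloor>2 ^ n * fst p / T\<rfloor>) \<in> measurable dt_P (count_space UNIV)"
      unfolding dt_P_eq by (rule measurable_compose[OF measurable_fst])
  qed
  moreover have "X (dyadic n (fst p)) (snd p) = f \<lfloor>2 ^ n * fst p / T\<rfloor> p" if "p \<in> space dt_P" for p
  proof -
    have "dyadic n (fst p) \<in> {0..T}" using that by (intro dyadic_in) (auto simp: space_dt_P)
    then show ?thesis unfolding f_def dyadic_def[symmetric] by simp
  qed
  ultimately show "(\<lambda>p. X (dyadic n (fst p)) (snd p)) \<in> borel_measurable dt_P"
    by (simp cong: measurable_cong)
qed

text \<open>The dyadic times are countable, so both processes agree at all of them outside a single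
  null set; continuity extends this to all times.\<close>

lemma continuous_AE_eq:
  assumes X: "AE \<omega> in M. continuous_on {0..T} (\<lambda>t. X t \<omega>)" and Y: "AE \<omega> in M. continuous_on {0..T} (\<lambda>t. Y t \<omega>)"
    and eq: "\<And>t. t \<in> {0..T} \<Longrightarrow> AE \<omega> in M. X t \<omega> = (Y t \<omega> :: real)"
  shows "AE \<omega> in M. \<forall>t\<in>{0..T}. X t \<omega> = Y t \<omega>"
proof -
  define D where "D = {t \<in> {0..T}. \<exists>n i. t = T * real_of_int i / 2 ^ n}"
  have "countable D"
  proof (rule countable_subset)
    show "D \<subseteq> (\<lambda>(n::nat, i::int). T * real_of_int i / 2 ^ n) ` UNIV" by (auto simp: D_def)
  qed simp
  then have "AE \<omega> in M. \<forall>t\<in>D. X t \<omega> = Y t \<omega>"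
    by (subst AE_ball_countable) (use eq in \<open>auto simp: D_def\<close>)
  with X Y show ?thesis
  proof eventually_elim
    case (elim \<omega>)
    show ?case
    proof
      fix t assume t: "t \<in> {0..T}"
      have "dyadic n t \<in> D" for n
        using dyadic_in[OF t, of n] unfolding D_def dyadic_def by blast
      then have "X (dyadic n t) \<omega> = Y (dyadic n t) \<omega>" for n using elim(3) by blast
      then show "X t \<omega> = Y t \<omega>"
        using continuous_dyadic[OF elim(1) t] continuous_dyadic[OF elim(2) t]
        by (simp only:) (rule LIMSEQ_unique)
    qed
  qed
qed

lemma integrable_time_iff: "integrable time_measure (f :: real \<Rightarrow> real) \<longleftrightarrow> set_integrable lborel {0..T} f"
  unfolding time_measure_def set_integrable_def by (rule integrable_restrict_space) simp

lemma integral_time: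
  assumes "t \<in> {0..T}"
  shows "(\<integral>s. indicator {0..t} s * f s \<partial>time_measure) = (LBINT s:{0..t}. f s :: real)"
proof -
  have "(\<integral>s. indicator {0..t} s * f s \<partial>time_measure) = (\<integral>s. indicator {0..T} s *\<^sub>R (indicator {0..t} s * f s) \<partial>lborel)"
    unfolding time_measure_def by (rule integral_restrict_space) simp
  also have "\<dots> = (LBINT s:{0..t}. f s)"
    unfolding set_lebesgue_integral_def using assms
    by (intro Bochner_Integration.integral_cong) (auto simp: indicator_def)
  finally show ?thesis .
qed

lemma AE_time_iff: "(AE s in time_measure. P s) \<longleftrightarrow> (AE s in lborel. s \<in> {0..T} \<longrightarrow> P s)"
  unfolding time_measure_def by (subst AE_restrict_space_iff) simp_all

lemma L2F_D:
  assumes "v \<in> L2F"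
  shows "adapted v" "sq_int dt_P (\<lambda>(t, \<omega>). v t \<omega>)" "(\<lambda>(t, \<omega>). v t \<omega>) \<in> borel_measurable dt_P"
    "integrable dt_P (\<lambda>(t, \<omega>). (v t \<omega>)\<^sup>2)"
  using assms unfolding L2F_iff sq_int_def by (auto simp: case_prod_beta')

lemma L2F_AE_sq_int_time:
  assumes v: "v \<in> L2F"
  shows "AE \<omega> in M. sq_int time_measure (\<lambda>s. v s \<omega>)"
proof -
  have i: "integrable (time_measure \<Otimes>\<^sub>M M) (\<lambda>(t, \<omega>). (v t \<omega>)\<^sup>2)"
    using L2F_D(4)[OF v] by (simp only: dt_P_eq)
  have m: "(\<lambda>s. v s \<omega>) \<in> borel_measurable time_measure" if "\<omega> \<in> space M" for \<omega>
    using measurable_compose[OF measurable_Pair2'[OF that] L2F_D(3)[OF v, unfolded dt_P_eq]] by simp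
  have "AE \<omega> in M. integrable time_measure (\<lambda>s. (v s \<omega>)\<^sup>2)"
    by (rule time_prob.AE_integrable_snd[OF i])
  with AE_space show ?thesis
    by eventually_elim (simp add: sq_int_def m)
qed

lemma L2F_AE_set_integrable: "v \<in> L2F \<Longrightarrow> AE \<omega> in M. set_integrable lborel {0..T} (\<lambda>s. v s \<omega>)"
  using L2F_AE_sq_int_time
  by (rule AE_mp) (auto simp: integrable_time_iff[symmetric] intro: time.sq_int_integrable)

lemma L2F_AE_sq_int:
  assumes v: "v \<in> L2F"
  shows "AE s in time_measure. sq_int M (v s)"
proof -
  have i: "integrable (time_measure \<Otimes>\<^sub>M M) (\<lambda>(t, \<omega>). (v t \<omega>)\<^sup>2)"
    using L2F_D(4)[OF v] by (simp only: dt_P_eq)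
  have "AE s in time_measure. integrable M (\<lambda>\<omega>. (v s \<omega>)\<^sup>2)"
    by (rule time_prob.AE_integrable_fst[OF i])
  with AE_space show ?thesis
    by eventually_elim (simp add: sq_int_def adaptedD(3)[OF L2F_D(1)[OF v]])
qed

definition time_integral :: "(real \<Rightarrow> 'a \<Rightarrow> real) \<Rightarrow> real \<Rightarrow> 'a \<Rightarrow> real" where
  "time_integral v t \<omega> = (LBINT s:{0..t}. v s \<omega>)"

text \<open>The moving upper limit is put into an indicator, so that the integration runs over the
  fixed measure \<open>time_measure\<close> and measurability of integrals with parameters
  applies.\<close>

lemma time_integral_measurable:
  assumes v: "(\<lambda>(t, \<omega>). v t \<omega>) \<in> borel_measurable dt_P"
  shows "(\<lambda>(t, \<omega>). time_integral v t \<omega>) \<in> borel_measurable dt_P"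
    and "t \<in> {0..T} \<Longrightarrow> time_integral v t \<in> borel_measurable M"
proof -
  define f where "f p s = indicator {0..fst p} s * v s (snd p)" for p :: "real \<times> 'a" and s :: real
  have "(\<lambda>(p, s). f p s) \<in> borel_measurable (dt_P \<Otimes>\<^sub>M time_measure)"
  proof -
    have id: "(\<lambda>s. s) \<in> borel_measurable time_measure" by (rule time_measurable) simp
    have s: "(\<lambda>x. snd x) \<in> borel_measurable (dt_P \<Otimes>\<^sub>M time_measure)"
      by (rule measurable_compose[OF measurable_snd id])
    have t: "(\<lambda>x. fst (fst x)) \<in> borel_measurable (dt_P \<Otimes>\<^sub>M time_measure)"
      by (rule measurable_compose[OF measurable_fst fst_dt_P_measurable]) simp
    have ind: "(\<lambda>x. if 0 \<le> snd x \<and> snd x \<le> fst (fst x) then 1 else 0 :: real) \<in> borel_measurable (dt_P \<Otimes>\<^sub>M time_measure)"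
      using s t by measurable
    have "(\<lambda>x. (snd x, snd (fst x))) \<in> measurable (dt_P \<Otimes>\<^sub>M time_measure) (time_measure \<Otimes>\<^sub>M M)"
      unfolding dt_P_eq
      by (intro measurable_Pair measurable_snd measurable_compose[OF measurable_fst measurable_snd])
    from measurable_compose[OF this v[unfolded dt_P_eq]]
    have "(\<lambda>x. v (snd x) (snd (fst x))) \<in> borel_measurable (dt_P \<Otimes>\<^sub>M time_measure)"
      by simp
    from borel_measurable_times[OF ind this] show ?thesis
      by (rule measurable_cong[THEN iffD1, rotated]) (auto simp: f_def indicator_def)
  qed
  from time.borel_measurable_lebesgue_integral[OF this]
  have 1: "(\<lambda>p. \<integral>s. f p s \<partial>time_measure) \<in> borel_measurable dt_P" .
  have 2: "(\<integral>s. f (t, \<omega>) s \<partial>time_measure) = time_integral v t \<omega>" if "t \<in> {0..T}" for t \<omega>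
    unfolding f_def time_integral_def fst_conv snd_conv by (rule integral_time[OF that])
  show "(\<lambda>(t, \<omega>). time_integral v t \<omega>) \<in> borel_measurable dt_P"
    using 1 by (rule measurable_cong[THEN iffD1, rotated]) (use 2 in \<open>auto simp: space_dt_P\<close>)
  assume t: "t \<in> {0..T}"
  have "(\<lambda>\<omega>. (t, \<omega>)) \<in> measurable M dt_P"
    unfolding dt_P_eq by (rule measurable_Pair1') (use t in simp)
  from measurable_compose[OF this 1] have "(\<lambda>\<omega>. \<integral>s. f (t, \<omega>) s \<partial>time_measure) \<in> borel_measurable M" .
  then show "time_integral v t \<in> borel_measurable M"
    unfolding 2[OF t] .
qed

lemma snd_sq_int: "sq_int M H \<Longrightarrow> sq_int dt_P (\<lambda>(t, \<omega>). H \<omega>)"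
  using dt_P_tensor(1)[of "\<lambda>_. 1" "\<lambda>\<omega>. (H \<omega>)\<^sup>2"] snd_dt_P_measurable[of H]
  by (simp add: sq_int_def case_prod_beta')

text \<open>Fubini in both orders. The last form contains \<open>v\<close> only through its values
  at single times, where adaptedness can be applied.\<close>

lemma time_integral_product:
  assumes v: "v \<in> L2F" and H: "sq_int M H" and t: "t \<in> {0..T}"
  shows "integrable dt_P (\<lambda>(s, \<omega>). indicator {0..t} s * (v s \<omega> * H \<omega>))"
    and "expectation (\<lambda>\<omega>. time_integral v t \<omega> * H \<omega>) = (\<integral>(s, \<omega>). indicator {0..t} s * (v s \<omega> * H \<omega>) \<partial>dt_P)"
    and "(\<integral>(s, \<omega>). indicator {0..t} s * (v s \<omega> * H \<omega>) \<partial>dt_P) =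
      (\<integral>s. indicator {0..t} s * expectation (\<lambda>\<omega>. v s \<omega> * H \<omega>) \<partial>time_measure)"
proof -
  have "integrable dt_P (\<lambda>p. (case p of (s, \<omega>) \<Rightarrow> v s \<omega>) * (case p of (s, \<omega>) \<Rightarrow> H \<omega>))"
    by (rule sq_int_mult[OF L2F_D(2)[OF v] snd_sq_int[OF H]])
  then have vH: "integrable dt_P (\<lambda>p. v (fst p) (snd p) * H (snd p))" by (simp add: case_prod_beta')
  have "integrable dt_P (\<lambda>p. indicator {0..t} (fst p) * (v (fst p) (snd p) * H (snd p)))"
  proof (rule Bochner_Integration.integrable_bound[OF vH])
    show "(\<lambda>p. indicator {0..t} (fst p) * (v (fst p) (snd p) * H (snd p))) \<in> borel_measurable dt_P"
      by (intro borel_measurable_times fst_dt_P_measurable borel_measurable_integrable[OF vH, THEN measurable_compose[OF _ measurable_ident_sets[OF refl]]])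
        (use borel_measurable_integrable[OF vH] L2F_D(3)[OF v] H in \<open>auto simp: case_prod_beta' sq_int_def intro: snd_dt_P_measurable\<close>)
  qed (auto simp: indicator_def)
  then show i: "integrable dt_P (\<lambda>(s, \<omega>). indicator {0..t} s * (v s \<omega> * H \<omega>))"
    by (simp add: case_prod_beta')
  note i' = i[unfolded dt_P_eq]
  have "expectation (\<lambda>\<omega>. time_integral v t \<omega> * H \<omega>) =
      (\<integral>\<omega>. (\<integral>s. indicator {0..t} s * (v s \<omega> * H \<omega>) \<partial>time_measure) \<partial>M)"
    by (simp add: time_integral_def integral_time[OF t, symmetric] mult.assoc[symmetric])
  also have "\<dots> = (\<integral>(s, \<omega>). indicator {0..t} s * (v s \<omega> * H \<omega>) \<partial>dt_P)"
    unfolding dt_P_eq by (rule time_prob.integral_snd[OF i'])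
  finally show "expectation (\<lambda>\<omega>. time_integral v t \<omega> * H \<omega>) = (\<integral>(s, \<omega>). indicator {0..t} s * (v s \<omega> * H \<omega>) \<partial>dt_P)" .
  show "(\<integral>(s, \<omega>). indicator {0..t} s * (v s \<omega> * H \<omega>) \<partial>dt_P) =
      (\<integral>s. indicator {0..t} s * expectation (\<lambda>\<omega>. v s \<omega> * H \<omega>) \<partial>time_measure)"
    unfolding dt_P_eq time_prob.integral_fst[OF i', symmetric] by (simp only: Bochner_Integration.integral_mult_right_zero)
qed

text \<open>Cauchy-Schwarz in time on each path, against the indicator of
  \<open>{0..t}\<close>.\<close>

lemma time_integral_sq_int:
  assumes v: "v \<in> L2F" and t: "t \<in> {0..T}"
  shows "sq_int M (time_integral v t)"
    and "expectation (\<lambda>\<omega>. (time_integral v t \<omega>)\<^sup>2) \<le> T * (\<integral>(s, \<omega>). (v s \<omega>)\<^sup>2 \<partial>dt_P)"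
proof -
  have i: "integrable (time_measure \<Otimes>\<^sub>M M) (\<lambda>(t, \<omega>). (v t \<omega>)\<^sup>2)"
    using L2F_D(4)[OF v] by (simp only: dt_P_eq)
  have m: "time_integral v t \<in> borel_measurable M"
    by (rule time_integral_measurable(2)[OF L2F_D(3)[OF v] t])
  have ii: "integrable M (\<lambda>\<omega>. T * (\<integral>s. (v s \<omega>)\<^sup>2 \<partial>time_measure))"
    using time_prob.integrable_snd[OF i] by (rule integrable_mult_right)
  have ind: "sq_int time_measure (indicator {0..t})"
    by (rule sq_int_bound[of _ "\<lambda>_. 1" _ 1]) (auto simp: indicator_def intro: time_measurable)
  have ind1: "(\<integral>s. (indicator {0..t} s)\<^sup>2 \<partial>time_measure) \<le> T"
  proof -
    have "(\<integral>s. (indicator {0..t} s)\<^sup>2 \<partial>time_measure) = (\<integral>s. indicator {0..t} s * (1 :: real) \<partial>time_measure)"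
      by (intro Bochner_Integration.integral_cong) (auto simp: indicator_def)
    also have "\<dots> = (LBINT s:{0..t}. 1)" by (rule integral_time[OF t])
    also have "\<dots> = t" using t by (simp add: set_lebesgue_integral_def)
    finally show ?thesis using t by simp
  qed
  have le: "AE \<omega> in M. (time_integral v t \<omega>)\<^sup>2 \<le> T * (\<integral>s. (v s \<omega>)\<^sup>2 \<partial>time_measure)"
    using L2F_AE_sq_int_time[OF v]
  proof eventually_elim
    case (elim \<omega>)
    have "(time_integral v t \<omega>)\<^sup>2 = (\<integral>s. indicator {0..t} s * v s \<omega> \<partial>time_measure)\<^sup>2"
      unfolding time_integral_def integral_time[OF t] ..
    also have "\<dots> \<le> (\<integral>s. (indicator {0..t} s)\<^sup>2 \<partial>time_measure) * (\<integral>s. (v s \<omega>)\<^sup>2 \<partial>time_measure)"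
      by (rule L2_Cauchy_Schwarz[OF ind elim])
    also have "\<dots> \<le> T * (\<integral>s. (v s \<omega>)\<^sup>2 \<partial>time_measure)"
      by (rule mult_right_mono[OF ind1]) simp
    finally show ?case .
  qed
  have "integrable M (\<lambda>\<omega>. (time_integral v t \<omega>)\<^sup>2)"
    by (rule Bochner_Integration.integrable_bound[OF ii]) (use m le in \<open>auto elim!: AE_mp\<close>)
  with m show sq: "sq_int M (time_integral v t)" by (simp add: sq_int_def)
  have "expectation (\<lambda>\<omega>. (time_integral v t \<omega>)\<^sup>2) \<le> expectation (\<lambda>\<omega>. T * (\<integral>s. (v s \<omega>)\<^sup>2 \<partial>time_measure))"
    by (rule integral_mono_AE[OF sq_intD(2)[OF sq] ii le])
  also have "\<dots> = T * (\<integral>(s, \<omega>). (v s \<omega>)\<^sup>2 \<partial>dt_P)"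
    using time_prob.integral_snd[OF i] by (simp add: dt_P_eq)
  finally show "expectation (\<lambda>\<omega>. (time_integral v t \<omega>)\<^sup>2) \<le> T * (\<integral>(s, \<omega>). (v s \<omega>)\<^sup>2 \<partial>dt_P)" .
qed

lemma time_integral_continuous:
  assumes "v \<in> L2F"
  shows "AE \<omega> in M. continuous_on {0..T} (\<lambda>t. time_integral v t \<omega>)"
  using L2F_AE_set_integrable[OF assms]
  by (rule AE_mp) (auto simp: time_integral_def intro: continuous_on_set_lebesgue_integral)

text \<open>
  An adapted process need not be progressively measurable, so that its time integral is not
  obviously known at the terminal time.  It is because it agrees with its conditional expectation:
  tested against an indicator, both see only the conditional expectation of the indicator.
\<close>

lemma time_integral_measurable_F:
  assumes v: "v \<in> L2F" and t: "t \<in> {0..T}"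
  shows "time_integral v t \<in> borel_measurable (\<F> t)"
proof -
  interpret sub: finite_measure_subalgebra M "\<F> t"
    by unfold_locales (use F_subset_events[of t] t in \<open>auto simp: subalgebra_def\<close>)
  define Y where "Y = time_integral v t"
  have Ysq: "sq_int M Y" unfolding Y_def by (rule time_integral_sq_int[OF v t])
  have Y: "integrable M Y" by (rule sq_int_integrable[OF Ysq])
  define C where "C = real_cond_exp M (\<F> t) Y"
  have C: "integrable M C" "C \<in> borel_measurable (\<F> t)"
    unfolding C_def by (rule sub.real_cond_exp_int(1)[OF Y], rule borel_measurable_cond_exp)
  have eq: "(\<integral>\<omega>. indicator B \<omega> * Y \<omega> \<partial>M) = (\<integral>\<omega>. indicator B \<omega> * C \<omega> \<partial>M)" if B: "B \<in> sets M" for B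
  proof -
    define G :: "'a \<Rightarrow> real" where "G = indicator B"
    have G: "integrable M G" "G \<in> borel_measurable M" "sq_int M G"
    proof -
      show "G \<in> borel_measurable M" unfolding G_def using B by (rule borel_measurable_indicator)
      then show "sq_int M G"
      proof (rule sq_int_bound[OF sq_int_const[of 1]])
        show "AE \<omega> in M. \<bar>G \<omega>\<bar> \<le> 1 * \<bar>1\<bar>" by (intro AE_I2) (simp add: G_def indicator_def)
      qed
      then show "integrable M G" by (rule sq_int_integrable)
    qed
    \<comment> \<open>Between 0 and 1 almost surely, hence square integrable and admissible in
      \<open>time_integral_product\<close>.\<close>
    define G' where "G' = real_cond_exp M (\<F> t) G"
    have G'F: "G' \<in> borel_measurable (\<F> t)" unfolding G'_def by (rule borel_measurable_cond_exp)
    have G'M: "G' \<in> borel_measurable M" by (rule F_measurable_M[OF _ G'F]) (use t in simp)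
    have "AE \<omega> in M. G' \<omega> \<ge> 0"
      unfolding G'_def by (rule sub.real_cond_exp_ge_c[OF G(1)]) (simp add: G_def)
    moreover have "AE \<omega> in M. G' \<omega> \<le> 1"
      unfolding G'_def by (rule sub.real_cond_exp_le_c[OF G(1)]) (simp add: G_def indicator_def)
    ultimately have G'1: "AE \<omega> in M. \<bar>G' \<omega>\<bar> \<le> 1 * \<bar>1\<bar>" by eventually_elim simp
    have G': "sq_int M G'"
      by (rule sq_int_bound[OF sq_int_const G'M G'1])
    have pull: "expectation (\<lambda>\<omega>. u \<omega> * G' \<omega>) = expectation (\<lambda>\<omega>. u \<omega> * G \<omega>)"
      if "u \<in> borel_measurable (\<F> t)" "integrable M (\<lambda>\<omega>. u \<omega> * G \<omega>)" for u
      unfolding G'_def by (rule sub.real_cond_exp_intg(2)[OF that(2,1) G(2)])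
    have "(\<integral>\<omega>. Y \<omega> * G \<omega> \<partial>M) = (\<integral>s. indicator {0..t} s * expectation (\<lambda>\<omega>. v s \<omega> * G \<omega>) \<partial>time_measure)"
      unfolding Y_def using time_integral_product(2,3)[OF v G(3) t] by simp
    \<comment> \<open>At almost every single time \<open>s \<le> t\<close> the variable
      \<open>v s\<close> is square integrable and known at time \<open>t\<close>, so
      \<open>G\<close> may be replaced by \<open>G'\<close> under the time integral.\<close>
    also have "\<dots> = (\<integral>s. indicator {0..t} s * expectation (\<lambda>\<omega>. v s \<omega> * G' \<omega>) \<partial>time_measure)"
    proof (rule integral_cong_AE)
      show "AE s in time_measure. indicator {0..t} s * expectation (\<lambda>\<omega>. v s \<omega> * G \<omega>) =
          indicator {0..t} s * expectation (\<lambda>\<omega>. v s \<omega> * G' \<omega>)"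
        using L2F_AE_sq_int[OF v]
      proof eventually_elim
        case (elim s)
        show ?case
        proof (cases "s \<in> {0..t}")
          case True
          then have "s \<in> {0..T}" "s \<le> t" using t by auto
          have "v s \<in> borel_measurable (\<F> t)"
            by (rule F_measurable_mono[OF \<open>s \<le> t\<close> adaptedD(2)[OF L2F_D(1)[OF v] \<open>s \<in> {0..T}\<close>]])
          from pull[OF this sq_int_mult[OF elim G(3)]] show ?thesis by simp
        qed simp
      qed
      have meas: "(\<lambda>s. indicator {0..t} s * expectation (\<lambda>\<omega>. v s \<omega> * H \<omega>)) \<in> borel_measurable time_measure"
        if "sq_int M H" for H
      proof -
        have "integrable time_measure (\<lambda>s. \<integral>\<omega>. indicator {0..t} s * (v s \<omega> * H \<omega>) \<partial>M)"
          by (rule time_prob.integrable_fst[OF time_integral_product(1)[OF v that t, unfolded dt_P_eq]])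
        from borel_measurable_integrable[OF this] show ?thesis by simp
      qed
      show "(\<lambda>s. indicator {0..t} s * expectation (\<lambda>\<omega>. v s \<omega> * G \<omega>)) \<in> borel_measurable time_measure"
        "(\<lambda>s. indicator {0..t} s * expectation (\<lambda>\<omega>. v s \<omega> * G' \<omega>)) \<in> borel_measurable time_measure"
        by (rule meas[OF G(3)], rule meas[OF G'])
    qed
    also have "\<dots> = expectation (\<lambda>\<omega>. Y \<omega> * G' \<omega>)"
      unfolding Y_def using time_integral_product(2,3)[OF v G' t] by simp
    also have "\<dots> = expectation (\<lambda>\<omega>. G' \<omega> * Y \<omega>)" by (simp only: mult.commute)
    also have "\<dots> = expectation (\<lambda>\<omega>. G' \<omega> * C \<omega>)"
      unfolding C_def
      by (rule sub.real_cond_exp_intg(2)[OF sq_int_mult[OF G' Ysq] G'F sq_intD(1)[OF Ysq], symmetric])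
    also have "\<dots> = expectation (\<lambda>\<omega>. C \<omega> * G \<omega>)"
    proof -
      have "integrable M (\<lambda>\<omega>. C \<omega> * G \<omega>)"
        unfolding G_def using integrable_mult_indicator[OF B C(1)] by (simp add: mult.commute)
      from pull[OF C(2) this] show ?thesis by (simp only: mult.commute)
    qed
    finally show ?thesis by (simp only: G_def mult.commute)
  qed
  \<comment> \<open>Equal integrals over all events give almost sure equality, and the completed
    \<open>\<F> t\<close> absorbs the null set.\<close>
  have "AE \<omega> in M. Y \<omega> = C \<omega>"
  proof (rule density_unique_real[OF Y C(1)])
    fix B assume B: "B \<in> sets M"
    show "(LINT x:B|M. Y x) = (LINT x:B|M. C x)"
      using eq[OF B] by (simp add: set_lebesgue_integral_def)
  qed
  then have "AE \<omega> in M. C \<omega> = time_integral v t \<omega>" by eventually_elim (simp add: Y_def)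
  with C(2) show ?thesis by (rule F_measurable_AE_eq)
qed

lemma time_integral_adapted: "v \<in> L2F \<Longrightarrow> adapted (time_integral v)"
  unfolding adapted_def
  using time_integral_measurable(1)[OF L2F_D(3)] time_integral_measurable_F by blast

lemma L2F_lin:
  assumes "u \<in> L2F" "v \<in> L2F"
  shows "(\<lambda>t \<omega>. a * u t \<omega> + b * v t \<omega>) \<in> L2F"
proof -
  have "sq_int dt_P (\<lambda>p. a * (case p of (t, \<omega>) \<Rightarrow> u t \<omega>) + b * (case p of (t, \<omega>) \<Rightarrow> v t \<omega>))"
    by (intro sq_int_lin L2F_D assms)
  then have sq: "sq_int dt_P (\<lambda>(t, \<omega>). a * u t \<omega> + b * v t \<omega>)" by (simp add: case_prod_beta')
  moreover have "adapted (\<lambda>t \<omega>. a * u t \<omega> + b * v t \<omega>)"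
    unfolding adapted_def
  proof (intro conjI ballI)
    show "(\<lambda>(t, \<omega>). a * u t \<omega> + b * v t \<omega>) \<in> borel_measurable dt_P"
      using sq by (rule sq_intD)
    fix t assume t: "t \<in> {0..T}"
    show "(\<lambda>\<omega>. a * u t \<omega> + b * v t \<omega>) \<in> borel_measurable (\<F> t)"
      by (intro borel_measurable_add borel_measurable_times borel_measurable_const
          adaptedD(2)[OF L2F_D(1)] assms t)
  qed
  ultimately show ?thesis by (simp add: L2F_iff)
qed

lemma ito_integral_L2F: "ito_integral v I \<Longrightarrow> v \<in> L2F"
  "ito_integral v I \<Longrightarrow> adapted I" "ito_integral v I \<Longrightarrow> AE \<omega> in M. continuous_on {0..T} (\<lambda>t. I t \<omega>)"
  unfolding ito_integral_def by blast+

text \<open>By the isometry the difference of the two sides is orthogonal to every stochastic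
  integral, and it is itself a combination of stochastic integrals; hence it vanishes at each time,
  and by continuity at all times together. Since \<open>ito_integral\<close> is a relation, this
  also gives uniqueness of the integral.\<close>

lemma ito_linear:
  assumes I: "ito_integral u I" and I': "ito_integral v I'" and I'': "ito_integral w I''"
    and w: "AE (t, \<omega>) in dt_P. w t \<omega> = a * u t \<omega> + b * v t \<omega>"
  shows "AE \<omega> in M. \<forall>t\<in>{0..T}. I'' t \<omega> = a * I t \<omega> + b * I' t \<omega>"
proof (rule continuous_AE_eq)
  show "AE \<omega> in M. continuous_on {0..T} (\<lambda>t. I'' t \<omega>)" by (rule ito_integral_L2F(3)[OF I''])
  show "AE \<omega> in M. continuous_on {0..T} (\<lambda>t. a * I t \<omega> + b * I' t \<omega>)"
    using ito_integral_L2F(3)[OF I] ito_integral_L2F(3)[OF I']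
    by eventually_elim (intro continuous_intros)
  fix t assume t: "t \<in> {0..T}"
  define D where "D \<omega> = I'' t \<omega> - (a * I t \<omega> + b * I' t \<omega>)" for \<omega>
  have D: "sq_int M D"
    unfolding D_def by (intro sq_int_diff sq_int_lin ito_sq_int[OF I t] ito_sq_int[OF I' t] ito_sq_int[OF I'' t])
  have orth: "expectation (\<lambda>\<omega>. K t \<omega> * D \<omega>) = 0" if K: "ito_integral z K" for z K
  proof -
    note sK = ito_sq_int[OF K t]
    have i: "integrable M (\<lambda>\<omega>. K t \<omega> * I t \<omega>)" "integrable M (\<lambda>\<omega>. K t \<omega> * I' t \<omega>)" "integrable M (\<lambda>\<omega>. K t \<omega> * I'' t \<omega>)"
      by (intro sq_int_mult sK ito_sq_int[OF I t] ito_sq_int[OF I' t] ito_sq_int[OF I'' t])+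
    have j: "integrable dt_P (\<lambda>(q, \<omega>). indicator {0..t} q * (z q \<omega> * y q \<omega>))" if "y \<in> L2F" for y
    proof -
      have sz: "sq_int dt_P (\<lambda>p. indicator {0..t} (fst p) * (case p of (q, \<omega>) \<Rightarrow> z q \<omega>))"
      proof (rule sq_int_bound[OF L2F_D(2)[OF ito_integral_L2F(1)[OF K]], of _ 1])
        show "(\<lambda>p. indicator {0..t} (fst p) * (case p of (q, \<omega>) \<Rightarrow> z q \<omega>)) \<in> borel_measurable dt_P"
          by (intro borel_measurable_times fst_dt_P_measurable L2F_D(3)[OF ito_integral_L2F(1)[OF K]]) simp
      qed (auto simp: indicator_def)
      show ?thesis
        using sq_int_mult[OF sz L2F_D(2)[OF that]] by (simp add: case_prod_beta' mult.assoc)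
    qed
    note j1 = j[OF ito_integral_L2F(1)[OF I]] and j2 = j[OF ito_integral_L2F(1)[OF I']]
      and j3 = j[OF ito_integral_L2F(1)[OF I'']]
    have "expectation (\<lambda>\<omega>. K t \<omega> * D \<omega>) =
        expectation (\<lambda>\<omega>. K t \<omega> * I'' t \<omega> - (a * (K t \<omega> * I t \<omega>) + b * (K t \<omega> * I' t \<omega>)))"
      by (simp add: D_def algebra_simps)
    also have "\<dots> = expectation (\<lambda>\<omega>. K t \<omega> * I'' t \<omega>) -
        (a * expectation (\<lambda>\<omega>. K t \<omega> * I t \<omega>) + b * expectation (\<lambda>\<omega>. K t \<omega> * I' t \<omega>))"
      using i by simp
    also have "\<dots> = (\<integral>(q, \<omega>). indicator {0..t} q * (z q \<omega> * w q \<omega>) \<partial>dt_P) -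
        (a * (\<integral>(q, \<omega>). indicator {0..t} q * (z q \<omega> * u q \<omega>) \<partial>dt_P) +
         b * (\<integral>(q, \<omega>). indicator {0..t} q * (z q \<omega> * v q \<omega>) \<partial>dt_P))"
      by (simp only: ito_isometry[OF K I t] ito_isometry[OF K I' t] ito_isometry[OF K I'' t])
    also have "\<dots> = (\<integral>p. (case p of (q, \<omega>) \<Rightarrow> indicator {0..t} q * (z q \<omega> * w q \<omega>)) -
        (a * (case p of (q, \<omega>) \<Rightarrow> indicator {0..t} q * (z q \<omega> * u q \<omega>)) +
         b * (case p of (q, \<omega>) \<Rightarrow> indicator {0..t} q * (z q \<omega> * v q \<omega>))) \<partial>dt_P)"
      using j1 j2 j3 by simp
    also have "\<dots> = (\<integral>p. 0 \<partial>dt_P)"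
    proof (rule integral_cong_AE)
      show "AE p in dt_P. (case p of (q, \<omega>) \<Rightarrow> indicator {0..t} q * (z q \<omega> * w q \<omega>)) -
        (a * (case p of (q, \<omega>) \<Rightarrow> indicator {0..t} q * (z q \<omega> * u q \<omega>)) +
         b * (case p of (q, \<omega>) \<Rightarrow> indicator {0..t} q * (z q \<omega> * v q \<omega>))) = 0"
        using w by eventually_elim (auto simp: algebra_simps)
      show "(\<lambda>p. (case p of (q, \<omega>) \<Rightarrow> indicator {0..t} q * (z q \<omega> * w q \<omega>)) -
        (a * (case p of (q, \<omega>) \<Rightarrow> indicator {0..t} q * (z q \<omega> * u q \<omega>)) +
         b * (case p of (q, \<omega>) \<Rightarrow> indicator {0..t} q * (z q \<omega> * v q \<omega>)))) \<in> borel_measurable dt_P"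
        by (intro borel_measurable_diff borel_measurable_add borel_measurable_times borel_measurable_const
            borel_measurable_integrable[OF j1] borel_measurable_integrable[OF j2] borel_measurable_integrable[OF j3])
    qed simp
    finally show ?thesis by simp
  qed
  have "expectation (\<lambda>\<omega>. (D \<omega>)\<^sup>2) =
      expectation (\<lambda>\<omega>. I'' t \<omega> * D \<omega> - (a * (I t \<omega> * D \<omega>) + b * (I' t \<omega> * D \<omega>)))"
    by (intro Bochner_Integration.integral_cong) (simp_all add: D_def power2_eq_square algebra_simps)
  also have "\<dots> = expectation (\<lambda>\<omega>. I'' t \<omega> * D \<omega>) - (a * expectation (\<lambda>\<omega>. I t \<omega> * D \<omega>) + b * expectation (\<lambda>\<omega>. I' t \<omega> * D \<omega>))"
    using sq_int_mult[OF ito_sq_int[OF I t] D] sq_int_mult[OF ito_sq_int[OF I' t] D] sq_int_mult[OF ito_sq_int[OF I'' t] D]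
    by simp
  also have "\<dots> = 0" by (simp add: orth[OF I] orth[OF I'] orth[OF I''])
  finally have "AE \<omega> in M. D \<omega> = 0" by (rule L2_zero_AE[OF D])
  then show "AE \<omega> in M. I'' t \<omega> = a * I t \<omega> + b * I' t \<omega>"
    by eventually_elim (simp add: D_def)
qed

end

subsection \<open>Density of simple processes\<close>

lemma integral_indicator_Icc_Ioc:
  "(\<integral>t. indicator {a..b} t * f t \<partial>lborel) = (\<integral>t. indicator {a<..b} t * (f t :: real) \<partial>lborel)"
  if f: "(\<lambda>t. indicator {a..b} t * f t) \<in> borel_measurable borel" for a b :: real
proof (rule integral_cong_AE)
  show "(\<lambda>t. indicator {a..b} t * f t) \<in> borel_measurable lborel" using f by (simp only: measurable_lborel2)
  have "(\<lambda>t. indicator {a<..b} t * f t) = (\<lambda>t. indicator {a<..b} t * (indicator {a..b} t * f t))"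
    by (auto simp: indicator_def fun_eq_iff)
  then show "(\<lambda>t. indicator {a<..b} t * f t) \<in> borel_measurable lborel"
    using f by simp
  show "AE t in lborel. indicator {a..b} t * f t = indicator {a<..b} t * f t"
    using AE_lborel_singleton[of a] by eventually_elim (auto simp: indicator_def)
qed

context brownian_space
begin

lemma L2F_bound:
  assumes v: "v \<in> L2F" and ad: "adapted u"
    and le: "AE (t, \<omega>) in dt_P. \<bar>u t \<omega>\<bar> \<le> c * \<bar>v t \<omega>\<bar>"
  shows "u \<in> L2F"
proof -
  have "sq_int dt_P (\<lambda>(t, \<omega>). u t \<omega>)"
  proof (rule sq_int_bound[OF L2F_D(2)[OF v] adaptedD(1)[OF ad]])
    show "AE p in dt_P. \<bar>case p of (t, \<omega>) \<Rightarrow> u t \<omega>\<bar> \<le> c * \<bar>case p of (t, \<omega>) \<Rightarrow> v t \<omega>\<bar>"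
      using le by eventually_elim auto
  qed
  with ad show ?thesis by (simp add: L2F_iff)
qed

lemma path_measurable:
  assumes v: "(\<lambda>(t, \<omega>). v t \<omega>) \<in> borel_measurable dt_P" and \<omega>: "\<omega> \<in> space M"
  shows "(\<lambda>s. indicator {0..T} s * (v s \<omega> :: real)) \<in> borel_measurable borel"
proof -
  have "(\<lambda>s. v s \<omega>) \<in> borel_measurable time_measure"
    using measurable_compose[OF measurable_Pair2'[OF \<omega>] v[unfolded dt_P_eq]] by simp
  then have "(\<lambda>s. indicator {0..T} s *\<^sub>R v s \<omega>) \<in> borel_measurable lborel"
    unfolding time_measure_def by (subst (asm) borel_measurable_restrict_space_iff) simp_all
  then show ?thesis by (simp add: measurable_lborel2)
qed

text \<open>The lagged means of the paths form simple processes: a mean over a past grid interval is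
  a difference quotient of \<open>time_integral v\<close> and is known at the right end point. On
  each path they converge in mean over time; boundedness lifts this to the product measure and from
  first to second powers.\<close>

lemma bounded_process_approx:
  assumes v: "v \<in> L2F" and K: "\<And>t \<omega>. t \<in> {0..T} \<Longrightarrow> \<omega> \<in> space M \<Longrightarrow> \<bar>v t \<omega>\<bar> \<le> K"
  shows "\<exists>s S. (\<forall>m::nat. simple_pair (s m) (S m)) \<and>
    (\<lambda>m. \<integral>(t, \<omega>). (s m t \<omega> - v t \<omega>)\<^sup>2 \<partial>dt_P) \<longlonglongrightarrow> 0"
proof -
  define h where "h m = T / real (Suc m)" for m
  have h: "h m > 0" "real (Suc m) * h m = T" for m using T_pos by (simp_all add: h_def)
  define \<tau> where "\<tau> m j = real j * h m" for m j :: nat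
  \<comment> \<open>On the initial interval the mean would look back before time 0, where the path
    is extended by 0; hence the value 0.\<close>
  define \<xi> where "\<xi> m j \<omega> = (if j = 0 then 0 else
     (time_integral v (real j * h m) \<omega> - time_integral v ((real j - 1) * h m) \<omega>) / h m)" for m j :: nat and \<omega>
  define f where "f \<omega> s = indicator {0..T} s * v s \<omega>" for \<omega> s
  have fm: "f \<omega> \<in> borel_measurable borel" if "\<omega> \<in> space M" for \<omega>
    unfolding f_def by (rule path_measurable[OF L2F_D(3)[OF v] that])
  have K0: "K \<ge> 0"
    using order_trans[OF abs_ge_zero K[of 0 "SOME \<omega>. \<omega> \<in> space M"]] T_pos not_empty
    by (simp add: some_in_eq)
  have fK: "\<bar>f \<omega> s\<bar> \<le> K" if "\<omega> \<in> space M" for \<omega> s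
    using K[OF _ that, of s] K0 by (auto simp: f_def indicator_def)
  have fint: "integrable lborel (\<lambda>s. indicator {a<..b} s * f \<omega> s)" if "\<omega> \<in> space M" for \<omega> a b
    using integrableI_bounded_set_indicator[of "{a<..b}" lborel "f \<omega>" K] fK[OF that] fm[OF that]
      emeasure_lborel_Ioc_finite[of a b] by simp
  have \<tau>T: "\<tau> m j \<in> {0..T}" if "j \<le> Suc m" for m j
  proof -
    have "real j * h m \<le> real (Suc m) * h m" using that h(1)[of m] by (intro mult_right_mono) auto
    then have "real j * h m \<le> T" unfolding h(2) .
    then show ?thesis using h(1)[of m] by (simp add: \<tau>_def)
  qed
  have mean: "(\<integral>s. indicator {(real j - 1) * h m<..real j * h m} s * f \<omega> s \<partial>lborel) / h m = \<xi> m j \<omega>"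
    if j: "j \<le> Suc m" and \<omega>: "\<omega> \<in> space M" for m j \<omega>
  proof (cases "j = 0")
    case True
    have "(\<integral>s. indicator {(real j - 1) * h m<..real j * h m} s * f \<omega> s \<partial>lborel) = (\<integral>s. 0 \<partial>(lborel :: real measure))"
    proof (rule integral_cong_AE)
      show "AE s in lborel. indicator {(real j - 1) * h m<..real j * h m} s * f \<omega> s = 0"
        using AE_lborel_singleton[of 0] by eventually_elim (auto simp: True f_def indicator_def)
    qed (use fm[OF \<omega>] in auto)
    with True show ?thesis by (simp add: \<xi>_def)
  next
    case False
    have eq: "indicator {0<..real j * h m} s * f \<omega> s = indicator {0<..(real j - 1) * h m} s * f \<omega> s +
        indicator {(real j - 1) * h m<..real j * h m} s * f \<omega> s" for s
    proof -
      have "0 \<le> (real j - 1) * h m" "(real j - 1) * h m \<le> real j * h m"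
        using False h(1)[of m] by (simp_all add: algebra_simps)
      then show ?thesis by (auto simp: indicator_def)
    qed
    have ti: "time_integral v t \<omega> = (\<integral>s. indicator {0<..t} s * f \<omega> s \<partial>lborel)" if t: "t \<in> {0..T}" for t
    proof -
      have "time_integral v t \<omega> = (\<integral>s. indicator {0..t} s * f \<omega> s \<partial>lborel)"
        unfolding time_integral_def set_lebesgue_integral_def f_def using t
        by (intro Bochner_Integration.integral_cong) (auto simp: indicator_def)
      also have "\<dots> = (\<integral>s. indicator {0<..t} s * f \<omega> s \<partial>lborel)"
        using fm[OF \<omega>] by (intro integral_indicator_Icc_Ioc) simp
      finally show ?thesis .
    qed
    have "(real j - 1) * h m \<in> {0..T}"
      using \<tau>T[of "j - 1" m] False j by (simp add: \<tau>_def of_nat_diff)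
    moreover have "real j * h m \<in> {0..T}" using \<tau>T[OF j] by (simp add: \<tau>_def)
    ultimately have "time_integral v (real j * h m) \<omega> - time_integral v ((real j - 1) * h m) \<omega> =
        (\<integral>s. indicator {(real j - 1) * h m<..real j * h m} s * f \<omega> s \<partial>lborel)"
      using fint[OF \<omega>] by (simp add: ti eq)
    with False show ?thesis by (simp add: \<xi>_def)
  qed
  have \<xi>K: "\<bar>\<xi> m j \<omega>\<bar> \<le> K" if j: "j \<le> Suc m" and \<omega>: "\<omega> \<in> space M" for m j \<omega>
  proof -
    let ?I = "{(real j - 1) * h m<..real j * h m}"
    have "\<bar>\<integral>s. indicator ?I s * f \<omega> s \<partial>lborel\<bar> \<le> (\<integral>s. \<bar>indicator ?I s * f \<omega> s\<bar> \<partial>lborel)"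
      by (rule integral_abs_bound)
    also have "\<dots> \<le> (\<integral>s. indicator ?I s * K \<partial>lborel)"
    proof (rule integral_mono_AE')
      show "integrable lborel (\<lambda>s. indicator ?I s * K)" by simp
    qed (use fK[OF \<omega>] K0 in \<open>auto simp: indicator_def\<close>)
    also have "\<dots> = h m * K" using h(1)[of m] by (simp add: algebra_simps)
    finally have "\<bar>\<integral>s. indicator ?I s * f \<omega> s \<partial>lborel\<bar> / h m \<le> K"
      using h(1)[of m] by (simp add: field_simps)
    then show ?thesis
      unfolding mean[OF that, symmetric] using h(1)[of m] by simp
  qed
  have si: "simple_integrand (Suc m) (\<tau> m) (\<xi> m)" for m
    unfolding simple_integrand_def
  proof (intro allI impI conjI)
    fix j assume j: "j < Suc m"
    show "0 \<le> \<tau> m j" "\<tau> m (Suc j) \<le> T" using \<tau>T[of j m] \<tau>T[of "Suc j" m] j by auto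
    show "\<tau> m j \<le> \<tau> m (Suc j)" unfolding \<tau>_def using h(1)[of m] by (intro mult_right_mono) auto
    show "\<exists>B. \<forall>\<omega>\<in>space M. \<bar>\<xi> m j \<omega>\<bar> \<le> B" using \<xi>K[of j m] j by (intro exI[of _ K]) auto
    show "\<xi> m j \<in> borel_measurable (\<F> (\<tau> m j))"
    proof (cases "j = 0")
      case True
      then have "\<xi> m j = (\<lambda>_. 0)" by (simp add: \<xi>_def fun_eq_iff)
      then show ?thesis by (simp only: borel_measurable_const)
    next
      case False
      have 1: "(real j - 1) * h m \<in> {0..T}"
        using \<tau>T[of "j - 1" m] False j by (simp add: \<tau>_def of_nat_diff)
      have 2: "real j * h m \<in> {0..T}" using \<tau>T[of j m] j by (simp add: \<tau>_def)
      have 3: "(real j - 1) * h m \<le> real j * h m" using h(1)[of m] by (simp add: algebra_simps)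
      have eq: "\<xi> m j = (\<lambda>\<omega>. (time_integral v (real j * h m) \<omega> - time_integral v ((real j - 1) * h m) \<omega>) / h m)"
        using False by (simp add: \<xi>_def fun_eq_iff)
      show ?thesis
        unfolding eq \<tau>_def
        by (intro borel_measurable_divide borel_measurable_diff borel_measurable_const
            time_integral_measurable_F[OF v 2] F_measurable_mono[OF 3 time_integral_measurable_F[OF v 1]])
    qed
  qed
  define s where "s m = simple_process (Suc m) (\<tau> m) (\<xi> m)" for m
  define S where "S m = simple_integral (Suc m) (\<tau> m) (\<xi> m)" for m
  have sp: "simple_pair (s m) (S m)" for m
    unfolding simple_pair_def s_def S_def using si by blast
  have s_eq: "s m t \<omega> = lagged_mean (h m) (Suc m) (f \<omega>) t" if "\<omega> \<in> space M" for m t \<omega>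
    unfolding s_def simple_process_def lagged_mean_def \<tau>_def
    by (intro sum.cong refl) (simp add: mean[OF _ that])
  have sK: "\<bar>s m t \<omega>\<bar> \<le> K" if t: "t \<in> {0<..T}" and \<omega>: "\<omega> \<in> space M" for m t \<omega>
  proof -
    obtain i where i: "i < Suc m" "t \<in> {real i * h m<..real (Suc i) * h m}"
    proof (rule grid_interval_exists[of "h m" t "Suc m"])
      show "t \<in> {0<..real (Suc m) * h m}" using t unfolding h(2) .
    qed (use h(1) in auto)
    show ?thesis
      unfolding s_eq[OF \<omega>] lagged_mean_eq[OF h(1) i] using mean[of i m \<omega>] \<xi>K[of i m \<omega>] i \<omega> by simp
  qed
  define d where "d m p = (case p of (t, \<omega>) \<Rightarrow> s m t \<omega> - v t \<omega>)" for m and p :: "real \<times> 'a"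
  have dsq: "sq_int dt_P (d m)" for m
    using sq_int_diff[OF simple_process_sq_int[OF sp[of m]] L2F_D(2)[OF v]]
    by (simp add: d_def[abs_def] case_prod_beta')
  \<comment> \<open>The left-open grid intervals cover only \<open>{0<..T}\<close>, so time 0 is
    discarded.\<close>
  have t0: "AE p in dt_P. fst p \<in> {0<..T}"
  proof -
    have "AE t in time_measure. t \<in> {0<..T}"
      unfolding AE_time_iff using AE_lborel_singleton[of 0] by eventually_elim auto
    then have ae: "AE t in time_measure. AE \<omega> in M. fst (t, \<omega>) \<in> {0<..T}" by simp
    have "(\<lambda>p. fst p) \<in> borel_measurable dt_P" by (rule fst_dt_P_measurable) simp
    from measurable_sets[OF this, of "{0<..T}"] have "{p \<in> space dt_P. fst p \<in> {0<..T}} \<in> sets dt_P"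
      by (simp add: vimage_def Int_def conj_commute)
    then show ?thesis
      unfolding dt_P_eq by (rule time_prob.AE_pair_measure[OF _ ae])
  qed
  have dK: "AE p in dt_P. \<bar>d m p\<bar> \<le> 2 * K" for m
    using t0 AE_space
  proof eventually_elim
    case (elim p)
    then show ?case
      using sK[of "fst p" "snd p" m] K[of "fst p" "snd p"] by (auto simp: d_def space_dt_P split: prod.split)
  qed
  have dint: "integrable dt_P (\<lambda>p. \<bar>d m p\<bar>)" for m
    using dtP.sq_int_integrable[OF dsq] by (rule integrable_abs)
  define \<phi> where "\<phi> m \<omega> = (\<integral>t. \<bar>s m t \<omega> - v t \<omega>\<bar> \<partial>time_measure)" for m \<omega>
  have dint': "integrable (time_measure \<Otimes>\<^sub>M M) (\<lambda>(t, \<omega>). \<bar>s m t \<omega> - v t \<omega>\<bar>)" for m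
    using dint[of m] by (simp add: d_def dt_P_eq case_prod_beta')
  have \<phi>_eq: "\<phi> m \<omega> = (\<integral>t. indicator {0<..T} t * \<bar>lagged_mean (h m) (Suc m) (f \<omega>) t - f \<omega> t\<bar> \<partial>lborel)"
    if \<omega>: "\<omega> \<in> space M" for m \<omega>
  proof -
    have "\<phi> m \<omega> = (\<integral>t. indicator {0..T} t *\<^sub>R \<bar>s m t \<omega> - v t \<omega>\<bar> \<partial>lborel)"
      unfolding \<phi>_def time_measure_def by (rule integral_restrict_space) simp
    also have "\<dots> = (\<integral>t. indicator {0..T} t * \<bar>lagged_mean (h m) (Suc m) (f \<omega>) t - f \<omega> t\<bar> \<partial>lborel)"
      using \<omega> by (intro Bochner_Integration.integral_cong) (auto simp: s_eq f_def indicator_def)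
    also have "\<dots> = (\<integral>t. indicator {0<..T} t * \<bar>lagged_mean (h m) (Suc m) (f \<omega>) t - f \<omega> t\<bar> \<partial>lborel)"
      using fm[OF \<omega>] by (intro integral_indicator_Icc_Ioc) simp
    finally show ?thesis .
  qed
  have \<phi>_lim: "(\<lambda>m. \<phi> m \<omega>) \<longlonglongrightarrow> 0" if \<omega>: "\<omega> \<in> space M" for \<omega>
    unfolding \<phi>_eq[OF \<omega>] h_def by (rule lagged_mean_L1_tendsto[OF fm[OF \<omega>] fK[OF \<omega>] T_pos])
  have \<phi>K: "\<bar>\<phi> m \<omega>\<bar> \<le> T * (2 * K)" if \<omega>: "\<omega> \<in> space M" for m \<omega>
  proof -
    have "\<phi> m \<omega> \<le> (\<integral>t. indicator {0<..T} t * (2 * K) \<partial>lborel)"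
      unfolding \<phi>_eq[OF \<omega>]
    proof (rule integral_mono_AE')
      show "AE t in lborel. indicator {0<..T} t * \<bar>lagged_mean (h m) (Suc m) (f \<omega>) t - f \<omega> t\<bar> \<le> indicator {0<..T} t * (2 * K)"
      proof (intro AE_I2)
        fix t
        show "indicator {0<..T} t * \<bar>lagged_mean (h m) (Suc m) (f \<omega>) t - f \<omega> t\<bar> \<le> indicator {0<..T} t * (2 * K)"
        proof (cases "t \<in> {0<..T}")
          case True
          have "\<bar>lagged_mean (h m) (Suc m) (f \<omega>) t\<bar> \<le> K" using sK[OF True \<omega>, of m] by (simp add: s_eq[OF \<omega>])
          with fK[OF \<omega>, of t] True show ?thesis by simp
        qed simp
      qed
    qed (use K0 in auto)
    also have "\<dots> = T * (2 * K)" using T_pos by simp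
    finally have "\<phi> m \<omega> \<le> T * (2 * K)" .
    moreover have "0 \<le> \<phi> m \<omega>" unfolding \<phi>_def by simp
    ultimately show ?thesis by simp
  qed
  have "(\<lambda>m. expectation (\<phi> m)) \<longlonglongrightarrow> expectation (\<lambda>_. 0)"
  proof (rule integral_dominated_convergence[where w = "\<lambda>_. T * (2 * K)"])
    show "\<phi> m \<in> borel_measurable M" for m
      unfolding \<phi>_def[abs_def] by (rule borel_measurable_integrable[OF time_prob.integrable_snd[OF dint']])
    show "AE \<omega> in M. (\<lambda>m. \<phi> m \<omega>) \<longlonglongrightarrow> 0" by (intro AE_I2 \<phi>_lim)
    show "AE \<omega> in M. norm (\<phi> m \<omega>) \<le> T * (2 * K)" for m by (intro AE_I2) (simp add: \<phi>K)
  qed simp_all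
  moreover have "expectation (\<phi> m) = (\<integral>p. \<bar>d m p\<bar> \<partial>dt_P)" for m
    using time_prob.integral_snd[OF dint'[of m]] by (simp add: \<phi>_def[abs_def] d_def dt_P_eq case_prod_beta')
  ultimately have L1: "(\<lambda>m. \<integral>p. \<bar>d m p\<bar> \<partial>dt_P) \<longlonglongrightarrow> 0" by simp
  have "(\<lambda>m. \<integral>p. (d m p)\<^sup>2 \<partial>dt_P) \<longlonglongrightarrow> 0"
  proof (rule tendsto_sandwich[of "\<lambda>_. 0"])
    show "(\<lambda>m. 2 * K * (\<integral>p. \<bar>d m p\<bar> \<partial>dt_P)) \<longlonglongrightarrow> 0"
      using tendsto_mult_right_zero[OF L1] .
    \<comment> \<open>Almost everywhere \<open>\<bar>d m p\<bar> \<le> 2 * K\<close>, and one factor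
      of the square is replaced by this bound.\<close>
    have "(\<integral>p. (d m p)\<^sup>2 \<partial>dt_P) \<le> (\<integral>p. 2 * K * \<bar>d m p\<bar> \<partial>dt_P)" for m
    proof (rule integral_mono_AE)
      show "integrable dt_P (\<lambda>p. (d m p)\<^sup>2)" using sq_intD(2)[OF dsq] .
      show "integrable dt_P (\<lambda>p. 2 * K * \<bar>d m p\<bar>)" using dint by (rule integrable_mult_right)
      show "AE p in dt_P. (d m p)\<^sup>2 \<le> 2 * K * \<bar>d m p\<bar>"
        using dK[of m]
      proof eventually_elim
        case (elim p)
        from mult_right_mono[OF this abs_ge_zero[of "d m p"]] show ?case
          by (simp add: power2_eq_square)
      qed
    qed
    then show "\<forall>\<^sub>F m in sequentially. (\<integral>p. (d m p)\<^sup>2 \<partial>dt_P) \<le> 2 * K * (\<integral>p. \<bar>d m p\<bar> \<partial>dt_P)" by simp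
  qed simp_all
  then have "(\<lambda>m. \<integral>(t, \<omega>). (s m t \<omega> - v t \<omega>)\<^sup>2 \<partial>dt_P) \<longlonglongrightarrow> 0"
    by (simp add: d_def case_prod_beta')
  with sp show ?thesis by blast
qed

text \<open>Truncation at level \<open>k\<close> reduces to bounded processes; the truncation error
  is at most \<open>\<bar>v\<bar>\<close>, which gives dominated convergence.\<close>

lemma simple_approx:
  assumes v: "v \<in> L2F" and e: "e > 0"
  obtains s S where "simple_pair s S" "(\<integral>(t, \<omega>). (s t \<omega> - v t \<omega>)\<^sup>2 \<partial>dt_P) < e"
proof -
  define w where "w k t \<omega> = max (- real k) (min (real k) (v t \<omega>))" for k :: nat and t \<omega>
  have wad: "adapted (w k)" for k
    unfolding adapted_def
  proof (intro conjI ballI)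
    have "(\<lambda>p. max (- real k) (min (real k) (case p of (t, \<omega>) \<Rightarrow> v t \<omega>))) \<in> borel_measurable dt_P"
      by (intro borel_measurable_max borel_measurable_min borel_measurable_const L2F_D(3)[OF v])
    then show "(\<lambda>(t, \<omega>). w k t \<omega>) \<in> borel_measurable dt_P" by (simp add: w_def case_prod_beta')
    fix t assume "t \<in> {0..T}"
    then show "w k t \<in> borel_measurable (\<F> t)"
      unfolding w_def by (intro borel_measurable_max borel_measurable_min borel_measurable_const adaptedD(2)[OF L2F_D(1)[OF v]])
  qed
  have wv: "\<bar>w k t \<omega>\<bar> \<le> \<bar>v t \<omega>\<bar>" for k t \<omega> unfolding w_def by auto
  have wL: "w k \<in> L2F" for k
    by (rule L2F_bound[OF v wad, of _ 1]) (simp add: wv case_prod_beta')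
  have "(\<lambda>k. \<integral>p. ((case p of (t, \<omega>) \<Rightarrow> w k t \<omega>) - (case p of (t, \<omega>) \<Rightarrow> v t \<omega>))\<^sup>2 \<partial>dt_P) \<longlonglongrightarrow> (\<integral>p. 0 \<partial>dt_P)"
  proof (rule integral_dominated_convergence[where w = "\<lambda>p. (case p of (t, \<omega>) \<Rightarrow> v t \<omega>)\<^sup>2"])
    show "(\<lambda>p. ((case p of (t, \<omega>) \<Rightarrow> w k t \<omega>) - (case p of (t, \<omega>) \<Rightarrow> v t \<omega>))\<^sup>2) \<in> borel_measurable dt_P" for k
      by (intro borel_measurable_power borel_measurable_diff L2F_D(3)[OF v] L2F_D(3)[OF wL])
    show "integrable dt_P (\<lambda>p. (case p of (t, \<omega>) \<Rightarrow> v t \<omega>)\<^sup>2)" using sq_intD(2)[OF L2F_D(2)[OF v]] .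
    show "AE p in dt_P. (\<lambda>k. ((case p of (t, \<omega>) \<Rightarrow> w k t \<omega>) - (case p of (t, \<omega>) \<Rightarrow> v t \<omega>))\<^sup>2) \<longlonglongrightarrow> 0"
    proof (intro AE_I2)
      fix p :: "real \<times> 'a"
      obtain t \<omega> where p: "p = (t, \<omega>)" by (cases p)
      obtain k0 :: nat where k0: "\<bar>v t \<omega>\<bar> \<le> real k0" using real_arch_simple by blast
      have "\<forall>\<^sub>F k in sequentially. (w k t \<omega> - v t \<omega>)\<^sup>2 = 0"
        using eventually_ge_at_top[of k0]
      proof eventually_elim
        case (elim k)
        then have "\<bar>v t \<omega>\<bar> \<le> real k" using k0 by linarith
        then show ?case by (simp add: w_def)
      qed
      then show "(\<lambda>k. ((case p of (t, \<omega>) \<Rightarrow> w k t \<omega>) - (case p of (t, \<omega>) \<Rightarrow> v t \<omega>))\<^sup>2) \<longlonglongrightarrow> 0"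
        unfolding p prod.case by (rule tendsto_eventually)
    qed
    show "AE p in dt_P. norm (((case p of (t, \<omega>) \<Rightarrow> w k t \<omega>) - (case p of (t, \<omega>) \<Rightarrow> v t \<omega>))\<^sup>2) \<le> (case p of (t, \<omega>) \<Rightarrow> v t \<omega>)\<^sup>2" for k
    proof (intro AE_I2)
      fix p :: "real \<times> 'a"
      obtain t \<omega> where p: "p = (t, \<omega>)" by (cases p)
      have "\<bar>w k t \<omega> - v t \<omega>\<bar> \<le> \<bar>v t \<omega>\<bar>" unfolding w_def by auto
      then have "(w k t \<omega> - v t \<omega>)\<^sup>2 \<le> (v t \<omega>)\<^sup>2" by (simp add: abs_le_square_iff)
      then show "norm (((case p of (t, \<omega>) \<Rightarrow> w k t \<omega>) - (case p of (t, \<omega>) \<Rightarrow> v t \<omega>))\<^sup>2) \<le> (case p of (t, \<omega>) \<Rightarrow> v t \<omega>)\<^sup>2"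
        unfolding p by simp
    qed
  qed simp
  \<comment> \<open>Both errors are kept below \<open>e / 4\<close> because the square of a sum is
    at most twice the sum of the squares.\<close>
  then have "\<forall>\<^sub>F k in sequentially. (\<integral>p. ((case p of (t, \<omega>) \<Rightarrow> w k t \<omega>) - (case p of (t, \<omega>) \<Rightarrow> v t \<omega>))\<^sup>2 \<partial>dt_P) < e / 4"
    using e by (intro order_tendstoD(2)[where a = "e / 4"]) auto
  then obtain k where k: "(\<integral>p. ((case p of (t, \<omega>) \<Rightarrow> w k t \<omega>) - (case p of (t, \<omega>) \<Rightarrow> v t \<omega>))\<^sup>2 \<partial>dt_P) < e / 4"
    unfolding eventually_sequentially by blast
  have wk: "\<bar>w k t \<omega>\<bar> \<le> real k" for t \<omega> unfolding w_def by auto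
  obtain s S where sS: "\<And>m::nat. simple_pair (s m) (S m)"
    and lim: "(\<lambda>m. \<integral>(t, \<omega>). (s m t \<omega> - w k t \<omega>)\<^sup>2 \<partial>dt_P) \<longlonglongrightarrow> 0"
    using bounded_process_approx[OF wL wk] by blast
  have "\<forall>\<^sub>F m in sequentially. (\<integral>(t, \<omega>). (s m t \<omega> - w k t \<omega>)\<^sup>2 \<partial>dt_P) < e / 4"
    using e by (intro order_tendstoD(2)[OF lim]) auto
  then obtain m where m: "(\<integral>(t, \<omega>). (s m t \<omega> - w k t \<omega>)\<^sup>2 \<partial>dt_P) < e / 4"
    unfolding eventually_sequentially by blast
  define A where "A p = (case p of (t, \<omega>) \<Rightarrow> s m t \<omega>) - (case p of (t, \<omega>) \<Rightarrow> w k t \<omega>)" for p :: "real \<times> 'a"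
  define B where "B p = (case p of (t, \<omega>) \<Rightarrow> w k t \<omega>) - (case p of (t, \<omega>) \<Rightarrow> v t \<omega>)" for p :: "real \<times> 'a"
  have AB: "sq_int dt_P A" "sq_int dt_P B"
    unfolding A_def B_def by (intro sq_int_diff simple_process_sq_int[OF sS] L2F_D(2) wL v)+
  have "(\<integral>p. (A p + B p)\<^sup>2 \<partial>dt_P) \<le> (\<integral>p. 2 * (A p)\<^sup>2 + 2 * (B p)\<^sup>2 \<partial>dt_P)"
  proof (rule integral_mono)
    show "integrable dt_P (\<lambda>p. (A p + B p)\<^sup>2)" using sq_intD(2)[OF sq_int_add[OF AB]] .
    show "integrable dt_P (\<lambda>p. 2 * (A p)\<^sup>2 + 2 * (B p)\<^sup>2)"
      by (intro Bochner_Integration.integrable_add integrable_mult_right sq_intD(2)[OF AB(1)] sq_intD(2)[OF AB(2)])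
    show "(A p + B p)\<^sup>2 \<le> 2 * (A p)\<^sup>2 + 2 * (B p)\<^sup>2" for p
      using zero_le_power2[of "A p - B p"] by (simp add: power2_eq_square algebra_simps)
  qed
  also have "\<dots> = 2 * (\<integral>p. (A p)\<^sup>2 \<partial>dt_P) + 2 * (\<integral>p. (B p)\<^sup>2 \<partial>dt_P)"
    using sq_intD(2)[OF AB(1)] sq_intD(2)[OF AB(2)] by simp
  also have "\<dots> < e"
    using k m e unfolding A_def B_def by (simp add: case_prod_beta')
  finally have "(\<integral>(t, \<omega>). (s m t \<omega> - v t \<omega>)\<^sup>2 \<partial>dt_P) < e"
    by (simp add: A_def B_def case_prod_beta')
  with sS show thesis by (rule that)
qed

end

subsection \<open>Existence of the stochastic integral\<close>

context brownian_space
begin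

text \<open>The martingale property in the tested form of \<open>simple_martingale\<close>. It
  speaks of fixed times only; path continuity enters separately in
  \<open>doob_maximal\<close>.\<close>

definition L2_martingale :: "(real \<Rightarrow> 'a \<Rightarrow> real) \<Rightarrow> bool" where
  "L2_martingale D \<longleftrightarrow>
     (\<forall>t\<in>{0..T}. D t \<in> borel_measurable (\<F> t) \<and> sq_int M (D t)) \<and>
     (\<forall>q t Z. 0 \<le> q \<longrightarrow> q \<le> t \<longrightarrow> t \<le> T \<longrightarrow> Z \<in> borel_measurable (\<F> q) \<longrightarrow> sq_int M Z \<longrightarrow>
        expectation (\<lambda>\<omega>. D t \<omega> * Z \<omega>) = expectation (\<lambda>\<omega>. D q \<omega> * Z \<omega>))"

lemma L2_martingaleD:
  assumes "L2_martingale D"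
  shows "t \<in> {0..T} \<Longrightarrow> D t \<in> borel_measurable (\<F> t)" "t \<in> {0..T} \<Longrightarrow> sq_int M (D t)"
    "0 \<le> q \<Longrightarrow> q \<le> t \<Longrightarrow> t \<le> T \<Longrightarrow> Z \<in> borel_measurable (\<F> q) \<Longrightarrow> sq_int M Z \<Longrightarrow>
      expectation (\<lambda>\<omega>. D t \<omega> * Z \<omega>) = expectation (\<lambda>\<omega>. D q \<omega> * Z \<omega>)"
  using assms unfolding L2_martingale_def by blast+

lemma sq_int_indicator_mult:
  assumes "sq_int M f" "A \<in> sets M"
  shows "sq_int M (\<lambda>\<omega>. f \<omega> * indicator A \<omega>)"
proof (rule sq_int_bound[OF assms(1)])
  show "(\<lambda>\<omega>. f \<omega> * indicator A \<omega>) \<in> borel_measurable M"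
    by (intro borel_measurable_times sq_intD(1)[OF assms(1)] borel_measurable_indicator assms(2))
  show "AE \<omega> in M. \<bar>f \<omega> * indicator A \<omega>\<bar> \<le> 1 * \<bar>f \<omega>\<bar>"
    by (intro AE_I2) (simp add: indicator_def)
qed

text \<open>Doob's maximal inequality. On the event \<open>A i\<close> that the threshold is passed
  at index \<open>i\<close> for the first time, the modulus of \<open>D (t i)\<close> exceeds
  \<open>e\<close>, and the second moment of \<open>D\<close> on an event known at time
  \<open>t i\<close> can only grow up to time \<open>T\<close>.\<close>

lemma doob_discrete:
  fixes t :: "nat \<Rightarrow> real"
  assumes D: "L2_martingale D" and t: "\<And>i. t i \<in> {0..T}" and e: "e > 0"
    and mono: "\<And>i j. i \<le> j \<Longrightarrow> t i \<le> t j"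
  shows "e\<^sup>2 * prob {\<omega> \<in> space M. \<exists>i<n. \<bar>D (t i) \<omega>\<bar> > e} \<le> expectation (\<lambda>\<omega>. (D T \<omega>)\<^sup>2)"
proof -
  define A where "A i = {\<omega> \<in> space M. \<bar>D (t i) \<omega>\<bar> > e \<and> (\<forall>j<i. \<bar>D (t j) \<omega>\<bar> \<le> e)}" for i
  have DF: "D (t j) \<in> borel_measurable (\<F> (t i))" if "j \<le> i" for i j
    by (rule F_measurable_mono[OF mono[OF that] L2_martingaleD(1)[OF D t]])
  have sqD: "sq_int M (D q)" if "q \<in> {0..T}" for q by (rule L2_martingaleD(2)[OF D that])
  have TT: "T \<in> {0..T}" using T_pos by simp
  have AF: "A i \<in> sets (\<F> (t i))" for i
  proof -
    have 1: "{\<omega> \<in> space (\<F> (t i)). e < \<bar>D (t i) \<omega>\<bar>} \<in> sets (\<F> (t i))"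
      by (rule borel_measurable_less[OF borel_measurable_const borel_measurable_abs[OF DF[OF order_refl]]])
    have 2: "{\<omega> \<in> space (\<F> (t i)). \<bar>D (t j) \<omega>\<bar> \<le> e} \<in> sets (\<F> (t i))" if "j < i" for j
      by (rule borel_measurable_le[OF borel_measurable_abs[OF DF[OF less_imp_le[OF that]]] borel_measurable_const])
    have "{\<omega> \<in> space (\<F> (t i)). \<forall>j\<in>{..<i}. \<bar>D (t j) \<omega>\<bar> \<le> e} \<in> sets (\<F> (t i))"
      by (rule sets.sets_Collect_finite_All) (use 2 in auto)
    from sets.sets_Collect_conj[OF this 1] have "{\<omega> \<in> space (\<F> (t i)). e < \<bar>D (t i) \<omega>\<bar> \<and> (\<forall>j\<in>{..<i}. \<bar>D (t j) \<omega>\<bar> \<le> e)} \<in> sets (\<F> (t i))" .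
    moreover have "A i = {\<omega> \<in> space (\<F> (t i)). e < \<bar>D (t i) \<omega>\<bar> \<and> (\<forall>j\<in>{..<i}. \<bar>D (t j) \<omega>\<bar> \<le> e)}"
      by (auto simp: A_def)
    ultimately show ?thesis by (simp only:)
  qed
  have AM: "A i \<in> sets M" for i using AF[of i] F_subset_events[of "t i"] t[of i] by auto
  have disj: "disjoint_family_on A {..<n}"
    unfolding disjoint_family_on_def A_def by (auto simp: not_less) (meson linorder_neqE_nat not_less)
  have union: "{\<omega> \<in> space M. \<exists>i<n. \<bar>D (t i) \<omega>\<bar> > e} = (\<Union>i<n. A i)"
  proof (intro equalityI subsetI)
    fix \<omega> assume "\<omega> \<in> {\<omega> \<in> space M. \<exists>i<n. \<bar>D (t i) \<omega>\<bar> > e}"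
    then have \<omega>: "\<omega> \<in> space M" and ex: "\<exists>i. i < n \<and> \<bar>D (t i) \<omega>\<bar> > e" by auto
    define i where "i = (LEAST i. i < n \<and> \<bar>D (t i) \<omega>\<bar> > e)"
    have i: "i < n" "\<bar>D (t i) \<omega>\<bar> > e" using LeastI_ex[OF ex] by (auto simp: i_def)
    have "\<bar>D (t j) \<omega>\<bar> \<le> e" if "j < i" for j
      using not_less_Least[OF that[unfolded i_def]] that i(1) by auto
    with i \<omega> show "\<omega> \<in> (\<Union>i<n. A i)" by (auto simp: A_def)
  qed (auto simp: A_def)
  have step: "e\<^sup>2 * prob (A i) \<le> expectation (\<lambda>\<omega>. (D T \<omega>)\<^sup>2 * indicator (A i) \<omega>)" for i
  proof -
    define X where "X \<omega> = D (t i) \<omega> * indicator (A i) \<omega>" for \<omega>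
    define Y where "Y \<omega> = D T \<omega> * indicator (A i) \<omega>" for \<omega>
    have X: "sq_int M X" and Y: "sq_int M Y"
      unfolding X_def Y_def by (intro sq_int_indicator_mult sqD t TT AM)+
    have XF: "X \<in> borel_measurable (\<F> (t i))"
      unfolding X_def by (intro borel_measurable_times DF order_refl borel_measurable_indicator AF)
    have ti: "0 \<le> t i" "t i \<le> T" using t[of i] by auto
    \<comment> \<open>\<open>X\<close> is known at time \<open>t i\<close>, so it is an admissible
      test variable; the nonnegative square of \<open>Y - X\<close> then orders the two second
      moments.\<close>
    have cross: "expectation (\<lambda>\<omega>. Y \<omega> * X \<omega>) = expectation (\<lambda>\<omega>. X \<omega> * X \<omega>)"
    proof -
      have "expectation (\<lambda>\<omega>. Y \<omega> * X \<omega>) = expectation (\<lambda>\<omega>. D T \<omega> * X \<omega>)"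
        by (intro Bochner_Integration.integral_cong) (auto simp: X_def Y_def indicator_def)
      also have "\<dots> = expectation (\<lambda>\<omega>. D (t i) \<omega> * X \<omega>)"
        by (rule L2_martingaleD(3)[OF D ti order_refl XF X])
      also have "\<dots> = expectation (\<lambda>\<omega>. X \<omega> * X \<omega>)"
        by (intro Bochner_Integration.integral_cong) (auto simp: X_def indicator_def)
      finally show ?thesis .
    qed
    have "0 \<le> expectation (\<lambda>\<omega>. (Y \<omega> - X \<omega>)\<^sup>2)" by simp
    also have "\<dots> = expectation (\<lambda>\<omega>. (Y \<omega>)\<^sup>2 - 2 * (Y \<omega> * X \<omega>) + X \<omega> * X \<omega>)"
      by (simp add: power2_eq_square algebra_simps)
    also have "\<dots> = expectation (\<lambda>\<omega>. (Y \<omega>)\<^sup>2) - 2 * expectation (\<lambda>\<omega>. Y \<omega> * X \<omega>) + expectation (\<lambda>\<omega>. X \<omega> * X \<omega>)"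
      using sq_intD(2)[OF Y] sq_int_mult[OF Y X] sq_int_mult[OF X X] by simp
    finally have XY: "expectation (\<lambda>\<omega>. X \<omega> * X \<omega>) \<le> expectation (\<lambda>\<omega>. (Y \<omega>)\<^sup>2)"
      using cross by simp
    have "e\<^sup>2 * prob (A i) = expectation (\<lambda>\<omega>. e\<^sup>2 * indicator (A i) \<omega>)"
      using AM[of i] by simp
    also have "\<dots> \<le> expectation (\<lambda>\<omega>. X \<omega> * X \<omega>)"
    proof (rule integral_mono)
      show "integrable M (\<lambda>\<omega>. e\<^sup>2 * indicator (A i) \<omega>)"
        by (intro integrable_mult_right integrable_real_indicator AM) (simp add: emeasure_eq_measure)
      show "integrable M (\<lambda>\<omega>. X \<omega> * X \<omega>)" by (rule sq_int_mult[OF X X])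
      fix \<omega>
      have "e * e \<le> \<bar>D (t i) \<omega>\<bar> * \<bar>D (t i) \<omega>\<bar>" if "\<omega> \<in> A i"
        using that e by (intro mult_mono) (auto simp: A_def)
      then show "e\<^sup>2 * indicator (A i) \<omega> \<le> X \<omega> * X \<omega>"
        by (auto simp: X_def indicator_def power2_eq_square)
    qed
    also note XY
    also have "expectation (\<lambda>\<omega>. (Y \<omega>)\<^sup>2) = expectation (\<lambda>\<omega>. (D T \<omega>)\<^sup>2 * indicator (A i) \<omega>)"
      by (intro Bochner_Integration.integral_cong) (auto simp: Y_def indicator_def)
    finally show ?thesis .
  qed
  have int: "integrable M (\<lambda>\<omega>. (D T \<omega>)\<^sup>2 * indicator (A i) \<omega>)" for i
    by (rule Bochner_Integration.integrable_bound[OF sq_intD(2)[OF sqD[OF TT]]])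
      (intro borel_measurable_times borel_measurable_power sq_intD(1)[OF sqD[OF TT]] borel_measurable_indicator AM,
        simp add: indicator_def)
  have "e\<^sup>2 * prob (\<Union>i<n. A i) = (\<Sum>i<n. e\<^sup>2 * prob (A i))"
    using AM by (subst finite_measure_finite_Union[OF _ _ disj]) (auto simp: sum_distrib_left)
  also have "\<dots> \<le> (\<Sum>i<n. expectation (\<lambda>\<omega>. (D T \<omega>)\<^sup>2 * indicator (A i) \<omega>))"
    by (intro sum_mono step)
  also have "\<dots> = expectation (\<lambda>\<omega>. \<Sum>i<n. (D T \<omega>)\<^sup>2 * indicator (A i) \<omega>)"
    by (rule Bochner_Integration.integral_sum[OF int, symmetric])
  also have "\<dots> \<le> expectation (\<lambda>\<omega>. (D T \<omega>)\<^sup>2)"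
  proof (rule integral_mono)
    show "integrable M (\<lambda>\<omega>. \<Sum>i<n. (D T \<omega>)\<^sup>2 * indicator (A i) \<omega>)"
      by (intro Bochner_Integration.integrable_sum int)
    show "integrable M (\<lambda>\<omega>. (D T \<omega>)\<^sup>2)" by (rule sq_intD(2)[OF sqD[OF TT]])
    fix \<omega>
    have "(\<Sum>i<n. indicator (A i) \<omega>) = (indicator (\<Union>i<n. A i) \<omega> :: real)"
      by (rule indicator_UN_disjoint[symmetric, OF _ disj]) simp
    also have "\<dots> \<le> 1" by (simp add: indicator_def)
    finally have "(D T \<omega>)\<^sup>2 * (\<Sum>i<n. indicator (A i) \<omega>) \<le> (D T \<omega>)\<^sup>2 * 1"
      by (intro mult_left_mono) simp_all
    then show "(\<Sum>i<n. (D T \<omega>)\<^sup>2 * indicator (A i) \<omega>) \<le> (D T \<omega>)\<^sup>2"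
      by (simp add: sum_distrib_left)
  qed
  finally show ?thesis unfolding union .
qed

text \<open>The exceptional event is taken over dyadic times, so that it is measurable.\<close>

lemma doob_maximal:
  assumes D: "L2_martingale D" and e: "e > 0"
  shows "\<exists>B\<in>sets M. e\<^sup>2 * prob B \<le> expectation (\<lambda>\<omega>. (D T \<omega>)\<^sup>2) \<and>
    (\<forall>\<omega>\<in>space M - B. continuous_on {0..T} (\<lambda>t. D t \<omega>) \<longrightarrow> (\<forall>t\<in>{0..T}. \<bar>D t \<omega>\<bar> \<le> e))"
proof -
  \<comment> \<open>Capped at \<open>T\<close>, so that \<open>t n\<close> is a monotone sequence in
    \<open>{0..T}\<close> indexed by all naturals, as \<open>doob_discrete\<close> asks.\<close>
  define t where "t n i = T * min 1 (real i / 2 ^ n)" for n i :: nat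
  define B where "B n = {\<omega> \<in> space M. \<exists>i<Suc (2 ^ n). \<bar>D (t n i) \<omega>\<bar> > e}" for n
  have t01: "t n i \<in> {0..T}" for n i
    using T_pos mult_left_mono[of "min 1 (real i / 2 ^ n)" 1 T] by (auto simp: t_def)
  have tmono: "t n i \<le> t n j" if "i \<le> j" for n i j
    unfolding t_def using T_pos that by (intro mult_left_mono min.mono divide_right_mono) auto
  have le: "e\<^sup>2 * prob (B n) \<le> expectation (\<lambda>\<omega>. (D T \<omega>)\<^sup>2)" for n
    unfolding B_def by (rule doob_discrete[OF D t01 e tmono])
  have BM: "B n \<in> sets M" for n
  proof -
    have "{\<omega> \<in> space M. e < \<bar>D (t n i) \<omega>\<bar>} \<in> sets M" for i
      by (rule borel_measurable_less[OF borel_measurable_const borel_measurable_abs])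
        (rule sq_intD(1)[OF L2_martingaleD(2)[OF D t01]])
    then have "{\<omega> \<in> space M. \<exists>i\<in>{..<Suc (2 ^ n)}. e < \<bar>D (t n i) \<omega>\<bar>} \<in> sets M"
      by (intro sets.sets_Collect_finite_Ex) auto
    moreover have "B n = {\<omega> \<in> space M. \<exists>i\<in>{..<Suc (2 ^ n)}. e < \<bar>D (t n i) \<omega>\<bar>}"
      unfolding B_def by blast
    ultimately show ?thesis by (simp only:)
  qed
  have "incseq B"
  proof (rule incseq_SucI)
    fix n
    show "B n \<subseteq> B (Suc n)"
    proof
      fix \<omega> assume "\<omega> \<in> B n"
      then obtain i where i: "\<omega> \<in> space M" "i < Suc (2 ^ n)" "\<bar>D (t n i) \<omega>\<bar> > e" by (auto simp: B_def)
      \<comment> \<open>Each grid point survives the refinement, which makes the exceptional events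
        increase.\<close>
      have "t (Suc n) (2 * i) = t n i" by (simp add: t_def)
      moreover have "2 * i < Suc (2 ^ Suc n)" using i(2) by simp
      ultimately have "2 * i < Suc (2 ^ Suc n) \<and> e < \<bar>D (t (Suc n) (2 * i)) \<omega>\<bar>" using i(3) by simp
      with i(1) show "\<omega> \<in> B (Suc n)" unfolding B_def by blast
    qed
  qed
  then have "(\<lambda>n. prob (B n)) \<longlonglongrightarrow> prob (\<Union>n. B n)"
    using BM by (intro finite_Lim_measure_incseq) auto
  then have "(\<lambda>n. e\<^sup>2 * prob (B n)) \<longlonglongrightarrow> e\<^sup>2 * prob (\<Union>n. B n)"
    by (rule tendsto_mult_left)
  then have "e\<^sup>2 * prob (\<Union>n. B n) \<le> expectation (\<lambda>\<omega>. (D T \<omega>)\<^sup>2)"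
    by (rule LIMSEQ_le_const2) (use le in auto)
  moreover have "\<bar>D q \<omega>\<bar> \<le> e"
    if \<omega>: "\<omega> \<in> space M - (\<Union>n. B n)" and cont: "continuous_on {0..T} (\<lambda>t. D t \<omega>)" and q: "q \<in> {0..T}" for \<omega> q
  proof -
    have "\<bar>D (dyadic n q) \<omega>\<bar> \<le> e" for n
    proof -
      define i where "i = nat \<lfloor>2 ^ n * q / T\<rfloor>"
      have qT: "0 \<le> 2 ^ n * q / T" "2 ^ n * q / T \<le> 2 ^ n"
        using q T_pos by (simp_all add: field_simps)
      then have ri: "real i = real_of_int \<lfloor>2 ^ n * q / T\<rfloor>" by (simp add: i_def)
      have "real i \<le> 2 ^ n" using ri of_int_floor_le[of "2 ^ n * q / T"] qT by linarith
      then have "i \<le> 2 ^ n" by (metis of_nat_le_iff of_nat_numeral of_nat_power)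
      moreover have "t n i = dyadic n q"
        using \<open>real i \<le> 2 ^ n\<close> by (simp add: t_def dyadic_def ri[symmetric])
      moreover have "\<not> e < \<bar>D (t n i) \<omega>\<bar>"
      proof
        assume "e < \<bar>D (t n i) \<omega>\<bar>"
        moreover have "i < Suc (2 ^ n)" using \<open>i \<le> 2 ^ n\<close> by simp
        ultimately have "\<omega> \<in> B n" unfolding B_def using \<omega> by blast
        with \<omega> show False by blast
      qed
      ultimately show ?thesis by simp
    qed
    then show ?thesis
      using continuous_dyadic[OF continuous_on_rabs[OF cont] q]
      by (intro LIMSEQ_le_const2) auto
  qed
  moreover have "(\<Union>n. B n) \<in> sets M" using BM by blast
  ultimately show ?thesis by blast
qed

lemma simple_diff_martingale:
  assumes S: "simple_pair s S" and S': "simple_pair s' S'"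
  shows "L2_martingale (\<lambda>t \<omega>. S t \<omega> - S' t \<omega>)"
  unfolding L2_martingale_def
proof (intro conjI ballI allI impI)
  fix t assume t: "t \<in> {0..T}"
  show "(\<lambda>\<omega>. S t \<omega> - S' t \<omega>) \<in> borel_measurable (\<F> t)"
    using t by (intro borel_measurable_diff simple_integral_measurable_F[OF S] simple_integral_measurable_F[OF S']) auto
  show "sq_int M (\<lambda>\<omega>. S t \<omega> - S' t \<omega>)"
    using t by (intro sq_int_diff simple_integral_sq_int[OF S] simple_integral_sq_int[OF S']) auto
next
  fix q t Z assume qt: "0 \<le> q" "q \<le> t" "t \<le> T" and Z: "Z \<in> borel_measurable (\<F> q)" "sq_int M Z"
  have "expectation (\<lambda>\<omega>. (S u \<omega> - S' u \<omega>) * Z \<omega>) = expectation (\<lambda>\<omega>. S u \<omega> * Z \<omega>) - expectation (\<lambda>\<omega>. S' u \<omega> * Z \<omega>)"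
    if u: "0 \<le> u" "u \<le> T" for u
    using sq_int_mult[OF simple_integral_sq_int[OF S u] Z(2)] sq_int_mult[OF simple_integral_sq_int[OF S' u] Z(2)]
    by (simp add: left_diff_distrib)
  then show "expectation (\<lambda>\<omega>. (S t \<omega> - S' t \<omega>) * Z \<omega>) = expectation (\<lambda>\<omega>. (S q \<omega> - S' q \<omega>) * Z \<omega>)"
    using simple_martingale[OF S qt Z] simple_martingale[OF S' qt Z] qt by simp
qed

text \<open>A difference of simple processes over different partitions is not rewritten as a simple
  process: the square is expanded and the polarised isometry is applied to each product.\<close>

lemma simple_isometry_diff:
  assumes S: "simple_pair s S" and S': "simple_pair s' S'" and t: "0 \<le> t" "t \<le> T"
  shows "expectation (\<lambda>\<omega>. (S t \<omega> - S' t \<omega>)\<^sup>2) \<le> (\<integral>(q, \<omega>). (s q \<omega> - s' q \<omega>)\<^sup>2 \<partial>dt_P)"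
proof -
  define f where "f p = indicator {0..t} (fst p) * (case p of (q, \<omega>) \<Rightarrow> s q \<omega>)" for p :: "real \<times> 'a"
  define f' where "f' p = indicator {0..t} (fst p) * (case p of (q, \<omega>) \<Rightarrow> s' q \<omega>)" for p :: "real \<times> 'a"
  have ind: "sq_int dt_P (\<lambda>p. indicator {0..t} (fst p) * (case p of (q, \<omega>) \<Rightarrow> z q \<omega>))" if "simple_pair z Z" for z Z
  proof (rule sq_int_bound[OF simple_process_sq_int[OF that], of _ 1])
    show "(\<lambda>p. indicator {0..t} (fst p) * (case p of (q, \<omega>) \<Rightarrow> z q \<omega>)) \<in> borel_measurable dt_P"
      by (intro borel_measurable_times fst_dt_P_measurable sq_intD(1)[OF simple_process_sq_int[OF that]]) simp
  qed (auto simp: indicator_def)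
  have f: "sq_int dt_P f" "sq_int dt_P f'" unfolding f_def f'_def by (intro ind[OF S] ind[OF S'])+
  note SS = simple_integral_sq_int[OF S t] simple_integral_sq_int[OF S' t]
  have quad: "(\<integral>x. (X x - Y x)\<^sup>2 \<partial>N) = (\<integral>x. X x * X x \<partial>N) - 2 * (\<integral>x. X x * Y x \<partial>N) + (\<integral>x. Y x * Y x \<partial>N)"
    if X: "sq_int N X" and Y: "sq_int N Y" for X Y :: "'c \<Rightarrow> real" and N
  proof -
    have "(\<integral>x. (X x - Y x)\<^sup>2 \<partial>N) = (\<integral>x. X x * X x - 2 * (X x * Y x) + Y x * Y x \<partial>N)"
      by (simp add: power2_eq_square algebra_simps)
    then show ?thesis using sq_int_mult[OF X X] sq_int_mult[OF X Y] sq_int_mult[OF Y Y] by simp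
  qed
  have iso: "expectation (\<lambda>\<omega>. Z t \<omega> * Z' t \<omega>) =
      (\<integral>p. (indicator {0..t} (fst p) * (case p of (q, \<omega>) \<Rightarrow> z q \<omega>)) * (indicator {0..t} (fst p) * (case p of (q, \<omega>) \<Rightarrow> z' q \<omega>)) \<partial>dt_P)"
    if "simple_pair z Z" "simple_pair z' Z'" for z Z z' Z'
    unfolding simple_isometry[OF that t]
    by (intro Bochner_Integration.integral_cong) (auto simp: indicator_def)
  have "expectation (\<lambda>\<omega>. (S t \<omega> - S' t \<omega>)\<^sup>2) = (\<integral>p. (f p - f' p)\<^sup>2 \<partial>dt_P)"
  proof -
    have "expectation (\<lambda>\<omega>. S t \<omega> * S t \<omega>) = (\<integral>p. f p * f p \<partial>dt_P)"
      "expectation (\<lambda>\<omega>. S t \<omega> * S' t \<omega>) = (\<integral>p. f p * f' p \<partial>dt_P)"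
      "expectation (\<lambda>\<omega>. S' t \<omega> * S' t \<omega>) = (\<integral>p. f' p * f' p \<partial>dt_P)"
      unfolding f_def f'_def by (rule iso[OF S S], rule iso[OF S S'], rule iso[OF S' S'])
    then show ?thesis unfolding quad[OF SS] quad[OF f] by (simp only:)
  qed
  also have "\<dots> \<le> (\<integral>p. ((case p of (q, \<omega>) \<Rightarrow> s q \<omega>) - (case p of (q, \<omega>) \<Rightarrow> s' q \<omega>))\<^sup>2 \<partial>dt_P)"
  proof (rule integral_mono)
    show "integrable dt_P (\<lambda>p. (f p - f' p)\<^sup>2)" using sq_intD(2)[OF sq_int_diff[OF f]] .
    show "integrable dt_P (\<lambda>p. ((case p of (q, \<omega>) \<Rightarrow> s q \<omega>) - (case p of (q, \<omega>) \<Rightarrow> s' q \<omega>))\<^sup>2)"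
      using sq_intD(2)[OF sq_int_diff[OF simple_process_sq_int[OF S] simple_process_sq_int[OF S']]] .
    show "(f p - f' p)\<^sup>2 \<le> ((case p of (q, \<omega>) \<Rightarrow> s q \<omega>) - (case p of (q, \<omega>) \<Rightarrow> s' q \<omega>))\<^sup>2" for p
      by (simp add: f_def f'_def indicator_def)
  qed
  finally show ?thesis by (simp add: case_prod_beta')
qed

text \<open>Approximation at a geometric rate makes the bounds of the maximal inequality summable,
  so that by Borel-Cantelli the simple integrals converge uniformly on almost every path. The limit
  is therefore continuous, and Fatou's lemma identifies it as the limit in mean square at every
  time.\<close>

theorem ito_exists:
  assumes v: "v \<in> L2F"
  shows "\<exists>I. ito_integral v I"
proof -
  define V where "V p = (case p of (t, \<omega>) \<Rightarrow> v t \<omega>)" for p :: "real \<times> 'a"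
  have Vsq: "sq_int dt_P V" unfolding V_def by (rule L2F_D(2)[OF v])
  \<comment> \<open>The rate 1/8 is chosen against the thresholds \<open>(1/2)^m\<close> below: the
    maximal inequality divides by \<open>(1/4)^m\<close>, which leaves exceptional probabilities of
    order \<open>(1/2)^m\<close>.\<close>
  have "\<forall>m::nat. \<exists>s S. simple_pair s S \<and> (\<integral>(t, \<omega>). (s t \<omega> - v t \<omega>)\<^sup>2 \<partial>dt_P) < (1/8)^m"
  proof
    fix m :: nat
    have "(1/8::real)^m > 0" by simp
    from simple_approx[OF v this]
    show "\<exists>s S. simple_pair s S \<and> (\<integral>(t, \<omega>). (s t \<omega> - v t \<omega>)\<^sup>2 \<partial>dt_P) < (1/8)^m" by blast
  qed
  then have "\<forall>m::nat. \<exists>z. simple_pair (fst z) (snd z) \<and> (\<integral>(t, \<omega>). (fst z t \<omega> - v t \<omega>)\<^sup>2 \<partial>dt_P) < (1/8)^m"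
    by simp
  from choice[OF this] obtain z where *: "\<forall>m. simple_pair (fst (z m)) (snd (z m)) \<and>
      (\<integral>(t, \<omega>). (fst (z m) t \<omega> - v t \<omega>)\<^sup>2 \<partial>dt_P) < (1/8)^m"
    by blast
  define s where "s m = fst (z m)" for m
  define S where "S m = snd (z m)" for m
  have sS: "simple_pair (s m) (S m)" and sv: "(\<integral>(t, \<omega>). (s m t \<omega> - v t \<omega>)\<^sup>2 \<partial>dt_P) < (1/8)^m" for m
    using * unfolding s_def S_def by blast+
  define s' where "s' m p = (case p of (t, \<omega>) \<Rightarrow> s m t \<omega>)" for m and p :: "real \<times> 'a"
  have s'sq: "sq_int dt_P (s' m)" for m unfolding s'_def by (rule simple_process_sq_int[OF sS])
  have s'V: "(\<integral>p. (s' m p - V p)\<^sup>2 \<partial>dt_P) < (1/8)^m" for m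
    using sv[of m] by (simp add: s'_def V_def case_prod_beta')
  have ss: "(\<integral>p. (s' m p - s' l p)\<^sup>2 \<partial>dt_P) \<le> 4 * (1/8)^k" if "k \<le> m" "k \<le> l" for k m l
  proof -
    have sq: "sq_int dt_P (\<lambda>p. s' m p - V p)" "sq_int dt_P (\<lambda>p. s' l p - V p)"
      by (intro sq_int_diff s'sq Vsq)+
    have "(\<integral>p. (s' m p - s' l p)\<^sup>2 \<partial>dt_P) \<le> (\<integral>p. 2 * (s' m p - V p)\<^sup>2 + 2 * (s' l p - V p)\<^sup>2 \<partial>dt_P)"
    proof (rule integral_mono)
      show "integrable dt_P (\<lambda>p. (s' m p - s' l p)\<^sup>2)" by (rule sq_intD(2)[OF sq_int_diff[OF s'sq s'sq]])
      show "integrable dt_P (\<lambda>p. 2 * (s' m p - V p)\<^sup>2 + 2 * (s' l p - V p)\<^sup>2)"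
        by (intro Bochner_Integration.integrable_add integrable_mult_right sq_intD(2)[OF sq(1)] sq_intD(2)[OF sq(2)])
      show "(s' m p - s' l p)\<^sup>2 \<le> 2 * (s' m p - V p)\<^sup>2 + 2 * (s' l p - V p)\<^sup>2" for p
        using zero_le_power2[of "(s' m p - V p) + (s' l p - V p)"] by (simp add: power2_eq_square algebra_simps)
    qed
    also have "\<dots> = 2 * (\<integral>p. (s' m p - V p)\<^sup>2 \<partial>dt_P) + 2 * (\<integral>p. (s' l p - V p)\<^sup>2 \<partial>dt_P)"
      using sq_intD(2)[OF sq(1)] sq_intD(2)[OF sq(2)] by simp
    also have "\<dots> \<le> 2 * (1/8)^k + 2 * (1/8)^k"
    proof -
      have "(1/8::real)^m \<le> (1/8)^k" "(1/8::real)^l \<le> (1/8)^k"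
        by (rule power_decreasing; use that in simp)+
      then show ?thesis using s'V[of m] s'V[of l] by linarith
    qed
    finally show ?thesis by simp
  qed
  have SS: "expectation (\<lambda>\<omega>. (S m t \<omega> - S l t \<omega>)\<^sup>2) \<le> 4 * (1/8)^k" if "k \<le> m" "k \<le> l" "t \<in> {0..T}" for k m l t
    using simple_isometry_diff[OF sS sS, of t m l] that ss[of k m l]
    by (auto simp: s'_def case_prod_beta' intro: order_trans)
  obtain N0 where N0: "N0 \<in> null_sets M" "{\<omega> \<in> space M. \<not> continuous_on {0..T} (\<lambda>t. W t \<omega>)} \<subseteq> N0"
    using W_continuous by (auto elim!: AE_E)
  have contS: "continuous_on {0..T} (\<lambda>t. S m t \<omega>)" if \<omega>: "\<omega> \<in> space M - N0" for m \<omega>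
  proof -
    obtain k \<tau> \<xi> where *: "simple_integrand k \<tau> \<xi>" "S m = simple_integral k \<tau> \<xi>"
      using sS[of m] unfolding simple_pair_def by blast
    have cW: "continuous_on {0..T} (\<lambda>t. W t \<omega>)" using \<omega> N0(2) by blast
    have "continuous_on {0..T} (\<lambda>t. W (min t b) \<omega>)" if "0 \<le> b" for b
      using that by (intro continuous_on_compose2[OF cW] continuous_intros) auto
    then have "continuous_on {0..T} (\<lambda>t. \<xi> j \<omega> * (W (min t (\<tau> (Suc j))) \<omega> - W (min t (\<tau> j)) \<omega>))" if "j < k" for j
      using simple_integrandD(1,2)[OF *(1) that] by (intro continuous_intros) auto
    then show ?thesis
      unfolding *(2) simple_integral_def by (intro continuous_on_sum) auto
  qed
  have "\<exists>B. B \<in> sets M \<and> ((1/2)^m)\<^sup>2 * prob B \<le> 4 * (1/8)^m \<and>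
    (\<forall>\<omega> t. \<omega> \<in> space M - B \<longrightarrow> \<omega> \<in> space M - N0 \<longrightarrow> t \<in> {0..T} \<longrightarrow> \<bar>S (Suc m) t \<omega> - S m t \<omega>\<bar> \<le> (1/2)^m)" for m
  proof -
    have e: "(1/2::real)^m > 0" by simp
    obtain B where B: "B \<in> sets M" "((1/2)^m)\<^sup>2 * prob B \<le> expectation (\<lambda>\<omega>. (S (Suc m) T \<omega> - S m T \<omega>)\<^sup>2)"
      and Bc: "\<forall>\<omega>\<in>space M - B. continuous_on {0..T} (\<lambda>t. S (Suc m) t \<omega> - S m t \<omega>) \<longrightarrow>
        (\<forall>t\<in>{0..T}. \<bar>S (Suc m) t \<omega> - S m t \<omega>\<bar> \<le> (1/2)^m)"
      using doob_maximal[OF simple_diff_martingale[OF sS[of "Suc m"] sS[of m]] e] by blast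
    have "((1/2)^m)\<^sup>2 * prob B \<le> 4 * (1/8)^m"
      using B(2) SS[of m "Suc m" m T] T_pos by simp
    moreover have "continuous_on {0..T} (\<lambda>t. S (Suc m) t \<omega> - S m t \<omega>)" if "\<omega> \<in> space M - N0" for \<omega>
      using contS[OF that] by (intro continuous_on_diff)
    ultimately show ?thesis
      using B(1) Bc by blast
  qed
  then have "\<forall>m. \<exists>B. B \<in> sets M \<and> ((1/2)^m)\<^sup>2 * prob B \<le> 4 * (1/8)^m \<and>
    (\<forall>\<omega> t. \<omega> \<in> space M - B \<longrightarrow> \<omega> \<in> space M - N0 \<longrightarrow> t \<in> {0..T} \<longrightarrow> \<bar>S (Suc m) t \<omega> - S m t \<omega>\<bar> \<le> (1/2)^m)"
    by blast
  from choice[OF this] obtain B where *: "\<forall>m. B m \<in> sets M \<and> ((1/2)^m)\<^sup>2 * prob (B m) \<le> 4 * (1/8)^m \<and>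
    (\<forall>\<omega> t. \<omega> \<in> space M - B m \<longrightarrow> \<omega> \<in> space M - N0 \<longrightarrow> t \<in> {0..T} \<longrightarrow> \<bar>S (Suc m) t \<omega> - S m t \<omega>\<bar> \<le> (1/2)^m)"
    by blast
  have B: "B m \<in> sets M" "((1/2)^m)\<^sup>2 * prob (B m) \<le> 4 * (1/8)^m" for m
    using * by blast+
  have Bd: "\<bar>S (Suc m) t \<omega> - S m t \<omega>\<bar> \<le> (1/2)^m"
    if "\<omega> \<in> space M - B m" "\<omega> \<in> space M - N0" "t \<in> {0..T}" for m \<omega> t
    using * that by blast
  have "prob (B m) \<le> 4 * (1/2)^m" for m
  proof -
    have "((1/2::real)^m)\<^sup>2 = (1/4)^m" by (simp add: power2_eq_square flip: power_mult_distrib)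
    then have "(1/4)^m * prob (B m) \<le> 4 * (1/8)^m" using B(2)[of m] by simp
    also have "(1/8::real)^m = (1/4)^m * (1/2)^m" by (simp flip: power_mult_distrib)
    finally have "(1/4)^m * prob (B m) \<le> (1/4)^m * (4 * (1/2)^m)" by (simp only: mult.left_commute)
    then show ?thesis by (subst (asm) mult_le_cancel_left_pos) simp_all
  qed
  moreover have "summable (\<lambda>m. 4 * (1/2::real)^m)" by (intro summable_mult summable_geometric) simp
  ultimately have "summable (\<lambda>m. prob (B m))"
    using summable_comparison_test'[of "\<lambda>m. 4 * (1/2::real)^m" 0 "\<lambda>m. prob (B m)"] by simp
  then have "AE \<omega> in M. \<forall>\<^sub>F m in sequentially. \<omega> \<in> space M - B m"
    by (intro borel_cantelli_AE1 B(1)) (simp_all add: emeasure_eq_measure)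
  then obtain N1 where N1: "N1 \<in> null_sets M"
    "{\<omega> \<in> space M. \<not> (\<forall>\<^sub>F m in sequentially. \<omega> \<in> space M - B m)} \<subseteq> N1"
    unfolding eventually_ae_filter by blast
  define N where "N = N0 \<union> N1"
  have N: "N \<in> null_sets M" unfolding N_def using N0(1) N1(1) by (rule null_sets.Un)
  have AEN: "AE \<omega> in M. \<omega> \<in> space M - N" using AE_not_in[OF N] AE_space by eventually_elim simp
  \<comment> \<open>The limit as a telescoping series; the value 0 on the exceptional set makes
    every path continuous.\<close>
  define I where "I t \<omega> = (if \<omega> \<in> space M - N then S 0 t \<omega> + (\<Sum>m. S (Suc m) t \<omega> - S m t \<omega>) else 0)" for t \<omega>
  have unif: "uniform_limit {0..T} (\<lambda>m t. S m t \<omega>) (\<lambda>t. I t \<omega>) sequentially" if \<omega>: "\<omega> \<in> space M - N" for \<omega>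
  proof -
    have \<omega>': "\<omega> \<in> space M - N0" "\<forall>\<^sub>F m in sequentially. \<omega> \<in> space M - B m"
      using \<omega> N1(2) by (auto simp: N_def)
    have tel: "(\<Sum>m<n. S (Suc m) t \<omega> - S m t \<omega>) = S n t \<omega> - S 0 t \<omega>" for n t
      by (rule sum_lessThan_telescope[of "\<lambda>m. S m t \<omega>"])
    have "uniform_limit {0..T} (\<lambda>n t. \<Sum>m<n. S (Suc m) t \<omega> - S m t \<omega>) (\<lambda>t. \<Sum>m. S (Suc m) t \<omega> - S m t \<omega>) sequentially"
    proof (rule Weierstrass_m_test_ev)
      show "\<forall>\<^sub>F m in sequentially. \<forall>t\<in>{0..T}. norm (S (Suc m) t \<omega> - S m t \<omega>) \<le> (1/2)^m"
        using \<omega>'(2) by eventually_elim (use Bd[OF _ \<omega>'(1)] in auto)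
      show "summable (\<lambda>m. (1/2::real)^m)" by (rule summable_geometric) simp
    qed
    then have "uniform_limit {0..T} (\<lambda>n t. S n t \<omega> - S 0 t \<omega>) (\<lambda>t. \<Sum>m. S (Suc m) t \<omega> - S m t \<omega>) sequentially"
      by (simp only: tel)
    from uniform_limit_add[OF uniform_limit_const this]
    have "uniform_limit {0..T} (\<lambda>n t. S 0 t \<omega> + (S n t \<omega> - S 0 t \<omega>)) (\<lambda>t. S 0 t \<omega> + (\<Sum>m. S (Suc m) t \<omega> - S m t \<omega>)) sequentially" .
    then show ?thesis using \<omega> by (simp add: I_def)
  qed
  have contI: "continuous_on {0..T} (\<lambda>t. I t \<omega>)" for \<omega>
  proof (cases "\<omega> \<in> space M - N")
    case True
    have "\<forall>\<^sub>F m in sequentially. continuous_on {0..T} (\<lambda>t. S m t \<omega>)"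
      using contS True by (simp add: N_def)
    then show ?thesis by (rule uniform_limit_theorem[OF _ unif[OF True]]) simp
  next
    case False
    then have "(\<lambda>t. I t \<omega>) = (\<lambda>t. 0)" unfolding I_def by (simp only: if_False)
    then show ?thesis by (simp only: continuous_on_const)
  qed
  have lim: "(\<lambda>m. S m t \<omega>) \<longlonglongrightarrow> I t \<omega>" if "\<omega> \<in> space M - N" "t \<in> {0..T}" for t \<omega>
    by (rule tendsto_uniform_limitI[OF unif[OF that(1)] that(2)])
  have SF: "S m t \<in> borel_measurable (\<F> t)" if "t \<in> {0..T}" for m t
    using that by (intro simple_integral_measurable_F[OF sS]) auto
  have IF: "I t \<in> borel_measurable (\<F> t)" if t: "t \<in> {0..T}" for t
  \<comment> \<open>Convergence is known only off \<open>N\<close>. Setting the approximants to 0 on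
    \<open>N\<close> keeps them measurable in the completed \<open>\<F> t\<close> and makes the
    convergence hold everywhere.\<close>
  proof (rule borel_measurable_LIMSEQ_real)
    show "(\<lambda>\<omega>. if \<omega> \<in> space M - N then S m t \<omega> else 0) \<in> borel_measurable (\<F> t)" for m
      by (rule F_measurable_AE_eq[OF SF[OF t, of m]]) (use AEN in eventually_elim, simp)
    fix \<omega>
    show "(\<lambda>m. if \<omega> \<in> space M - N then S m t \<omega> else 0) \<longlonglongrightarrow> I t \<omega>"
    proof (cases "\<omega> \<in> space M - N")
      case True
      with lim[OF True t] show ?thesis by simp
    next
      case False
      then have "I t \<omega> = 0" unfolding I_def by (simp only: if_False)
      with False show ?thesis by (simp only: if_False tendsto_const)
    qed
  qed
  have Iad: "adapted I"
    unfolding adapted_def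
  proof (intro conjI ballI IF)
    show "(\<lambda>(t, \<omega>). I t \<omega>) \<in> borel_measurable dt_P"
    proof (rule continuous_paths_measurable[OF _ contI])
      show "I t \<in> borel_measurable M" if "t \<in> {0..T}" for t
        by (rule F_measurable_M[OF _ IF[OF that]]) (use that in simp)
    qed
  qed
  have L2: "L2_tendsto M (\<lambda>m. S m t) (I t)" if t: "t \<in> {0..T}" for t
  proof -
    have Ssq: "sq_int M (S m t)" for m using t by (intro simple_integral_sq_int[OF sS]) auto
    have est: "sq_int M (\<lambda>\<omega>. S m t \<omega> - I t \<omega>)" "expectation (\<lambda>\<omega>. (S m t \<omega> - I t \<omega>)\<^sup>2) \<le> 4 * (1/8)^m" for m
    proof -
      have m: "(\<lambda>\<omega>. S m t \<omega> - I t \<omega>) \<in> borel_measurable M"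
        by (intro borel_measurable_diff sq_intD(1)[OF Ssq] adaptedD(3)[OF Iad t])
      have l: "AE \<omega> in M. (\<lambda>l. S m t \<omega> - S l t \<omega>) \<longlonglongrightarrow> S m t \<omega> - I t \<omega>"
        using AEN by eventually_elim (intro tendsto_diff tendsto_const lim t)
      show "sq_int M (\<lambda>\<omega>. S m t \<omega> - I t \<omega>)" "expectation (\<lambda>\<omega>. (S m t \<omega> - I t \<omega>)\<^sup>2) \<le> 4 * (1/8)^m"
        by (rule L2_Fatou[OF sq_int_diff[OF Ssq Ssq] m SS[OF order_refl _ t] l]; simp)+
    qed
    have "sq_int M (I t)"
      using sq_int_diff[OF Ssq[of 0] est(1)[of 0]] by simp
    moreover have "(\<lambda>m. expectation (\<lambda>\<omega>. (S m t \<omega> - I t \<omega>)\<^sup>2)) \<longlonglongrightarrow> 0"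
    proof (rule tendsto_sandwich[of "\<lambda>_. 0"])
      show "(\<lambda>m. 4 * (1/8::real)^m) \<longlonglongrightarrow> 0"
        by (intro tendsto_mult_right_zero LIMSEQ_realpow_zero) simp_all
    qed (use est(2) in auto)
    ultimately show ?thesis using Ssq by (simp add: L2_tendsto_def)
  qed
  have L2v: "L2_tendsto dt_P s' V"
  proof -
    have "(\<lambda>m. \<integral>p. (s' m p - V p)\<^sup>2 \<partial>dt_P) \<longlonglongrightarrow> 0"
    proof (rule tendsto_sandwich[of "\<lambda>_. 0"])
      show "(\<lambda>m. (1/8::real)^m) \<longlonglongrightarrow> 0" by (rule LIMSEQ_realpow_zero) simp_all
    qed (use s'V in \<open>auto intro!: always_eventually less_imp_le\<close>)
    then show ?thesis using s'sq Vsq by (simp add: L2_tendsto_def)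
  qed
  \<comment> \<open>\<open>simple_pair\<close> hides the representation that the definition of
    \<open>ito_integral\<close> asks for, so one is chosen for each index.\<close>
  have "\<forall>m. \<exists>y. simple_integrand (fst y) (fst (snd y)) (snd (snd y)) \<and>
      s m = simple_process (fst y) (fst (snd y)) (snd (snd y)) \<and>
      S m = simple_integral (fst y) (fst (snd y)) (snd (snd y))"
    using sS unfolding simple_pair_def by fastforce
  from choice[OF this] obtain y where y: "\<forall>m. simple_integrand (fst (y m)) (fst (snd (y m))) (snd (snd (y m))) \<and>
      s m = simple_process (fst (y m)) (fst (snd (y m))) (snd (snd (y m))) \<and>
      S m = simple_integral (fst (y m)) (fst (snd (y m))) (snd (snd (y m)))"
    by blast
  define k where "k m = fst (y m)" for m
  define \<tau> where "\<tau> m = fst (snd (y m))" for m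
  define \<xi> where "\<xi> m = snd (snd (y m))" for m
  have k: "simple_integrand (k m) (\<tau> m) (\<xi> m)"
    "s m = simple_process (k m) (\<tau> m) (\<xi> m)" "S m = simple_integral (k m) (\<tau> m) (\<xi> m)" for m
    using y unfolding k_def \<tau>_def \<xi>_def by blast+
  have "ito_integral v I"
    unfolding ito_integral_def
  proof (intro conjI v Iad exI allI ballI)
    show "AE \<omega> in M. continuous_on {0..T} (\<lambda>t. I t \<omega>)" by (intro AE_I2 contI)
    show "simple_integrand (k m) (\<tau> m) (\<xi> m)" for m by (rule k)
    show "(\<lambda>m. \<integral>\<^sup>+ (t, \<omega>). ennreal ((simple_process (k m) (\<tau> m) (\<xi> m) t \<omega> - v t \<omega>)\<^sup>2) \<partial>dt_P) \<longlonglongrightarrow> 0"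
      using L2_tendsto_nnD[OF L2v] by (simp add: s'_def V_def k(2) case_prod_beta')
    show "(\<lambda>m. \<integral>\<^sup>+ \<omega>. ennreal ((simple_integral (k m) (\<tau> m) (\<xi> m) t \<omega> - I t \<omega>)\<^sup>2) \<partial>M) \<longlonglongrightarrow> 0"
      if "t \<in> {0..T}" for t
      using L2_tendsto_nnD[OF L2[OF that]] by (simp add: k(3))
  qed
  then show ?thesis by blast
qed

end

subsection \<open>Linear equations and the energy estimate\<close>

lemma set_integrable_const_Icc: "set_integrable lborel {a..b::real} (\<lambda>_. c::real)"
  unfolding set_integrable_def
  by (rule integrableI_bounded_set_indicator[where B = "\<bar>c\<bar>"]) (auto simp: emeasure_lborel_Icc_eq)

text \<open>Integrating factor: the product of \<open>D - c\<close> and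
  \<open>exp (- R) - 1\<close>, both indefinite integrals, is evaluated by parts and collapses to
  \<open>D t * exp (- R t) = c\<close>. As \<open>g\<close> is merely integrable, no derivative is
  taken.\<close>

lemma linear_ode_unique:
  fixes g D :: "real \<Rightarrow> real"
  defines "R t \<equiv> LBINT s:{0..t}. g s"
  assumes g: "set_integrable lborel {0..T} g" and D: "continuous_on {0..T} D"
    and eq: "\<And>t. t \<in> {0..T} \<Longrightarrow> D t = c + (LBINT s:{0..t}. g s * D s)" and t: "t \<in> {0..T}"
  shows "D t = c * exp (R t)"
proof -
  have cR: "continuous_on {0..T} R"
    unfolding R_def by (rule continuous_on_set_lebesgue_integral[OF g])
  have ng: "set_integrable lborel {0..T} (\<lambda>s. - g s)"
    using set_integrable_mult_right[of "-1" lborel "{0..T}" g] g by simp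
  have nR: "(LBINT s:{0..q}. - g s) = - R q" if "q \<in> {0..T}" for q
    unfolding R_def by (rule set_integral_uminus) (rule set_integrable_subset[OF g], use that in auto)
  have u: "set_integrable lborel {0..T} (\<lambda>s. D s * g s)"
    by (rule set_integrable_continuous_mult[OF g D])
  have v: "set_integrable lborel {0..T} (\<lambda>s. exp (- R s) * (- g s))"
    by (intro set_integrable_continuous_mult[OF ng] continuous_intros cR)
  have U: "(LBINT s:{0..q}. D s * g s) = D q - c" if "q \<in> {0..T}" for q
    using eq[OF that] by (simp add: mult.commute)
  have V: "(LBINT s:{0..q}. exp (- R s) * (- g s)) = exp (- R q) - 1" if q: "q \<in> {0..T}" for q
  proof -
    have "exp (LBINT s:{0..q}. - g s) = 1 + (LBINT s:{0..q}. - g s * exp (LBINT y:{0..s}. - g y))"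
      by (rule set_lebesgue_integral_exp[OF ng q])
    also have "(LBINT s:{0..q}. - g s * exp (LBINT y:{0..s}. - g y)) = (LBINT s:{0..q}. exp (- R s) * (- g s))"
      using q by (intro set_lebesgue_integral_cong) (auto simp: nR)
    finally show ?thesis using nR[OF q] by simp
  qed
  have "(D t - c) * (exp (- R t) - 1) =
      (LBINT s:{0..t}. D s * g s * (LBINT y:{0..s}. exp (- R y) * (- g y)) + (LBINT y:{0..s}. D y * g y) * (exp (- R s) * (- g s)))"
    using set_lebesgue_integral_by_parts[OF u v t] unfolding U[OF t] V[OF t] .
  also have "\<dots> = (LBINT s:{0..t}. - (D s * g s) - c * (exp (- R s) * (- g s)))"
  proof (rule set_lebesgue_integral_cong)
    show "\<forall>s. s \<in> {0..t} \<longrightarrow> D s * g s * (LBINT y:{0..s}. exp (- R y) * (- g y)) + (LBINT y:{0..s}. D y * g y) * (exp (- R s) * (- g s)) =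
        - (D s * g s) - c * (exp (- R s) * (- g s))"
    proof (intro allI impI)
      fix s assume "s \<in> {0..t}"
      then have "s \<in> {0..T}" using t by auto
      show "D s * g s * (LBINT y:{0..s}. exp (- R y) * (- g y)) + (LBINT y:{0..s}. D y * g y) * (exp (- R s) * (- g s)) =
        - (D s * g s) - c * (exp (- R s) * (- g s))"
        unfolding U[OF \<open>s \<in> {0..T}\<close>] V[OF \<open>s \<in> {0..T}\<close>] by (simp add: algebra_simps)
    qed
  qed simp
  also have "\<dots> = - (D t - c) - c * (exp (- R t) - 1)"
  proof -
    have st: "{0..t} \<subseteq> {0..T}" using t by auto
    have 1: "set_integrable lborel {0..t} (\<lambda>s. - (D s * g s))"
      using set_integrable_mult_right[of "-1", OF set_integrable_subset[OF u _ st]] by simp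
    have 2: "set_integrable lborel {0..t} (\<lambda>s. c * (exp (- R s) * (- g s)))"
      using set_integrable_subset[OF v _ st] by (intro set_integrable_mult_right) simp_all
    have "(LBINT s:{0..t}. - (D s * g s) - c * (exp (- R s) * (- g s))) =
        (LBINT s:{0..t}. - (D s * g s)) - (LBINT s:{0..t}. c * (exp (- R s) * (- g s)))"
      by (rule set_integral_diff(2)[OF 1 2])
    also have "(LBINT s:{0..t}. - (D s * g s)) = - (D t - c)"
      unfolding U[OF t, symmetric] by (rule set_integral_uminus[OF set_integrable_subset[OF u _ st]]) simp
    also have "(LBINT s:{0..t}. c * (exp (- R s) * (- g s))) = c * (exp (- R t) - 1)"
      unfolding V[OF t, symmetric] by (rule set_integral_mult_right)
    finally show ?thesis .
  qed
  finally have "D t * exp (- R t) = c" by (simp add: algebra_simps)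
  then show ?thesis by (simp add: exp_minus field_simps)
qed

text \<open>Variation of constants for a forcing path \<open>F\<close> that is merely continuous:
  \<open>X\<close> contains a time integral of \<open>F\<close> but no increment of
  \<open>F\<close>. Hence \<open>F\<close> may later contain a stochastic integral, and the equation
  is solved path by path.\<close>

lemma linear_ode_exists:
  fixes g F :: "real \<Rightarrow> real"
  defines "R t \<equiv> LBINT s:{0..t}. g s"
  defines "X t \<equiv> F t + exp (R t) * (LBINT s:{0..t}. exp (- R s) * g s * F s)"
  assumes g: "set_integrable lborel {0..T} g" and F: "continuous_on {0..T} F"
  shows "continuous_on {0..T} X" "t \<in> {0..T} \<Longrightarrow> X t = F t + (LBINT s:{0..t}. g s * X s)"
proof -
  have cR: "continuous_on {0..T} R"
    unfolding R_def by (rule continuous_on_set_lebesgue_integral[OF g])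
  have v: "set_integrable lborel {0..T} (\<lambda>s. exp (- R s) * g s * F s)"
  proof -
    have "set_integrable lborel {0..T} (\<lambda>s. (exp (- R s) * F s) * g s)"
      by (intro set_integrable_continuous_mult[OF g] continuous_intros cR F)
    then show ?thesis by (simp add: mult_ac)
  qed
  have u: "set_integrable lborel {0..T} (\<lambda>s. g s * exp (R s))"
  proof -
    have "set_integrable lborel {0..T} (\<lambda>s. exp (R s) * g s)"
      by (intro set_integrable_continuous_mult[OF g] continuous_intros cR)
    then show ?thesis by (simp add: mult_ac)
  qed
  define H where "H t = (LBINT s:{0..t}. exp (- R s) * g s * F s)" for t
  have cH: "continuous_on {0..T} H"
    unfolding H_def by (rule continuous_on_set_lebesgue_integral[OF v])
  show cX: "continuous_on {0..T} X"
    unfolding X_def H_def[symmetric] by (intro continuous_intros F cR cH)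
  assume t: "t \<in> {0..T}"
  then have st: "{0..t} \<subseteq> {0..T}" by auto
  have U: "(LBINT s:{0..q}. g s * exp (R s)) = exp (R q) - 1" if "q \<in> {0..T}" for q
    using set_lebesgue_integral_exp[OF g that] unfolding R_def by simp
  have "(exp (R t) - 1) * H t = (LBINT s:{0..t}. g s * exp (R s) * H s + (LBINT y:{0..s}. g y * exp (R y)) * (exp (- R s) * g s * F s))"
    using set_lebesgue_integral_by_parts[OF u v t] unfolding U[OF t] H_def[symmetric] .
  also have "\<dots> = (LBINT s:{0..t}. g s * X s - exp (- R s) * g s * F s)"
  proof (rule set_lebesgue_integral_cong)
    show "\<forall>s. s \<in> {0..t} \<longrightarrow> g s * exp (R s) * H s + (LBINT y:{0..s}. g y * exp (R y)) * (exp (- R s) * g s * F s) =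
        g s * X s - exp (- R s) * g s * F s"
    proof (intro allI impI)
      fix s assume "s \<in> {0..t}"
      then have "s \<in> {0..T}" using t by auto
      show "g s * exp (R s) * H s + (LBINT y:{0..s}. g y * exp (R y)) * (exp (- R s) * g s * F s) =
        g s * X s - exp (- R s) * g s * F s"
        unfolding U[OF \<open>s \<in> {0..T}\<close>] X_def H_def[symmetric]
        by (simp add: algebra_simps exp_minus)
    qed
  qed simp
  also have "\<dots> = (LBINT s:{0..t}. g s * X s) - H t"
    unfolding H_def
  proof (rule set_integral_diff(2))
    have "set_integrable lborel {0..T} (\<lambda>s. X s * g s)" by (rule set_integrable_continuous_mult[OF g cX])
    then have "set_integrable lborel {0..T} (\<lambda>s. g s * X s)" by (simp add: mult.commute)
    then show "set_integrable lborel {0..t} (\<lambda>s. g s * X s)" by (rule set_integrable_subset) (use st in auto)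
    show "set_integrable lborel {0..t} (\<lambda>s. exp (- R s) * g s * F s)"
      by (rule set_integrable_subset[OF v]) (use st in auto)
  qed
  finally have "exp (R t) * H t = (LBINT s:{0..t}. g s * X s)" by (simp add: algebra_simps)
  then show "X t = F t + (LBINT s:{0..t}. g s * X s)"
    by (simp add: X_def H_def)
qed

context brownian_space
begin

text \<open>Tonelli on the product measure. It places time integrals and stochastic integrals back
  into \<open>L2F\<close>, so that they can serve as factors in \<open>L2F_product\<close>.\<close>

lemma L2F_bounded_moment:
  assumes X: "adapted X" and sq: "\<And>t. t \<in> {0..T} \<Longrightarrow> sq_int M (X t)"
    and C: "\<And>t. t \<in> {0..T} \<Longrightarrow> expectation (\<lambda>\<omega>. (X t \<omega>)\<^sup>2) \<le> C"
  shows "X \<in> L2F"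
proof -
  have m: "(\<lambda>(t, \<omega>). X t \<omega>) \<in> borel_measurable (time_measure \<Otimes>\<^sub>M M)"
    using adaptedD(1)[OF X] by (simp only: dt_P_eq)
  have m2: "(\<lambda>p. ennreal ((case p of (t, \<omega>) \<Rightarrow> X t \<omega>)\<^sup>2)) \<in> borel_measurable (time_measure \<Otimes>\<^sub>M M)"
    using m by measurable
  have "(\<integral>\<^sup>+ p. ennreal ((case p of (t, \<omega>) \<Rightarrow> X t \<omega>)\<^sup>2) \<partial>dt_P) =
      (\<integral>\<^sup>+ t. (\<integral>\<^sup>+ \<omega>. ennreal ((X t \<omega>)\<^sup>2) \<partial>M) \<partial>time_measure)"
    unfolding dt_P_eq using nn_integral_fst[OF m2] by simp
  also have "\<dots> \<le> (\<integral>\<^sup>+ t. ennreal C \<partial>time_measure)"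
  proof (rule nn_integral_mono)
    fix t assume "t \<in> space time_measure"
    then have t: "t \<in> {0..T}" by simp
    have "(\<integral>\<^sup>+ \<omega>. ennreal ((X t \<omega>)\<^sup>2) \<partial>M) = ennreal (expectation (\<lambda>\<omega>. (X t \<omega>)\<^sup>2))"
      using sq_intD(2)[OF sq[OF t]] by (intro nn_integral_eq_integral) auto
    also have "\<dots> \<le> ennreal C" by (rule ennreal_leI[OF C[OF t]])
    finally show "(\<integral>\<^sup>+ \<omega>. ennreal ((X t \<omega>)\<^sup>2) \<partial>M) \<le> ennreal C" .
  qed
  also have "\<dots> = ennreal C * emeasure time_measure {0..T}" by simp
  also have "\<dots> < \<infinity>"
    by (simp add: time.emeasure_eq_measure ennreal_mult_less_top)
  finally have "sq_int dt_P (\<lambda>(t, \<omega>). X t \<omega>)"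
    by (rule sq_intI_nn[OF adaptedD(1)[OF X]])
  with X show ?thesis by (simp add: L2F_iff)
qed

lemma L2F_product:
  assumes X: "X \<in> L2F" and Y: "Y \<in> L2F" and t: "t \<in> {0..T}"
  shows "integrable dt_P (\<lambda>(s, \<omega>). X s \<omega> * Y s \<omega>)"
    and "set_integrable lborel {0..T} (\<lambda>s. expectation (\<lambda>\<omega>. X s \<omega> * Y s \<omega>))"
    and "expectation (\<lambda>\<omega>. LBINT s:{0..t}. X s \<omega> * Y s \<omega>) = (LBINT s:{0..t}. expectation (\<lambda>\<omega>. X s \<omega> * Y s \<omega>))"
    and "(\<integral>(s, \<omega>). indicator {0..t} s * (X s \<omega> * Y s \<omega>) \<partial>dt_P) = (LBINT s:{0..t}. expectation (\<lambda>\<omega>. X s \<omega> * Y s \<omega>))"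
    and "(\<lambda>\<omega>. LBINT s:{0..t}. X s \<omega> * Y s \<omega>) \<in> borel_measurable M"
proof -
  have XY: "integrable dt_P (\<lambda>p. X (fst p) (snd p) * Y (fst p) (snd p))"
    using sq_int_mult[OF L2F_D(2)[OF X] L2F_D(2)[OF Y]] by (simp add: case_prod_beta')
  then show XY': "integrable dt_P (\<lambda>(s, \<omega>). X s \<omega> * Y s \<omega>)" by (simp add: case_prod_beta')
  have "integrable dt_P (\<lambda>p. indicator {0..t} (fst p) * (X (fst p) (snd p) * Y (fst p) (snd p)))"
  proof (rule Bochner_Integration.integrable_bound[OF XY])
    show "(\<lambda>p. indicator {0..t} (fst p) * (X (fst p) (snd p) * Y (fst p) (snd p))) \<in> borel_measurable dt_P"
      by (rule borel_measurable_times[OF fst_dt_P_measurable borel_measurable_integrable[OF XY]]) simp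
  qed (auto simp: indicator_def)
  then have i: "integrable (time_measure \<Otimes>\<^sub>M M) (\<lambda>(s, \<omega>). indicator {0..t} s * (X s \<omega> * Y s \<omega>))"
    by (simp add: case_prod_beta' dt_P_eq)
  have "integrable time_measure (\<lambda>s. expectation (\<lambda>\<omega>. X s \<omega> * Y s \<omega>))"
    by (rule time_prob.integrable_fst[OF XY'[unfolded dt_P_eq]])
  then show "set_integrable lborel {0..T} (\<lambda>s. expectation (\<lambda>\<omega>. X s \<omega> * Y s \<omega>))"
    by (simp only: integrable_time_iff)
  have 1: "(\<integral>(s, \<omega>). indicator {0..t} s * (X s \<omega> * Y s \<omega>) \<partial>dt_P) =
      (\<integral>s. expectation (\<lambda>\<omega>. indicator {0..t} s * (X s \<omega> * Y s \<omega>)) \<partial>time_measure)"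
    unfolding dt_P_eq by (rule time_prob.integral_fst[OF i, symmetric])
  also have "\<dots> = (LBINT s:{0..t}. expectation (\<lambda>\<omega>. X s \<omega> * Y s \<omega>))"
    unfolding integral_time[OF t, symmetric] by simp
  finally show 2: "(\<integral>(s, \<omega>). indicator {0..t} s * (X s \<omega> * Y s \<omega>) \<partial>dt_P) = (LBINT s:{0..t}. expectation (\<lambda>\<omega>. X s \<omega> * Y s \<omega>))" .
  have "expectation (\<lambda>\<omega>. LBINT s:{0..t}. X s \<omega> * Y s \<omega>) =
      expectation (\<lambda>\<omega>. \<integral>s. indicator {0..t} s * (X s \<omega> * Y s \<omega>) \<partial>time_measure)"
    by (simp only: integral_time[OF t])
  also have "\<dots> = (\<integral>(s, \<omega>). indicator {0..t} s * (X s \<omega> * Y s \<omega>) \<partial>dt_P)"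
    unfolding dt_P_eq by (rule time_prob.integral_snd[OF i])
  finally show "expectation (\<lambda>\<omega>. LBINT s:{0..t}. X s \<omega> * Y s \<omega>) = (LBINT s:{0..t}. expectation (\<lambda>\<omega>. X s \<omega> * Y s \<omega>))"
    unfolding 2 .
  have "(\<lambda>\<omega>. \<integral>s. indicator {0..t} s * (X s \<omega> * Y s \<omega>) \<partial>time_measure) \<in> borel_measurable M"
    by (rule borel_measurable_integrable[OF time_prob.integrable_snd[OF i]])
  then show "(\<lambda>\<omega>. LBINT s:{0..t}. X s \<omega> * Y s \<omega>) \<in> borel_measurable M"
    by (simp only: integral_time[OF t])
qed

lemma L2F_norm_eq:
  assumes "v \<in> L2F"
  shows "(\<integral>(s, \<omega>). (v s \<omega>)\<^sup>2 \<partial>dt_P) = (LBINT s:{0..T}. expectation (\<lambda>\<omega>. v s \<omega> * v s \<omega>))"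
proof -
  have "(\<integral>(s, \<omega>). (v s \<omega>)\<^sup>2 \<partial>dt_P) = (\<integral>(s, \<omega>). indicator {0..T} s * (v s \<omega> * v s \<omega>) \<partial>dt_P)"
    by (intro Bochner_Integration.integral_cong) (auto simp: space_dt_P power2_eq_square)
  then show ?thesis using L2F_product(4)[OF assms assms, of T] T_pos by simp
qed

lemma time_integral_L2F: "a \<in> L2F \<Longrightarrow> time_integral a \<in> L2F"
  by (rule L2F_bounded_moment[OF time_integral_adapted time_integral_sq_int(1) time_integral_sq_int(2)])

lemma ito_second_moment:
  assumes I: "ito_integral v I" and t: "t \<in> {0..T}"
  shows "expectation (\<lambda>\<omega>. (I t \<omega>)\<^sup>2) \<le> (\<integral>(s, \<omega>). (v s \<omega>)\<^sup>2 \<partial>dt_P)"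
proof -
  note v = ito_integral_L2F(1)[OF I]
  have "expectation (\<lambda>\<omega>. (I t \<omega>)\<^sup>2) = (\<integral>(q, \<omega>). indicator {0..t} q * (v q \<omega> * v q \<omega>) \<partial>dt_P)"
    using ito_isometry[OF I I t] by (simp add: power2_eq_square)
  also have "\<dots> \<le> (\<integral>(s, \<omega>). (v s \<omega>)\<^sup>2 \<partial>dt_P)"
    by (rule integral_mono_AE'[OF L2F_D(4)[OF v]]) (auto simp: indicator_def power2_eq_square)
  finally show ?thesis .
qed

lemma ito_L2F: "ito_integral v I \<Longrightarrow> I \<in> L2F"
  by (rule L2F_bounded_moment[OF ito_integral_L2F(2) ito_sq_int ito_second_moment])

text \<open>The expected value of Ito's formula for the square, obtained without it: the squared
  time integral is treated by parts on each path, the squared stochastic integral by the isometry,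
  and the mixed term by Fubini and the martingale property.\<close>

lemma energy_identity:
  fixes z :: real
  assumes a: "a \<in> L2F" and I: "ito_integral v I" and t: "t \<in> {0..T}"
  defines "Z s \<omega> \<equiv> z + time_integral a s \<omega> + I s \<omega>"
  shows "expectation (\<lambda>\<omega>. (Z t \<omega>)\<^sup>2) =
    z\<^sup>2 + (LBINT s:{0..t}. 2 * expectation (\<lambda>\<omega>. Z s \<omega> * a s \<omega>) + expectation (\<lambda>\<omega>. v s \<omega> * v s \<omega>))"
proof -
  define A where "A = time_integral a"
  note v = ito_integral_L2F(1)[OF I]
  have AL: "A \<in> L2F" and IL: "I \<in> L2F" unfolding A_def by (rule time_integral_L2F[OF a], rule ito_L2F[OF I])
  have Asq: "sq_int M (A q)" if "q \<in> {0..T}" for q unfolding A_def by (rule time_integral_sq_int[OF a that])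
  have Isq: "sq_int M (I q)" if "q \<in> {0..T}" for q by (rule ito_sq_int[OF I that])
  have st: "{0..t} \<subseteq> {0..T}" using t by auto
  have eA: "expectation (A t) = (LBINT s:{0..t}. expectation (a s))"
    using time_integral_product(2,3)[OF a sq_int_const[of 1] t] unfolding A_def integral_time[OF t] by simp
  have eAA: "expectation (\<lambda>\<omega>. A t \<omega> * A t \<omega>) = (LBINT s:{0..t}. 2 * expectation (\<lambda>\<omega>. A s \<omega> * a s \<omega>))"
  proof -
    have "expectation (\<lambda>\<omega>. A t \<omega> * A t \<omega>) = expectation (\<lambda>\<omega>. 2 * (LBINT s:{0..t}. A s \<omega> * a s \<omega>))"
    proof (rule integral_cong_AE)
      show "(\<lambda>\<omega>. A t \<omega> * A t \<omega>) \<in> borel_measurable M"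
        using sq_intD(1)[OF Asq[OF t]] by (intro borel_measurable_times)
      show "(\<lambda>\<omega>. 2 * (LBINT s:{0..t}. A s \<omega> * a s \<omega>)) \<in> borel_measurable M"
        by (intro borel_measurable_times borel_measurable_const L2F_product(5)[OF AL a t])
      show "AE \<omega> in M. A t \<omega> * A t \<omega> = 2 * (LBINT s:{0..t}. A s \<omega> * a s \<omega>)"
        using L2F_AE_set_integrable[OF a]
      proof eventually_elim
        case (elim \<omega>)
        have "A t \<omega> * A t \<omega> = (LBINT s:{0..t}. a s \<omega> * A s \<omega> + A s \<omega> * a s \<omega>)"
          unfolding A_def time_integral_def by (rule set_lebesgue_integral_by_parts[OF elim elim t])
        also have "\<dots> = (LBINT s:{0..t}. 2 * (A s \<omega> * a s \<omega>))" by (simp add: mult.commute)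
        finally show ?case by simp
      qed
    qed
    then show ?thesis using L2F_product(3)[OF AL a t] by simp
  qed
  \<comment> \<open>\<open>a s\<close> is known at time \<open>s\<close>, so \<open>I t\<close> may
    be replaced by \<open>I s\<close> under the time integral.\<close>
  have eAI: "expectation (\<lambda>\<omega>. A t \<omega> * I t \<omega>) = (LBINT s:{0..t}. expectation (\<lambda>\<omega>. I s \<omega> * a s \<omega>))"
  proof -
    have "expectation (\<lambda>\<omega>. A t \<omega> * I t \<omega>) = (LBINT s:{0..t}. expectation (\<lambda>\<omega>. a s \<omega> * I t \<omega>))"
      unfolding A_def time_integral_product(2,3)[OF a Isq[OF t] t] integral_time[OF t] ..
    also have "\<dots> = (LBINT s:{0..t}. expectation (\<lambda>\<omega>. I s \<omega> * a s \<omega>))"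
      unfolding integral_time[OF t, symmetric]
    proof (rule integral_cong_AE)
      have i: "integrable time_measure (\<lambda>s. \<integral>\<omega>. indicator {0..t} s * (a s \<omega> * I t \<omega>) \<partial>M)"
        by (rule time_prob.integrable_fst[OF time_integral_product(1)[OF a Isq[OF t] t, unfolded dt_P_eq]])
      from borel_measurable_integrable[OF this]
      show "(\<lambda>s. indicator {0..t} s * expectation (\<lambda>\<omega>. a s \<omega> * I t \<omega>)) \<in> borel_measurable time_measure" by simp
      have "integrable time_measure (\<lambda>s. expectation (\<lambda>\<omega>. I s \<omega> * a s \<omega>))"
        using L2F_product(2)[OF IL a t] by (simp only: integrable_time_iff)
      from borel_measurable_times[OF time_measurable[of "indicator {0..t}"] borel_measurable_integrable[OF this]]
      show "(\<lambda>s. indicator {0..t} s * expectation (\<lambda>\<omega>. I s \<omega> * a s \<omega>)) \<in> borel_measurable time_measure"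
        by simp
      show "AE s in time_measure. indicator {0..t} s * expectation (\<lambda>\<omega>. a s \<omega> * I t \<omega>) =
          indicator {0..t} s * expectation (\<lambda>\<omega>. I s \<omega> * a s \<omega>)"
        using L2F_AE_sq_int[OF a]
      proof eventually_elim
        case (elim s)
        show ?case
        proof (cases "s \<in> {0..t}")
          case True
          then have s: "s \<in> {0..T}" "0 \<le> s" "s \<le> t" "t \<le> T" using t by auto
          have "expectation (\<lambda>\<omega>. I t \<omega> * a s \<omega>) = expectation (\<lambda>\<omega>. I s \<omega> * a s \<omega>)"
            by (rule ito_martingale[OF I s(2-4) adaptedD(2)[OF L2F_D(1)[OF a] s(1)] elim])
          then show ?thesis by (simp add: mult.commute)
        qed simp
      qed
    qed
    finally show ?thesis .
  qed
  have eII: "expectation (\<lambda>\<omega>. I t \<omega> * I t \<omega>) = (LBINT s:{0..t}. expectation (\<lambda>\<omega>. v s \<omega> * v s \<omega>))"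
    unfolding ito_isometry[OF I I t] by (rule L2F_product(4)[OF v v t])
  have eI: "expectation (I t) = 0" by (rule ito_expectation[OF I t])
  have iA: "integrable M (A t)" and iI: "integrable M (I t)"
    by (rule sq_int_integrable[OF Asq[OF t]], rule sq_int_integrable[OF Isq[OF t]])
  note iAA = sq_int_mult[OF Asq[OF t] Asq[OF t]] and iAI = sq_int_mult[OF Asq[OF t] Isq[OF t]]
    and iII = sq_int_mult[OF Isq[OF t] Isq[OF t]]
  have one: "(\<lambda>t \<omega>. 1) \<in> L2F"
    by (rule L2F_bounded_moment[where C = 1]) (auto simp: adapted_def prob_space)
  have "set_integrable lborel {0..T} (\<lambda>s. expectation (a s))"
    using L2F_product(2)[OF a one t] by simp
  then have 1: "set_integrable lborel {0..t} (\<lambda>s. 2 * z * expectation (a s))"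
    by (intro set_integrable_mult_right) (rule set_integrable_subset, use st in auto)
  have 2: "set_integrable lborel {0..t} (\<lambda>s. 2 * expectation (\<lambda>\<omega>. A s \<omega> * a s \<omega>))"
    by (intro set_integrable_mult_right set_integrable_subset[OF L2F_product(2)[OF AL a t]]) (use st in auto)
  have 3: "set_integrable lborel {0..t} (\<lambda>s. 2 * expectation (\<lambda>\<omega>. I s \<omega> * a s \<omega>))"
    by (intro set_integrable_mult_right set_integrable_subset[OF L2F_product(2)[OF IL a t]]) (use st in auto)
  have 4: "set_integrable lborel {0..t} (\<lambda>s. expectation (\<lambda>\<omega>. v s \<omega> * v s \<omega>))"
    by (intro set_integrable_subset[OF L2F_product(2)[OF v v t]]) (use st in auto)
  have ZL: "Z \<in> L2F"
    using L2F_lin[OF L2F_lin[OF one AL, of z 1] IL, of 1 1] by (simp add: Z_def[abs_def] A_def)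
  have 5: "set_integrable lborel {0..t} (\<lambda>s. 2 * expectation (\<lambda>\<omega>. Z s \<omega> * a s \<omega>) + expectation (\<lambda>\<omega>. v s \<omega> * v s \<omega>))"
    by (intro set_integral_add(1)[OF _ 4] set_integrable_mult_right set_integrable_subset[OF L2F_product(2)[OF ZL a t]])
      (use st in auto)
  have "expectation (\<lambda>\<omega>. (Z t \<omega>)\<^sup>2) = expectation (\<lambda>\<omega>. z\<^sup>2 + 2 * z * A t \<omega> + 2 * z * I t \<omega> + A t \<omega> * A t \<omega> + 2 * (A t \<omega> * I t \<omega>) + I t \<omega> * I t \<omega>)"
    by (intro Bochner_Integration.integral_cong) (simp_all add: Z_def A_def power2_eq_square algebra_simps)
  also have "\<dots> = z\<^sup>2 + 2 * z * expectation (A t) + 2 * z * expectation (I t) + expectation (\<lambda>\<omega>. A t \<omega> * A t \<omega>) +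
      2 * expectation (\<lambda>\<omega>. A t \<omega> * I t \<omega>) + expectation (\<lambda>\<omega>. I t \<omega> * I t \<omega>)"
    using iA iI iAA iAI iII by (simp add: prob_space)
  also have "\<dots> = z\<^sup>2 + ((LBINT s:{0..t}. 2 * z * expectation (a s)) + (LBINT s:{0..t}. 2 * expectation (\<lambda>\<omega>. A s \<omega> * a s \<omega>)) +
      (LBINT s:{0..t}. 2 * expectation (\<lambda>\<omega>. I s \<omega> * a s \<omega>)) + (LBINT s:{0..t}. expectation (\<lambda>\<omega>. v s \<omega> * v s \<omega>)))"
    unfolding eA eI eAA eAI eII by simp
  also have "(LBINT s:{0..t}. 2 * z * expectation (a s)) + (LBINT s:{0..t}. 2 * expectation (\<lambda>\<omega>. A s \<omega> * a s \<omega>)) +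
      (LBINT s:{0..t}. 2 * expectation (\<lambda>\<omega>. I s \<omega> * a s \<omega>)) + (LBINT s:{0..t}. expectation (\<lambda>\<omega>. v s \<omega> * v s \<omega>)) =
      (LBINT s:{0..t}. 2 * z * expectation (a s) + 2 * expectation (\<lambda>\<omega>. A s \<omega> * a s \<omega>) +
        2 * expectation (\<lambda>\<omega>. I s \<omega> * a s \<omega>) + expectation (\<lambda>\<omega>. v s \<omega> * v s \<omega>))"
    by (simp only: set_integral_add(2)[OF set_integral_add(1)[OF set_integral_add(1)[OF 1 2] 3] 4]
          set_integral_add(2)[OF set_integral_add(1)[OF 1 2] 3] set_integral_add(2)[OF 1 2])
  also have "\<dots> = (LBINT s:{0..t}. 2 * expectation (\<lambda>\<omega>. Z s \<omega> * a s \<omega>) + expectation (\<lambda>\<omega>. v s \<omega> * v s \<omega>))"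
  proof -
    note 6 = set_integral_add(1)[OF set_integral_add(1)[OF set_integral_add(1)[OF 1 2] 3] 4]
    have ae: "AE s in lborel. s \<in> {0..T} \<longrightarrow> sq_int M (a s)"
      using L2F_AE_sq_int[OF a] by (simp only: AE_time_iff)
    show ?thesis
      unfolding set_lebesgue_integral_def
    proof (rule integral_cong_AE)
      show "AE s in lborel. indicator {0..t} s *\<^sub>R (2 * z * expectation (a s) + 2 * expectation (\<lambda>\<omega>. A s \<omega> * a s \<omega>) +
          2 * expectation (\<lambda>\<omega>. I s \<omega> * a s \<omega>) + expectation (\<lambda>\<omega>. v s \<omega> * v s \<omega>)) =
        indicator {0..t} s *\<^sub>R (2 * expectation (\<lambda>\<omega>. Z s \<omega> * a s \<omega>) + expectation (\<lambda>\<omega>. v s \<omega> * v s \<omega>))"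
        using ae
      proof eventually_elim
        case (elim s)
        show ?case
        proof (cases "s \<in> {0..t}")
          case True
          then have s: "s \<in> {0..T}" using st by auto
          with elim have as: "sq_int M (a s)" by blast
          have "expectation (\<lambda>\<omega>. Z s \<omega> * a s \<omega>) = expectation (\<lambda>\<omega>. z * a s \<omega> + A s \<omega> * a s \<omega> + I s \<omega> * a s \<omega>)"
            by (simp add: Z_def A_def algebra_simps)
          also have "\<dots> = z * expectation (a s) + expectation (\<lambda>\<omega>. A s \<omega> * a s \<omega>) + expectation (\<lambda>\<omega>. I s \<omega> * a s \<omega>)"
            using sq_int_integrable[OF as] sq_int_mult[OF Asq[OF s] as] sq_int_mult[OF Isq[OF s] as] by simp
          finally show ?thesis by simp
        qed simp
      qed
    qed (use 5 6 in \<open>simp_all only: set_integrable_def borel_measurable_integrable\<close>)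
  qed
  finally show ?thesis .
qed

lemma L2F_const: "(\<lambda>t \<omega>. c) \<in> L2F"
  by (rule L2F_bounded_moment[where C = "c\<^sup>2"]) (auto simp: adapted_def prob_space)

text \<open>An estimate as for backward equations. With \<open>\<phi> s\<close> the second moment of
  \<open>Z s\<close>, the weight \<open>exp (\<beta> * s)\<close> is chosen so that the weighted
  \<open>\<phi>\<close> grows at least at half the rate of the second moment of \<open>v s\<close>.
  Integrating up to \<open>T\<close> bounds the whole of \<open>v\<close> by the terminal value,
  uniformly in \<open>z\<close>.\<close>

lemma backward_estimate:
  fixes z :: real
  assumes a: "a \<in> L2F" and I: "ito_integral v I" and K: "K \<ge> 0"
  defines "Z s \<omega> \<equiv> z + time_integral a s \<omega> + I s \<omega>"
  assumes le: "AE (s, \<omega>) in dt_P. \<bar>a s \<omega>\<bar> \<le> K * (\<bar>Z s \<omega>\<bar> + \<bar>v s \<omega>\<bar>)"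
  shows "(\<integral>(s, \<omega>). (v s \<omega>)\<^sup>2 \<partial>dt_P) \<le> 2 * exp ((2 * K + 2 * K\<^sup>2) * T) * expectation (\<lambda>\<omega>. (Z T \<omega>)\<^sup>2)"
proof -
  \<comment> \<open>The part \<open>2 * K\<close> absorbs the \<open>Z\<close>-term in the bound on
    \<open>a\<close>, the part \<open>2 * K\<^sup>2\<close> its mixed term, for which half of the
    square of \<open>v\<close> is given up.\<close>
  define \<beta> where "\<beta> = 2 * K + 2 * K\<^sup>2"
  have \<beta>: "\<beta> \<ge> 0" using K by (simp add: \<beta>_def)
  note v = ito_integral_L2F(1)[OF I]
  have TT: "T \<in> {0..T}" using T_pos by simp
  have ZL: "Z \<in> L2F"
    using L2F_lin[OF L2F_lin[OF L2F_const[of 1] time_integral_L2F[OF a], of z 1] ito_L2F[OF I], of 1 1] by (simp add: Z_def[abs_def])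
  have Zsq: "sq_int M (Z t)" if "t \<in> {0..T}" for t
    unfolding Z_def by (intro sq_int_add sq_int_const time_integral_sq_int(1)[OF a that] ito_sq_int[OF I that])
  define G where "G s = 2 * expectation (\<lambda>\<omega>. Z s \<omega> * a s \<omega>) + expectation (\<lambda>\<omega>. v s \<omega> * v s \<omega>)" for s
  have Gint: "set_integrable lborel {0..T} G"
    unfolding G_def
    by (intro set_integral_add(1) set_integrable_mult_right L2F_product(2)[OF ZL a TT] L2F_product(2)[OF v v TT])
  define \<phi> where "\<phi> t = expectation (\<lambda>\<omega>. (Z t \<omega>)\<^sup>2)" for t
  have \<phi>: "(LBINT s:{0..t}. G s) = \<phi> t - z\<^sup>2" if "t \<in> {0..T}" for t
    using energy_identity[OF a I that, of z] by (simp add: \<phi>_def G_def Z_def)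
  have c\<phi>: "continuous_on {0..T} \<phi>"
  proof -
    have "continuous_on {0..T} (\<lambda>t. (LBINT s:{0..t}. G s) + z\<^sup>2)"
      by (intro continuous_intros continuous_on_set_lebesgue_integral[OF Gint])
    then show ?thesis by (rule continuous_on_eq) (simp add: \<phi>)
  qed
  note const = set_integrable_const_Icc[of 0 T]
  have lin: "(LBINT s:{0..t}. \<beta>) = \<beta> * t" if "t \<in> {0..T}" for t
    using that by (simp add: set_lebesgue_integral_def)
  have V: "(LBINT s:{0..t}. exp (\<beta> * s) * \<beta>) = exp (\<beta> * t) - 1" if t: "t \<in> {0..T}" for t
  proof -
    have "exp (LBINT s:{0..t}. \<beta>) = 1 + (LBINT s:{0..t}. \<beta> * exp (LBINT y:{0..s}. \<beta>))"
      by (rule set_lebesgue_integral_exp[OF const t])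
    also have "(LBINT s:{0..t}. \<beta> * exp (LBINT y:{0..s}. \<beta>)) = (LBINT s:{0..t}. exp (\<beta> * s) * \<beta>)"
      using t by (intro set_lebesgue_integral_cong) (auto simp: lin)
    finally show ?thesis using lin[OF t] by simp
  qed
  have vint: "set_integrable lborel {0..T} (\<lambda>s. exp (\<beta> * s) * \<beta>)"
    by (intro set_integrable_continuous_mult[OF const] continuous_intros)
  \<comment> \<open>Density of \<open>exp (\<beta> * s) * \<phi> s\<close>; the increments of this
    product are computed by parts, because \<open>\<phi>\<close> is known only as an indefinite
    integral.\<close>
  define Q where "Q s = exp (\<beta> * s) * (G s + \<beta> * \<phi> s)" for s
  have \<phi>int: "set_integrable lborel {0..T} (\<lambda>s. \<beta> * \<phi> s)"
    using set_integrable_continuous_mult[OF const[of \<beta>] c\<phi>] by (simp add: mult.commute)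
  have Qint: "set_integrable lborel {0..T} Q"
    unfolding Q_def
    by (intro set_integrable_continuous_mult[OF set_integral_add(1)[OF Gint \<phi>int]] continuous_intros)
  have "(\<phi> T - z\<^sup>2) * (exp (\<beta> * T) - 1) =
      (LBINT s:{0..T}. G s * (LBINT y:{0..s}. exp (\<beta> * y) * \<beta>) + (LBINT y:{0..s}. G y) * (exp (\<beta> * s) * \<beta>))"
    using set_lebesgue_integral_by_parts[OF Gint vint TT] unfolding \<phi>[OF TT] V[OF TT] .
  also have "\<dots> = (LBINT s:{0..T}. (Q s - G s) - z\<^sup>2 * (exp (\<beta> * s) * \<beta>))"
  proof (rule set_lebesgue_integral_cong)
    show "\<forall>s. s \<in> {0..T} \<longrightarrow> G s * (LBINT y:{0..s}. exp (\<beta> * y) * \<beta>) + (LBINT y:{0..s}. G y) * (exp (\<beta> * s) * \<beta>) =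
        (Q s - G s) - z\<^sup>2 * (exp (\<beta> * s) * \<beta>)"
    proof (intro allI impI)
      fix s assume "s \<in> {0..T}"
      then show "G s * (LBINT y:{0..s}. exp (\<beta> * y) * \<beta>) + (LBINT y:{0..s}. G y) * (exp (\<beta> * s) * \<beta>) =
        (Q s - G s) - z\<^sup>2 * (exp (\<beta> * s) * \<beta>)"
        unfolding V[OF \<open>s \<in> {0..T}\<close>] \<phi>[OF \<open>s \<in> {0..T}\<close>] Q_def by (simp add: algebra_simps)
    qed
  qed simp
  also have "\<dots> = (LBINT s:{0..T}. Q s) - (\<phi> T - z\<^sup>2) - z\<^sup>2 * (exp (\<beta> * T) - 1)"
  proof -
    have "(LBINT s:{0..T}. (Q s - G s) - z\<^sup>2 * (exp (\<beta> * s) * \<beta>)) =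
        (LBINT s:{0..T}. Q s - G s) - (LBINT s:{0..T}. z\<^sup>2 * (exp (\<beta> * s) * \<beta>))"
      by (intro set_integral_diff Qint Gint set_integrable_mult_right vint)
    also have "(LBINT s:{0..T}. Q s - G s) = (LBINT s:{0..T}. Q s) - (LBINT s:{0..T}. G s)"
      by (rule set_integral_diff(2)[OF Qint Gint])
    also have "(LBINT s:{0..T}. z\<^sup>2 * (exp (\<beta> * s) * \<beta>)) = z\<^sup>2 * (LBINT s:{0..T}. exp (\<beta> * s) * \<beta>)"
      by (rule set_integral_mult_right)
    finally show ?thesis unfolding V[OF TT] \<phi>[OF TT] .
  qed
  finally have Qeq: "exp (\<beta> * T) * \<phi> T = z\<^sup>2 + (LBINT s:{0..T}. Q s)"
    by (simp add: algebra_simps)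
  have le': "AE s in time_measure. AE \<omega> in M. \<bar>a s \<omega>\<bar> \<le> K * (\<bar>Z s \<omega>\<bar> + \<bar>v s \<omega>\<bar>)"
    using time_prob.AE_pair[OF le[unfolded dt_P_eq]] by simp
  have "(LBINT s:{0..T}. expectation (\<lambda>\<omega>. v s \<omega> * v s \<omega>) / 2) \<le> (LBINT s:{0..T}. Q s)"
  proof (rule set_integral_mono_AE[OF _ Qint])
    show "set_integrable lborel {0..T} (\<lambda>s. expectation (\<lambda>\<omega>. v s \<omega> * v s \<omega>) / 2)"
      by (intro set_integrable_divide L2F_product(2)[OF v v TT])
    have "AE s in time_measure. expectation (\<lambda>\<omega>. v s \<omega> * v s \<omega>) / 2 \<le> Q s"
      using le' L2F_AE_sq_int[OF a] L2F_AE_sq_int[OF v] AE_space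
    proof eventually_elim
      case (elim s)
      then have s: "s \<in> {0..T}" and as: "sq_int M (a s)" and vs: "sq_int M (v s)" by simp_all
      note Zs = Zsq[OF s]
      have "expectation (\<lambda>\<omega>. v s \<omega> * v s \<omega>) / 2 = expectation (\<lambda>\<omega>. v s \<omega> * v s \<omega> / 2)" by simp
      also have "\<dots> \<le> expectation (\<lambda>\<omega>. 2 * (Z s \<omega> * a s \<omega>) + v s \<omega> * v s \<omega> + \<beta> * (Z s \<omega>)\<^sup>2)"
      proof (rule integral_mono_AE)
        show "integrable M (\<lambda>\<omega>. v s \<omega> * v s \<omega> / 2)" using sq_int_mult[OF vs vs] by simp
        show "integrable M (\<lambda>\<omega>. 2 * (Z s \<omega> * a s \<omega>) + v s \<omega> * v s \<omega> + \<beta> * (Z s \<omega>)\<^sup>2)"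
          by (intro Bochner_Integration.integrable_add integrable_mult_right sq_int_mult[OF vs vs] sq_int_mult[OF Zs as] sq_intD(2)[OF Zs])
        show "AE \<omega> in M. v s \<omega> * v s \<omega> / 2 \<le> 2 * (Z s \<omega> * a s \<omega>) + v s \<omega> * v s \<omega> + \<beta> * (Z s \<omega>)\<^sup>2"
          using elim(1)
        proof eventually_elim
          case (elim \<omega>)
          define x where "x = \<bar>Z s \<omega>\<bar>"
          define y where "y = \<bar>v s \<omega>\<bar>"
          have "\<bar>Z s \<omega> * a s \<omega>\<bar> \<le> x * (K * (x + y))"
            unfolding abs_mult x_def[symmetric]
            using elim by (intro mult_left_mono) (simp_all add: x_def y_def)
          then have 1: "2 * (Z s \<omega> * a s \<omega>) \<ge> - 2 * (x * (K * (x + y)))" by linarith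
          \<comment> \<open>Young's inequality: \<open>2 * K * x * y \<le> 2 * K\<^sup>2 * x\<^sup>2
            + y\<^sup>2 / 2\<close>.\<close>
          have 2: "0 \<le> (2 * K * x - y)\<^sup>2" by simp
          have 3: "v s \<omega> * v s \<omega> = y\<^sup>2" "(Z s \<omega>)\<^sup>2 = x\<^sup>2" by (simp_all add: x_def y_def power2_eq_square)
          show ?case
            unfolding 3 \<beta>_def using 1 2 by (simp add: power2_eq_square algebra_simps)
        qed
      qed
      also have "\<dots> = G s + \<beta> * \<phi> s"
        unfolding G_def \<phi>_def using sq_int_mult[OF vs vs] sq_int_mult[OF Zs as] sq_intD(2)[OF Zs] by simp
      finally have 1: "expectation (\<lambda>\<omega>. v s \<omega> * v s \<omega>) / 2 \<le> G s + \<beta> * \<phi> s" .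
      have "0 \<le> expectation (\<lambda>\<omega>. v s \<omega> * v s \<omega>) / 2" by simp
      with 1 have "0 \<le> G s + \<beta> * \<phi> s" by linarith
      moreover have "1 \<le> exp (\<beta> * s)" using \<beta> s by simp
      ultimately have "1 * (G s + \<beta> * \<phi> s) \<le> Q s" unfolding Q_def by (intro mult_right_mono)
      with 1 show ?case by simp
    qed
    then show "AE s\<in>{0..T} in lborel. expectation (\<lambda>\<omega>. v s \<omega> * v s \<omega>) / 2 \<le> Q s"
      by (simp only: AE_time_iff)
  qed
  also have "\<dots> \<le> exp (\<beta> * T) * \<phi> T" unfolding Qeq by simp
  finally have "(LBINT s:{0..T}. expectation (\<lambda>\<omega>. v s \<omega> * v s \<omega>)) / 2 \<le> exp (\<beta> * T) * \<phi> T"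
    by simp
  then show ?thesis
    unfolding L2F_norm_eq[OF v] \<phi>_def \<beta>_def by simp
qed

text \<open>Sections in the other order. The predicate may fail to be measurable, so the two almost
  everywhere quantifiers are exchanged for a measurable null set containing its failures.\<close>

lemma AE_dt_P_swap:
  assumes "AE (s, \<omega>) in dt_P. P s \<omega>"
  shows "AE \<omega> in M. AE s in time_measure. P s \<omega>"
proof -
  obtain N where N: "N \<in> null_sets dt_P" "{p \<in> space dt_P. \<not> (case p of (s, \<omega>) \<Rightarrow> P s \<omega>)} \<subseteq> N"
    using assms unfolding eventually_ae_filter by blast
  have NS: "N \<in> sets dt_P" using N(1) by auto
  have "AE p in time_measure \<Otimes>\<^sub>M M. p \<notin> N"
    using AE_not_in[OF N(1)] by (simp only: dt_P_eq)
  from time_prob.AE_pair[OF this] have 1: "AE s in time_measure. AE \<omega> in M. (s, \<omega>) \<notin> N" .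
  have "{p \<in> space (time_measure \<Otimes>\<^sub>M M). (fst p, snd p) \<notin> N} = space (time_measure \<Otimes>\<^sub>M M) - N" by auto
  also have "\<dots> \<in> sets (time_measure \<Otimes>\<^sub>M M)" using NS unfolding dt_P_eq by (rule sets.compl_sets)
  finally have "AE \<omega> in M. AE s in time_measure. (s, \<omega>) \<notin> N"
    using 1 by (subst (asm) time_prob.AE_commute) simp_all
  with AE_space show ?thesis
  proof eventually_elim
    case (elim \<omega>)
    from elim(2) AE_space show "AE s in time_measure. P s \<omega>"
    proof eventually_elim
      case (elim s)
      show ?case
      proof (rule ccontr)
        assume "\<not> P s \<omega>"
        with elim(2) \<open>\<omega> \<in> space M\<close> have "(s, \<omega>) \<in> {p \<in> space dt_P. \<not> (case p of (s, \<omega>) \<Rightarrow> P s \<omega>)}"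
          by (simp add: space_dt_P)
        with N(2) elim(1) show False by blast
      qed
    qed
  qed
qed

text \<open>An exceptional null set of scenarios becomes a null set of the product, after
  enlargement to a measurable one.\<close>

lemma AE_dt_P_I:
  assumes "AE \<omega> in M. \<forall>t\<in>{0..T}. P t \<omega>"
  shows "AE (t, \<omega>) in dt_P. P t \<omega>"
proof -
  obtain N where N: "N \<in> null_sets M" "{\<omega> \<in> space M. \<not> (\<forall>t\<in>{0..T}. P t \<omega>)} \<subseteq> N"
    using assms unfolding eventually_ae_filter by blast
  have NS: "N \<in> sets M" using N(1) by auto
  have "AE t in time_measure. AE \<omega> in M. snd (t, \<omega>) \<notin> N"
    using AE_not_in[OF N(1)] by simp
  moreover have "{p \<in> space (time_measure \<Otimes>\<^sub>M M). snd p \<notin> N} \<in> sets (time_measure \<Otimes>\<^sub>M M)"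
  proof -
    have "{p \<in> space (time_measure \<Otimes>\<^sub>M M). snd p \<notin> N} = snd -` (space M - N) \<inter> space (time_measure \<Otimes>\<^sub>M M)"
      by (auto simp: space_pair_measure)
    also have "\<dots> \<in> sets (time_measure \<Otimes>\<^sub>M M)"
      by (rule measurable_sets[OF measurable_snd sets.compl_sets[OF NS]])
    finally show ?thesis .
  qed
  ultimately have "AE p in dt_P. snd p \<notin> N"
    unfolding dt_P_eq by (intro time_prob.AE_pair_measure)
  with AE_space show ?thesis
  proof eventually_elim
    case (elim p)
    then show ?case using N(2) by (auto simp: space_dt_P split: prod.split)
  qed
qed

lemma time_integral_linear:
  assumes b: "b \<in> L2F" and b': "b' \<in> L2F" and eq: "AE (t, \<omega>) in dt_P. b'' t \<omega> = \<alpha> * b t \<omega> + \<beta> * b' t \<omega>"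
    and m: "(\<lambda>(t, \<omega>). b'' t \<omega>) \<in> borel_measurable dt_P"
  shows "AE \<omega> in M. \<forall>t\<in>{0..T}. time_integral b'' t \<omega> = \<alpha> * time_integral b t \<omega> + \<beta> * time_integral b' t \<omega>"
  using AE_dt_P_swap[OF eq] L2F_AE_set_integrable[OF b] L2F_AE_set_integrable[OF b'] AE_space
proof eventually_elim
  case (elim \<omega>)
  show ?case
  proof
    fix t assume t: "t \<in> {0..T}"
    then have st: "{0..t} \<subseteq> {0..T}" by auto
    have i: "set_integrable lborel {0..t} (\<lambda>s. b s \<omega>)" "set_integrable lborel {0..t} (\<lambda>s. b' s \<omega>)"
      by (rule set_integrable_subset[OF elim(2)], use st in auto, rule set_integrable_subset[OF elim(3)], use st in auto)
    have "time_integral b'' t \<omega> = (\<integral>s. indicator {0..t} s * b'' s \<omega> \<partial>time_measure)"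
      unfolding time_integral_def integral_time[OF t] ..
    also have "\<dots> = (\<integral>s. indicator {0..t} s * (\<alpha> * b s \<omega> + \<beta> * b' s \<omega>) \<partial>time_measure)"
    proof (rule integral_cong_AE)
      have tm: "(\<lambda>s. c s \<omega>) \<in> borel_measurable time_measure" if "(\<lambda>(t, \<omega>). c t \<omega>) \<in> borel_measurable dt_P" for c :: "real \<Rightarrow> 'a \<Rightarrow> real"
        using measurable_compose[OF measurable_Pair2'[OF elim(4)] that[unfolded dt_P_eq]] by simp
      have ind: "indicator {0..t} \<in> borel_measurable time_measure" by (rule time_measurable) simp
      show "(\<lambda>s. indicator {0..t} s * b'' s \<omega>) \<in> borel_measurable time_measure"
        by (rule borel_measurable_times[OF ind tm[OF m]])
      show "(\<lambda>s. indicator {0..t} s * (\<alpha> * b s \<omega> + \<beta> * b' s \<omega>)) \<in> borel_measurable time_measure"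
        by (intro borel_measurable_times borel_measurable_add borel_measurable_const ind tm L2F_D(3)[OF b] L2F_D(3)[OF b'])
      show "AE s in time_measure. indicator {0..t} s * b'' s \<omega> = indicator {0..t} s * (\<alpha> * b s \<omega> + \<beta> * b' s \<omega>)"
        using elim(1) by eventually_elim simp
    qed
    also have "\<dots> = (LBINT s:{0..t}. \<alpha> * b s \<omega> + \<beta> * b' s \<omega>)" by (rule integral_time[OF t])
    also have "\<dots> = (LBINT s:{0..t}. \<alpha> * b s \<omega>) + (LBINT s:{0..t}. \<beta> * b' s \<omega>)"
      by (intro set_integral_add(2) set_integrable_mult_right i)
    also have "\<dots> = \<alpha> * time_integral b t \<omega> + \<beta> * time_integral b' t \<omega>"
      by (simp add: time_integral_def)
    finally show "time_integral b'' t \<omega> = \<alpha> * time_integral b t \<omega> + \<beta> * time_integral b' t \<omega>" .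
  qed
qed

lemma adapted_det_mult:
  assumes X: "adapted X" and f: "f \<in> borel_measurable time_measure"
  shows "adapted (\<lambda>t \<omega>. f t * X t \<omega>)"
  unfolding adapted_def
proof (intro conjI ballI)
  have "(\<lambda>p. f (fst p)) \<in> borel_measurable dt_P"
    unfolding dt_P_eq by (rule measurable_compose[OF measurable_fst f])
  from borel_measurable_times[OF this adaptedD(1)[OF X]]
  show "(\<lambda>(t, \<omega>). f t * X t \<omega>) \<in> borel_measurable dt_P" by (simp add: case_prod_beta')
  fix t assume t: "t \<in> {0..T}"
  show "(\<lambda>\<omega>. f t * X t \<omega>) \<in> borel_measurable (\<F> t)"
    by (rule borel_measurable_times[OF borel_measurable_const adaptedD(2)[OF X t]])
qed

lemma continuous_time_measurable:
  assumes "continuous_on {0..T} (f :: real \<Rightarrow> real)"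
  shows "f \<in> borel_measurable time_measure"
  unfolding time_measure_def
  using borel_measurable_continuous_on_indicator[OF _ assms]
  by (subst borel_measurable_restrict_space_iff) (simp_all add: measurable_lborel2)

lemma adapted_lin:
  assumes "adapted u" "adapted v"
  shows "adapted (\<lambda>t \<omega>. a * u t \<omega> + b * v t \<omega>)"
  unfolding adapted_def
proof (intro conjI ballI)
  have "(\<lambda>p. a * (case p of (t, \<omega>) \<Rightarrow> u t \<omega>) + b * (case p of (t, \<omega>) \<Rightarrow> v t \<omega>)) \<in> borel_measurable dt_P"
    by (intro borel_measurable_add borel_measurable_times borel_measurable_const adaptedD(1) assms)
  then show "(\<lambda>(t, \<omega>). a * u t \<omega> + b * v t \<omega>) \<in> borel_measurable dt_P" by (simp add: case_prod_beta')
  fix t assume t: "t \<in> {0..T}"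
  show "(\<lambda>\<omega>. a * u t \<omega> + b * v t \<omega>) \<in> borel_measurable (\<F> t)"
    by (intro borel_measurable_add borel_measurable_times borel_measurable_const adaptedD(2) assms t)
qed

section \<open>Linear stochastic equations with a rate depending on time only\<close>

definition L2F_norm2 :: "(real \<Rightarrow> 'a \<Rightarrow> real) \<Rightarrow> real" where
  "L2F_norm2 v = (\<integral>(s, \<omega>). (v s \<omega>)\<^sup>2 \<partial>dt_P)"

lemma L2F_norm2_nonneg: "0 \<le> L2F_norm2 v"
  unfolding L2F_norm2_def by (rule Bochner_Integration.integral_nonneg) auto

lemma L2F_norm2_mono:
  assumes v: "v \<in> L2F" and le: "AE (t, \<omega>) in dt_P. \<bar>u t \<omega>\<bar> \<le> c * \<bar>v t \<omega>\<bar>" and u: "u \<in> L2F"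
  shows "L2F_norm2 u \<le> c\<^sup>2 * L2F_norm2 v"
proof -
  have "L2F_norm2 u \<le> (\<integral>p. c\<^sup>2 * (case p of (t, \<omega>) \<Rightarrow> (v t \<omega>)\<^sup>2) \<partial>dt_P)"
    unfolding L2F_norm2_def
  proof (rule integral_mono_AE[OF L2F_D(4)[OF u] integrable_mult_right[OF L2F_D(4)[OF v]]])
    show "AE p in dt_P. (case p of (t, \<omega>) \<Rightarrow> (u t \<omega>)\<^sup>2) \<le> c\<^sup>2 * (case p of (t, \<omega>) \<Rightarrow> (v t \<omega>)\<^sup>2)"
      using le
    proof eventually_elim
      case (elim p)
      obtain t \<omega> where p: "p = (t, \<omega>)" by (cases p)
      have "\<bar>u t \<omega>\<bar>\<^sup>2 \<le> (c * \<bar>v t \<omega>\<bar>)\<^sup>2" using elim p by (intro power_mono) auto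
      then show ?case by (simp add: p power_mult_distrib)
    qed
  qed
  then show ?thesis by (simp add: L2F_norm2_def)
qed

text \<open>The time integrals are kept apart from the stochastic one and the rate is not random, so
  that for fixed \<open>\<omega>\<close> this is a linear integral equation to which
  \<open>linear_ode_exists\<close> and \<open>linear_ode_unique\<close> apply.\<close>

definition linear_solution ::
    "(real \<Rightarrow> real) \<Rightarrow> real \<Rightarrow> (real \<Rightarrow> 'a \<Rightarrow> real) \<Rightarrow> (real \<Rightarrow> 'a \<Rightarrow> real) \<Rightarrow> (real \<Rightarrow> 'a \<Rightarrow> real) \<Rightarrow> bool" where
  "linear_solution g z b v X \<longleftrightarrow>
     adapted X \<and> (AE \<omega> in M. continuous_on {0..T} (\<lambda>t. X t \<omega>)) \<and>
     (\<exists>I. ito_integral v I \<and>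
        (AE \<omega> in M. \<forall>t\<in>{0..T}. X t \<omega> = z + (LBINT s:{0..t}. g s * X s \<omega>) + time_integral b t \<omega> + I t \<omega>))"

text \<open>On almost every path the combination of the three solutions solves the homogeneous
  equation, since time and stochastic integrals cancel by linearity; it is therefore the initial
  mismatch times a factor independent of the path. With coefficients 1 and 0 this compares two
  solutions that differ in the initial value.\<close>

lemma superposition:
  assumes g: "set_integrable lborel {0..T} g"
    and X: "linear_solution g z b v X" and X': "linear_solution g z' b' v' X'" and X'': "linear_solution g z'' b'' v'' X''"
    and b: "b \<in> L2F" "b' \<in> L2F" "b'' \<in> L2F"
    and beq: "AE (t, \<omega>) in dt_P. b'' t \<omega> = \<alpha> * b t \<omega> + \<beta> * b' t \<omega>"
    and veq: "AE (t, \<omega>) in dt_P. v'' t \<omega> = \<alpha> * v t \<omega> + \<beta> * v' t \<omega>"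
  shows "AE \<omega> in M. \<forall>t\<in>{0..T}. X'' t \<omega> = \<alpha> * X t \<omega> + \<beta> * X' t \<omega> + (z'' - \<alpha> * z - \<beta> * z') * exp (LBINT s:{0..t}. g s)"
proof -
  obtain I where I: "ito_integral v I" and XI: "AE \<omega> in M. \<forall>t\<in>{0..T}. X t \<omega> = z + (LBINT s:{0..t}. g s * X s \<omega>) + time_integral b t \<omega> + I t \<omega>"
    using X unfolding linear_solution_def by blast
  obtain I' where I': "ito_integral v' I'" and XI': "AE \<omega> in M. \<forall>t\<in>{0..T}. X' t \<omega> = z' + (LBINT s:{0..t}. g s * X' s \<omega>) + time_integral b' t \<omega> + I' t \<omega>"
    using X' unfolding linear_solution_def by blast
  obtain I'' where I'': "ito_integral v'' I''" and XI'': "AE \<omega> in M. \<forall>t\<in>{0..T}. X'' t \<omega> = z'' + (LBINT s:{0..t}. g s * X'' s \<omega>) + time_integral b'' t \<omega> + I'' t \<omega>"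
    using X'' unfolding linear_solution_def by blast
  have c: "AE \<omega> in M. continuous_on {0..T} (\<lambda>t. X t \<omega>)" "AE \<omega> in M. continuous_on {0..T} (\<lambda>t. X' t \<omega>)"
    "AE \<omega> in M. continuous_on {0..T} (\<lambda>t. X'' t \<omega>)"
    using X X' X'' unfolding linear_solution_def by blast+
  show ?thesis
    using XI XI' XI'' c ito_linear[OF I I' I'' veq] time_integral_linear[OF b(1,2) beq L2F_D(3)[OF b(3)]]
  proof eventually_elim
    case (elim \<omega>)
    define D where "D t = X'' t \<omega> - \<alpha> * X t \<omega> - \<beta> * X' t \<omega>" for t
    define c where "c = z'' - \<alpha> * z - \<beta> * z'"
    have cD: "continuous_on {0..T} D" unfolding D_def by (intro continuous_intros elim)
    have gi: "set_integrable lborel {0..t} (\<lambda>s. g s * Y s)" if "continuous_on {0..T} Y" "t \<in> {0..T}" for Y t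
    proof -
      have "set_integrable lborel {0..T} (\<lambda>s. Y s * g s)" by (rule set_integrable_continuous_mult[OF g that(1)])
      then have "set_integrable lborel {0..T} (\<lambda>s. g s * Y s)" by (simp add: mult.commute)
      then show ?thesis by (rule set_integrable_subset) (use that(2) in auto)
    qed
    have D: "D t = c + (LBINT s:{0..t}. g s * D s)" if t: "t \<in> {0..T}" for t
    proof -
      note i = gi[OF elim(4) t] gi[OF elim(5) t] gi[OF elim(6) t]
      have "(LBINT s:{0..t}. g s * D s) = (LBINT s:{0..t}. g s * X'' s \<omega> - \<alpha> * (g s * X s \<omega>) - \<beta> * (g s * X' s \<omega>))"
        by (simp add: D_def algebra_simps)
      also have "\<dots> = (LBINT s:{0..t}. g s * X'' s \<omega> - \<alpha> * (g s * X s \<omega>)) - (LBINT s:{0..t}. \<beta> * (g s * X' s \<omega>))"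
        by (intro set_integral_diff set_integrable_mult_right i)
      also have "(LBINT s:{0..t}. g s * X'' s \<omega> - \<alpha> * (g s * X s \<omega>)) = (LBINT s:{0..t}. g s * X'' s \<omega>) - (LBINT s:{0..t}. \<alpha> * (g s * X s \<omega>))"
        by (intro set_integral_diff set_integrable_mult_right i)
      finally have e: "(LBINT s:{0..t}. g s * D s) = (LBINT s:{0..t}. g s * X'' s \<omega>) - \<alpha> * (LBINT s:{0..t}. g s * X s \<omega>) - \<beta> * (LBINT s:{0..t}. g s * X' s \<omega>)"
        by simp
      have "X t \<omega> = z + (LBINT s:{0..t}. g s * X s \<omega>) + time_integral b t \<omega> + I t \<omega>"
        "X' t \<omega> = z' + (LBINT s:{0..t}. g s * X' s \<omega>) + time_integral b' t \<omega> + I' t \<omega>"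
        "X'' t \<omega> = z'' + (LBINT s:{0..t}. g s * X'' s \<omega>) + time_integral b'' t \<omega> + I'' t \<omega>"
        "I'' t \<omega> = \<alpha> * I t \<omega> + \<beta> * I' t \<omega>" "time_integral b'' t \<omega> = \<alpha> * time_integral b t \<omega> + \<beta> * time_integral b' t \<omega>"
        using elim t by blast+
      then show ?thesis
        unfolding e unfolding D_def c_def by (simp add: algebra_simps)
    qed
    show ?case
    proof
      fix t assume t: "t \<in> {0..T}"
      have "D t = c * exp (LBINT s:{0..t}. g s)" by (rule linear_ode_unique[OF g cD D t])
      then show "X'' t \<omega> = \<alpha> * X t \<omega> + \<beta> * X' t \<omega> + (z'' - \<alpha> * z - \<beta> * z') * exp (LBINT s:{0..t}. g s)"
        unfolding D_def c_def by simp
    qed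
  qed
qed

text \<open>Existence comes path by path from \<open>linear_ode_exists\<close>, the forcing path
  being initial value plus time integral plus stochastic integral. The constant depends on
  \<open>g\<close>, its bound and \<open>T\<close> alone, which makes the terminal value a bounded
  map of the data.\<close>

lemma linear_solution_exists:
  assumes g: "g \<in> borel_measurable borel" and gK: "\<And>t. \<bar>g t\<bar> \<le> K"
  shows "\<exists>C\<ge>0. \<forall>z. \<forall>b\<in>L2F. \<forall>v\<in>L2F. \<exists>X. linear_solution g z b v X \<and> X \<in> L2F \<and>
    sq_int M (X T) \<and> expectation (\<lambda>\<omega>. (X T \<omega>)\<^sup>2) \<le> C * (z\<^sup>2 + L2F_norm2 b + L2F_norm2 v)"
proof -
  have K0: "K \<ge> 0" using order_trans[OF abs_ge_zero gK[of 0]] .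
  have gint: "set_integrable lborel {0..T} g"
    unfolding set_integrable_def
    by (rule integrableI_bounded_set_indicator[where B = K]) (use g gK in \<open>auto simp: emeasure_lborel_Icc_eq\<close>)
  define R where "R t = (LBINT s:{0..t}. g s)" for t
  have cR: "continuous_on {0..T} R" unfolding R_def by (rule continuous_on_set_lebesgue_integral[OF gint])
  define \<kappa> where "\<kappa> s = exp (- R s) * g s" for s
  have ce: "continuous_on {0..T} (\<lambda>s. exp (- R s))" by (intro continuous_intros cR)
  obtain E where E: "E \<ge> 0" "\<And>s. s \<in> {0..T} \<Longrightarrow> \<bar>exp (- R s)\<bar> \<le> E"
    using continuous_on_Icc_bounded[OF ce] by blast
  have \<kappa>m: "\<kappa> \<in> borel_measurable time_measure"
    unfolding \<kappa>_def by (intro borel_measurable_times continuous_time_measurable[OF ce] time_measurable g)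
  have \<kappa>K: "\<bar>\<kappa> s\<bar> \<le> E * K" if "s \<in> {0..T}" for s
    unfolding \<kappa>_def abs_mult by (rule mult_mono[OF E(2)[OF that] gK E(1) abs_ge_zero])
  \<comment> \<open>Dominates the coefficients 1, \<open>T\<close> and 1 in the bound for the second
    moment of \<open>F\<close>; the accompanying factor 3 comes from squaring a sum of three
    terms.\<close>
  define B where "B = 1 + T + 1"
  define C where "C = 6 * B + 2 * (exp (R T))\<^sup>2 * (T * ((E * K)\<^sup>2 * (T * (3 * B))))"
  have B0: "B \<ge> 0" using T_pos by (simp add: B_def)
  have C0: "C \<ge> 0" unfolding C_def using B0 T_pos by simp
  have TT: "T \<in> {0..T}" using T_pos by simp
  have "\<exists>X. linear_solution g z b v X \<and> X \<in> L2F \<and> sq_int M (X T) \<and>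
      expectation (\<lambda>\<omega>. (X T \<omega>)\<^sup>2) \<le> C * (z\<^sup>2 + L2F_norm2 b + L2F_norm2 v)"
    if b: "b \<in> L2F" and v: "v \<in> L2F" for z b v
  proof -
    obtain I where I: "ito_integral v I" using ito_exists[OF v] by blast
    define F where "F t \<omega> = z + time_integral b t \<omega> + I t \<omega>" for t \<omega>
    define m where "m = z\<^sup>2 + L2F_norm2 b + L2F_norm2 v"
    have FL: "F \<in> L2F"
      using L2F_lin[OF L2F_lin[OF L2F_const[of 1] time_integral_L2F[OF b], of z 1] ito_L2F[OF I], of 1 1] by (simp add: F_def[abs_def])
    have Fsq: "sq_int M (F t)" if "t \<in> {0..T}" for t
      unfolding F_def by (intro sq_int_add sq_int_const time_integral_sq_int(1)[OF b that] ito_sq_int[OF I that])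
    have m0: "m \<ge> 0" unfolding m_def using L2F_norm2_nonneg[of b] L2F_norm2_nonneg[of v] by simp
    have Fm: "expectation (\<lambda>\<omega>. (F t \<omega>)\<^sup>2) \<le> 3 * B * m" if t: "t \<in> {0..T}" for t
    proof -
      note s1 = time_integral_sq_int[OF b t] and s2 = ito_sq_int[OF I t]
      have "expectation (\<lambda>\<omega>. (F t \<omega>)\<^sup>2) \<le> expectation (\<lambda>\<omega>. 3 * z\<^sup>2 + 3 * (time_integral b t \<omega>)\<^sup>2 + 3 * (I t \<omega>)\<^sup>2)"
      proof (rule integral_mono)
        show "integrable M (\<lambda>\<omega>. (F t \<omega>)\<^sup>2)" by (rule sq_intD(2)[OF Fsq[OF t]])
        show "integrable M (\<lambda>\<omega>. 3 * z\<^sup>2 + 3 * (time_integral b t \<omega>)\<^sup>2 + 3 * (I t \<omega>)\<^sup>2)"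
          by (intro Bochner_Integration.integrable_add integrable_mult_right integrable_const sq_intD(2)[OF s1(1)] sq_intD(2)[OF s2])
        fix \<omega>
        have "(x + y + w)\<^sup>2 \<le> 3 * x\<^sup>2 + 3 * y\<^sup>2 + 3 * w\<^sup>2" for x y w :: real
          using zero_le_power2[of "x - y"] zero_le_power2[of "y - w"] zero_le_power2[of "x - w"]
          by (simp add: power2_eq_square algebra_simps)
        then show "(F t \<omega>)\<^sup>2 \<le> 3 * z\<^sup>2 + 3 * (time_integral b t \<omega>)\<^sup>2 + 3 * (I t \<omega>)\<^sup>2"
          unfolding F_def .
      qed
      also have "\<dots> = 3 * z\<^sup>2 + 3 * expectation (\<lambda>\<omega>. (time_integral b t \<omega>)\<^sup>2) + 3 * expectation (\<lambda>\<omega>. (I t \<omega>)\<^sup>2)"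
        using sq_intD(2)[OF s1(1)] sq_intD(2)[OF s2] by (simp add: prob_space)
      also have "\<dots> \<le> 3 * z\<^sup>2 + 3 * (T * L2F_norm2 b) + 3 * L2F_norm2 v"
        using s1(2) ito_second_moment[OF I t] unfolding L2F_norm2_def by linarith
      also have "\<dots> \<le> 3 * B * m"
      proof -
        have "z\<^sup>2 \<le> B * z\<^sup>2" "T * L2F_norm2 b \<le> B * L2F_norm2 b" "L2F_norm2 v \<le> B * L2F_norm2 v"
          using T_pos L2F_norm2_nonneg[of b] L2F_norm2_nonneg[of v]
            mult_right_mono[of 1 B "z\<^sup>2"] mult_right_mono[of T B "L2F_norm2 b"] mult_right_mono[of 1 B "L2F_norm2 v"]
          by (simp_all add: B_def)
        then show ?thesis unfolding m_def by (simp add: algebra_simps)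
      qed
      finally show ?thesis .
    qed
    define h where "h t \<omega> = \<kappa> t * F t \<omega>" for t \<omega>
    have hle: "AE (t, \<omega>) in dt_P. \<bar>h t \<omega>\<bar> \<le> (E * K) * \<bar>F t \<omega>\<bar>"
    proof (intro AE_I2)
      fix p assume "p \<in> space dt_P"
      then show "case p of (t, \<omega>) \<Rightarrow> \<bar>h t \<omega>\<bar> \<le> (E * K) * \<bar>F t \<omega>\<bar>"
        using \<kappa>K by (auto simp: space_dt_P h_def abs_mult intro!: mult_right_mono)
    qed
    have hL: "h \<in> L2F"
      by (rule L2F_bound[OF FL _ hle]) (unfold h_def, rule adapted_det_mult[OF L2F_D(1)[OF FL] \<kappa>m])
    \<comment> \<open>Variation of constants with the correction written as a time integral of the
      adapted process \<open>h\<close>, so that adaptedness of \<open>X\<close> follows from that of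
      time integrals.\<close>
    define X where "X t \<omega> = F t \<omega> + exp (R t) * time_integral h t \<omega>" for t \<omega>
    have ceR: "continuous_on {0..T} (\<lambda>t. exp (R t))" by (intro continuous_intros cR)
    have ceRm: "(\<lambda>t. exp (R t)) \<in> borel_measurable time_measure" by (rule continuous_time_measurable[OF ceR])
    have Xad: "adapted X"
      using adapted_lin[OF L2F_D(1)[OF FL] adapted_det_mult[OF time_integral_adapted[OF hL] ceRm], of 1 1]
      by (simp add: X_def[abs_def])
    have Fc: "AE \<omega> in M. continuous_on {0..T} (\<lambda>t. F t \<omega>)"
      using time_integral_continuous[OF b] ito_integral_L2F(3)[OF I]
      by eventually_elim (unfold F_def, intro continuous_intros)
    have Xeq: "AE \<omega> in M. continuous_on {0..T} (\<lambda>t. X t \<omega>) \<and> (\<forall>t\<in>{0..T}. X t \<omega> = F t \<omega> + (LBINT s:{0..t}. g s * X s \<omega>))"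
      using Fc
    proof eventually_elim
      case (elim \<omega>)
      have Xt: "X t \<omega> = F t \<omega> + exp (LBINT s:{0..t}. g s) * (LBINT s:{0..t}. exp (- (LBINT y:{0..s}. g y)) * g s * F s \<omega>)" for t
        by (simp add: X_def time_integral_def h_def \<kappa>_def R_def)
      note ode = linear_ode_exists[OF gint elim, folded Xt]
      show ?case
        by (intro conjI ballI) (rule ode(1), rule ode(2))
    qed
    have ls: "linear_solution g z b v X"
      unfolding linear_solution_def
    proof (intro conjI Xad exI[of _ I] I)
      show "AE \<omega> in M. continuous_on {0..T} (\<lambda>t. X t \<omega>)" using Xeq by eventually_elim blast
      show "AE \<omega> in M. \<forall>t\<in>{0..T}. X t \<omega> = z + (LBINT s:{0..t}. g s * X s \<omega>) + time_integral b t \<omega> + I t \<omega>"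
        using Xeq
      proof eventually_elim
        case (elim \<omega>)
        show ?case
        proof
          fix t assume "t \<in> {0..T}"
          with elim have "X t \<omega> = F t \<omega> + (LBINT s:{0..t}. g s * X s \<omega>)" by blast
          then show "X t \<omega> = z + (LBINT s:{0..t}. g s * X s \<omega>) + time_integral b t \<omega> + I t \<omega>"
            by (simp add: F_def)
        qed
      qed
    qed
    obtain E' where E': "E' \<ge> 0" "\<And>s. s \<in> {0..T} \<Longrightarrow> \<bar>exp (R s)\<bar> \<le> E'"
      using continuous_on_Icc_bounded[OF ceR] by blast
    have XL: "X \<in> L2F"
    proof -
      have "(\<lambda>t \<omega>. exp (R t) * time_integral h t \<omega>) \<in> L2F"
      proof (rule L2F_bound[OF time_integral_L2F[OF hL], of _ E'])
        show "adapted (\<lambda>t \<omega>. exp (R t) * time_integral h t \<omega>)"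
          by (rule adapted_det_mult[OF time_integral_adapted[OF hL] ceRm])
        show "AE (t, \<omega>) in dt_P. \<bar>exp (R t) * time_integral h t \<omega>\<bar> \<le> E' * \<bar>time_integral h t \<omega>\<bar>"
        proof (intro AE_I2)
          fix p assume "p \<in> space dt_P"
          then show "case p of (t, \<omega>) \<Rightarrow> \<bar>exp (R t) * time_integral h t \<omega>\<bar> \<le> E' * \<bar>time_integral h t \<omega>\<bar>"
            using E'(2) by (auto simp: space_dt_P abs_mult intro!: mult_right_mono)
        qed
      qed
      from L2F_lin[OF FL this, of 1 1] show ?thesis by (simp add: X_def[abs_def])
    qed
    note th = time_integral_sq_int[OF hL TT]
    have XTsq: "sq_int M (X T)"
      unfolding X_def by (intro sq_int_add sq_int_cmult Fsq[OF TT] th(1))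
    have "L2F_norm2 F \<le> T * (3 * B * m)"
    proof -
      have "L2F_norm2 F = (LBINT s:{0..T}. expectation (\<lambda>\<omega>. F s \<omega> * F s \<omega>))"
        unfolding L2F_norm2_def by (rule L2F_norm_eq[OF FL])
      also have "\<dots> \<le> (LBINT s:{0..T}. 3 * B * m)"
      proof (rule set_integral_mono[OF L2F_product(2)[OF FL FL TT]])
        show "set_integrable lborel {0..T} (\<lambda>_. 3 * B * m)" by (rule set_integrable_const_Icc)
        show "expectation (\<lambda>\<omega>. F s \<omega> * F s \<omega>) \<le> 3 * B * m" if "s \<in> {0..T}" for s
          using Fm[OF that] by (simp add: power2_eq_square)
      qed
      also have "\<dots> = T * (3 * B * m)" using T_pos by (simp add: set_lebesgue_integral_def)
      finally show ?thesis .
    qed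
    then have "L2F_norm2 h \<le> (E * K)\<^sup>2 * (T * (3 * B * m))"
      by (rule order_trans[OF L2F_norm2_mono[OF FL hle hL] mult_left_mono]) simp
    then have hT: "expectation (\<lambda>\<omega>. (time_integral h T \<omega>)\<^sup>2) \<le> T * ((E * K)\<^sup>2 * (T * (3 * B * m)))"
      using T_pos by (intro order_trans[OF th(2)[folded L2F_norm2_def] mult_left_mono]) auto
    have "expectation (\<lambda>\<omega>. (X T \<omega>)\<^sup>2) \<le> expectation (\<lambda>\<omega>. 2 * (F T \<omega>)\<^sup>2 + 2 * (exp (R T))\<^sup>2 * (time_integral h T \<omega>)\<^sup>2)"
    proof (rule integral_mono)
      show "integrable M (\<lambda>\<omega>. (X T \<omega>)\<^sup>2)" by (rule sq_intD(2)[OF XTsq])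
      show "integrable M (\<lambda>\<omega>. 2 * (F T \<omega>)\<^sup>2 + 2 * (exp (R T))\<^sup>2 * (time_integral h T \<omega>)\<^sup>2)"
        by (intro Bochner_Integration.integrable_add integrable_mult_right sq_intD(2)[OF Fsq[OF TT]] sq_intD(2)[OF th(1)])
      fix \<omega>
      show "(X T \<omega>)\<^sup>2 \<le> 2 * (F T \<omega>)\<^sup>2 + 2 * (exp (R T))\<^sup>2 * (time_integral h T \<omega>)\<^sup>2"
        using zero_le_power2[of "F T \<omega> - exp (R T) * time_integral h T \<omega>"]
        unfolding X_def by (simp add: power2_eq_square algebra_simps)
    qed
    also have "\<dots> = 2 * expectation (\<lambda>\<omega>. (F T \<omega>)\<^sup>2) + 2 * (exp (R T))\<^sup>2 * expectation (\<lambda>\<omega>. (time_integral h T \<omega>)\<^sup>2)"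
      using sq_intD(2)[OF Fsq[OF TT]] sq_intD(2)[OF th(1)] by simp
    also have "\<dots> \<le> 2 * (3 * B * m) + 2 * (exp (R T))\<^sup>2 * (T * ((E * K)\<^sup>2 * (T * (3 * B * m))))"
      using Fm[OF TT] hT by (intro add_mono mult_left_mono) auto
    also have "\<dots> = C * m" unfolding C_def by (simp add: algebra_simps)
    finally show ?thesis using ls XL XTsq unfolding m_def by blast
  qed
  with C0 show ?thesis by blast
qed

text \<open>The terminal shift by \<open>c\<close> is produced at time 0: the solution started from
  \<open>z'\<close> ends at \<open>X T - c\<close>. Its drift \<open>g * Y + b\<close> is bounded by
  that solution and \<open>v\<close>, so \<open>backward_estimate\<close> applies. With
  \<open>c\<close> the mean of \<open>X T\<close> the right side contains a variance.\<close>

lemma linear_solution_coercive: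
  assumes g: "g \<in> borel_measurable borel" and gK: "\<And>t. \<bar>g t\<bar> \<le> K"
    and b: "b \<in> L2F" and v: "v \<in> L2F" and bv: "AE (t, \<omega>) in dt_P. \<bar>b t \<omega>\<bar> \<le> K * \<bar>v t \<omega>\<bar>"
    and X: "linear_solution g z b v X"
  shows "L2F_norm2 v \<le> 2 * exp ((2 * K + 2 * K\<^sup>2) * T) * expectation (\<lambda>\<omega>. (X T \<omega> - c)\<^sup>2)"
proof -
  have K0: "K \<ge> 0" using order_trans[OF abs_ge_zero gK[of 0]] .
  have gint: "set_integrable lborel {0..T} g"
    unfolding set_integrable_def
    by (rule integrableI_bounded_set_indicator[where B = K]) (use g gK in \<open>auto simp: emeasure_lborel_Icc_eq\<close>)
  have TT: "T \<in> {0..T}" using T_pos by simp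
  \<comment> \<open>Here \<open>c\<close> is discounted from \<open>T\<close> to 0 along the rate
    \<open>g\<close>.\<close>
  define z' where "z' = z - c * exp (- (LBINT s:{0..T}. g s))"
  obtain Y where Y: "linear_solution g z' b v Y" and YL: "Y \<in> L2F"
    using linear_solution_exists[OF g gK] b v by blast
  obtain I where I: "ito_integral v I"
    and YI: "AE \<omega> in M. \<forall>t\<in>{0..T}. Y t \<omega> = z' + (LBINT s:{0..t}. g s * Y s \<omega>) + time_integral b t \<omega> + I t \<omega>"
    using Y unfolding linear_solution_def by blast
  have cY: "AE \<omega> in M. continuous_on {0..T} (\<lambda>t. Y t \<omega>)" using Y unfolding linear_solution_def by blast
  have gm: "g \<in> borel_measurable time_measure" by (rule time_measurable[OF g])
  have gYL: "(\<lambda>t \<omega>. g t * Y t \<omega>) \<in> L2F"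
  proof (rule L2F_bound[OF YL, of _ K])
    show "adapted (\<lambda>t \<omega>. g t * Y t \<omega>)" by (rule adapted_det_mult[OF L2F_D(1)[OF YL] gm])
    show "AE (t, \<omega>) in dt_P. \<bar>g t * Y t \<omega>\<bar> \<le> K * \<bar>Y t \<omega>\<bar>"
      by (intro AE_I2) (auto simp: abs_mult intro!: mult_right_mono gK)
  qed
  define a where "a t \<omega> = g t * Y t \<omega> + b t \<omega>" for t \<omega>
  have a: "a \<in> L2F" using L2F_lin[OF gYL b, of 1 1] by (simp add: a_def[abs_def])
  define Z where "Z t \<omega> = z' + time_integral a t \<omega> + I t \<omega>" for t \<omega>
  have YZ: "AE \<omega> in M. \<forall>t\<in>{0..T}. Y t \<omega> = Z t \<omega>"
    using YI L2F_AE_set_integrable[OF gYL] L2F_AE_set_integrable[OF b]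
  proof eventually_elim
    case (elim \<omega>)
    show ?case
    proof
      fix t assume t: "t \<in> {0..T}"
      then have st: "{0..t} \<subseteq> {0..T}" by auto
      have "time_integral a t \<omega> = (LBINT s:{0..t}. g s * Y s \<omega>) + time_integral b t \<omega>"
        unfolding time_integral_def a_def
        by (rule set_integral_add(2); rule set_integrable_subset, (rule elim)?, use st in auto)
      with elim(1) t show "Y t \<omega> = Z t \<omega>" by (simp add: Z_def)
    qed
  qed
  have "L2F_norm2 v \<le> 2 * exp ((2 * K + 2 * K\<^sup>2) * T) * expectation (\<lambda>\<omega>. (Z T \<omega>)\<^sup>2)"
    unfolding L2F_norm2_def Z_def
  proof (rule backward_estimate[OF a I K0])
    show "AE (s, \<omega>) in dt_P. \<bar>a s \<omega>\<bar> \<le> K * (\<bar>z' + time_integral a s \<omega> + I s \<omega>\<bar> + \<bar>v s \<omega>\<bar>)"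
      using AE_dt_P_I[OF YZ] bv
    proof eventually_elim
      case (elim p)
      obtain s \<omega> where p: "p = (s, \<omega>)" by (cases p)
      have "\<bar>a s \<omega>\<bar> \<le> \<bar>g s * Y s \<omega>\<bar> + \<bar>b s \<omega>\<bar>" unfolding a_def by (rule abs_triangle_ineq)
      also have "\<dots> \<le> K * \<bar>Y s \<omega>\<bar> + K * \<bar>v s \<omega>\<bar>"
        using elim(2) by (intro add_mono) (auto simp: p abs_mult intro!: mult_right_mono gK)
      finally show ?case using elim(1) by (simp add: p Z_def algebra_simps)
    qed
  qed
  also have "expectation (\<lambda>\<omega>. (Z T \<omega>)\<^sup>2) = expectation (\<lambda>\<omega>. (X T \<omega> - c)\<^sup>2)"
  proof (rule integral_cong_AE)
    have Zm: "Z T \<in> borel_measurable M"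
      unfolding Z_def
      by (intro borel_measurable_add borel_measurable_const sq_intD(1)[OF time_integral_sq_int(1)[OF a TT]] sq_intD(1)[OF ito_sq_int[OF I TT]])
    have "adapted X" using X unfolding linear_solution_def by blast
    then have Xm: "X T \<in> borel_measurable M" by (rule adaptedD(3)[OF _ TT])
    show "(\<lambda>\<omega>. (Z T \<omega>)\<^sup>2) \<in> borel_measurable M" by (rule borel_measurable_power[OF Zm])
    show "(\<lambda>\<omega>. (X T \<omega> - c)\<^sup>2) \<in> borel_measurable M"
      by (intro borel_measurable_power borel_measurable_diff Xm borel_measurable_const)
    have "AE \<omega> in M. \<forall>t\<in>{0..T}. Y t \<omega> = 1 * X t \<omega> + 0 * X t \<omega> + (z' - 1 * z - 0 * z) * exp (LBINT s:{0..t}. g s)"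
      by (rule superposition[OF gint X X Y b b b]) auto
    with YZ show "AE \<omega> in M. (Z T \<omega>)\<^sup>2 = (X T \<omega> - c)\<^sup>2"
    proof eventually_elim
      case (elim \<omega>)
      have "Z T \<omega> = X T \<omega> + (z' - z) * exp (LBINT s:{0..T}. g s)"
        using elim TT by auto
      also have "(z' - z) * exp (LBINT s:{0..T}. g s) = - c"
        by (simp add: z'_def flip: exp_add mult.assoc)
      finally show ?case by simp
    qed
  qed
  finally show ?thesis .
qed

end

subsection \<open>The equilibrium system\<close>

context brownian_space
begin

section \<open>Covariance as a semi-inner product\<close>

definition covar :: "('a \<Rightarrow> real) \<Rightarrow> ('a \<Rightarrow> real) \<Rightarrow> real" where
  "covar X Y = expectation (\<lambda>\<omega>. X \<omega> * Y \<omega>) - expectation X * expectation Y"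

lemma covar_cong_AE:
  assumes "AE \<omega> in M. X \<omega> = X' \<omega>" "AE \<omega> in M. Y \<omega> = Y' \<omega>"
    and "sq_int M X" "sq_int M X'" "sq_int M Y" "sq_int M Y'"
  shows "covar X Y = covar X' Y'"
proof -
  note m = sq_intD(1)[OF assms(3)] sq_intD(1)[OF assms(4)] sq_intD(1)[OF assms(5)] sq_intD(1)[OF assms(6)]
  have "expectation (\<lambda>\<omega>. X \<omega> * Y \<omega>) = expectation (\<lambda>\<omega>. X' \<omega> * Y' \<omega>)"
  proof (rule integral_cong_AE)
    show "AE \<omega> in M. X \<omega> * Y \<omega> = X' \<omega> * Y' \<omega>" using assms(1,2) by eventually_elim simp
  qed (intro borel_measurable_times m)+
  moreover have "expectation X = expectation X'" by (rule integral_cong_AE[OF m(1,2) assms(1)])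
  moreover have "expectation Y = expectation Y'" by (rule integral_cong_AE[OF m(3,4) assms(2)])
  ultimately show ?thesis by (simp add: covar_def)
qed

lemma covar_variance:
  assumes "sq_int M X"
  shows "covar X X = expectation (\<lambda>\<omega>. (X \<omega> - c)\<^sup>2) - (expectation X - c)\<^sup>2"
    and "covar X X = variance X"
proof -
  have *: "expectation (\<lambda>\<omega>. (X \<omega> - c)\<^sup>2) = expectation (\<lambda>\<omega>. X \<omega> * X \<omega>) - 2 * c * expectation X + c\<^sup>2" for c
  proof -
    have "expectation (\<lambda>\<omega>. (X \<omega> - c)\<^sup>2) = expectation (\<lambda>\<omega>. X \<omega> * X \<omega> - 2 * c * X \<omega> + c\<^sup>2)"
      by (simp add: power2_eq_square algebra_simps)
    then show ?thesis
      using sq_int_mult[OF assms assms] sq_int_integrable[OF assms] by (simp add: prob_space)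
  qed
  show "covar X X = expectation (\<lambda>\<omega>. (X \<omega> - c)\<^sup>2) - (expectation X - c)\<^sup>2"
    unfolding * covar_def by (simp add: power2_eq_square algebra_simps)
  show "covar X X = variance X"
    unfolding * covar_def by (simp add: power2_eq_square)
qed

lemma covar_le_second_moment:
  assumes "sq_int M X" shows "covar X X \<le> expectation (\<lambda>\<omega>. (X \<omega> - c)\<^sup>2)"
  using covar_variance(1)[OF assms, of c] by simp

lemma covar_sym: "covar X Y = covar Y X"
  by (simp add: covar_def mult.commute)

lemma covar_lin:
  assumes "sq_int M X" "sq_int M Y" "sq_int M Z"
  shows "covar (\<lambda>\<omega>. a * X \<omega> + b * Y \<omega>) Z = a * covar X Z + b * covar Y Z"
proof -
  note i = sq_int_mult[OF assms(1,3)] sq_int_mult[OF assms(2,3)] sq_int_integrable[OF assms(1)] sq_int_integrable[OF assms(2)]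
  have "expectation (\<lambda>\<omega>. (a * X \<omega> + b * Y \<omega>) * Z \<omega>) = expectation (\<lambda>\<omega>. a * (X \<omega> * Z \<omega>) + b * (Y \<omega> * Z \<omega>))"
    by (simp add: algebra_simps)
  also have "\<dots> = a * expectation (\<lambda>\<omega>. X \<omega> * Z \<omega>) + b * expectation (\<lambda>\<omega>. Y \<omega> * Z \<omega>)"
    using i by simp
  finally show ?thesis
    unfolding covar_def using i by (simp add: algebra_simps)
qed

lemma covar_sum:
  assumes "\<And>i. i \<in> I \<Longrightarrow> sq_int M (X i)" "sq_int M Z"
  shows "covar (\<lambda>\<omega>. \<Sum>i\<in>I. X i \<omega>) Z = (\<Sum>i\<in>I. covar (X i) Z)"
  using assms(1)
proof (induction I rule: infinite_finite_induct)
  case (insert i I)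
  have "covar (\<lambda>\<omega>. 1 * X i \<omega> + 1 * (\<Sum>i\<in>I. X i \<omega>)) Z = 1 * covar (X i) Z + 1 * covar (\<lambda>\<omega>. \<Sum>i\<in>I. X i \<omega>) Z"
    by (rule covar_lin) (use insert assms(2) in \<open>auto intro: sq_int_sum\<close>)
  with insert show ?case by simp
qed (simp_all add: covar_def)

text \<open>Semidefinite only, as constants are orthogonal to everything.\<close>

sublocale cov: semi_inner "{X. sq_int M X}" "\<lambda>a u b v \<omega>. a * u \<omega> + b * v \<omega>" covar
proof (unfold_locales, goal_cases)
  case (4 u)
  have "0 \<le> variance u" by simp
  with 4 show ?case by (simp add: covar_variance(2))
qed (auto intro: sq_int_lin covar_sym simp: covar_lin)

lemma covar_nonneg: "sq_int M X \<Longrightarrow> 0 \<le> covar X X"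
  using cov.B_nonneg[of X] by simp

lemma covar_Cauchy_Schwarz: "sq_int M X \<Longrightarrow> sq_int M Y \<Longrightarrow> (covar X Y)\<^sup>2 \<le> covar X X * covar Y Y"
  using cov.B_Cauchy_Schwarz[of X Y] by simp

lemma covar_add_scaled:
  assumes "sq_int M X" "sq_int M V"
  shows "covar (\<lambda>\<omega>. 1 * X \<omega> + s * V \<omega>) (\<lambda>\<omega>. 1 * X \<omega> + s * V \<omega>) = covar X X + 2 * s * covar X V + s\<^sup>2 * covar V V"
proof -
  note sq = sq_int_lin[OF assms, of 1 s]
  have "covar (\<lambda>\<omega>. 1 * X \<omega> + s * V \<omega>) (\<lambda>\<omega>. 1 * X \<omega> + s * V \<omega>) =
      1 * covar X (\<lambda>\<omega>. 1 * X \<omega> + s * V \<omega>) + s * covar V (\<lambda>\<omega>. 1 * X \<omega> + s * V \<omega>)"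
    by (rule covar_lin[OF assms sq])
  also have "covar X (\<lambda>\<omega>. 1 * X \<omega> + s * V \<omega>) = 1 * covar X X + s * covar V X"
    by (rule trans[OF covar_sym covar_lin[OF assms assms(1)]])
  also have "covar V (\<lambda>\<omega>. 1 * X \<omega> + s * V \<omega>) = 1 * covar X V + s * covar V V"
    by (rule trans[OF covar_sym covar_lin[OF assms assms(2)]])
  also have "covar V X = covar X V" by (rule covar_sym)
  finally show ?thesis by (simp add: power2_eq_square algebra_simps)
qed

text \<open>A limit in the product measure is determined only almost everywhere, whereas adaptedness
  is required at each single time. The limit is therefore taken pointwise along one subsequence,
  which makes its section at \<open>t\<close> measurable in \<open>\<F> t\<close>.\<close>

lemma L2F_complete:
  assumes u: "\<And>m. u m \<in> L2F"
    and cauchy: "\<And>e. e > 0 \<Longrightarrow> \<exists>K. \<forall>m\<ge>K. \<forall>k\<ge>K. L2F_norm2 (\<lambda>t \<omega>. 1 * u m t \<omega> + (-1) * u k t \<omega>) < e"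
  shows "\<exists>v\<in>L2F. (\<lambda>m. L2F_norm2 (\<lambda>t \<omega>. 1 * u m t \<omega> + (-1) * v t \<omega>)) \<longlonglongrightarrow> 0"
proof -
  define f where "f m p = (case p of (t, \<omega>) \<Rightarrow> u m t \<omega>)" for m and p :: "real \<times> 'a"
  have f: "sq_int dt_P (f m)" for m unfolding f_def by (rule L2F_D(2)[OF u])
  have eq: "(\<integral>p. (f m p - f k p)\<^sup>2 \<partial>dt_P) = L2F_norm2 (\<lambda>t \<omega>. 1 * u m t \<omega> + (-1) * u k t \<omega>)" for m k
    by (simp add: L2F_norm2_def f_def case_prod_beta')
  have c: "\<exists>K. \<forall>m\<ge>K. \<forall>k\<ge>K. (\<integral>p. (f m p - f k p)\<^sup>2 \<partial>dt_P) < e" if "e > 0" for e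
    unfolding eq by (rule cauchy[OF that])
  obtain s where s: "L2_tendsto dt_P f (\<lambda>x. if convergent (\<lambda>k. f (s k) x) then lim (\<lambda>k. f (s k) x) else 0)"
    using L2_complete[OF f c] by blast
  define v where "v t \<omega> = (if convergent (\<lambda>k. u (s k) t \<omega>) then lim (\<lambda>k. u (s k) t \<omega>) else 0)" for t \<omega>
  have v_eq: "(\<lambda>x. if convergent (\<lambda>k. f (s k) x) then lim (\<lambda>k. f (s k) x) else 0) = (\<lambda>(t, \<omega>). v t \<omega>)"
    by (simp add: f_def v_def fun_eq_iff)
  have sv: "L2_tendsto dt_P f (\<lambda>(t, \<omega>). v t \<omega>)" using s unfolding v_eq .
  then have sqv: "sq_int dt_P (\<lambda>(t, \<omega>). v t \<omega>)" unfolding L2_tendsto_def by blast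
  have "adapted v"
    unfolding adapted_def
  proof (intro conjI ballI)
    show "(\<lambda>(t, \<omega>). v t \<omega>) \<in> borel_measurable dt_P" by (rule sq_intD(1)[OF sqv])
    fix t assume t: "t \<in> {0..T}"
    have um: "u (s k) t \<in> borel_measurable (\<F> t)" for k by (rule adaptedD(2)[OF L2F_D(1)[OF u] t])
    have conv: "Measurable.pred (\<F> t) (\<lambda>\<omega>. convergent (\<lambda>k. u (s k) t \<omega>))"
      unfolding Cauchy_convergent_iff[symmetric] pred_def by (rule sets_Collect_Cauchy[OF um])
    show "v t \<in> borel_measurable (\<F> t)"
      unfolding v_def
      by (rule measurable_If[OF borel_measurable_lim_metric[OF um] borel_measurable_const conv[unfolded pred_def]])
  qed
  with sqv have vL: "v \<in> L2F" by (simp add: L2F_iff)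
  have "(\<lambda>m. \<integral>p. (f m p - (case p of (t, \<omega>) \<Rightarrow> v t \<omega>))\<^sup>2 \<partial>dt_P) \<longlonglongrightarrow> 0"
    using sv unfolding L2_tendsto_def by blast
  then have "(\<lambda>m. L2F_norm2 (\<lambda>t \<omega>. 1 * u m t \<omega> + (-1) * v t \<omega>)) \<longlonglongrightarrow> 0"
    by (simp add: L2F_norm2_def f_def case_prod_beta')
  with vL show ?thesis by blast
qed

end

text \<open>
  \<open>Y i p\<close> stands for the part of the terminal wealth of agent \<open>i\<close> that is linear in the strategy.
\<close>

locale terminal_maps = brownian_space M T W
  for M :: "'a measure" and T :: real and W :: "real \<Rightarrow> 'a \<Rightarrow> real" +
  fixes I :: "nat set" and Y :: "nat \<Rightarrow> (real \<Rightarrow> 'a \<Rightarrow> real) \<Rightarrow> 'a \<Rightarrow> real"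
  assumes finite_I: "finite I"
    and Y_sq_int: "\<And>i p. i \<in> I \<Longrightarrow> p \<in> L2F \<Longrightarrow> sq_int M (Y i p)"
    and Y_linear: "\<And>i p q u a b. i \<in> I \<Longrightarrow> p \<in> L2F \<Longrightarrow> q \<in> L2F \<Longrightarrow> u \<in> L2F \<Longrightarrow>
      AE (t, \<omega>) in dt_P. u t \<omega> = a * p t \<omega> + b * q t \<omega> \<Longrightarrow> AE \<omega> in M. Y i u \<omega> = a * Y i p \<omega> + b * Y i q \<omega>"
    and Y_bounded: "\<And>i. i \<in> I \<Longrightarrow> \<exists>C\<ge>0. \<forall>p\<in>L2F. expectation (\<lambda>\<omega>. (Y i p \<omega>)\<^sup>2) \<le> C * L2F_norm2 p"
    and Y_coercive: "\<And>i. i \<in> I \<Longrightarrow> \<exists>C\<ge>0. \<forall>p\<in>L2F. L2F_norm2 p \<le> C * covar (Y i p) (Y i p)"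
begin

lemma Y_lin:
  "i \<in> I \<Longrightarrow> p \<in> L2F \<Longrightarrow> q \<in> L2F \<Longrightarrow> AE \<omega> in M. Y i (\<lambda>t \<omega>. a * p t \<omega> + b * q t \<omega>) \<omega> = a * Y i p \<omega> + b * Y i q \<omega>"
  by (rule Y_linear[OF _ _ _ L2F_lin]) auto

lemma covar_Y_lin:
  assumes i: "i \<in> I" and p: "p \<in> L2F" "q \<in> L2F" and Z: "sq_int M Z"
  shows "covar (Y i (\<lambda>t \<omega>. a * p t \<omega> + b * q t \<omega>)) Z = a * covar (Y i p) Z + b * covar (Y i q) Z"
proof -
  note s = Y_sq_int[OF i p(1)] Y_sq_int[OF i p(2)] Y_sq_int[OF i L2F_lin[OF p]]
  have "covar (Y i (\<lambda>t \<omega>. a * p t \<omega> + b * q t \<omega>)) Z = covar (\<lambda>\<omega>. a * Y i p \<omega> + b * Y i q \<omega>) Z"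
    by (rule covar_cong_AE[OF Y_lin[OF i p] _ s(3) sq_int_lin[OF s(1,2)] Z Z]) simp
  then show ?thesis by (simp add: covar_lin[OF s(1,2) Z])
qed

text \<open>Strategies carry the covariance of their images under \<open>Y i\<close> as semi-inner
  product. \<open>Y_coercive\<close> and \<open>Y_bounded\<close> compare it with
  \<open>L2F_norm2\<close> in both directions, so completeness is inherited from
  \<open>L2F_complete\<close>.\<close>

lemma agent_riesz:
  assumes i: "i \<in> I"
    and l_lin: "\<And>a b p q. p \<in> L2F \<Longrightarrow> q \<in> L2F \<Longrightarrow> l (\<lambda>t \<omega>. a * p t \<omega> + b * q t \<omega>) = a * l p + b * l q"
    and l_bdd: "C \<ge> 0" "\<And>p. p \<in> L2F \<Longrightarrow> (l p)\<^sup>2 \<le> C * covar (Y i p) (Y i p)"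
  shows "\<exists>u\<in>L2F. \<forall>p\<in>L2F. covar (Y i u) (Y i p) = l p"
proof -
  interpret V: semi_inner L2F "\<lambda>a u b v t \<omega>. a * u t \<omega> + b * v t \<omega>" "\<lambda>p q. covar (Y i p) (Y i q)"
  proof (unfold_locales, goal_cases)
    case (2 u v w a b)
    then show ?case by (intro covar_Y_lin[OF i] Y_sq_int[OF i])
  qed (auto intro: L2F_lin covar_sym covar_nonneg Y_sq_int[OF i])
  obtain C1 where C1: "C1 \<ge> 0" "\<And>p. p \<in> L2F \<Longrightarrow> expectation (\<lambda>\<omega>. (Y i p \<omega>)\<^sup>2) \<le> C1 * L2F_norm2 p"
    using Y_bounded[OF i] by blast
  obtain C2 where C2: "C2 \<ge> 0" "\<And>p. p \<in> L2F \<Longrightarrow> L2F_norm2 p \<le> C2 * covar (Y i p) (Y i p)"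
    using Y_coercive[OF i] by blast
  show ?thesis
  proof (rule V.riesz_representation[OF _ _ l_lin l_bdd])
    show "L2F \<noteq> {}" using L2F_const by blast
    fix u :: "nat \<Rightarrow> real \<Rightarrow> 'a \<Rightarrow> real"
    assume u: "\<And>m. u m \<in> L2F"
      and cauchy: "\<And>e. e > 0 \<Longrightarrow> \<exists>K. \<forall>m\<ge>K. \<forall>k\<ge>K.
        covar (Y i (\<lambda>t \<omega>. 1 * u m t \<omega> + (-1) * u k t \<omega>)) (Y i (\<lambda>t \<omega>. 1 * u m t \<omega> + (-1) * u k t \<omega>)) < e"
    have "\<exists>v\<in>L2F. (\<lambda>m. L2F_norm2 (\<lambda>t \<omega>. 1 * u m t \<omega> + (-1) * v t \<omega>)) \<longlonglongrightarrow> 0"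
    proof (rule L2F_complete[OF u])
      fix e :: real assume e: "e > 0"
      \<comment> \<open>The added 1 allows for \<open>C2 = 0\<close>.\<close>
      have "e / (C2 + 1) > 0" using e C2(1) by simp
      from cauchy[OF this] obtain K where K: "\<forall>m\<ge>K. \<forall>k\<ge>K.
        covar (Y i (\<lambda>t \<omega>. 1 * u m t \<omega> + (-1) * u k t \<omega>)) (Y i (\<lambda>t \<omega>. 1 * u m t \<omega> + (-1) * u k t \<omega>)) < e / (C2 + 1)"
        by blast
      have "L2F_norm2 (\<lambda>t \<omega>. 1 * u m t \<omega> + (-1) * u k t \<omega>) < e" if mk: "m \<ge> K" "k \<ge> K" for m k
      proof -
        let ?w = "\<lambda>t \<omega>. 1 * u m t \<omega> + (-1) * u k t \<omega>"
        have w: "?w \<in> L2F" by (rule L2F_lin[OF u u])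
        have "L2F_norm2 ?w \<le> C2 * covar (Y i ?w) (Y i ?w)" by (rule C2(2)[OF w])
        also have "\<dots> \<le> C2 * (e / (C2 + 1))"
          using K mk by (intro mult_left_mono[OF less_imp_le C2(1)]) blast
        also have "\<dots> < e" using e C2(1) by (simp add: field_simps)
        finally show ?thesis .
      qed
      then show "\<exists>K. \<forall>m\<ge>K. \<forall>k\<ge>K. L2F_norm2 (\<lambda>t \<omega>. 1 * u m t \<omega> + (-1) * u k t \<omega>) < e" by blast
    qed
    then obtain v where v: "v \<in> L2F" and lim: "(\<lambda>m. L2F_norm2 (\<lambda>t \<omega>. 1 * u m t \<omega> + (-1) * v t \<omega>)) \<longlonglongrightarrow> 0"
      by blast
    have "(\<lambda>m. covar (Y i (\<lambda>t \<omega>. 1 * u m t \<omega> + (-1) * v t \<omega>)) (Y i (\<lambda>t \<omega>. 1 * u m t \<omega> + (-1) * v t \<omega>))) \<longlonglongrightarrow> 0"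
    proof (rule tendsto_sandwich[of "\<lambda>_. 0"])
      show "(\<lambda>m. C1 * L2F_norm2 (\<lambda>t \<omega>. 1 * u m t \<omega> + (-1) * v t \<omega>)) \<longlonglongrightarrow> 0"
        by (rule tendsto_mult_right_zero[OF lim])
      show "\<forall>\<^sub>F m in sequentially. 0 \<le> covar (Y i (\<lambda>t \<omega>. 1 * u m t \<omega> + (-1) * v t \<omega>)) (Y i (\<lambda>t \<omega>. 1 * u m t \<omega> + (-1) * v t \<omega>))"
        by (intro always_eventually allI covar_nonneg Y_sq_int[OF i] L2F_lin u v)
      show "\<forall>\<^sub>F m in sequentially. covar (Y i (\<lambda>t \<omega>. 1 * u m t \<omega> + (-1) * v t \<omega>)) (Y i (\<lambda>t \<omega>. 1 * u m t \<omega> + (-1) * v t \<omega>))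
          \<le> C1 * L2F_norm2 (\<lambda>t \<omega>. 1 * u m t \<omega> + (-1) * v t \<omega>)"
      proof (intro always_eventually allI)
        fix m
        let ?w = "\<lambda>t \<omega>. 1 * u m t \<omega> + (-1) * v t \<omega>"
        have w: "?w \<in> L2F" by (rule L2F_lin[OF u v])
        have "covar (Y i ?w) (Y i ?w) \<le> expectation (\<lambda>\<omega>. (Y i ?w \<omega> - 0)\<^sup>2)"
          by (rule covar_le_second_moment[OF Y_sq_int[OF i w]])
        also have "\<dots> \<le> C1 * L2F_norm2 ?w" using C1(2)[OF w] by simp
        finally show "covar (Y i ?w) (Y i ?w) \<le> C1 * L2F_norm2 ?w" .
      qed
    qed simp
    with v show "\<exists>v\<in>L2F. (\<lambda>m. covar (Y i (\<lambda>t \<omega>. 1 * u m t \<omega> + (-1) * v t \<omega>)) (Y i (\<lambda>t \<omega>. 1 * u m t \<omega> + (-1) * v t \<omega>))) \<longlonglongrightarrow> 0"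
      by blast
  qed
qed

text \<open>For the difference \<open>w\<close> of two solutions the mean terms cancel, and with
  \<open>p = w i\<close> the variance of \<open>Y i (w i)\<close> equals \<open>q i\<close> times
  its covariance with the aggregate \<open>S\<close>. Cauchy-Schwarz and summation bound the
  variance of \<open>S\<close> by the sum of the \<open>q i\<close> times itself, so it is 0;
  coercivity leads back from \<open>Y i (w i)\<close> to \<open>w i\<close>.\<close>

theorem equilibrium_system_unique:
  assumes q: "\<And>i. i \<in> I \<Longrightarrow> q i \<ge> 0" "(\<Sum>i\<in>I. q i) < 1"
    and u: "\<And>i. i \<in> I \<Longrightarrow> u i \<in> L2F" and u': "\<And>i. i \<in> I \<Longrightarrow> u' i \<in> L2F"
    and eq: "\<And>i p. i \<in> I \<Longrightarrow> p \<in> L2F \<Longrightarrow>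
      covar (Y i (u i)) (Y i p) = q i * covar (\<lambda>\<omega>. \<Sum>k\<in>I. Y k (u k) \<omega>) (Y i p) + \<kappa> i * expectation (Y i p)"
    and eq': "\<And>i p. i \<in> I \<Longrightarrow> p \<in> L2F \<Longrightarrow>
      covar (Y i (u' i)) (Y i p) = q i * covar (\<lambda>\<omega>. \<Sum>k\<in>I. Y k (u' k) \<omega>) (Y i p) + \<kappa> i * expectation (Y i p)"
    and i: "i \<in> I"
  shows "ae_eq (u i) (u' i)"
proof -
  define w where "w i t \<omega> = 1 * u i t \<omega> + (-1) * u' i t \<omega>" for i t \<omega>
  have w: "w i \<in> L2F" if "i \<in> I" for i unfolding w_def by (rule L2F_lin[OF u[OF that] u'[OF that]])
  define S where "S \<omega> = (\<Sum>k\<in>I. Y k (w k) \<omega>)" for \<omega>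
  have Ssq: "sq_int M S" unfolding S_def by (intro sq_int_sum Y_sq_int w)
  have lin: "covar (Y i (w i)) Z = covar (Y i (u i)) Z - covar (Y i (u' i)) Z" if "i \<in> I" "sq_int M Z" for i Z
    unfolding w_def using covar_Y_lin[OF that(1) u[OF that(1)] u'[OF that(1)] that(2), of 1 "-1"] by simp
  have cS: "covar S Z = covar (\<lambda>\<omega>. \<Sum>k\<in>I. Y k (u k) \<omega>) Z - covar (\<lambda>\<omega>. \<Sum>k\<in>I. Y k (u' k) \<omega>) Z" if Z: "sq_int M Z" for Z
  proof -
    have "covar S Z = (\<Sum>k\<in>I. covar (Y k (w k)) Z)"
      unfolding S_def by (rule covar_sum[OF Y_sq_int[OF _ w] Z])
    also have "\<dots> = (\<Sum>k\<in>I. covar (Y k (u k)) Z - covar (Y k (u' k)) Z)"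
      by (intro sum.cong refl lin Z)
    also have "\<dots> = (\<Sum>k\<in>I. covar (Y k (u k)) Z) - (\<Sum>k\<in>I. covar (Y k (u' k)) Z)" by (rule sum_subtractf)
    also have "(\<Sum>k\<in>I. covar (Y k (u k)) Z) = covar (\<lambda>\<omega>. \<Sum>k\<in>I. Y k (u k) \<omega>) Z"
      by (rule covar_sum[OF Y_sq_int[OF _ u] Z, symmetric])
    also have "(\<Sum>k\<in>I. covar (Y k (u' k)) Z) = covar (\<lambda>\<omega>. \<Sum>k\<in>I. Y k (u' k) \<omega>) Z"
      by (rule covar_sum[OF Y_sq_int[OF _ u'] Z, symmetric])
    finally show ?thesis .
  qed
  have key: "covar (Y i (w i)) (Y i (w i)) = q i * covar S (Y i (w i))" if "i \<in> I" for i
    unfolding lin[OF that Y_sq_int[OF that w[OF that]]] cS[OF Y_sq_int[OF that w[OF that]]]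
      eq[OF that w[OF that]] eq'[OF that w[OF that]] by (simp add: algebra_simps)
  have VS: "0 \<le> covar S S" by (rule covar_nonneg[OF Ssq])
  \<comment> \<open>Cauchy-Schwarz combined with \<open>key\<close> is divided by the covariance
    when this is positive; otherwise the nonnegative right side suffices.\<close>
  have le: "covar S (Y i (w i)) \<le> q i * covar S S" if "i \<in> I" for i
  proof (cases "covar S (Y i (w i)) \<le> 0")
    case True
    moreover have "0 \<le> q i * covar S S" using q(1)[OF that] VS by simp
    ultimately show ?thesis by linarith
  next
    case False
    have "covar S (Y i (w i)) * covar S (Y i (w i)) \<le> (q i * covar S S) * covar S (Y i (w i))"
      using covar_Cauchy_Schwarz[OF Ssq Y_sq_int[OF that w[OF that]]] unfolding key[OF that]
      by (simp add: power2_eq_square mult_ac)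
    with False show ?thesis by (simp add: mult_le_cancel_right)
  qed
  have "covar S S = (\<Sum>k\<in>I. covar S (Y k (w k)))"
  proof -
    have "covar S S = covar (\<lambda>\<omega>. \<Sum>k\<in>I. Y k (w k) \<omega>) S" by (simp add: S_def[abs_def])
    also have "\<dots> = (\<Sum>k\<in>I. covar (Y k (w k)) S)" by (rule covar_sum[OF Y_sq_int[OF _ w] Ssq])
    also have "\<dots> = (\<Sum>k\<in>I. covar S (Y k (w k)))" by (intro sum.cong refl covar_sym)
    finally show ?thesis .
  qed
  also have "\<dots> \<le> (\<Sum>k\<in>I. q k * covar S S)" by (intro sum_mono le)
  also have "\<dots> = (\<Sum>k\<in>I. q k) * covar S S" by (rule sum_distrib_right[symmetric])
  finally have "(1 - (\<Sum>k\<in>I. q k)) * covar S S \<le> 0" by (simp add: left_diff_distrib)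
  with q(2) VS have S0: "covar S S = 0" by (simp add: mult_le_0_iff)
  have "(covar S (Y i (w i)))\<^sup>2 \<le> 0"
    using covar_Cauchy_Schwarz[OF Ssq Y_sq_int[OF i w[OF i]]] by (simp add: S0)
  then have "covar S (Y i (w i)) = 0" by simp
  with key[OF i] have "covar (Y i (w i)) (Y i (w i)) = 0" by simp
  moreover obtain C where "\<And>p. p \<in> L2F \<Longrightarrow> L2F_norm2 p \<le> C * covar (Y i p) (Y i p)"
    using Y_coercive[OF i] by blast
  from this[OF w[OF i]] have "L2F_norm2 (w i) \<le> C * covar (Y i (w i)) (Y i (w i))" .
  ultimately have "L2F_norm2 (w i) = 0" using L2F_norm2_nonneg[of "w i"] by simp
  then have "(\<integral>p. (case p of (t, \<omega>) \<Rightarrow> w i t \<omega>)\<^sup>2 \<partial>dt_P) = 0"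
    by (simp add: L2F_norm2_def case_prod_beta')
  from L2_zero_AE[OF L2F_D(2)[OF w[OF i]] this] show ?thesis
    unfolding ae_eq_def by eventually_elim (auto simp: w_def)
qed

text \<open>Covariance does not see constants, so the means may drift along the sequence.
  Subtracting them turns the covariance of differences into the distance in mean square, where
  completeness is known.\<close>

lemma centred_complete:
  assumes z: "\<And>m. sq_int M (z m)"
    and cauchy: "\<And>e. e > 0 \<Longrightarrow> \<exists>K. \<forall>m\<ge>K. \<forall>k\<ge>K. covar (\<lambda>\<omega>. 1 * z m \<omega> + (-1) * z k \<omega>) (\<lambda>\<omega>. 1 * z m \<omega> + (-1) * z k \<omega>) < e"
  shows "\<exists>\<zeta>. sq_int M \<zeta> \<and> (\<lambda>m. covar (\<lambda>\<omega>. 1 * z m \<omega> + (-1) * \<zeta> \<omega>) (\<lambda>\<omega>. 1 * z m \<omega> + (-1) * \<zeta> \<omega>)) \<longlonglongrightarrow> 0"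
proof -
  define f where "f m \<omega> = z m \<omega> - expectation (z m)" for m \<omega>
  have f: "sq_int M (f m)" for m unfolding f_def by (intro sq_int_diff z sq_int_const)
  have eq: "expectation (\<lambda>\<omega>. (f m \<omega> - f k \<omega>)\<^sup>2) = covar (\<lambda>\<omega>. 1 * z m \<omega> + (-1) * z k \<omega>) (\<lambda>\<omega>. 1 * z m \<omega> + (-1) * z k \<omega>)" for m k
  proof -
    have *: "expectation (\<lambda>\<omega>. 1 * z m \<omega> + (-1) * z k \<omega>) = expectation (z m) - expectation (z k)"
      using sq_int_integrable[OF z] by simp
    show ?thesis
      unfolding covar_variance(2)[OF sq_int_lin[OF z z]] *
      by (intro Bochner_Integration.integral_cong refl) (simp add: f_def algebra_simps)
  qed
  have c: "\<exists>K. \<forall>m\<ge>K. \<forall>k\<ge>K. expectation (\<lambda>\<omega>. (f m \<omega> - f k \<omega>)\<^sup>2) < e" if "e > 0" for e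
    unfolding eq by (rule cauchy[OF that])
  obtain s where s: "L2_tendsto M f (\<lambda>x. if convergent (\<lambda>k. f (s k) x) then lim (\<lambda>k. f (s k) x) else 0)"
    using L2_complete[OF f c] by blast
  define \<zeta> where "\<zeta> x = (if convergent (\<lambda>k. f (s k) x) then lim (\<lambda>k. f (s k) x) else 0)" for x
  have lim: "L2_tendsto M f \<zeta>" using s unfolding \<zeta>_def .
  then have \<zeta>: "sq_int M \<zeta>" and lim': "(\<lambda>m. expectation (\<lambda>\<omega>. (f m \<omega> - \<zeta> \<omega>)\<^sup>2)) \<longlonglongrightarrow> 0"
    unfolding L2_tendsto_def by blast+
  have "(\<lambda>m. covar (\<lambda>\<omega>. 1 * z m \<omega> + (-1) * \<zeta> \<omega>) (\<lambda>\<omega>. 1 * z m \<omega> + (-1) * \<zeta> \<omega>)) \<longlonglongrightarrow> 0"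
  proof (rule tendsto_sandwich[of "\<lambda>_. 0"])
    show "(\<lambda>m. expectation (\<lambda>\<omega>. (f m \<omega> - \<zeta> \<omega>)\<^sup>2)) \<longlonglongrightarrow> 0" by (rule lim')
    show "\<forall>\<^sub>F m in sequentially. 0 \<le> covar (\<lambda>\<omega>. 1 * z m \<omega> + (-1) * \<zeta> \<omega>) (\<lambda>\<omega>. 1 * z m \<omega> + (-1) * \<zeta> \<omega>)"
      by (intro always_eventually allI covar_nonneg sq_int_lin z \<zeta>)
    show "\<forall>\<^sub>F m in sequentially. covar (\<lambda>\<omega>. 1 * z m \<omega> + (-1) * \<zeta> \<omega>) (\<lambda>\<omega>. 1 * z m \<omega> + (-1) * \<zeta> \<omega>)
        \<le> expectation (\<lambda>\<omega>. (f m \<omega> - \<zeta> \<omega>)\<^sup>2)"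
    proof (intro always_eventually allI)
      fix m
      have "covar (\<lambda>\<omega>. 1 * z m \<omega> + (-1) * \<zeta> \<omega>) (\<lambda>\<omega>. 1 * z m \<omega> + (-1) * \<zeta> \<omega>) \<le>
          expectation (\<lambda>\<omega>. (1 * z m \<omega> + (-1) * \<zeta> \<omega> - expectation (z m))\<^sup>2)"
        by (rule covar_le_second_moment[OF sq_int_lin[OF z \<zeta>]])
      then show "covar (\<lambda>\<omega>. 1 * z m \<omega> + (-1) * \<zeta> \<omega>) (\<lambda>\<omega>. 1 * z m \<omega> + (-1) * \<zeta> \<omega>) \<le> expectation (\<lambda>\<omega>. (f m \<omega> - \<zeta> \<omega>)\<^sup>2)"
        by (simp add: f_def algebra_simps)
    qed
  qed simp
  with \<zeta> show ?thesis by blast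
qed

text \<open>
  Writing \<open>P\<^sub>i\<close> for the projection onto the range of \<open>Y i\<close> (represented by \<open>G i\<close>), the aggregate
  \<open>S\<close> must solve \<open>S - \<Sum>\<^sub>i q\<^sub>i P\<^sub>i S = \<Sum>\<^sub>i Y\<^sub>i f\<^sub>i\<close>; the form on the left is coercive because \<open>\<Sum>\<^sub>i q\<^sub>i < 1\<close>.
\<close>

theorem equilibrium_system_exists:
  assumes q: "\<And>i. i \<in> I \<Longrightarrow> q i \<ge> 0" "(\<Sum>i\<in>I. q i) < 1"
  shows "\<exists>u. (\<forall>i\<in>I. u i \<in> L2F) \<and> (\<forall>i\<in>I. \<forall>p\<in>L2F.
      covar (Y i (u i)) (Y i p) = q i * covar (\<lambda>\<omega>. \<Sum>k\<in>I. Y k (u k) \<omega>) (Y i p) + \<kappa> i * expectation (Y i p))"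
proof -
  \<comment> \<open>\<open>f i\<close> solves the equation of agent \<open>i\<close> with the
    aggregate term dropped: it represents the mean term in the covariance form.\<close>
  have "\<forall>i\<in>I. \<exists>f\<in>L2F. \<forall>p\<in>L2F. covar (Y i f) (Y i p) = \<kappa> i * expectation (Y i p)"
  proof
    fix i assume i: "i \<in> I"
    obtain C1 where C1: "C1 \<ge> 0" "\<And>p. p \<in> L2F \<Longrightarrow> expectation (\<lambda>\<omega>. (Y i p \<omega>)\<^sup>2) \<le> C1 * L2F_norm2 p"
      using Y_bounded[OF i] by blast
    obtain C2 where C2: "C2 \<ge> 0" "\<And>p. p \<in> L2F \<Longrightarrow> L2F_norm2 p \<le> C2 * covar (Y i p) (Y i p)"
      using Y_coercive[OF i] by blast
    show "\<exists>f\<in>L2F. \<forall>p\<in>L2F. covar (Y i f) (Y i p) = \<kappa> i * expectation (Y i p)"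
    proof (rule agent_riesz[OF i])
      fix a b p r assume p: "p \<in> L2F" "r \<in> L2F"
      note s = Y_sq_int[OF i p(1)] Y_sq_int[OF i p(2)] Y_sq_int[OF i L2F_lin[OF p]]
      have "expectation (Y i (\<lambda>t \<omega>. a * p t \<omega> + b * r t \<omega>)) = expectation (\<lambda>\<omega>. a * Y i p \<omega> + b * Y i r \<omega>)"
        by (rule integral_cong_AE[OF sq_intD(1)[OF s(3)] sq_intD(1)[OF sq_int_lin[OF s(1,2)]] Y_lin[OF i p]])
      also have "\<dots> = a * expectation (Y i p) + b * expectation (Y i r)"
        using sq_int_integrable[OF s(1)] sq_int_integrable[OF s(2)] by simp
      finally show "\<kappa> i * expectation (Y i (\<lambda>t \<omega>. a * p t \<omega> + b * r t \<omega>)) = a * (\<kappa> i * expectation (Y i p)) + b * (\<kappa> i * expectation (Y i r))"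
        by (simp add: algebra_simps)
    next
      show "(\<kappa> i)\<^sup>2 * (C1 * C2) \<ge> 0" using C1 C2 by simp
      fix p assume p: "p \<in> L2F"
      note s = Y_sq_int[OF i p]
      have "(expectation (Y i p))\<^sup>2 \<le> expectation (\<lambda>\<omega>. (Y i p \<omega> - 0)\<^sup>2)"
        using covar_variance(1)[OF s, of 0] covar_nonneg[OF s] by simp
      also have "\<dots> \<le> C1 * L2F_norm2 p" using C1(2)[OF p] by simp
      also have "\<dots> \<le> C1 * (C2 * covar (Y i p) (Y i p))" by (rule mult_left_mono[OF C2(2)[OF p] C1(1)])
      finally have "(\<kappa> i)\<^sup>2 * (expectation (Y i p))\<^sup>2 \<le> (\<kappa> i)\<^sup>2 * (C1 * (C2 * covar (Y i p) (Y i p)))"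
        by (rule mult_left_mono) simp
      then show "(\<kappa> i * expectation (Y i p))\<^sup>2 \<le> (\<kappa> i)\<^sup>2 * (C1 * C2) * covar (Y i p) (Y i p)"
        by (simp add: power_mult_distrib mult.assoc)
    qed
  qed
  from bchoice[OF this[unfolded Bex_def]] obtain f where f: "\<And>i. i \<in> I \<Longrightarrow> f i \<in> L2F"
    and fY: "\<And>i p. i \<in> I \<Longrightarrow> p \<in> L2F \<Longrightarrow> covar (Y i (f i)) (Y i p) = \<kappa> i * expectation (Y i p)"
    by blast
  \<comment> \<open>The side conditions are placed inside the existential, so that one choice
    function \<open>G\<close> is defined for all arguments.\<close>
  have ex: "\<exists>u. (i \<in> I \<and> sq_int M \<zeta> \<longrightarrow> u \<in> L2F \<and> (\<forall>p\<in>L2F. covar (Y i u) (Y i p) = covar \<zeta> (Y i p)))" for i \<zeta>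
  proof (cases "i \<in> I \<and> sq_int M \<zeta>")
    case True
    then have i: "i \<in> I" and \<zeta>: "sq_int M \<zeta>" by auto
    have "\<exists>u\<in>L2F. \<forall>p\<in>L2F. covar (Y i u) (Y i p) = covar \<zeta> (Y i p)"
    proof (rule agent_riesz[OF i])
      fix a b p r assume p: "p \<in> L2F" "r \<in> L2F"
      show "covar \<zeta> (Y i (\<lambda>t \<omega>. a * p t \<omega> + b * r t \<omega>)) = a * covar \<zeta> (Y i p) + b * covar \<zeta> (Y i r)"
        unfolding covar_sym[of \<zeta>] by (rule covar_Y_lin[OF i p \<zeta>])
    next
      show "covar \<zeta> \<zeta> \<ge> 0" by (rule covar_nonneg[OF \<zeta>])
      show "(covar \<zeta> (Y i p))\<^sup>2 \<le> covar \<zeta> \<zeta> * covar (Y i p) (Y i p)" if "p \<in> L2F" for p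
        by (rule covar_Cauchy_Schwarz[OF \<zeta> Y_sq_int[OF i that]])
    qed
    then show ?thesis by blast
  next
    case False
    then show ?thesis by blast
  qed
  define G where "G i \<zeta> = (SOME u. i \<in> I \<and> sq_int M \<zeta> \<longrightarrow> u \<in> L2F \<and> (\<forall>p\<in>L2F. covar (Y i u) (Y i p) = covar \<zeta> (Y i p)))" for i \<zeta>
  have G: "G i \<zeta> \<in> L2F" and GY: "p \<in> L2F \<Longrightarrow> covar (Y i (G i \<zeta>)) (Y i p) = covar \<zeta> (Y i p)"
    if "i \<in> I" "sq_int M \<zeta>" for i \<zeta> p
    using someI_ex[OF ex[of i \<zeta>]] that unfolding G_def by blast+
  define P where "P i \<zeta> = Y i (G i \<zeta>)" for i \<zeta>
  have Psq: "sq_int M (P i \<zeta>)" if "i \<in> I" "sq_int M \<zeta>" for i \<zeta>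
    unfolding P_def by (rule Y_sq_int[OF that(1) G[OF that]])
  have PP: "covar (P i \<zeta>) (P i \<eta>) = covar \<zeta> (P i \<eta>)" if "i \<in> I" "sq_int M \<zeta>" "sq_int M \<eta>" for i \<zeta> \<eta>
    unfolding P_def by (rule GY[OF that(1,2) G[OF that(1,3)]])
  \<comment> \<open>A projection does not increase variance; this follows from \<open>PP\<close> and
    Cauchy-Schwarz after division by the variance of the projection.\<close>
  have Ple: "covar (P i \<zeta>) (P i \<zeta>) \<le> covar \<zeta> \<zeta>" if i: "i \<in> I" and \<zeta>: "sq_int M \<zeta>" for i \<zeta>
  proof -
    define a where "a = covar (P i \<zeta>) (P i \<zeta>)"
    have a0: "a \<ge> 0" unfolding a_def by (rule covar_nonneg[OF Psq[OF that]])
    have "(covar \<zeta> (P i \<zeta>))\<^sup>2 \<le> covar \<zeta> \<zeta> * covar (P i \<zeta>) (P i \<zeta>)"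
      by (rule covar_Cauchy_Schwarz[OF \<zeta> Psq[OF that]])
    then have le: "a * a \<le> covar \<zeta> \<zeta> * a" unfolding PP[OF i \<zeta> \<zeta>, symmetric] a_def[symmetric] by (simp only: power2_eq_square)
    show ?thesis
    proof (cases "a = 0")
      case True
      then show ?thesis using covar_nonneg[OF \<zeta>] unfolding a_def by simp
    next
      case False
      with a0 le have "a \<le> covar \<zeta> \<zeta>" by (simp add: mult_le_cancel_right)
      then show ?thesis unfolding a_def .
    qed
  qed
  \<comment> \<open>Both arguments are projected, which makes the symmetry of the form
    evident.\<close>
  define B where "B \<zeta> \<eta> = covar \<zeta> \<eta> - (\<Sum>i\<in>I. q i * covar (P i \<zeta>) (P i \<eta>))" for \<zeta> \<eta>
  define \<delta> where "\<delta> = 1 - (\<Sum>i\<in>I. q i)"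
  have \<delta>: "\<delta> > 0" using q(2) by (simp add: \<delta>_def)
  have Bcoer: "\<delta> * covar \<zeta> \<zeta> \<le> B \<zeta> \<zeta>" if \<zeta>: "sq_int M \<zeta>" for \<zeta>
  proof -
    have "(\<Sum>i\<in>I. q i * covar (P i \<zeta>) (P i \<zeta>)) \<le> (\<Sum>i\<in>I. q i * covar \<zeta> \<zeta>)"
      by (intro sum_mono mult_left_mono Ple \<zeta> q(1))
    also have "\<dots> = (\<Sum>i\<in>I. q i) * covar \<zeta> \<zeta>" by (rule sum_distrib_right[symmetric])
    finally show ?thesis by (simp add: B_def \<delta>_def algebra_simps)
  qed
  have Ble: "B \<zeta> \<zeta> \<le> covar \<zeta> \<zeta>" if \<zeta>: "sq_int M \<zeta>" for \<zeta>
  proof -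
    have "0 \<le> (\<Sum>i\<in>I. q i * covar (P i \<zeta>) (P i \<zeta>))"
      by (intro sum_nonneg mult_nonneg_nonneg q(1) covar_nonneg Psq \<zeta>)
    then show ?thesis by (simp add: B_def)
  qed
  interpret H: semi_inner "{\<zeta>. sq_int M \<zeta>}" "\<lambda>a u b v \<omega>. a * u \<omega> + b * v \<omega>" B
  proof (unfold_locales, unfold mem_Collect_eq)
    fix u v w a b assume s: "sq_int M u" "sq_int M v" "sq_int M w"
    \<comment> \<open>\<open>G\<close> is a choice and need not be linear. Covariances with
      \<open>P i w\<close> are linear nevertheless, because \<open>PP\<close> removes the projection
      from the other argument.\<close>
    have "(\<Sum>i\<in>I. q i * covar (P i (\<lambda>\<omega>. a * u \<omega> + b * v \<omega>)) (P i w)) =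
        (\<Sum>i\<in>I. a * (q i * covar (P i u) (P i w)) + b * (q i * covar (P i v) (P i w)))"
    proof (rule sum.cong[OF refl])
      fix i assume i: "i \<in> I"
      have "covar (P i (\<lambda>\<omega>. a * u \<omega> + b * v \<omega>)) (P i w) = a * covar (P i u) (P i w) + b * covar (P i v) (P i w)"
        unfolding PP[OF i sq_int_lin[OF s(1,2)] s(3)] PP[OF i s(1,3)] PP[OF i s(2,3)]
        by (rule covar_lin[OF s(1,2) Psq[OF i s(3)]])
      then show "q i * covar (P i (\<lambda>\<omega>. a * u \<omega> + b * v \<omega>)) (P i w) =
          a * (q i * covar (P i u) (P i w)) + b * (q i * covar (P i v) (P i w))"
        by (simp add: algebra_simps)
    qed
    then show "B (\<lambda>\<omega>. a * u \<omega> + b * v \<omega>) w = a * B u w + b * B v w"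
      unfolding B_def covar_lin[OF s] by (simp add: sum.distrib sum_distrib_left algebra_simps)
  next
    fix u assume "sq_int M u"
    then have "0 \<le> \<delta> * covar u u" using \<delta> by (simp add: covar_nonneg)
    then show "0 \<le> B u u" using Bcoer[OF \<open>sq_int M u\<close>] by linarith
  qed (auto intro: sq_int_lin simp: B_def covar_sym)
  define \<Phi> where "\<Phi> \<omega> = (\<Sum>k\<in>I. Y k (f k) \<omega>)" for \<omega>
  have \<Phi>: "sq_int M \<Phi>" unfolding \<Phi>_def by (intro sq_int_sum Y_sq_int f)
  have "\<exists>S\<in>{\<zeta>. sq_int M \<zeta>}. \<forall>\<eta>\<in>{\<zeta>. sq_int M \<zeta>}. B S \<eta> = covar \<Phi> \<eta>"
  proof (rule H.riesz_representation[where C = "covar \<Phi> \<Phi> / \<delta>"])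
    show "{\<zeta>. sq_int M \<zeta>} \<noteq> {}" using sq_int_zero[of M] by blast
    show "covar \<Phi> \<Phi> / \<delta> \<ge> 0" using covar_nonneg[OF \<Phi>] \<delta> by simp
    show "covar \<Phi> (\<lambda>\<omega>. a * u \<omega> + b * v \<omega>) = a * covar \<Phi> u + b * covar \<Phi> v"
      if "u \<in> {\<zeta>. sq_int M \<zeta>}" "v \<in> {\<zeta>. sq_int M \<zeta>}" for a b u v
      unfolding covar_sym[of \<Phi>] using that \<Phi> by (intro covar_lin) auto
    show "(covar \<Phi> u)\<^sup>2 \<le> covar \<Phi> \<Phi> / \<delta> * B u u" if "u \<in> {\<zeta>. sq_int M \<zeta>}" for u
    proof -
      have u: "sq_int M u" using that by simp
      have "(covar \<Phi> u)\<^sup>2 \<le> covar \<Phi> \<Phi> * covar u u" by (rule covar_Cauchy_Schwarz[OF \<Phi> u])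
      also have "\<dots> = covar \<Phi> \<Phi> / \<delta> * (\<delta> * covar u u)" using \<delta> by simp
      also have "\<dots> \<le> covar \<Phi> \<Phi> / \<delta> * B u u"
        using covar_nonneg[OF \<Phi>] \<delta> by (intro mult_left_mono Bcoer[OF u]) simp
      finally show ?thesis .
    qed
    fix z :: "nat \<Rightarrow> 'a \<Rightarrow> real"
    assume z: "\<And>m. z m \<in> {\<zeta>. sq_int M \<zeta>}"
      and cauchy: "\<And>e. e > 0 \<Longrightarrow> \<exists>K. \<forall>m\<ge>K. \<forall>k\<ge>K. B (\<lambda>\<omega>. 1 * z m \<omega> + (-1) * z k \<omega>) (\<lambda>\<omega>. 1 * z m \<omega> + (-1) * z k \<omega>) < e"
    have zs: "sq_int M (z m)" for m using z by simp
    have "\<exists>\<zeta>. sq_int M \<zeta> \<and> (\<lambda>m. covar (\<lambda>\<omega>. 1 * z m \<omega> + (-1) * \<zeta> \<omega>) (\<lambda>\<omega>. 1 * z m \<omega> + (-1) * \<zeta> \<omega>)) \<longlonglongrightarrow> 0"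
    proof (rule centred_complete[OF zs])
      fix e :: real assume "e > 0"
      then have "\<delta> * e > 0" using \<delta> by simp
      from cauchy[OF this] obtain K where K: "\<forall>m\<ge>K. \<forall>k\<ge>K. B (\<lambda>\<omega>. 1 * z m \<omega> + (-1) * z k \<omega>) (\<lambda>\<omega>. 1 * z m \<omega> + (-1) * z k \<omega>) < \<delta> * e"
        by blast
      have "covar (\<lambda>\<omega>. 1 * z m \<omega> + (-1) * z k \<omega>) (\<lambda>\<omega>. 1 * z m \<omega> + (-1) * z k \<omega>) < e" if "m \<ge> K" "k \<ge> K" for m k
      proof -
        have "\<delta> * covar (\<lambda>\<omega>. 1 * z m \<omega> + (-1) * z k \<omega>) (\<lambda>\<omega>. 1 * z m \<omega> + (-1) * z k \<omega>) < \<delta> * e"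
          using K that by (intro le_less_trans[OF Bcoer[OF sq_int_lin[OF zs zs]]]) blast
        with \<delta> show ?thesis by (simp only: mult_less_cancel_left_pos)
      qed
      then show "\<exists>K. \<forall>m\<ge>K. \<forall>k\<ge>K. covar (\<lambda>\<omega>. 1 * z m \<omega> + (-1) * z k \<omega>) (\<lambda>\<omega>. 1 * z m \<omega> + (-1) * z k \<omega>) < e"
        by blast
    qed
    then obtain \<zeta> where \<zeta>: "sq_int M \<zeta>"
      and lim: "(\<lambda>m. covar (\<lambda>\<omega>. 1 * z m \<omega> + (-1) * \<zeta> \<omega>) (\<lambda>\<omega>. 1 * z m \<omega> + (-1) * \<zeta> \<omega>)) \<longlonglongrightarrow> 0"
      by blast
    have "(\<lambda>m. B (\<lambda>\<omega>. 1 * z m \<omega> + (-1) * \<zeta> \<omega>) (\<lambda>\<omega>. 1 * z m \<omega> + (-1) * \<zeta> \<omega>)) \<longlonglongrightarrow> 0"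
    proof (rule tendsto_sandwich[OF _ _ tendsto_const lim])
      show "\<forall>\<^sub>F m in sequentially. 0 \<le> B (\<lambda>\<omega>. 1 * z m \<omega> + (-1) * \<zeta> \<omega>) (\<lambda>\<omega>. 1 * z m \<omega> + (-1) * \<zeta> \<omega>)"
        using H.B_nonneg sq_int_lin[OF zs \<zeta>] by (intro always_eventually allI) blast
      show "\<forall>\<^sub>F m in sequentially. B (\<lambda>\<omega>. 1 * z m \<omega> + (-1) * \<zeta> \<omega>) (\<lambda>\<omega>. 1 * z m \<omega> + (-1) * \<zeta> \<omega>)
          \<le> covar (\<lambda>\<omega>. 1 * z m \<omega> + (-1) * \<zeta> \<omega>) (\<lambda>\<omega>. 1 * z m \<omega> + (-1) * \<zeta> \<omega>)"
        by (intro always_eventually allI Ble sq_int_lin zs \<zeta>)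
    qed
    with \<zeta> show "\<exists>v\<in>{\<zeta>. sq_int M \<zeta>}. (\<lambda>m. B (\<lambda>\<omega>. 1 * z m \<omega> + (-1) * v \<omega>) (\<lambda>\<omega>. 1 * z m \<omega> + (-1) * v \<omega>)) \<longlonglongrightarrow> 0"
      by blast
  qed
  then obtain S where S: "sq_int M S" and SB: "\<And>\<eta>. sq_int M \<eta> \<Longrightarrow> B S \<eta> = covar \<Phi> \<eta>" by blast
  \<comment> \<open>The response to the aggregate \<open>S\<close>: its scaled projection plus the
    representative of the mean term.\<close>
  define u where "u i t \<omega> = q i * G i S t \<omega> + 1 * f i t \<omega>" for i t \<omega>
  have u: "u i \<in> L2F" if "i \<in> I" for i
    unfolding u_def by (rule L2F_lin[OF G[OF that S] f[OF that]])
  have uY: "covar (Y i (u i)) Z = q i * covar (P i S) Z + covar (Y i (f i)) Z" if "i \<in> I" "sq_int M Z" for i Z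
    unfolding u_def P_def using covar_Y_lin[OF that(1) G[OF that(1) S] f[OF that(1)] that(2), of "q i" 1] by simp
  \<comment> \<open>Self-consistency: the aggregate of the strategies built from \<open>S\<close>
    has the same covariances as \<open>S\<close>, that is, it equals \<open>S\<close> up to a
    constant.\<close>
  have agg: "covar (\<lambda>\<omega>. \<Sum>k\<in>I. Y k (u k) \<omega>) \<eta> = covar S \<eta>" if \<eta>: "sq_int M \<eta>" for \<eta>
  proof -
    have "covar (\<lambda>\<omega>. \<Sum>k\<in>I. Y k (u k) \<omega>) \<eta> = (\<Sum>k\<in>I. covar (Y k (u k)) \<eta>)"
      by (rule covar_sum[OF Y_sq_int[OF _ u] \<eta>])
    also have "\<dots> = (\<Sum>k\<in>I. q k * covar (P k S) (P k \<eta>) + covar (Y k (f k)) \<eta>)"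
    proof (rule sum.cong[OF refl])
      fix k assume k: "k \<in> I"
      have "covar (P k S) \<eta> = covar (P k S) (P k \<eta>)"
        using trans[OF covar_sym trans[OF PP[OF k \<eta> S, symmetric] covar_sym]] .
      then show "covar (Y k (u k)) \<eta> = q k * covar (P k S) (P k \<eta>) + covar (Y k (f k)) \<eta>"
        by (simp only: uY[OF k \<eta>])
    qed
    also have "\<dots> = (\<Sum>k\<in>I. q k * covar (P k S) (P k \<eta>)) + (\<Sum>k\<in>I. covar (Y k (f k)) \<eta>)" by (rule sum.distrib)
    also have "(\<Sum>k\<in>I. covar (Y k (f k)) \<eta>) = covar \<Phi> \<eta>"
      unfolding \<Phi>_def by (rule covar_sum[OF Y_sq_int[OF _ f] \<eta>, symmetric])
    finally show ?thesis using SB[OF \<eta>] by (simp add: B_def)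
  qed
  have "covar (Y i (u i)) (Y i p) = q i * covar (\<lambda>\<omega>. \<Sum>k\<in>I. Y k (u k) \<omega>) (Y i p) + \<kappa> i * expectation (Y i p)"
    if i: "i \<in> I" and p: "p \<in> L2F" for i p
    unfolding agg[OF Y_sq_int[OF i p]] uY[OF i Y_sq_int[OF i p]] fY[OF i p] P_def GY[OF i S p] ..
  with u show ?thesis by blast
qed

end

subsection \<open>Wealth processes\<close>

context brownian_space
begin

lemma adapted_mult:
  assumes "adapted u" "adapted v"
  shows "adapted (\<lambda>t \<omega>. u t \<omega> * v t \<omega>)"
  unfolding adapted_def
proof (intro conjI ballI)
  show "(\<lambda>(t, \<omega>). u t \<omega> * v t \<omega>) \<in> borel_measurable dt_P"
    using borel_measurable_times[OF adaptedD(1)[OF assms(1)] adaptedD(1)[OF assms(2)]] by (simp add: case_prod_beta')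
  fix t assume t: "t \<in> {0..T}"
  show "(\<lambda>\<omega>. u t \<omega> * v t \<omega>) \<in> borel_measurable (\<F> t)"
    by (intro borel_measurable_times adaptedD(2) assms t)
qed

lemma adapted_divide:
  assumes "adapted u" "adapted v"
  shows "adapted (\<lambda>t \<omega>. u t \<omega> / v t \<omega>)"
  unfolding adapted_def
proof (intro conjI ballI)
  show "(\<lambda>(t, \<omega>). u t \<omega> / v t \<omega>) \<in> borel_measurable dt_P"
    using borel_measurable_divide[OF adaptedD(1)[OF assms(1)] adaptedD(1)[OF assms(2)]] by (simp add: case_prod_beta')
  fix t assume t: "t \<in> {0..T}"
  show "(\<lambda>\<omega>. u t \<omega> / v t \<omega>) \<in> borel_measurable (\<F> t)"
    by (intro borel_measurable_divide adaptedD(2) assms t)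
qed

text \<open>The function supplied by \<open>deterministic\<close> is bounded only almost everywhere;
  clipping it at the essential bound makes it bounded at every time and still equal to
  \<open>r\<close> almost everywhere.\<close>

lemma deterministic_bounded:
  assumes "deterministic r" "ess_bounded r"
  obtains g K where "g \<in> borel_measurable borel" "\<And>t. \<bar>g t\<bar> \<le> K" "AE (t, \<omega>) in dt_P. r t \<omega> = g t"
proof -
  obtain h where h: "h \<in> borel_measurable borel" and rh: "AE (t, \<omega>) in dt_P. r t \<omega> = h t"
    using assms(1) unfolding deterministic_def ae_eq_def measurable_lborel2 by blast
  obtain K where K: "AE (t, \<omega>) in dt_P. \<bar>r t \<omega>\<bar> \<le> K"
    using assms(2) unfolding ess_bounded_def by blast
  show ?thesis
  proof (rule that)
    show "(\<lambda>t. max (- \<bar>K\<bar>) (min \<bar>K\<bar> (h t))) \<in> borel_measurable borel"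
      by (intro borel_measurable_max borel_measurable_min borel_measurable_const h)
    show "\<bar>max (- \<bar>K\<bar>) (min \<bar>K\<bar> (h t))\<bar> \<le> \<bar>K\<bar>" for t by linarith
    show "AE (t, \<omega>) in dt_P. r t \<omega> = max (- \<bar>K\<bar>) (min \<bar>K\<bar> (h t))"
      using rh K
    proof eventually_elim
      case (elim p)
      obtain t \<omega> where p: "p = (t, \<omega>)" by (cases p)
      have "r t \<omega> = h t" "\<bar>h t\<bar> \<le> \<bar>K\<bar>" using elim unfolding p by auto
      then show ?case unfolding p prod.case by linarith
    qed
  qed
qed

text \<open>\<open>linear_solution_exists\<close> bounds the solution it constructs; superposition
  carries the bound over to every solution, in particular to the one selected by
  \<open>wealth\<close>. Subtracting the grown value of \<open>z'\<close> at \<open>T\<close>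
  amounts to lowering the initial value by \<open>z'\<close>.\<close>

lemma linear_solution_terminal:
  assumes g: "g \<in> borel_measurable borel" and gK: "\<And>t. \<bar>g t\<bar> \<le> K"
  shows "\<exists>C\<ge>0. \<forall>z z' b v X. b \<in> L2F \<longrightarrow> v \<in> L2F \<longrightarrow> linear_solution g z b v X \<longrightarrow>
    sq_int M (\<lambda>\<omega>. X T \<omega> - z' * exp (LBINT s:{0..T}. g s)) \<and>
    expectation (\<lambda>\<omega>. (X T \<omega> - z' * exp (LBINT s:{0..T}. g s))\<^sup>2) \<le> C * ((z - z')\<^sup>2 + L2F_norm2 b + L2F_norm2 v)"
proof -
  have TT: "T \<in> {0..T}" using T_pos by simp
  have gint: "set_integrable lborel {0..T} g"
    unfolding set_integrable_def
    by (rule integrableI_bounded_set_indicator[where B = K]) (use g gK in \<open>auto simp: emeasure_lborel_Icc_eq\<close>)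
  obtain C where C: "C \<ge> 0" and ex: "\<forall>z. \<forall>b\<in>L2F. \<forall>v\<in>L2F. \<exists>X. linear_solution g z b v X \<and> X \<in> L2F \<and>
    sq_int M (X T) \<and> expectation (\<lambda>\<omega>. (X T \<omega>)\<^sup>2) \<le> C * (z\<^sup>2 + L2F_norm2 b + L2F_norm2 v)"
    using linear_solution_exists[OF g gK] by blast
  have "sq_int M (\<lambda>\<omega>. X T \<omega> - z' * exp (LBINT s:{0..T}. g s)) \<and>
    expectation (\<lambda>\<omega>. (X T \<omega> - z' * exp (LBINT s:{0..T}. g s))\<^sup>2) \<le> C * ((z - z')\<^sup>2 + L2F_norm2 b + L2F_norm2 v)"
    if b: "b \<in> L2F" and v: "v \<in> L2F" and X: "linear_solution g z b v X" for z z' b v X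
  proof -
    obtain X0 where X0: "linear_solution g (z - z') b v X0" and sq: "sq_int M (X0 T)"
      and le: "expectation (\<lambda>\<omega>. (X0 T \<omega>)\<^sup>2) \<le> C * ((z - z')\<^sup>2 + L2F_norm2 b + L2F_norm2 v)"
      using ex b v by blast
    have "AE \<omega> in M. \<forall>t\<in>{0..T}. X t \<omega> = 1 * X0 t \<omega> + 0 * X0 t \<omega> + (z - 1 * (z - z') - 0 * (z - z')) * exp (LBINT s:{0..t}. g s)"
      by (rule superposition[OF gint X0 X0 X b b b]) simp_all
    then have eq: "AE \<omega> in M. X T \<omega> - z' * exp (LBINT s:{0..T}. g s) = X0 T \<omega>"
    proof eventually_elim
      case (elim \<omega>)
      from bspec[OF this TT] show ?case by (simp add: algebra_simps)
    qed
    have XM: "X T \<in> borel_measurable M"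
      using X TT unfolding linear_solution_def by (blast intro: adaptedD(3))
    then have m: "(\<lambda>\<omega>. X T \<omega> - z' * exp (LBINT s:{0..T}. g s)) \<in> borel_measurable M"
      by (intro borel_measurable_diff borel_measurable_const)
    have "sq_int M (\<lambda>\<omega>. X T \<omega> - z' * exp (LBINT s:{0..T}. g s))"
      by (rule sq_int_bound[OF sq m, where c = 1]) (use eq in \<open>eventually_elim, simp\<close>)
    moreover have "expectation (\<lambda>\<omega>. (X T \<omega> - z' * exp (LBINT s:{0..T}. g s))\<^sup>2) = expectation (\<lambda>\<omega>. (X0 T \<omega>)\<^sup>2)"
    proof (rule integral_cong_AE)
      show "AE \<omega> in M. (X T \<omega> - z' * exp (LBINT s:{0..T}. g s))\<^sup>2 = (X0 T \<omega>)\<^sup>2"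
        using eq by eventually_elim simp
    qed (intro borel_measurable_power m sq_intD(1)[OF sq])+
    ultimately show ?thesis using le by simp
  qed
  with C show ?thesis by blast
qed

end

section \<open>The game with a deterministic interest rate\<close>

locale deterministic_rate_game = relative_wealth_game M T W n x \<theta> \<gamma> r \<mu> \<sigma>
  for M :: "'a measure" and T :: real and W :: "real \<Rightarrow> 'a \<Rightarrow> real"
    and n :: nat and x \<theta> \<gamma> :: "nat \<Rightarrow> real"
    and r :: "real \<Rightarrow> 'a \<Rightarrow> real" and \<mu> \<sigma> :: "nat \<Rightarrow> real \<Rightarrow> 'a \<Rightarrow> real" +
  fixes g :: "real \<Rightarrow> real" and K :: real
  assumes g_measurable: "g \<in> borel_measurable borel" and g_bounded: "\<And>t. \<bar>g t\<bar> \<le> K"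
    and r_eq: "AE (t, \<omega>) in dt_P. r t \<omega> = g t"
begin

lemma T_in: "T \<in> {0..T}"
  using T_pos by simp

lemma g_integrable: "set_integrable lborel {0..T} g"
  unfolding set_integrable_def
  by (rule integrableI_bounded_set_indicator[where B = K]) (use g_measurable g_bounded in \<open>auto simp: emeasure_lborel_Icc_eq\<close>)

lemma \<rho>_adapted: "i \<in> {1..n} \<Longrightarrow> adapted (\<rho> i)"
  unfolding \<rho>_def[abs_def]
  using adapted_divide[OF adapted_lin[OF \<mu>_adapted r_adapted, of i 1 "-1"] \<sigma>_adapted, of i] by simp

lemma \<rho>_bounded:
  assumes i: "i \<in> {1..n}"
  shows "\<exists>k. AE (t, \<omega>) in dt_P. \<bar>\<rho> i t \<omega>\<bar> \<le> k"
proof -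
  obtain a where a: "AE (t, \<omega>) in dt_P. \<bar>r t \<omega>\<bar> \<le> a" using r_bounded unfolding ess_bounded_def by blast
  obtain b where b: "AE (t, \<omega>) in dt_P. \<bar>\<mu> i t \<omega>\<bar> \<le> b" using \<mu>_bounded[OF i] unfolding ess_bounded_def by blast
  obtain c where c: "c > 0" "AE (t, \<omega>) in dt_P. inverse c \<le> \<sigma> i t \<omega> \<and> \<sigma> i t \<omega> \<le> c" using \<sigma>_bounds[OF i] by blast
  have "AE (t, \<omega>) in dt_P. \<bar>\<rho> i t \<omega>\<bar> \<le> (b + a) * c"
    using a b c(2)
  proof eventually_elim
    case (elim p)
    obtain t \<omega> where p: "p = (t, \<omega>)" by (cases p)
    have pos: "inverse c > 0" using c(1) by simp
    have s: "\<bar>r t \<omega>\<bar> \<le> a" "\<bar>\<mu> i t \<omega>\<bar> \<le> b" "inverse c \<le> \<sigma> i t \<omega>" using elim unfolding p by auto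
    have "\<sigma> i t \<omega> > 0" using pos s(3) by linarith
    have "inverse (\<sigma> i t \<omega>) \<le> inverse (inverse c)" by (rule le_imp_inverse_le[OF s(3) pos])
    then have inv: "inverse (\<sigma> i t \<omega>) \<le> c" by simp
    have "\<bar>\<rho> i t \<omega>\<bar> = \<bar>\<mu> i t \<omega> - r t \<omega>\<bar> * inverse (\<sigma> i t \<omega>)"
      using \<open>\<sigma> i t \<omega> > 0\<close> by (simp add: \<rho>_def divide_inverse abs_mult)
    also have "\<dots> \<le> (b + a) * c"
      using s inv \<open>\<sigma> i t \<omega> > 0\<close> by (intro mult_mono) auto
    finally show ?case by (simp add: p)
  qed
  then show ?thesis by blast
qed

definition vol :: "nat \<Rightarrow> (real \<Rightarrow> 'a \<Rightarrow> real) \<Rightarrow> real \<Rightarrow> 'a \<Rightarrow> real" where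
  "vol i p t \<omega> = p t \<omega> * \<sigma> i t \<omega>"

definition drift :: "nat \<Rightarrow> (real \<Rightarrow> 'a \<Rightarrow> real) \<Rightarrow> real \<Rightarrow> 'a \<Rightarrow> real" where
  "drift i p t \<omega> = p t \<omega> * \<sigma> i t \<omega> * \<rho> i t \<omega>"

text \<open>One constant works in both directions because \<open>c\<close> bounds
  \<open>\<sigma> i\<close> as well as its inverse.\<close>

lemma vol_bounds:
  assumes i: "i \<in> {1..n}"
  shows "\<exists>c>0. \<forall>p\<in>L2F. vol i p \<in> L2F \<and> L2F_norm2 p \<le> c\<^sup>2 * L2F_norm2 (vol i p) \<and> L2F_norm2 (vol i p) \<le> c\<^sup>2 * L2F_norm2 p"
proof -
  obtain c where c: "c > 0" "AE (t, \<omega>) in dt_P. inverse c \<le> \<sigma> i t \<omega> \<and> \<sigma> i t \<omega> \<le> c" using \<sigma>_bounds[OF i] by blast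
  have "vol i p \<in> L2F \<and> L2F_norm2 p \<le> c\<^sup>2 * L2F_norm2 (vol i p) \<and> L2F_norm2 (vol i p) \<le> c\<^sup>2 * L2F_norm2 p"
    if p: "p \<in> L2F" for p
  proof -
    have ad: "adapted (vol i p)"
      unfolding vol_def[abs_def] by (rule adapted_mult[OF L2F_D(1)[OF p] \<sigma>_adapted[OF i]])
    have both: "AE (t, \<omega>) in dt_P. \<bar>vol i p t \<omega>\<bar> \<le> c * \<bar>p t \<omega>\<bar> \<and> \<bar>p t \<omega>\<bar> \<le> c * \<bar>vol i p t \<omega>\<bar>"
      using c(2)
    proof eventually_elim
      case (elim q)
      obtain t \<omega> where q: "q = (t, \<omega>)" by (cases q)
      have s: "inverse c \<le> \<sigma> i t \<omega>" "\<sigma> i t \<omega> \<le> c" using elim unfolding q by auto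
      have pos: "\<sigma> i t \<omega> > 0" using s(1) c(1) by (meson less_le_trans positive_imp_inverse_positive)
      have v: "\<bar>vol i p t \<omega>\<bar> = \<bar>p t \<omega>\<bar> * \<sigma> i t \<omega>" using pos by (simp add: vol_def abs_mult)
      have "\<bar>p t \<omega>\<bar> * \<sigma> i t \<omega> \<le> \<bar>p t \<omega>\<bar> * c" using s by (intro mult_left_mono) auto
      moreover have "\<bar>p t \<omega>\<bar> \<le> c * (\<bar>p t \<omega>\<bar> * \<sigma> i t \<omega>)"
      proof -
        have "1 \<le> c * \<sigma> i t \<omega>" using s(1) c(1) by (simp add: field_simps)
        from mult_left_mono[OF this, of "\<bar>p t \<omega>\<bar>"] show ?thesis by (simp add: mult_ac)
      qed
      ultimately show ?case unfolding q by (simp add: v mult.commute)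
    qed
    have 1: "AE (t, \<omega>) in dt_P. \<bar>vol i p t \<omega>\<bar> \<le> c * \<bar>p t \<omega>\<bar>" using both by eventually_elim auto
    have 2: "AE (t, \<omega>) in dt_P. \<bar>p t \<omega>\<bar> \<le> c * \<bar>vol i p t \<omega>\<bar>" using both by eventually_elim auto
    have v: "vol i p \<in> L2F" by (rule L2F_bound[OF p ad 1])
    show ?thesis by (intro conjI v L2F_norm2_mono[OF v 2 p] L2F_norm2_mono[OF p 1 v])
  qed
  with c(1) show ?thesis by blast
qed

lemma vol_L2F: "i \<in> {1..n} \<Longrightarrow> p \<in> L2F \<Longrightarrow> vol i p \<in> L2F"
  using vol_bounds by blast

lemma drift_bounds:
  assumes i: "i \<in> {1..n}"
  shows "\<exists>k. \<forall>p\<in>L2F. drift i p \<in> L2F \<and> (AE (t, \<omega>) in dt_P. \<bar>drift i p t \<omega>\<bar> \<le> k * \<bar>vol i p t \<omega>\<bar>)"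
proof -
  obtain k where k: "AE (t, \<omega>) in dt_P. \<bar>\<rho> i t \<omega>\<bar> \<le> k" using \<rho>_bounded[OF i] by blast
  have "drift i p \<in> L2F \<and> (AE (t, \<omega>) in dt_P. \<bar>drift i p t \<omega>\<bar> \<le> k * \<bar>vol i p t \<omega>\<bar>)" if p: "p \<in> L2F" for p
  proof -
    note v = vol_L2F[OF i p]
    have ad: "adapted (drift i p)"
      using adapted_mult[OF L2F_D(1)[OF v] \<rho>_adapted[OF i]] by (simp add: drift_def[abs_def] vol_def[abs_def])
    have le: "AE (t, \<omega>) in dt_P. \<bar>drift i p t \<omega>\<bar> \<le> k * \<bar>vol i p t \<omega>\<bar>"
      using k
    proof eventually_elim
      case (elim q)
      obtain t \<omega> where q: "q = (t, \<omega>)" by (cases q)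
      have "\<bar>drift i p t \<omega>\<bar> = \<bar>\<rho> i t \<omega>\<bar> * \<bar>vol i p t \<omega>\<bar>" by (simp add: drift_def vol_def abs_mult)
      also have "\<dots> \<le> k * \<bar>vol i p t \<omega>\<bar>" using elim by (intro mult_right_mono) (auto simp: q)
      finally show ?case by (simp add: q)
    qed
    show ?thesis by (intro conjI L2F_bound[OF v ad le] le)
  qed
  then show ?thesis by blast
qed

lemma drift_L2F: "i \<in> {1..n} \<Longrightarrow> p \<in> L2F \<Longrightarrow> drift i p \<in> L2F"
  using drift_bounds by blast

text \<open>\<open>r\<close> equals \<open>g\<close> almost everywhere on the product, hence for
  almost every \<open>\<omega>\<close> at almost every time; time integrals do not notice the
  difference.\<close>

lemma wealth_drift:
  assumes b: "b \<in> L2F" and X: "adapted X" and c: "AE \<omega> in M. continuous_on {0..T} (\<lambda>t. X t \<omega>)"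
  shows "AE \<omega> in M. set_integrable lborel {0..T} (\<lambda>s. r s \<omega> * X s \<omega> + b s \<omega>) \<and>
    (\<forall>t\<in>{0..T}. (LBINT s:{0..t}. r s \<omega> * X s \<omega> + b s \<omega>) = (LBINT s:{0..t}. g s * X s \<omega>) + time_integral b t \<omega>)"
  using AE_dt_P_swap[OF r_eq] L2F_AE_set_integrable[OF b] c AE_space
proof eventually_elim
  case (elim \<omega>)
  have tm: "(\<lambda>s. c s \<omega>) \<in> borel_measurable time_measure" if "(\<lambda>(t, \<omega>). c t \<omega>) \<in> borel_measurable dt_P" for c :: "real \<Rightarrow> 'a \<Rightarrow> real"
    using measurable_compose[OF measurable_Pair2'[OF elim(4)] that[unfolded dt_P_eq]] by simp
  have gX: "set_integrable lborel {0..T} (\<lambda>s. g s * X s \<omega>)"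
    using set_integrable_continuous_mult[OF g_integrable elim(3)] by (simp only: mult.commute)
  have m1: "(\<lambda>s. r s \<omega> * X s \<omega> + b s \<omega>) \<in> borel_measurable time_measure"
    by (intro borel_measurable_add borel_measurable_times tm adaptedD(1) r_adapted X L2F_D(1)[OF b])
  have m2: "(\<lambda>s. g s * X s \<omega> + b s \<omega>) \<in> borel_measurable time_measure"
    by (intro borel_measurable_add borel_measurable_times tm adaptedD(1) X L2F_D(1)[OF b] time_measurable g_measurable)
  have eq: "AE s in time_measure. r s \<omega> * X s \<omega> + b s \<omega> = g s * X s \<omega> + b s \<omega>"
    using elim(1) by eventually_elim simp
  have "integrable time_measure (\<lambda>s. g s * X s \<omega> + b s \<omega>)"
    unfolding integrable_time_iff by (rule set_integral_add(1)[OF gX elim(2)])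
  then have "integrable time_measure (\<lambda>s. r s \<omega> * X s \<omega> + b s \<omega>)"
    using integrable_cong_AE[OF m1 m2 eq] by blast
  then have 1: "set_integrable lborel {0..T} (\<lambda>s. r s \<omega> * X s \<omega> + b s \<omega>)"
    by (simp only: integrable_time_iff)
  show ?case
  proof (intro conjI ballI 1)
    fix t assume t: "t \<in> {0..T}"
    then have st: "{0..t} \<subseteq> {0..T}" by auto
    have ind: "indicator {0..t} \<in> borel_measurable time_measure" by (rule time_measurable) simp
    have "(LBINT s:{0..t}. r s \<omega> * X s \<omega> + b s \<omega>) = (\<integral>s. indicator {0..t} s * (r s \<omega> * X s \<omega> + b s \<omega>) \<partial>time_measure)"
      by (rule integral_time[OF t, symmetric])
    also have "\<dots> = (\<integral>s. indicator {0..t} s * (g s * X s \<omega> + b s \<omega>) \<partial>time_measure)"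
    proof (rule integral_cong_AE)
      show "AE s in time_measure. indicator {0..t} s * (r s \<omega> * X s \<omega> + b s \<omega>) = indicator {0..t} s * (g s * X s \<omega> + b s \<omega>)"
        using eq by eventually_elim simp
    qed (rule borel_measurable_times[OF ind m1] borel_measurable_times[OF ind m2])+
    also have "\<dots> = (LBINT s:{0..t}. g s * X s \<omega> + b s \<omega>)" by (rule integral_time[OF t])
    also have "\<dots> = (LBINT s:{0..t}. g s * X s \<omega>) + (LBINT s:{0..t}. b s \<omega>)"
      by (rule set_integral_add(2)[OF set_integrable_subset[OF gX _ st] set_integrable_subset[OF elim(2) _ st]]) simp_all
    finally show "(LBINT s:{0..t}. r s \<omega> * X s \<omega> + b s \<omega>) = (LBINT s:{0..t}. g s * X s \<omega>) + time_integral b t \<omega>"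
      by (simp only: time_integral_def)
  qed
qed

text \<open>Translates the wealth equation into the form with rate \<open>g\<close> and separated
  drift; the integrability clause of \<open>sde_solution\<close> is supplied by
  \<open>wealth_drift\<close>.\<close>

lemma is_wealth_iff:
  assumes i: "i \<in> {1..n}" and p: "p \<in> L2F"
  shows "is_wealth i p X \<longleftrightarrow> linear_solution g (x i) (drift i p) (vol i p) X"
proof -
  have eq: "is_wealth i p X \<longleftrightarrow> adapted X \<and> (AE \<omega> in M. continuous_on {0..T} (\<lambda>t. X t \<omega>)) \<and>
     (\<exists>I. ito_integral (vol i p) I \<and>
        (AE \<omega> in M. set_integrable lborel {0..T} (\<lambda>s. r s \<omega> * X s \<omega> + drift i p s \<omega>) \<and>
           (\<forall>t\<in>{0..T}. X t \<omega> = x i + (LBINT s:{0..t}. r s \<omega> * X s \<omega> + drift i p s \<omega>) + I t \<omega>)))"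
    by (simp only: is_wealth_def sde_solution_def drift_def[abs_def] vol_def[abs_def])
  show ?thesis
  proof (cases "adapted X \<and> (AE \<omega> in M. continuous_on {0..T} (\<lambda>t. X t \<omega>))")
    case True
    then have X: "adapted X" and c: "AE \<omega> in M. continuous_on {0..T} (\<lambda>t. X t \<omega>)" by auto
    note d = wealth_drift[OF drift_L2F[OF i p] X c]
    have "(AE \<omega> in M. set_integrable lborel {0..T} (\<lambda>s. r s \<omega> * X s \<omega> + drift i p s \<omega>) \<and>
           (\<forall>t\<in>{0..T}. X t \<omega> = x i + (LBINT s:{0..t}. r s \<omega> * X s \<omega> + drift i p s \<omega>) + I t \<omega>)) \<longleftrightarrow>
        (AE \<omega> in M. \<forall>t\<in>{0..T}. X t \<omega> = x i + (LBINT s:{0..t}. g s * X s \<omega>) + time_integral (drift i p) t \<omega> + I t \<omega>)"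
      (is "?A \<longleftrightarrow> ?B") for I
    proof
      assume ?A
      then show ?B using d
      proof eventually_elim
        case (elim \<omega>)
        show ?case
        proof
          fix t assume t: "t \<in> {0..T}"
          have "X t \<omega> = x i + (LBINT s:{0..t}. r s \<omega> * X s \<omega> + drift i p s \<omega>) + I t \<omega>" using elim(1) t by blast
          also have "(LBINT s:{0..t}. r s \<omega> * X s \<omega> + drift i p s \<omega>) = (LBINT s:{0..t}. g s * X s \<omega>) + time_integral (drift i p) t \<omega>"
            using elim(2) t by blast
          finally show "X t \<omega> = x i + (LBINT s:{0..t}. g s * X s \<omega>) + time_integral (drift i p) t \<omega> + I t \<omega>" by simp
        qed
      qed
    next
      assume ?B
      then show ?A using d
      proof eventually_elim
        case (elim \<omega>)
        show ?case
        proof (intro conjI ballI)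
          show "set_integrable lborel {0..T} (\<lambda>s. r s \<omega> * X s \<omega> + drift i p s \<omega>)" using elim(2) by blast
          fix t assume t: "t \<in> {0..T}"
          have "(LBINT s:{0..t}. r s \<omega> * X s \<omega> + drift i p s \<omega>) = (LBINT s:{0..t}. g s * X s \<omega>) + time_integral (drift i p) t \<omega>"
            using elim(2) t by blast
          moreover have "X t \<omega> = x i + (LBINT s:{0..t}. g s * X s \<omega>) + time_integral (drift i p) t \<omega> + I t \<omega>" using elim(1) t by blast
          ultimately show "X t \<omega> = x i + (LBINT s:{0..t}. r s \<omega> * X s \<omega> + drift i p s \<omega>) + I t \<omega>" by (simp only: add.assoc)
        qed
      qed
    qed
    then show ?thesis unfolding eq linear_solution_def by (simp only:)
  next
    case False
    then show ?thesis unfolding eq linear_solution_def by blast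
  qed
qed

lemma wealth_solution:
  assumes i: "i \<in> {1..n}" and p: "p \<in> L2F"
  shows "linear_solution g (x i) (drift i p) (vol i p) (wealth i p)"
proof -
  have "\<exists>X. is_wealth i p X"
    unfolding is_wealth_iff[OF assms]
    using linear_solution_exists[OF g_measurable g_bounded] drift_L2F[OF assms] vol_L2F[OF assms] by blast
  from someI_ex[OF this] show ?thesis
    unfolding wealth_def is_wealth_iff[OF assms] .
qed

definition growth :: real where
  "growth = exp (LBINT s:{0..T}. g s)"

text \<open>\<open>x i * growth\<close> is the terminal wealth without trading; removing it turns
  the affine map from strategies to terminal wealth into a linear one.\<close>

definition Y :: "nat \<Rightarrow> (real \<Rightarrow> 'a \<Rightarrow> real) \<Rightarrow> 'a \<Rightarrow> real" where
  "Y i p \<omega> = wealth i p T \<omega> - x i * growth"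

sublocale terminal_maps M T W "{1..n}" Y
proof unfold_locales
  show "finite {1..n}" by simp
  obtain C where C: "C \<ge> 0" and ex: "\<forall>z z' b v X. b \<in> L2F \<longrightarrow> v \<in> L2F \<longrightarrow> linear_solution g z b v X \<longrightarrow>
    sq_int M (\<lambda>\<omega>. X T \<omega> - z' * exp (LBINT s:{0..T}. g s)) \<and>
    expectation (\<lambda>\<omega>. (X T \<omega> - z' * exp (LBINT s:{0..T}. g s))\<^sup>2) \<le> C * ((z - z')\<^sup>2 + L2F_norm2 b + L2F_norm2 v)"
    using linear_solution_terminal[OF g_measurable g_bounded] by blast
  have Y: "sq_int M (Y i p) \<and> expectation (\<lambda>\<omega>. (Y i p \<omega>)\<^sup>2) \<le> C * ((x i - x i)\<^sup>2 + L2F_norm2 (drift i p) + L2F_norm2 (vol i p))"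
    if "i \<in> {1..n}" "p \<in> L2F" for i p
    unfolding Y_def growth_def using ex drift_L2F[OF that] vol_L2F[OF that] wealth_solution[OF that] by blast
  fix i assume i: "i \<in> {1..n}"
  show Ysq: "sq_int M (Y i p)" if "p \<in> L2F" for p using Y[OF i that] by blast
  obtain c where c: "c > 0" and cv: "\<And>p. p \<in> L2F \<Longrightarrow> L2F_norm2 p \<le> c\<^sup>2 * L2F_norm2 (vol i p)"
    "\<And>p. p \<in> L2F \<Longrightarrow> L2F_norm2 (vol i p) \<le> c\<^sup>2 * L2F_norm2 p"
    using vol_bounds[OF i] by blast
  obtain k where k: "\<And>p. p \<in> L2F \<Longrightarrow> AE (t, \<omega>) in dt_P. \<bar>drift i p t \<omega>\<bar> \<le> k * \<bar>vol i p t \<omega>\<bar>"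
    using drift_bounds[OF i] by blast
  show "\<exists>C\<ge>0. \<forall>p\<in>L2F. expectation (\<lambda>\<omega>. (Y i p \<omega>)\<^sup>2) \<le> C * L2F_norm2 p"
  proof (intro exI[of _ "C * ((k\<^sup>2 + 1) * c\<^sup>2)"] conjI ballI)
    show "0 \<le> C * ((k\<^sup>2 + 1) * c\<^sup>2)" using C by simp
    fix p assume p: "p \<in> L2F"
    have "L2F_norm2 (drift i p) \<le> k\<^sup>2 * L2F_norm2 (vol i p)"
      by (rule L2F_norm2_mono[OF vol_L2F[OF i p] k[OF p] drift_L2F[OF i p]])
    then have "L2F_norm2 (drift i p) + L2F_norm2 (vol i p) \<le> (k\<^sup>2 + 1) * L2F_norm2 (vol i p)" by (simp add: algebra_simps)
    also have "\<dots> \<le> (k\<^sup>2 + 1) * (c\<^sup>2 * L2F_norm2 p)" by (rule mult_left_mono[OF cv(2)[OF p]]) simp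
    finally have le: "L2F_norm2 (drift i p) + L2F_norm2 (vol i p) \<le> (k\<^sup>2 + 1) * (c\<^sup>2 * L2F_norm2 p)" .
    have "expectation (\<lambda>\<omega>. (Y i p \<omega>)\<^sup>2) \<le> C * (L2F_norm2 (drift i p) + L2F_norm2 (vol i p))"
      using Y[OF i p] by simp
    also have "\<dots> \<le> C * ((k\<^sup>2 + 1) * (c\<^sup>2 * L2F_norm2 p))" by (rule mult_left_mono[OF le C])
    finally show "expectation (\<lambda>\<omega>. (Y i p \<omega>)\<^sup>2) \<le> C * ((k\<^sup>2 + 1) * c\<^sup>2) * L2F_norm2 p" by (simp only: mult.assoc)
  qed
  show "\<exists>C\<ge>0. \<forall>p\<in>L2F. L2F_norm2 p \<le> C * covar (Y i p) (Y i p)"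
  proof -
    \<comment> \<open>\<open>linear_solution_coercive\<close> takes a single bound for the rate and
      for the ratio of drift to volatility.\<close>
    define k' where "k' = max K k"
    define E where "E = 2 * exp ((2 * k' + 2 * k'\<^sup>2) * T)"
    have gk: "\<bar>g t\<bar> \<le> k'" for t using g_bounded[of t] by (simp add: k'_def)
    have "L2F_norm2 p \<le> (c\<^sup>2 * E) * covar (Y i p) (Y i p)" if p: "p \<in> L2F" for p
    proof -
      have dk: "AE (t, \<omega>) in dt_P. \<bar>drift i p t \<omega>\<bar> \<le> k' * \<bar>vol i p t \<omega>\<bar>"
        using k[OF p]
      proof eventually_elim
        case (elim q)
        obtain t \<omega> where q: "q = (t, \<omega>)" by (cases q)
        have "\<bar>drift i p t \<omega>\<bar> \<le> k * \<bar>vol i p t \<omega>\<bar>" using elim unfolding q by simp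
        also have "\<dots> \<le> k' * \<bar>vol i p t \<omega>\<bar>" by (rule mult_right_mono) (simp_all add: k'_def)
        finally show ?case by (simp add: q)
      qed
      \<comment> \<open>The free constant is taken as the mean terminal wealth, so that the right
        side becomes the variance of \<open>Y i p\<close>.\<close>
      have "L2F_norm2 (vol i p) \<le> E * expectation (\<lambda>\<omega>. (wealth i p T \<omega> - (x i * growth + expectation (Y i p)))\<^sup>2)"
        unfolding E_def
        by (rule linear_solution_coercive[OF g_measurable gk drift_L2F[OF i p] vol_L2F[OF i p] dk wealth_solution[OF i p]])
      also have "(\<lambda>\<omega>. (wealth i p T \<omega> - (x i * growth + expectation (Y i p)))\<^sup>2) = (\<lambda>\<omega>. (Y i p \<omega> - expectation (Y i p))\<^sup>2)"
        by (simp add: Y_def fun_eq_iff diff_diff_eq)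
      finally have le: "L2F_norm2 (vol i p) \<le> E * covar (Y i p) (Y i p)"
        unfolding covar_variance(2)[OF Ysq[OF p]] .
      have "L2F_norm2 p \<le> c\<^sup>2 * L2F_norm2 (vol i p)" by (rule cv(1)[OF p])
      also have "\<dots> \<le> c\<^sup>2 * (E * covar (Y i p) (Y i p))" by (rule mult_left_mono[OF le]) simp
      finally show ?thesis by (simp only: mult.assoc)
    qed
    moreover have "c\<^sup>2 * E \<ge> 0" by (simp add: E_def)
    ultimately show ?thesis by blast
  qed
  fix p q u :: "real \<Rightarrow> 'a \<Rightarrow> real" and a b :: real
  assume L: "p \<in> L2F" "q \<in> L2F" "u \<in> L2F" and eq: "AE (t, \<omega>) in dt_P. u t \<omega> = a * p t \<omega> + b * q t \<omega>"
  have "AE \<omega> in M. \<forall>t\<in>{0..T}. wealth i u t \<omega> = a * wealth i p t \<omega> + b * wealth i q t \<omega> + (x i - a * x i - b * x i) * exp (LBINT s:{0..t}. g s)"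
  proof (rule superposition[OF g_integrable wealth_solution[OF i L(1)] wealth_solution[OF i L(2)] wealth_solution[OF i L(3)] drift_L2F[OF i L(1)] drift_L2F[OF i L(2)] drift_L2F[OF i L(3)]])
    show "AE (t, \<omega>) in dt_P. drift i u t \<omega> = a * drift i p t \<omega> + b * drift i q t \<omega>"
      using eq by eventually_elim (auto simp: drift_def algebra_simps)
    show "AE (t, \<omega>) in dt_P. vol i u t \<omega> = a * vol i p t \<omega> + b * vol i q t \<omega>"
      using eq by eventually_elim (auto simp: vol_def algebra_simps)
  qed
  then show "AE \<omega> in M. Y i u \<omega> = a * Y i p \<omega> + b * Y i q \<omega>"
  proof eventually_elim
    case (elim \<omega>)
    have "wealth i u T \<omega> = a * wealth i p T \<omega> + b * wealth i q T \<omega> + (x i - a * x i - b * x i) * growth"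
      unfolding growth_def using elim T_in by blast
    then show ?case by (simp add: Y_def algebra_simps)
  qed
qed

subsection \<open>Nash equilibria\<close>

text \<open>Adding the own term of agent \<open>i\<close> completes the peer sum to the aggregate
  and is compensated by the factor \<open>1 + \<theta> i / (real n - 1)\<close> on
  \<open>Y i\<close>. The constant is chosen before the profile, since the initial endowments only
  shift relative wealth.\<close>

lemma relative_wealth_eq:
  assumes i: "i \<in> {1..n}"
  shows "\<exists>c. \<forall>\<pi> \<omega>. relative_wealth i \<pi> \<omega> = c + ((1 + \<theta> i / (real n - 1)) * Y i (\<pi> i) \<omega> + (- (\<theta> i / (real n - 1))) * (\<Sum>k=1..n. Y k (\<pi> k) \<omega>))"
proof (intro exI allI)
  fix \<pi> :: "nat \<Rightarrow> real \<Rightarrow> 'a \<Rightarrow> real" and \<omega>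
  define b where "b = \<theta> i / (real n - 1)"
  have w: "wealth k (\<pi> k) T \<omega> = Y k (\<pi> k) \<omega> + x k * growth" for k by (simp add: Y_def)
  have s: "(\<Sum>k=1..n. Y k (\<pi> k) \<omega>) = Y i (\<pi> i) \<omega> + (\<Sum>k\<in>{1..n} - {i}. Y k (\<pi> k) \<omega>)"
    using i by (intro sum.remove) auto
  have "relative_wealth i \<pi> \<omega> = Y i (\<pi> i) \<omega> + x i * growth
      - b * ((\<Sum>k\<in>{1..n} - {i}. Y k (\<pi> k) \<omega>) + (\<Sum>k\<in>{1..n} - {i}. x k * growth))"
    by (simp add: relative_wealth_def peer_wealth_def w sum.distrib b_def)
  then show "relative_wealth i \<pi> \<omega> = (x i * growth - b * (\<Sum>k\<in>{1..n} - {i}. x k * growth)) +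
      ((1 + \<theta> i / (real n - 1)) * Y i (\<pi> i) \<omega> + (- (\<theta> i / (real n - 1))) * (\<Sum>k=1..n. Y k (\<pi> k) \<omega>))"
    unfolding s b_def[symmetric] by (simp add: algebra_simps)
qed

definition Z :: "nat \<Rightarrow> (nat \<Rightarrow> real \<Rightarrow> 'a \<Rightarrow> real) \<Rightarrow> 'a \<Rightarrow> real" where
  "Z i \<pi> \<omega> = (1 + \<theta> i / (real n - 1)) * Y i (\<pi> i) \<omega> + (- (\<theta> i / (real n - 1))) * (\<Sum>k=1..n. Y k (\<pi> k) \<omega>)"

lemma Z_sq_int:
  assumes "i \<in> {1..n}" "\<And>k. k \<in> {1..n} \<Longrightarrow> \<pi> k \<in> L2F"
  shows "sq_int M (Z i \<pi>)"
  unfolding Z_def using assms by (intro sq_int_lin sq_int_sum Y_sq_int)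

lemma J_eq:
  assumes i: "i \<in> {1..n}"
  shows "\<exists>c. \<forall>\<pi>. (\<forall>k\<in>{1..n}. \<pi> k \<in> L2F) \<longrightarrow> J i \<pi> = c + expectation (Z i \<pi>) - \<gamma> i / 2 * covar (Z i \<pi>) (Z i \<pi>)"
proof -
  obtain c where c: "\<And>\<pi> \<omega>. relative_wealth i \<pi> \<omega> = c + Z i \<pi> \<omega>"
    using relative_wealth_eq[OF i] unfolding Z_def by blast
  have "J i \<pi> = c + expectation (Z i \<pi>) - \<gamma> i / 2 * covar (Z i \<pi>) (Z i \<pi>)" if \<pi>: "\<forall>k\<in>{1..n}. \<pi> k \<in> L2F" for \<pi>
  proof -
    have sq: "sq_int M (Z i \<pi>)" using \<pi> by (intro Z_sq_int[OF i]) blast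
    have R: "relative_wealth i \<pi> = (\<lambda>\<omega>. c + Z i \<pi> \<omega>)" by (simp add: c fun_eq_iff)
    have E: "expectation (\<lambda>\<omega>. c + Z i \<pi> \<omega>) = c + expectation (Z i \<pi>)"
      using sq_int_integrable[OF sq] by (simp add: prob_space)
    show ?thesis unfolding J_def R E covar_variance(2)[OF sq] by simp
  qed
  then show ?thesis by blast
qed

text \<open>A deviation by \<open>s * v\<close> moves \<open>Y i\<close> and the aggregate alike, so
  the coefficients in \<open>Z\<close> leave a net change of exactly \<open>s * Y i v\<close>; mean
  and variance then give a polynomial of degree at most two in \<open>s\<close>.\<close>

lemma J_deviation:
  assumes i: "i \<in> {1..n}" and all: "\<forall>k\<in>{1..n}. \<pi> k \<in> L2F" and v: "v \<in> L2F"
  shows "J i (\<pi>(i := \<lambda>t \<omega>. 1 * \<pi> i t \<omega> + s * v t \<omega>)) =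
    J i \<pi> + s * (expectation (Y i v) - \<gamma> i * covar (Z i \<pi>) (Y i v)) - \<gamma> i / 2 * s\<^sup>2 * covar (Y i v) (Y i v)"
proof -
  have \<pi>: "\<pi> k \<in> L2F" if "k \<in> {1..n}" for k using all that by blast
  let ?p = "\<lambda>t \<omega>. 1 * \<pi> i t \<omega> + s * v t \<omega>"
  let ?\<pi> = "\<pi>(i := ?p)"
  have p: "?p \<in> L2F" by (rule L2F_lin[OF \<pi>[OF i] v])
  have \<pi>': "?\<pi> k \<in> L2F" if "k \<in> {1..n}" for k using p \<pi>[OF that] by (cases "k = i") simp_all
  note V = Y_sq_int[OF i v]
  have Zs: "sq_int M (Z i \<pi>)" by (rule Z_sq_int[OF i \<pi>])
  have Zs': "sq_int M (Z i ?\<pi>)" by (rule Z_sq_int[OF i \<pi>'])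
  have lin: "sq_int M (\<lambda>\<omega>. 1 * Z i \<pi> \<omega> + s * Y i v \<omega>)" by (rule sq_int_lin[OF Zs V])
  have eq: "AE \<omega> in M. Z i ?\<pi> \<omega> = 1 * Z i \<pi> \<omega> + s * Y i v \<omega>"
    using Y_lin[OF i \<pi>[OF i] v, of 1 s]
  proof eventually_elim
    case (elim \<omega>)
    have "(\<Sum>k=1..n. Y k (?\<pi> k) \<omega>) = Y i ?p \<omega> + (\<Sum>k\<in>{1..n} - {i}. Y k (?\<pi> k) \<omega>)"
      using i by (subst sum.remove[of _ i]) auto
    also have "(\<Sum>k\<in>{1..n} - {i}. Y k (?\<pi> k) \<omega>) = (\<Sum>k\<in>{1..n} - {i}. Y k (\<pi> k) \<omega>)"
      by (rule sum.cong) auto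
    also have "Y i ?p \<omega> + \<dots> = s * Y i v \<omega> + (Y i (\<pi> i) \<omega> + (\<Sum>k\<in>{1..n} - {i}. Y k (\<pi> k) \<omega>))"
      unfolding elim by simp
    also have "Y i (\<pi> i) \<omega> + (\<Sum>k\<in>{1..n} - {i}. Y k (\<pi> k) \<omega>) = (\<Sum>k=1..n. Y k (\<pi> k) \<omega>)"
      using i by (intro sum.remove[symmetric]) auto
    finally have S: "(\<Sum>k=1..n. Y k (?\<pi> k) \<omega>) = s * Y i v \<omega> + (\<Sum>k=1..n. Y k (\<pi> k) \<omega>)" .
    show ?case unfolding Z_def S fun_upd_same elim by (simp add: algebra_simps)
  qed
  have E: "expectation (Z i ?\<pi>) = expectation (Z i \<pi>) + s * expectation (Y i v)"
  proof -
    have "expectation (Z i ?\<pi>) = expectation (\<lambda>\<omega>. 1 * Z i \<pi> \<omega> + s * Y i v \<omega>)"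
      by (rule integral_cong_AE[OF sq_intD(1)[OF Zs'] sq_intD(1)[OF lin] eq])
    then show ?thesis using sq_int_integrable[OF Zs] sq_int_integrable[OF V] by simp
  qed
  have C: "covar (Z i ?\<pi>) (Z i ?\<pi>) = covar (Z i \<pi>) (Z i \<pi>) + 2 * s * covar (Z i \<pi>) (Y i v) + s\<^sup>2 * covar (Y i v) (Y i v)"
    using trans[OF covar_cong_AE[OF eq eq Zs' lin Zs' lin] covar_add_scaled[OF Zs V]] .
  obtain c where c: "\<And>\<pi>. (\<forall>k\<in>{1..n}. \<pi> k \<in> L2F) \<Longrightarrow> J i \<pi> = c + expectation (Z i \<pi>) - \<gamma> i / 2 * covar (Z i \<pi>) (Z i \<pi>)"
    using J_eq[OF i] by blast
  have "J i \<pi> = c + expectation (Z i \<pi>) - \<gamma> i / 2 * covar (Z i \<pi>) (Z i \<pi>)" by (rule c[OF all])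
  moreover have "J i ?\<pi> = c + expectation (Z i ?\<pi>) - \<gamma> i / 2 * covar (Z i ?\<pi>) (Z i ?\<pi>)"
    using \<pi>' by (intro c) blast
  ultimately show ?thesis unfolding E C by (simp add: algebra_simps)
qed

lemma first_order_condition:
  assumes i: "i \<in> {1..n}" and all: "\<forall>k\<in>{1..n}. \<pi> k \<in> L2F"
  shows "(\<forall>p\<in>L2F. J i \<pi> \<ge> J i (\<pi>(i := p))) \<longleftrightarrow> (\<forall>v\<in>L2F. expectation (Y i v) = \<gamma> i * covar (Z i \<pi>) (Y i v))"
proof
  assume opt: "\<forall>p\<in>L2F. J i \<pi> \<ge> J i (\<pi>(i := p))"
  show "\<forall>v\<in>L2F. expectation (Y i v) = \<gamma> i * covar (Z i \<pi>) (Y i v)"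
  proof
    fix v assume v: "v \<in> L2F"
    define A where "A = expectation (Y i v) - \<gamma> i * covar (Z i \<pi>) (Y i v)"
    define B where "B = \<gamma> i / 2 * covar (Y i v) (Y i v)"
    \<comment> \<open>Optimality says that a quadratic with vanishing constant term is nonnegative;
      its discriminant forces the linear coefficient to be 0.\<close>
    have "0 + 2 * s * (- A / 2) + s\<^sup>2 * B \<ge> 0" for s
    proof -
      have "J i (\<pi>(i := \<lambda>t \<omega>. 1 * \<pi> i t \<omega> + s * v t \<omega>)) \<le> J i \<pi>" using opt L2F_lin[OF _ v] all i by blast
      then have "J i \<pi> + s * A - B * s\<^sup>2 \<le> J i \<pi>"
        using J_deviation[OF i all v, where s = s] by (simp add: A_def B_def mult_ac)
      then show ?thesis by (simp add: mult.commute)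
    qed
    from quadratic_nonneg_imp[OF this] have "A = 0" by simp
    then show "expectation (Y i v) = \<gamma> i * covar (Z i \<pi>) (Y i v)" by (simp add: A_def)
  qed
next
  assume foc: "\<forall>v\<in>L2F. expectation (Y i v) = \<gamma> i * covar (Z i \<pi>) (Y i v)"
  show "\<forall>p\<in>L2F. J i \<pi> \<ge> J i (\<pi>(i := p))"
  proof
    fix p assume p: "p \<in> L2F"
    \<comment> \<open>Every strategy is reached from \<open>\<pi> i\<close> by a deviation with step
      1, and the remaining quadratic term only lowers the objective.\<close>
    define v where "v t \<omega> = 1 * p t \<omega> + (-1) * \<pi> i t \<omega>" for t \<omega>
    have v: "v \<in> L2F" unfolding v_def using all i by (intro L2F_lin[OF p]) blast
    have eq: "(\<lambda>t \<omega>. 1 * \<pi> i t \<omega> + 1 * v t \<omega>) = p" by (simp add: v_def fun_eq_iff)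
    have "J i (\<pi>(i := p)) = J i \<pi> + 1 * (expectation (Y i v) - \<gamma> i * covar (Z i \<pi>) (Y i v)) - \<gamma> i / 2 * 1\<^sup>2 * covar (Y i v) (Y i v)"
      using J_deviation[OF i all v, where s = 1] unfolding eq .
    moreover have "\<gamma> i / 2 * 1\<^sup>2 * covar (Y i v) (Y i v) \<ge> 0"
      using \<gamma>_pos[OF i] covar_nonneg[OF Y_sq_int[OF i v]] by simp
    moreover have "expectation (Y i v) = \<gamma> i * covar (Z i \<pi>) (Y i v)" using foc v by blast
    ultimately show "J i \<pi> \<ge> J i (\<pi>(i := p))" by simp
  qed
qed

text \<open>Dividing the first-order condition by the coefficient
  \<open>1 + \<theta> i / (real n - 1)\<close> of \<open>Y i\<close> in \<open>Z i\<close> produces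
  this weight on the aggregate and \<open>\<kappa> i\<close> on the mean; the weights sum to
  \<open>\<Psi>\<close>.\<close>

definition q :: "nat \<Rightarrow> real" where
  "q i = \<theta> i / (real n - 1 + \<theta> i)"

definition \<kappa> :: "nat \<Rightarrow> real" where
  "\<kappa> i = (real n - 1) / (\<gamma> i * (real n - 1 + \<theta> i))"

lemma q_nonneg: "i \<in> {1..n} \<Longrightarrow> q i \<ge> 0"
  using \<theta>_range[of i] n_ge_2 by (simp add: q_def)

lemma nash_iff:
  "nash_equilibrium \<pi> \<longleftrightarrow> (\<forall>i\<in>{1..n}. \<pi> i \<in> L2F) \<and> (\<forall>i\<in>{1..n}. \<forall>p\<in>L2F.
     covar (Y i (\<pi> i)) (Y i p) = q i * covar (\<lambda>\<omega>. \<Sum>k=1..n. Y k (\<pi> k) \<omega>) (Y i p) + \<kappa> i * expectation (Y i p))"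
proof (cases "\<forall>i\<in>{1..n}. \<pi> i \<in> L2F")
  case True
  then have \<pi>: "\<pi> k \<in> L2F" if "k \<in> {1..n}" for k using that by blast
  have "(\<forall>p\<in>L2F. J i \<pi> \<ge> J i (\<pi>(i := p))) \<longleftrightarrow> (\<forall>p\<in>L2F.
     covar (Y i (\<pi> i)) (Y i p) = q i * covar (\<lambda>\<omega>. \<Sum>k=1..n. Y k (\<pi> k) \<omega>) (Y i p) + \<kappa> i * expectation (Y i p))"
    if i: "i \<in> {1..n}" for i
    unfolding first_order_condition[OF i True]
  proof (intro ball_cong refl)
    fix p assume p: "p \<in> L2F"
    define m where "m = real n - 1"
    define d where "d = m + \<theta> i"
    have m: "m > 0" using n_ge_2 by (simp add: m_def)
    have d: "d > 0" using m \<theta>_range[OF i] by (simp add: d_def)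
    have \<gamma>: "\<gamma> i > 0" by (rule \<gamma>_pos[OF i])
    define A where "A = covar (Y i (\<pi> i)) (Y i p)"
    define S where "S = covar (\<lambda>\<omega>. \<Sum>k=1..n. Y k (\<pi> k) \<omega>) (Y i p)"
    define E where "E = expectation (Y i p)"
    have "covar (Z i \<pi>) (Y i p) = (1 + \<theta> i / m) * A + (- (\<theta> i / m)) * S"
      unfolding Z_def m_def A_def S_def
      by (rule covar_lin[OF Y_sq_int[OF i \<pi>[OF i]] sq_int_sum[OF Y_sq_int[OF _ \<pi>]] Y_sq_int[OF i p]])
    also have "\<dots> = (d * A - \<theta> i * S) / m" using m by (simp add: d_def field_simps)
    finally have C: "covar (Z i \<pi>) (Y i p) = (d * A - \<theta> i * S) / m" .
    have "(E = \<gamma> i * covar (Z i \<pi>) (Y i p)) \<longleftrightarrow> m * E = \<gamma> i * (d * A - \<theta> i * S)"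
      unfolding C times_divide_eq_right eq_divide_eq using m by (simp add: mult.commute[of E])
    also have "\<dots> \<longleftrightarrow> A = \<theta> i / d * S + m / (\<gamma> i * d) * E"
    proof -
      have e: "\<theta> i / d * S + m / (\<gamma> i * d) * E = (\<gamma> i * \<theta> i * S + m * E) / (\<gamma> i * d)"
        using d \<gamma> by (simp add: add_divide_distrib)
      have "A = \<theta> i / d * S + m / (\<gamma> i * d) * E \<longleftrightarrow> A * (\<gamma> i * d) = \<gamma> i * \<theta> i * S + m * E"
        unfolding e eq_divide_eq using d \<gamma> by simp
      moreover have "m * E = \<gamma> i * (d * A - \<theta> i * S) \<longleftrightarrow> A * (\<gamma> i * d) = \<gamma> i * \<theta> i * S + m * E"
        by (auto simp: algebra_simps)
      ultimately show ?thesis by simp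
    qed
    finally show "(expectation (Y i p) = \<gamma> i * covar (Z i \<pi>) (Y i p)) =
      (covar (Y i (\<pi> i)) (Y i p) = q i * covar (\<lambda>\<omega>. \<Sum>k=1..n. Y k (\<pi> k) \<omega>) (Y i p) + \<kappa> i * expectation (Y i p))"
      unfolding A_def S_def E_def q_def \<kappa>_def d_def m_def .
  qed
  with True show ?thesis unfolding nash_equilibrium_def by blast
next
  case False
  then show ?thesis unfolding nash_equilibrium_def by blast
qed

theorem unique_nash:
  assumes "\<Psi> < 1"
  shows unique_nash_equilibrium
proof -
  have q1: "(\<Sum>i=1..n. q i) < 1" using assms by (simp add: \<Psi>_def q_def)
  obtain \<pi> where "(\<forall>i\<in>{1..n}. \<pi> i \<in> L2F) \<and> (\<forall>i\<in>{1..n}. \<forall>p\<in>L2F.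
     covar (Y i (\<pi> i)) (Y i p) = q i * covar (\<lambda>\<omega>. \<Sum>k=1..n. Y k (\<pi> k) \<omega>) (Y i p) + \<kappa> i * expectation (Y i p))"
    using equilibrium_system_exists[OF q_nonneg q1] by blast
  then have \<pi>: "nash_equilibrium \<pi>" by (simp only: nash_iff)
  have "ae_eq (\<pi>' i) (\<pi> i)" if \<pi>': "nash_equilibrium \<pi>'" and i: "i \<in> {1..n}" for \<pi>' i
  proof (rule equilibrium_system_unique[OF q_nonneg q1])
    show "i \<in> {1..n}" by (rule i)
  qed (use \<pi> \<pi>' in \<open>unfold nash_iff, blast+\<close>)
  with \<pi> show ?thesis unfolding unique_nash_equilibrium_def by blast
qed

end

theorem theorem4p4:
  fixes M :: "'a measure" and T :: real and W :: "real \<Rightarrow> 'a \<Rightarrow> real"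
    and n :: nat and x \<theta> \<gamma> :: "nat \<Rightarrow> real"
    and r :: "real \<Rightarrow> 'a \<Rightarrow> real" and \<mu> \<sigma> :: "nat \<Rightarrow> real \<Rightarrow> 'a \<Rightarrow> real"
  assumes "relative_wealth_game M T W n \<theta> \<gamma> r \<mu> \<sigma>"
    and "brownian_space.deterministic M T r"
    and "\<And>i. i \<in> {1..n} \<Longrightarrow>
      brownian_space.deterministic M T (relative_wealth_game.\<rho> r \<mu> \<sigma> i)"
    and "\<And>i. i \<in> {1..n} \<Longrightarrow>
      \<not> brownian_space.ae_eq M T (relative_wealth_game.\<rho> r \<mu> \<sigma> i) (\<lambda>t \<omega>. 0)"
    and "relative_wealth_game.\<Psi> n \<theta> < 1"
  shows "relative_wealth_game.unique_nash_equilibrium M T W n x \<theta> \<gamma> r \<mu> \<sigma>"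
proof -
  interpret relative_wealth_game M T W n x \<theta> \<gamma> r \<mu> \<sigma> by (rule assms(1))
  \<comment> \<open>The essentially bounded \<open>r\<close>, deterministic up to a null set, is
    exchanged for a Borel function of time bounded everywhere, as the pathwise equations
    require.\<close>
  obtain g K where "g \<in> borel_measurable borel" "\<And>t. \<bar>g t\<bar> \<le> K" "AE (t, \<omega>) in dt_P. r t \<omega> = g t"
    using deterministic_bounded[OF assms(2) r_bounded] by blast
  then interpret deterministic_rate_game M T W n x \<theta> \<gamma> r \<mu> \<sigma> g K
    by unfold_locales
  show ?thesis by (rule unique_nash[OF assms(5)])
qed

end
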